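(* Let $\mathcal{S}$ be a class of measurable subsets of $\mathbb{R}^d$ with Gaussian surface area at most $\Gamma(\mathcal{S})$. Let $\mathcal{N}^*=\mathcal{N}(\boldsymbol\mu^*,\boldsymbol\Sigma^* )$ be a Gaussian with $(\boldsymbol\mu^*,\boldsymbol\Sigma^* )$ in $(O(\log(1/\alpha)),1/16)$-isotropic position, and let $S\in\mathcal{S}$ be unknown with $\mathcal{N}(\boldsymbol\mu^*,\boldsymbol\Sigma^*;S)\ge\alpha$. Then, given $$d^{\,\mathrm{poly}(1/\alpha)\,\Gamma(\mathcal{S})^2/\varepsilon^{32}}$$ independent samples from the conditional distribution $\mathcal{N}^*_S=\mathcal{N}(\boldsymbol\mu^*,\boldsymbol\Sigma^*,S)$, we can recover an indicator function $\widetilde S:\mathbb{R}^d\to\{0,1\}$ of a set such that with probability at least $99\%$ it holds $$\Pr_{\boldsymbol x\sim\mathcal{N}^*}\big[\widetilde S(\boldsymbol x)\ne \mathbf 1_S(\boldsymbol x)\big]\le\varepsilon .$$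
   Context: $\mathcal{N}(\boldsymbol\mu,\boldsymbol\Sigma;S)$ is the mass assigned to $S$ by $\mathcal{N}(\boldsymbol\mu,\boldsymbol\Sigma)$; $\mathcal{N}(\boldsymbol\mu,\boldsymbol\Sigma,S)$ is this Gaussian conditioned on lying in $S$. $\alpha>0$ is a known absolute constant; $\boldsymbol\mu^*,\boldsymbol\Sigma^*,S$ are unknown. Isotropic position: for $a,b>0$, $(\boldsymbol\mu,\boldsymbol\Sigma)$ with $\boldsymbol\Sigma$ symmetric positive semidefinite is in $(a,b)$-isotropic position if $\|\boldsymbol\mu\|_2^2\le a$, $\|\boldsymbol\Sigma-\boldsymbol I\|_F^2\le a$ and $(1-b)\boldsymbol I\preceq\boldsymbol\Sigma\preceq\frac{1}{1-b}\boldsymbol I$. Gaussian surface area: for a Borel set $A\subseteq\mathbb{R}^d$ let $A_\delta=\{x:\mathrm{dist}(x,A)\le\delta\}$ and $\Gamma(A)=\liminf_{\delta\to0}\mathcal{N}_0(A_\delta\setminus A)/\delta$, with $\mathcal{N}_0=\mathcal{N}(\boldsymbol 0,\boldsymbol I)$; for a family, $\Gamma(\mathcal{S})=\sup_{A\in\mathcal{S}}\Gamma(A)$. $\mathrm{poly}(\cdot)$ denotes a fixed polynomial independent of the instance; the constant in $O(\cdot)$ is absolute.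
   Formalization: The base d of the sample count is replaced by max(d,2): for d = 1 the stated count is a single sample, which cannot suffice (for example for half-lines); for d ≥ 2 the count is as stated. *)

theory Defs
  imports "Jordan_Normal_Form.Gauss_Jordan_Elimination" "Jordan_Normal_Form.Determinant"
    "HOL-Probability.Probability"
begin

text \<open>
  The polynomial in the sample bound has to be chosen before the dimension \<open>d\<close>, so \<open>d\<close> cannot be
  a type.  Points of \<open>\<real>\<^sup>d\<close> are therefore extensional functions on \<open>{..<d}\<close>, and matrices are
  \<open>d \<times> d\<close> matrices of type \<^typ>\<open>real mat\<close>.
\<close>

text \<open>Lebesgue measure on the Borel sets of \<open>\<real>\<^sup>d\<close>.\<close>

definition Rd :: "nat \<Rightarrow> (nat \<Rightarrow> real) measure" where
  "Rd d = Pi\<^sub>M {..<d} (\<lambda>_. lborel)"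

definition psd_mat :: "nat \<Rightarrow> real mat \<Rightarrow> bool" where
  "psd_mat d A \<longleftrightarrow> A \<in> carrier_mat d d \<and> transpose_mat A = A \<and>
     (\<forall>v\<in>carrier_vec d. 0 \<le> scalar_prod v (A *\<^sub>v v))"

definition frob_norm :: "real mat \<Rightarrow> real" where
  "frob_norm A = sqrt (\<Sum>i<dim_row A. \<Sum>j<dim_col A. (A $$ (i, j))\<^sup>2)"

text \<open>
  The normal distribution, by its density
  \<open>exp (- (x - \<mu>)\<^sup>T \<Sigma>\<^sup>-\<^sup>1 (x - \<mu>) / 2) / sqrt ((2 \<pi>)\<^sup>d det \<Sigma>)\<close>.  It is the intended measure only for
  positive definite \<open>\<Sigma>\<close>; an \<open>(a,b)\<close>-isotropic position with \<open>0 < b < 1\<close> guarantees this.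
\<close>

definition gaussian :: "nat \<Rightarrow> (nat \<Rightarrow> real) \<Rightarrow> real mat \<Rightarrow> (nat \<Rightarrow> real) measure" where
  "gaussian d \<mu> \<Sigma> = density (Rd d) (\<lambda>x.
     let z = Matrix.vec d (\<lambda>i. x i - \<mu> i) in
     ennreal (exp (- scalar_prod z (the (mat_inverse \<Sigma>) *\<^sub>v z) / 2)
              / sqrt ((2 * pi) ^ d * Determinant.det \<Sigma>)))"

abbreviation std_gaussian :: "nat \<Rightarrow> (nat \<Rightarrow> real) measure" where
  "std_gaussian d \<equiv> gaussian d (\<lambda>i\<in>{..<d}. 0) (1\<^sub>m d)"

text \<open>The conditional distribution \<open>\<N>(\<mu>,\<Sigma>,S)\<close>.\<close>

definition truncated_gaussian ::
    "nat \<Rightarrow> (nat \<Rightarrow> real) \<Rightarrow> real mat \<Rightarrow> (nat \<Rightarrow> real) set \<Rightarrow> (nat \<Rightarrow> real) measure" where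
  "truncated_gaussian d \<mu> \<Sigma> S = uniform_measure (gaussian d \<mu> \<Sigma>) S"

definition isotropic_position :: "nat \<Rightarrow> real \<Rightarrow> real \<Rightarrow> (nat \<Rightarrow> real) \<Rightarrow> real mat \<Rightarrow> bool" where
  "isotropic_position d a b \<mu> \<Sigma> \<longleftrightarrow>
     \<mu> \<in> space (Rd d) \<and> psd_mat d \<Sigma> \<and>
     (L2_set \<mu> {..<d})\<^sup>2 \<le> a \<and>
     (frob_norm (\<Sigma> - 1\<^sub>m d))\<^sup>2 \<le> a \<and>
     psd_mat d (\<Sigma> - (1 - b) \<cdot>\<^sub>m 1\<^sub>m d) \<and>
     psd_mat d ((1 / (1 - b)) \<cdot>\<^sub>m 1\<^sub>m d - \<Sigma>)"

text \<open>
  The distance is written out because the library metric on \<^typ>\<open>nat \<Rightarrow> real\<close> is not the Euclidean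
  one.  Taking the infimum in \<^typ>\<open>ennreal\<close> gives the empty set distance \<open>\<infinity>\<close> (with \<open>infdist\<close> it
  would be \<open>0\<close>), so the neighbourhoods of the empty set are empty.
\<close>

definition neighbourhood :: "nat \<Rightarrow> (nat \<Rightarrow> real) set \<Rightarrow> real \<Rightarrow> (nat \<Rightarrow> real) set" where
  "neighbourhood d A \<delta> =
     {x \<in> space (Rd d). (INF y\<in>A. ennreal (L2_set (\<lambda>i. x i - y i) {..<d})) \<le> ennreal \<delta>}"

definition gauss_surface_area :: "nat \<Rightarrow> (nat \<Rightarrow> real) set \<Rightarrow> ennreal" where
  "gauss_surface_area d A =
     Liminf (at_right 0) (\<lambda>\<delta>. emeasure (std_gaussian d) (neighbourhood d A \<delta> - A) / ennreal \<delta>)"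

definition class_surface_area :: "nat \<Rightarrow> (nat \<Rightarrow> real) set set \<Rightarrow> ennreal" where
  "class_surface_area d \<S> = (SUP A\<in>\<S>. gauss_surface_area d A)"

text \<open>
  Estimators: functions of a sample \<open>X\<close> of size \<open>n\<close> that return a \<open>{0,1}\<close>-valued function on \<open>\<real>\<^sup>d\<close>.
  Joint measurability makes every returned indicator function, and every event about its error, measurable.
\<close>

definition set_estimator :: "nat \<Rightarrow> nat \<Rightarrow> ((nat \<Rightarrow> nat \<Rightarrow> real) \<Rightarrow> (nat \<Rightarrow> real) \<Rightarrow> real) \<Rightarrow> bool" where
  "set_estimator d n E \<longleftrightarrow>
     (\<lambda>(X, x). E X x) \<in> (Pi\<^sub>M {..<n} (\<lambda>_. Rd d) \<Otimes>\<^sub>M Rd d) \<rightarrow>\<^sub>M count_space {0, 1}"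

end

theory Submission
  imports Defs "Jordan_Normal_Form.Schur_Decomposition"
begin

text \<open>
  A set \<open>A\<close> of Gaussian surface area \<open>\<Gamma>\<close> is noise stable: replacing \<open>x\<close> by \<open>x cos \<theta> + y sin \<theta>\<close> in a random
  set of coordinates changes \<open>1\<^sub>A(x)\<close> with probability \<open>O(\<theta> \<Gamma> sqrt \<delta>)\<close>, where \<open>\<delta>\<close> is the probability
  that a given coordinate is chosen.  This is obtained by splitting the rotation into small steps and bounding
  the gradient of the Gaussian smoothing of \<open>1\<^sub>A\<close> by \<open>\<Gamma>\<close>.  After each coordinate is discretised into \<open>m\<close>
  cells, stability with \<open>\<theta> = \<pi>/2\<close> shows that almost all Fourier weight of \<open>1\<^sub>A\<close> in an orthonormal product
  basis sits on basis functions of few nontrivial factors, so that \<open>A\<close> is approximated by a threshold of a combination of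
  few basis functions, with coefficients on a grid.  Hence finitely many sets cover the whole class.

  Isotropic position bounds both chi-square divergences between the unknown Gaussian and the standard one by a
  power of \<open>1/\<alpha>\<close>, so small sets for one are small for the other.  The learner returns the cover element of
  least standard Gaussian mass that contains nearly all samples: it nearly contains \<open>S\<close> and
  is no heavier than an approximation of \<open>S\<close>, hence is close to \<open>S\<close>.
\<close>

section \<open>Standard Gaussian measure on extensional functions\<close>

text \<open>The sample lies inside \<open>S\<close>, so there are no labels to fit; a cover element
  can only be tested for containing the sample, and the known standard Gaussian mass has to decide
  between the survivors. The number of nontrivial factors is the right degree because a quarter turn
  resamples a coordinate, and resampling is diagonal in every product basis whose first factor is 1;
  cells make such a basis finite and bounded. An indicator has no gradient, so estimates pass
  through its smoothing at angle \<open>\<phi>\<close>; the bound on \<open>cot \<phi>\<close> times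
  the mean gradient is uniform in \<open>\<phi>\<close>, which may tend to 0. Cauchy-Schwarz over
  the random set gives \<open>sqrt \<delta>\<close>; against accuracy \<open>1 / r^2\<close> this
  asks for degree about \<open>\<Gamma>^2 r^4 log r\<close>, hence the exponent
  \<open>\<Gamma>^2\<close>. A factor \<open>log \<Gamma>\<close> must not appear, hence a second
  count \<open>m^d\<close> of basis functions when \<open>\<Gamma> + 1\<close> exceeds
  \<open>d\<close>. The power 32 of \<open>1 / \<epsilon>\<close> is 28 + 4: \<open>r\<close> is of
  order \<open>\<epsilon>^(-4)\<close> and enters as \<open>r^7\<close>, and bounding
  \<open>\<Gamma> + 1\<close> by a multiple of \<open>\<Gamma>\<close> costs
  \<open>\<epsilon>^(-2)\<close>, squared.\<close>

lemma sets_Rd [measurable_cong]: "sets (Rd d) = sets (Pi\<^sub>M {..<d} (\<lambda>_. borel))"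
  unfolding Rd_def by (intro sets_PiM_cong) auto

lemma space_Rd: "space (Rd d) = {..<d} \<rightarrow>\<^sub>E UNIV"
  unfolding Rd_def by (simp add: space_PiM)

interpretation lborel_prod: product_sigma_finite "\<lambda>_::nat. lborel :: real measure"
  by unfold_locales

interpretation Rd: sigma_finite_measure "Rd d"
  unfolding Rd_def by (rule lborel_prod.sigma_finite) simp

interpretation std_normal_prod: product_sigma_finite "\<lambda>_::nat. std_normal_distribution"
proof
  show "\<exists>A. countable A \<and> A \<subseteq> sets std_normal_distribution \<and> \<Union> A = space std_normal_distribution \<and>
     (\<forall>a\<in>A. emeasure std_normal_distribution a \<noteq> \<infinity>)"
  proof -
    interpret prob_space std_normal_distribution by (rule prob_space_normal_density) simp
    show ?thesis using sigma_finite_countable by simp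
  qed
qed

text \<open>The product form gives Fubini and coordinatewise integrals directly;
  \<open>std_gaussian_eq_Nd\<close> identifies it with the density form in which the theorem
  speaks.\<close>

definition Nd :: "nat \<Rightarrow> (nat \<Rightarrow> real) measure" where
  "Nd d = Pi\<^sub>M {..<d} (\<lambda>_. std_normal_distribution)"

lemma sets_Nd [measurable_cong]: "sets (Nd d) = sets (Rd d)"
  unfolding Nd_def Rd_def by (intro sets_PiM_cong) auto

lemma space_Nd: "space (Nd d) = {..<d} \<rightarrow>\<^sub>E UNIV"
  unfolding Nd_def by (simp add: space_PiM)

lemma prob_space_Nd: "prob_space (Nd d)"
  unfolding Nd_def by (intro prob_space_PiM prob_space_normal_density) simp

interpretation Nd: prob_space "Nd d" by (rule prob_space_Nd)
interpretation Nd2: pair_prob_space "Nd d" "Nd d'" ..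

lemma measurable_Rd_component [measurable]: "i < d \<Longrightarrow> (\<lambda>x. x i) \<in> borel_measurable (Rd d)"
  unfolding Rd_def by measurable

lemma measurable_vecI:
  assumes "\<And>i. i < d \<Longrightarrow> (\<lambda>x. f x i) \<in> borel_measurable M"
  shows "(\<lambda>x. \<lambda>i\<in>{..<d}. f x i) \<in> M \<rightarrow>\<^sub>M Rd d"
  unfolding Rd_def using assms by (intro measurable_restrict) auto

lemma Nd_density:
  "Nd d = density (Rd d) (\<lambda>x. ennreal (\<Prod>i<d. std_normal_density (x i)))"
proof -
  have "density (Rd d) (\<lambda>x. ennreal (\<Prod>i<d. std_normal_density (x i))) = Pi\<^sub>M {..<d} (\<lambda>_. std_normal_distribution)"
  proof (rule std_normal_prod.PiM_eqI)
    show "sets (density (Rd d) (\<lambda>x. ennreal (\<Prod>i<d. std_normal_density (x i)))) =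
      sets (Pi\<^sub>M {..<d} (\<lambda>_. std_normal_distribution))"
      using sets_Nd[of d] by (simp add: Nd_def)
    fix A :: "nat \<Rightarrow> real set"
    assume A: "\<And>i. i \<in> {..<d} \<Longrightarrow> A i \<in> sets std_normal_distribution"
    have [measurable]: "i < d \<Longrightarrow> A i \<in> sets borel" for i using A[of i] by simp
    have PA: "Pi\<^sub>E {..<d} A \<in> sets (Rd d)"
      unfolding Rd_def using A by (intro sets_PiM_I_finite) auto
    have "emeasure (density (Rd d) (\<lambda>x. ennreal (\<Prod>i<d. std_normal_density (x i)))) (Pi\<^sub>E {..<d} A)
      = (\<integral>\<^sup>+x. ennreal (\<Prod>i<d. std_normal_density (x i)) * indicator (Pi\<^sub>E {..<d} A) x \<partial>Rd d)"
      using PA by (subst emeasure_density) (auto simp: Rd_def)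
    also have "\<dots> = (\<integral>\<^sup>+x. (\<Prod>i<d. ennreal (std_normal_density (x i)) * indicator (A i) (x i)) \<partial>Rd d)"
    proof (intro nn_integral_cong)
      fix x assume "x \<in> space (Rd d)"
      then have "indicator (Pi\<^sub>E {..<d} A) x = (\<Prod>i<d. indicator (A i) (x i) :: ennreal)"
        by (auto simp: indicator_def space_Rd PiE_iff prod_eq_1_iff intro!: prod_zero[symmetric])
      then show "ennreal (\<Prod>i<d. std_normal_density (x i)) * indicator (Pi\<^sub>E {..<d} A) x =
        (\<Prod>i<d. ennreal (std_normal_density (x i)) * indicator (A i) (x i))"
        by (simp add: prod.distrib prod_ennreal)
    qed
    also have "\<dots> = (\<Prod>i<d. \<integral>\<^sup>+t. ennreal (std_normal_density t) * indicator (A i) t \<partial>lborel)"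
      unfolding Rd_def by (intro lborel_prod.product_nn_integral_prod) auto
    also have "\<dots> = (\<Prod>i<d. emeasure std_normal_distribution (A i))"
      by (intro prod.cong refl) (simp add: emeasure_density)
    finally show "emeasure (density (Rd d) (\<lambda>x. ennreal (\<Prod>i<d. std_normal_density (x i)))) (Pi\<^sub>E {..<d} A)
      = (\<Prod>i<d. emeasure std_normal_distribution (A i))" .
  qed simp
  then show ?thesis by (simp add: Nd_def)
qed

section \<open>Shifts of Lebesgue measure and of the standard Gaussian\<close>

lemma measurable_shift [measurable]:
  "(\<lambda>x. \<lambda>i\<in>{..<d}. x i + c i) \<in> Rd d \<rightarrow>\<^sub>M Rd d"
  by (intro measurable_vecI) simp

lemma distr_Rd_shift: "distr (Rd d) (Rd d) (\<lambda>x. \<lambda>i\<in>{..<d}. x i + c i) = Rd d"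
proof -
  have "distr (Rd d) (Rd d) (\<lambda>x. \<lambda>i\<in>{..<d}. x i + c i) = Pi\<^sub>M {..<d} (\<lambda>_. lborel)"
  proof (rule lborel_prod.PiM_eqI)
    fix A :: "nat \<Rightarrow> real set"
    assume A: "\<And>i. i \<in> {..<d} \<Longrightarrow> A i \<in> sets lborel"
    have [measurable]: "i < d \<Longrightarrow> A i \<in> sets borel" for i using A[of i] by simp
    have PA [measurable]: "Pi\<^sub>E {..<d} A \<in> sets (Rd d)"
      unfolding Rd_def using A by (intro sets_PiM_I_finite) auto
    have "(\<lambda>x. \<lambda>i\<in>{..<d}. x i + c i) -` Pi\<^sub>E {..<d} A \<inter> space (Rd d)
      = Pi\<^sub>E {..<d} (\<lambda>i. (\<lambda>t. c i + t) -` A i)"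
      by (auto simp: space_Rd PiE_iff add.commute extensional_def)
    then have "emeasure (distr (Rd d) (Rd d) (\<lambda>x. \<lambda>i\<in>{..<d}. x i + c i)) (Pi\<^sub>E {..<d} A)
      = emeasure (Rd d) (Pi\<^sub>E {..<d} (\<lambda>i. (\<lambda>t. c i + t) -` A i))"
      by (subst emeasure_distr) auto
    also have "\<dots> = (\<Prod>i<d. emeasure lborel ((\<lambda>t. c i + t) -` A i))"
      unfolding Rd_def by (intro lborel_prod.emeasure_PiM) (auto intro!: measurable_sets_borel[of _ borel])
    also have "\<dots> = (\<Prod>i<d. emeasure lborel (A i))"
    proof (intro prod.cong refl)
      fix i assume "i \<in> {..<d}"
      then have [measurable]: "A i \<in> sets borel" using A by simp
      have "emeasure lborel (A i) = emeasure (distr lborel borel ((+) (c i))) (A i)"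
        by (simp add: lborel_distr_plus)
      also have "\<dots> = emeasure lborel ((\<lambda>t. c i + t) -` A i)" by (subst emeasure_distr) auto
      finally show "emeasure lborel ((\<lambda>t. c i + t) -` A i) = emeasure lborel (A i)" by simp
    qed
    finally show "emeasure (distr (Rd d) (Rd d) (\<lambda>x. \<lambda>i\<in>{..<d}. x i + c i)) (Pi\<^sub>E {..<d} A)
      = (\<Prod>i<d. emeasure lborel (A i))" .
  qed (auto simp: Rd_def)
  then show ?thesis by (simp add: Rd_def)
qed

lemma nn_integral_Rd_shift:
  assumes [measurable]: "F \<in> borel_measurable (Rd d)"
  shows "(\<integral>\<^sup>+x. F (\<lambda>i\<in>{..<d}. x i + c i) \<partial>Rd d) = (\<integral>\<^sup>+x. F x \<partial>Rd d)"
  by (subst (2) distr_Rd_shift[of d c, symmetric], subst nn_integral_distr) auto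

definition dotp :: "nat \<Rightarrow> (nat \<Rightarrow> real) \<Rightarrow> (nat \<Rightarrow> real) \<Rightarrow> real" where
  "dotp d x y = (\<Sum>i<d. x i * y i)"

lemma measurable_dotp [measurable]:
  assumes "\<And>i. i < d \<Longrightarrow> (\<lambda>w. f w i) \<in> borel_measurable M" "\<And>i. i < d \<Longrightarrow> (\<lambda>w. g w i) \<in> borel_measurable M"
  shows "(\<lambda>w. dotp d (f w) (g w)) \<in> borel_measurable M"
  unfolding dotp_def using assms by (intro borel_measurable_sum borel_measurable_times) auto

lemma std_normal_prod_eq:
  "(\<Prod>i<d. std_normal_density (x i)) = exp (- dotp d x x / 2) / sqrt (2 * pi) ^ d"
  unfolding std_normal_density_def dotp_def
  by (simp add: prod.distrib exp_sum[symmetric] sum_divide_distrib sum_negf power2_eq_square prod_dividef divide_simps)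

text \<open>Cameron-Martin formula: \<open>|z - m|^2\<close> expands to
  \<open>|z|^2 - 2 m.z + |m|^2\<close>, so the shift is paid for by an exponential weight. The
  regularity of the Gaussian smoothing rests on this identity.\<close>

lemma nn_integral_Nd_shift:
  assumes [measurable]: "F \<in> borel_measurable (Rd d)"
  shows "(\<integral>\<^sup>+z. F (\<lambda>i\<in>{..<d}. z i + m i) \<partial>Nd d)
    = (\<integral>\<^sup>+z. F z * ennreal (exp (dotp d m z - dotp d m m / 2)) \<partial>Nd d)"
proof -
  let ?\<phi> = "\<lambda>x. ennreal (\<Prod>i<d. std_normal_density (x i))"
  have "(\<integral>\<^sup>+z. F (\<lambda>i\<in>{..<d}. z i + m i) \<partial>Nd d) =
     (\<integral>\<^sup>+z. ?\<phi> z * F (\<lambda>i\<in>{..<d}. z i + m i) \<partial>Rd d)"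
    unfolding Nd_density by (subst nn_integral_density) auto
  \<comment> \<open>Each coordinate is written as shifted and shifted back, so that the integrand
    becomes a function of the shifted point and translation invariance applies.\<close>
  also have "\<dots> = (\<integral>\<^sup>+z. ?\<phi> (\<lambda>i\<in>{..<d}. (\<lambda>i\<in>{..<d}. z i + m i) i + - m i) * F (\<lambda>i\<in>{..<d}. z i + m i) \<partial>Rd d)"
    by (intro nn_integral_cong) (auto intro!: arg_cong2[where f="(*)"] prod.cong)
  also have "\<dots> = (\<integral>\<^sup>+z. ?\<phi> (\<lambda>i\<in>{..<d}. z i + - m i) * F z \<partial>Rd d)"
    by (rule nn_integral_Rd_shift[of "\<lambda>z. ?\<phi> (\<lambda>i\<in>{..<d}. z i + - m i) * F z"]) measurable
  also have "\<dots> = (\<integral>\<^sup>+z. ?\<phi> z * (F z * ennreal (exp (dotp d m z - dotp d m m / 2))) \<partial>Rd d)"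
  proof (intro nn_integral_cong)
    fix z
    have "dotp d (\<lambda>i\<in>{..<d}. z i + - m i) (\<lambda>i\<in>{..<d}. z i + - m i) = dotp d z z - 2 * dotp d m z + dotp d m m"
      unfolding dotp_def sum_distrib_left sum_subtractf[symmetric] sum.distrib[symmetric]
      by (intro sum.cong) (auto simp: algebra_simps)
    then have "exp (- dotp d (\<lambda>i\<in>{..<d}. z i + - m i) (\<lambda>i\<in>{..<d}. z i + - m i) / 2) =
      exp (- dotp d z z / 2) * exp (dotp d m z - dotp d m m / 2)"
      by (simp add: exp_add[symmetric] field_simps)
    then have "(\<Prod>i<d. std_normal_density ((\<lambda>i\<in>{..<d}. z i + - m i) i)) =
      (\<Prod>i<d. std_normal_density (z i)) * exp (dotp d m z - dotp d m m / 2)"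
      by (simp only: std_normal_prod_eq times_divide_eq_left)
    then show "?\<phi> (\<lambda>i\<in>{..<d}. z i + - m i) * F z = ?\<phi> z * (F z * ennreal (exp (dotp d m z - dotp d m m / 2)))"
      by (simp only: ennreal_mult'' exp_ge_zero mult_ac)
  qed
  also have "\<dots> = (\<integral>\<^sup>+z. F z * ennreal (exp (dotp d m z - dotp d m m / 2)) \<partial>Nd d)"
    unfolding Nd_density by (subst nn_integral_density) auto
  finally show ?thesis .
qed

section \<open>Cauchy-Schwarz and low moments\<close>

lemma Cauchy_Schwarz_integral:
  fixes f g :: "'a \<Rightarrow> real"
  assumes [measurable]: "f \<in> borel_measurable M" "g \<in> borel_measurable M"
    and f: "integrable M (\<lambda>x. (f x)\<^sup>2)" and g: "integrable M (\<lambda>x. (g x)\<^sup>2)"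
  shows "integrable M (\<lambda>x. f x * g x)"
    and "(\<integral>x. \<bar>f x * g x\<bar> \<partial>M)\<^sup>2 \<le> (\<integral>x. (f x)\<^sup>2 \<partial>M) * (\<integral>x. (g x)\<^sup>2 \<partial>M)"
proof -
  show i: "integrable M (\<lambda>x. f x * g x)"
  proof (rule Bochner_Integration.integrable_bound[OF Bochner_Integration.integrable_add[OF f g]])
    have "\<bar>a * b\<bar> \<le> \<bar>a\<^sup>2 + b\<^sup>2\<bar>" for a b :: real
    proof -
      have "2 * (\<bar>a\<bar> * \<bar>b\<bar>) \<le> a\<^sup>2 + b\<^sup>2" using sum_squares_bound[of "\<bar>a\<bar>" "\<bar>b\<bar>"] by simp
      moreover have "0 \<le> \<bar>a\<bar> * \<bar>b\<bar>" by simp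
      ultimately have "\<bar>a\<bar> * \<bar>b\<bar> \<le> a\<^sup>2 + b\<^sup>2" by linarith
      then show ?thesis by (simp add: abs_mult)
    qed
    then show "AE x in M. norm (f x * g x) \<le> norm ((f x)\<^sup>2 + (g x)\<^sup>2)" by simp
  qed measurable
  have "ennreal ((\<integral>x. \<bar>f x * g x\<bar> \<partial>M)\<^sup>2) = (\<integral>\<^sup>+x. ennreal \<bar>f x\<bar> * ennreal \<bar>g x\<bar> \<partial>M)\<^sup>2"
    using integrable_abs[OF i]
    by (subst ennreal_power[symmetric], simp, subst nn_integral_eq_integral[symmetric])
      (auto simp: abs_mult ennreal_mult')
  also have "\<dots> \<le> (\<integral>\<^sup>+x. (ennreal \<bar>f x\<bar>)\<^sup>2 \<partial>M) * (\<integral>\<^sup>+x. (ennreal \<bar>g x\<bar>)\<^sup>2 \<partial>M)"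
    by (rule Cauchy_Schwarz_nn_integral) measurable
  also have "(\<integral>\<^sup>+x. (ennreal \<bar>f x\<bar>)\<^sup>2 \<partial>M) = ennreal (\<integral>x. (f x)\<^sup>2 \<partial>M)"
    using f by (simp add: ennreal_power nn_integral_eq_integral)
  also have "(\<integral>\<^sup>+x. (ennreal \<bar>g x\<bar>)\<^sup>2 \<partial>M) = ennreal (\<integral>x. (g x)\<^sup>2 \<partial>M)"
    using g by (simp add: ennreal_power nn_integral_eq_integral)
  finally show "(\<integral>x. \<bar>f x * g x\<bar> \<partial>M)\<^sup>2 \<le> (\<integral>x. (f x)\<^sup>2 \<partial>M) * (\<integral>x. (g x)\<^sup>2 \<partial>M)"
    by (subst (asm) ennreal_mult'[symmetric], simp, subst (asm) ennreal_le_iff) (auto intro!: mult_nonneg_nonneg)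
qed

lemma integral_abs_le_sqrt:
  fixes f :: "'a \<Rightarrow> real"
  assumes "prob_space M" and [measurable]: "f \<in> borel_measurable M" and f: "integrable M (\<lambda>x. (f x)\<^sup>2)"
  shows "integrable M f" "(\<integral>x. \<bar>f x\<bar> \<partial>M) \<le> sqrt (\<integral>x. (f x)\<^sup>2 \<partial>M)"
proof -
  interpret prob_space M by fact
  show "integrable M f" using Cauchy_Schwarz_integral(1)[of f M "\<lambda>_. 1"] f by simp
  show "(\<integral>x. \<bar>f x\<bar> \<partial>M) \<le> sqrt (\<integral>x. (f x)\<^sup>2 \<partial>M)"
    using Cauchy_Schwarz_integral(2)[of f M "\<lambda>_. 1"] f by (intro real_le_rsqrt) (simp add: prob_space)
qed

lemma std_normal_integrals:
  "integrable std_normal_distribution (\<lambda>t. t)" "(\<integral>t. t \<partial>std_normal_distribution) = 0"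
  "integrable std_normal_distribution (\<lambda>t. t * t)" "(\<integral>t. t * t \<partial>std_normal_distribution) = 1"
  "integrable std_normal_distribution (\<lambda>t. 1::real)" "(\<integral>t. (1::real) \<partial>std_normal_distribution) = 1"
proof -
  interpret prob_space std_normal_distribution by (rule prob_space_normal_density) simp
  show "integrable std_normal_distribution (\<lambda>t. 1::real)" "(\<integral>t. (1::real) \<partial>std_normal_distribution) = 1"
    using prob_space by (auto simp del: space_density)
  show "integrable std_normal_distribution (\<lambda>t. t)" using integrable_std_normal_distribution_moment[of 1] by simp
  show "integrable std_normal_distribution (\<lambda>t. t * t)"
    using integrable_std_normal_distribution_moment[of 2] by (simp add: power2_eq_square)
  show "(\<integral>t. t \<partial>std_normal_distribution) = 0" using integral_std_normal_distribution_moment_odd[of 1] by simp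
  show "(\<integral>t. t * t \<partial>std_normal_distribution) = 1"
    using std_normal_distribution_even_moments(1)[of 1] by (simp add: power2_eq_square fact_numeral)
qed

lemma Nd_coord_mult:
  assumes "i < d" "j < d"
  shows "integrable (Nd d) (\<lambda>z. z i * z j)"
    "(\<integral>z. z i * z j \<partial>Nd d) = (if i = j then 1 else 0)"
proof -
  \<comment> \<open>One factor per coordinate, identically 1 away from \<open>i\<close> and
    \<open>j\<close>; for \<open>i = j\<close> the two conditionals multiply to
    \<open>t * t\<close>.\<close>
  define f where "f k t = (if k = i then t else 1) * (if k = j then t else (1::real))" for k t
  have fi: "integrable std_normal_distribution (f k)" for k
    unfolding f_def using std_normal_integrals by (cases "k = i"; cases "k = j") auto
  have e: "z i * z j = (\<Prod>k<d. f k (z k))" for z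
    unfolding f_def prod.distrib using assms by (simp add: prod.delta)
  show "integrable (Nd d) (\<lambda>z. z i * z j)"
    unfolding e Nd_def by (intro std_normal_prod.product_integrable_prod fi) auto
  have "(\<integral>z. z i * z j \<partial>Nd d) = (\<Prod>k<d. \<integral>t. f k t \<partial>std_normal_distribution)"
    unfolding e Nd_def by (intro std_normal_prod.product_integral_prod fi) auto
  also have "\<dots> = (\<Prod>k<d. if k = i \<and> i \<noteq> j \<or> k = j \<and> i \<noteq> j then 0 else 1)"
  proof (intro prod.cong refl)
    fix k
    have "f k = (\<lambda>t. t * t) \<and> k = i \<and> i = j \<or> f k = (\<lambda>t. t) \<and> (k = i \<and> i \<noteq> j \<or> k = j \<and> i \<noteq> j) \<or>
      f k = (\<lambda>t. 1) \<and> k \<noteq> i \<and> k \<noteq> j"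
      unfolding f_def by (auto simp: fun_eq_iff)
    then show "(\<integral>t. f k t \<partial>std_normal_distribution) = (if k = i \<and> i \<noteq> j \<or> k = j \<and> i \<noteq> j then 0 else 1)"
      by (elim disjE conjE) (simp_all only: std_normal_integrals simp_thms if_True if_False not_True_eq_False not_False_eq_True refl)
  qed
  also have "\<dots> = (if i = j then 1 else 0)" using assms by (auto intro!: prod_zero)
  finally show "(\<integral>z. z i * z j \<partial>Nd d) = (if i = j then 1 else 0)" .
qed

lemma Nd_coord:
  assumes "i < d"
  shows "integrable (Nd d) (\<lambda>z. z i)" "(\<integral>z. z i \<partial>Nd d) = 0"
proof -
  define f where "f k t = (if k = i then t else (1::real))" for k t
  have fi: "integrable std_normal_distribution (f k)" for k
    unfolding f_def using std_normal_integrals by (cases "k = i") auto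
  have e: "z i = (\<Prod>k<d. f k (z k))" for z
    unfolding f_def using assms by (simp add: prod.delta)
  show "integrable (Nd d) (\<lambda>z. z i)"
    unfolding e Nd_def by (intro std_normal_prod.product_integrable_prod fi) auto
  have "(\<integral>z. z i \<partial>Nd d) = (\<Prod>k<d. \<integral>t. f k t \<partial>std_normal_distribution)"
    unfolding e Nd_def by (intro std_normal_prod.product_integral_prod fi) auto
  also have "\<dots> = 0" using assms std_normal_integrals by (auto simp: f_def intro!: bexI[of _ i])
  finally show "(\<integral>z. z i \<partial>Nd d) = 0" .
qed

lemma Nd_dotp:
  "integrable (Nd d) (\<lambda>z. dotp d m z)" "(\<integral>z. dotp d m z \<partial>Nd d) = 0"
  "integrable (Nd d) (\<lambda>z. (dotp d m z)\<^sup>2)" "(\<integral>z. (dotp d m z)\<^sup>2 \<partial>Nd d) = dotp d m m"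
proof -
  show "integrable (Nd d) (\<lambda>z. dotp d m z)" "(\<integral>z. dotp d m z \<partial>Nd d) = 0"
    unfolding dotp_def using Nd_coord[of _ d] by (auto simp: Bochner_Integration.integral_sum)
  have e: "(dotp d m z)\<^sup>2 = (\<Sum>i<d. \<Sum>j<d. m i * m j * (z i * z j))" for z
    unfolding dotp_def power2_eq_square sum_product by (intro sum.cong refl) simp
  have h: "has_bochner_integral (Nd d) (\<lambda>z. \<Sum>i<d. \<Sum>j<d. m i * m j * (z i * z j))
    (\<Sum>i<d. \<Sum>j<d. m i * m j * (if i = j then 1 else 0))"
    by (intro has_bochner_integral_sum has_bochner_integral_mult_right)
      (simp add: has_bochner_integral_iff Nd_coord_mult)
  have "(\<Sum>i<d. \<Sum>j<d. m i * m j * (if i = j then 1 else 0)) = dotp d m m"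
    unfolding dotp_def by (intro sum.cong refl) (simp add: if_distrib[of "(*) _"] sum.delta cong: if_cong)
  with h show "integrable (Nd d) (\<lambda>z. (dotp d m z)\<^sup>2)" "(\<integral>z. (dotp d m z)\<^sup>2 \<partial>Nd d) = dotp d m m"
    unfolding e by (auto simp: has_bochner_integral_iff)
qed

text \<open>The likelihood ratio of the Gaussian with mean \<open>m\<close> to the standard one, as
  in the shift formula.\<close>

definition Lm :: "nat \<Rightarrow> (nat \<Rightarrow> real) \<Rightarrow> (nat \<Rightarrow> real) \<Rightarrow> real" where
  "Lm d m z = exp (dotp d m z - dotp d m m / 2)"

lemma measurable_Lm [measurable]: "Lm d m \<in> borel_measurable (Rd d)"
  unfolding Lm_def by measurable

lemma distr_Nd_shift: "distr (Nd d) (Rd d) (\<lambda>z. \<lambda>i\<in>{..<d}. z i + m i) = density (Nd d) (\<lambda>z. ennreal (Lm d m z))"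
proof (rule measure_eqI)
  fix A assume "A \<in> sets (distr (Nd d) (Rd d) (\<lambda>z. \<lambda>i\<in>{..<d}. z i + m i))"
  then have [measurable]: "A \<in> sets (Rd d)" by simp
  have "emeasure (distr (Nd d) (Rd d) (\<lambda>z. \<lambda>i\<in>{..<d}. z i + m i)) A =
    (\<integral>\<^sup>+z. indicator A z \<partial>distr (Nd d) (Rd d) (\<lambda>z. \<lambda>i\<in>{..<d}. z i + m i))" by simp
  also have "\<dots> = (\<integral>\<^sup>+z. indicator A (\<lambda>i\<in>{..<d}. z i + m i) \<partial>Nd d)"
    by (subst nn_integral_distr) auto
  also have "\<dots> = (\<integral>\<^sup>+z. indicator A z * ennreal (Lm d m z) \<partial>Nd d)"
    unfolding Lm_def by (rule nn_integral_Nd_shift) simp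
  also have "\<dots> = emeasure (density (Nd d) (\<lambda>z. ennreal (Lm d m z))) A"
    by (subst emeasure_density) (auto simp: mult.commute)
  finally show "emeasure (distr (Nd d) (Rd d) (\<lambda>z. \<lambda>i\<in>{..<d}. z i + m i)) A =
    emeasure (density (Nd d) (\<lambda>z. ennreal (Lm d m z))) A" .
qed (simp add: sets_Nd)

lemma Nd_shift:
  fixes F :: "_ \<Rightarrow> real"
  assumes [measurable]: "F \<in> borel_measurable (Rd d)"
  shows "integrable (Nd d) (\<lambda>z. Lm d m z * F z) \<longleftrightarrow> integrable (Nd d) (\<lambda>z. F (\<lambda>i\<in>{..<d}. z i + m i))"
    "(\<integral>z. F (\<lambda>i\<in>{..<d}. z i + m i) \<partial>Nd d) = (\<integral>z. Lm d m z * F z \<partial>Nd d)"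
proof -
  have [measurable]: "(\<lambda>z. \<lambda>i\<in>{..<d}. z i + m i) \<in> Nd d \<rightarrow>\<^sub>M Rd d" by measurable
  have "integrable (Nd d) (\<lambda>z. F (\<lambda>i\<in>{..<d}. z i + m i)) \<longleftrightarrow>
      integrable (distr (Nd d) (Rd d) (\<lambda>z. \<lambda>i\<in>{..<d}. z i + m i)) F"
    by (subst integrable_distr_eq) auto
  also have "\<dots> \<longleftrightarrow> integrable (Nd d) (\<lambda>z. Lm d m z * F z)"
    unfolding distr_Nd_shift by (subst integrable_density) (auto simp: Lm_def)
  finally show "integrable (Nd d) (\<lambda>z. Lm d m z * F z) \<longleftrightarrow> integrable (Nd d) (\<lambda>z. F (\<lambda>i\<in>{..<d}. z i + m i))" ..
  have "(\<integral>z. F (\<lambda>i\<in>{..<d}. z i + m i) \<partial>Nd d) = (\<integral>z. F z \<partial>distr (Nd d) (Rd d) (\<lambda>z. \<lambda>i\<in>{..<d}. z i + m i))"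
    by (subst integral_distr) auto
  also have "\<dots> = (\<integral>z. Lm d m z * F z \<partial>Nd d)"
    unfolding distr_Nd_shift by (subst integral_density) (auto simp: Lm_def)
  finally show "(\<integral>z. F (\<lambda>i\<in>{..<d}. z i + m i) \<partial>Nd d) = (\<integral>z. Lm d m z * F z \<partial>Nd d)" .
qed

text \<open>The square of the ratio for \<open>m\<close> is \<open>exp |m|^2\<close> times the ratio
  for \<open>2 m\<close>, and every ratio has mean 1. Weighting \<open>dotp d m z\<close> by the
  ratio is a shift by \<open>m\<close>, which leaves the mean of
  \<open>dotp d m z + |m|^2\<close>.\<close>

lemma Lm_moments:
  defines "s d m \<equiv> dotp d m m"
  shows "integrable (Nd d) (Lm d m)" "(\<integral>z. Lm d m z \<partial>Nd d) = 1"
    "integrable (Nd d) (\<lambda>z. (Lm d m z)\<^sup>2)" "(\<integral>z. (Lm d m z)\<^sup>2 \<partial>Nd d) = exp (s d m)"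
    "integrable (Nd d) (\<lambda>z. Lm d m z * dotp d m z)" "(\<integral>z. Lm d m z * dotp d m z \<partial>Nd d) = s d m"
proof -
  show *: "integrable (Nd d) (Lm d m)" "(\<integral>z. Lm d m z \<partial>Nd d) = 1" for m
    using Nd_shift[of "\<lambda>_. 1" d m] Nd.prob_space by auto
  have e: "(Lm d m z)\<^sup>2 = exp (s d m) * Lm d (\<lambda>i. 2 * m i) z" for z
  proof -
    have "dotp d (\<lambda>i. 2 * m i) z = 2 * dotp d m z" "dotp d (\<lambda>i. 2 * m i) (\<lambda>i. 2 * m i) = 4 * dotp d m m"
      unfolding dotp_def sum_distrib_left by (intro sum.cong; simp)+
    then show ?thesis unfolding Lm_def s_def
      by (simp add: power2_eq_square exp_add[symmetric] algebra_simps)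
  qed
  show "integrable (Nd d) (\<lambda>z. (Lm d m z)\<^sup>2)" "(\<integral>z. (Lm d m z)\<^sup>2 \<partial>Nd d) = exp (s d m)"
    unfolding e using * by auto
  have r: "dotp d m (\<lambda>i\<in>{..<d}. z i + m i) = dotp d m z + s d m" for z
    unfolding dotp_def s_def sum.distrib[symmetric] by (intro sum.cong) (auto simp: algebra_simps)
  show "integrable (Nd d) (\<lambda>z. Lm d m z * dotp d m z)" "(\<integral>z. Lm d m z * dotp d m z \<partial>Nd d) = s d m"
    using Nd_shift[of "dotp d m" d m] Nd_dotp[of d m] Nd.prob_space unfolding r by auto
qed

text \<open>\<open>1 + dotp d m z\<close> is the first-order expansion of the ratio in
  \<open>m\<close>. The second moments of the errors of order zero and one are tails of the
  exponential series at \<open>|m|^2\<close>, so for small \<open>m\<close> they are of order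
  \<open>|m|^2\<close> and \<open>|m|^4\<close>.\<close>

lemma Lm_variance:
  "integrable (Nd d) (\<lambda>z. (Lm d m z - 1)\<^sup>2)" "(\<integral>z. (Lm d m z - 1)\<^sup>2 \<partial>Nd d) = exp (dotp d m m) - 1"
  "integrable (Nd d) (\<lambda>z. (Lm d m z - 1 - dotp d m z)\<^sup>2)"
  "(\<integral>z. (Lm d m z - 1 - dotp d m z)\<^sup>2 \<partial>Nd d) = exp (dotp d m m) - 1 - dotp d m m"
proof -
  note I = Lm_moments[of d m] Nd_dotp[of d m]
  have e: "(Lm d m z - 1)\<^sup>2 = (Lm d m z)\<^sup>2 + 1 - 2 * Lm d m z" for z by (simp add: power2_eq_square algebra_simps)
  have e2: "(Lm d m z - 1 - dotp d m z)\<^sup>2 = (Lm d m z)\<^sup>2 + 1 + (dotp d m z)\<^sup>2 - 2 * Lm d m z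
     - 2 * (Lm d m z * dotp d m z) + 2 * dotp d m z" for z by (simp add: power2_eq_square algebra_simps)
  show "integrable (Nd d) (\<lambda>z. (Lm d m z - 1)\<^sup>2)" unfolding e using I by auto
  show "integrable (Nd d) (\<lambda>z. (Lm d m z - 1 - dotp d m z)\<^sup>2)" unfolding e2 using I by auto
  show "(\<integral>z. (Lm d m z - 1)\<^sup>2 \<partial>Nd d) = exp (dotp d m m) - 1"
    unfolding e using I Nd.prob_space by simp
  show "(\<integral>z. (Lm d m z - 1 - dotp d m z)\<^sup>2 \<partial>Nd d) = exp (dotp d m m) - 1 - dotp d m m"
    unfolding e2 using I Nd.prob_space by simp
qed

text \<open>The difference is the integral of \<open>f\<close> against the ratio minus 1, and
  Cauchy-Schwarz keeps the root of the mean of \<open>f\<close>. For a shell, whose mass is of order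
  \<open>h\<close>, a shift of length of order \<open>h\<close> thus costs \<open>h^(3/2)\<close>,
  less than the main term.\<close>

lemma Nd_shift_diff:
  assumes [measurable]: "f \<in> borel_measurable (Rd d)" and f: "\<And>z. 0 \<le> f z" "\<And>z. f z \<le> (1::real)"
    and m: "dotp d m m \<le> 1"
  shows "\<bar>(\<integral>z. f (\<lambda>i\<in>{..<d}. z i + m i) \<partial>Nd d) - (\<integral>z. f z \<partial>Nd d)\<bar>
    \<le> 2 * sqrt (\<integral>z. f z \<partial>Nd d) * sqrt (dotp d m m)"
proof -
  have m0: "0 \<le> dotp d m m" unfolding dotp_def by (intro sum_nonneg) simp
  have fi: "integrable (Nd d) f" using f by (intro Nd.integrable_const_bound[of _ 1]) (auto simp: abs_le_iff)
  have f2: "(f z)\<^sup>2 \<le> f z" for z using f[of z] by (simp add: power2_eq_square mult_left_le)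
  have f2i: "integrable (Nd d) (\<lambda>z. (f z)\<^sup>2)"
    by (rule Bochner_Integration.integrable_bound[OF fi]) (use f f2 in auto)
  note L = Lm_variance[of d m]
  have fL: "integrable (Nd d) (\<lambda>z. Lm d m z * f z)"
    by (subst Nd_shift) (use f in \<open>auto intro!: Nd.integrable_const_bound[of _ 1] simp: abs_le_iff\<close>)
  have "(\<integral>z. f (\<lambda>i\<in>{..<d}. z i + m i) \<partial>Nd d) - (\<integral>z. f z \<partial>Nd d) = (\<integral>z. f z * (Lm d m z - 1) \<partial>Nd d)"
    unfolding Nd_shift(2)[OF assms(1)] using fL fi by (simp add: algebra_simps)
  also have "\<bar>\<dots>\<bar> \<le> (\<integral>z. \<bar>f z * (Lm d m z - 1)\<bar> \<partial>Nd d)" by (rule integral_abs_bound)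
  also have "\<dots> \<le> sqrt ((\<integral>z. f z \<partial>Nd d) * (4 * dotp d m m))"
  proof (rule real_le_rsqrt)
    have "(\<integral>z. \<bar>f z * (Lm d m z - 1)\<bar> \<partial>Nd d)\<^sup>2 \<le> (\<integral>z. (f z)\<^sup>2 \<partial>Nd d) * (\<integral>z. (Lm d m z - 1)\<^sup>2 \<partial>Nd d)"
      by (rule Cauchy_Schwarz_integral) (use f2i L in auto)
    also have "\<dots> \<le> (\<integral>z. f z \<partial>Nd d) * (4 * dotp d m m)"
    proof (intro mult_mono)
      show "(\<integral>z. (f z)\<^sup>2 \<partial>Nd d) \<le> (\<integral>z. f z \<partial>Nd d)" by (intro integral_mono f2i fi f2)
      show "(\<integral>z. (Lm d m z - 1)\<^sup>2 \<partial>Nd d) \<le> 4 * dotp d m m"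
        using L exp_bound[OF m0 m] m0 m mult_left_le[OF m m0] by (simp add: power2_eq_square)
      show "0 \<le> (\<integral>z. f z \<partial>Nd d)" using f by simp
    qed simp
    finally show "(\<integral>z. \<bar>f z * (Lm d m z - 1)\<bar> \<partial>Nd d)\<^sup>2 \<le> \<dots>" .
  qed
  also have "\<dots> = 2 * sqrt (\<integral>z. f z \<partial>Nd d) * sqrt (dotp d m m)"
    by (simp add: real_sqrt_mult)
  finally show ?thesis .
qed

text \<open>A first-order expansion uniform in \<open>f\<close>: the bounds 0 and 1 replace
  smoothness. For \<open>|m| \<le> 1\<close> the remainder of the ratio has second moment at most
  \<open>|m|^4\<close>; for larger \<open>m\<close> the trivial bounds 1 and \<open>|m|\<close> on
  the two parts already fit.\<close>

lemma Nd_shift_linear: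
  assumes [measurable]: "f \<in> borel_measurable (Rd d)" and f: "\<And>z. 0 \<le> f z" "\<And>z. f z \<le> (1::real)"
  shows "\<bar>(\<integral>z. f (\<lambda>i\<in>{..<d}. z i + m i) \<partial>Nd d) - (\<integral>z. f z \<partial>Nd d) - (\<integral>z. f z * dotp d m z \<partial>Nd d)\<bar>
    \<le> 2 * dotp d m m"
proof -
  define t where "t = dotp d m m"
  have t0: "0 \<le> t" unfolding dotp_def t_def by (intro sum_nonneg) simp
  have fi: "integrable (Nd d) f" using f by (intro Nd.integrable_const_bound[of _ 1]) (auto simp: abs_le_iff)
  have fs: "integrable (Nd d) (\<lambda>z. f (\<lambda>i\<in>{..<d}. z i + m i))"
    using f by (intro Nd.integrable_const_bound[of _ 1]) (auto simp: abs_le_iff)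
  have fL: "integrable (Nd d) (\<lambda>z. Lm d m z * f z)"
    by (subst Nd_shift) (use f fs in auto)
  have fg: "\<bar>f z * g\<bar> \<le> \<bar>g\<bar>" for z g using f[of z] by (simp add: abs_mult mult_left_le_one_le)
  have fw: "integrable (Nd d) (\<lambda>z. f z * dotp d m z)"
    by (rule Bochner_Integration.integrable_bound[OF Nd_dotp(1)[of d m]]) (use fg in auto)
  show ?thesis
  proof (cases "t \<le> 1")
    case True
    note L = Lm_variance[of d m]
    let ?R = "\<lambda>z. Lm d m z - 1 - dotp d m z"
    have Ri: "integrable (Nd d) ?R" using Lm_moments(1)[of d m] Nd_dotp[of d m] by simp
    have "(\<integral>z. f (\<lambda>i\<in>{..<d}. z i + m i) \<partial>Nd d) - (\<integral>z. f z \<partial>Nd d) - (\<integral>z. f z * dotp d m z \<partial>Nd d)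
      = (\<integral>z. f z * ?R z \<partial>Nd d)"
      unfolding Nd_shift(2)[OF assms(1)] using fL fi fw by (simp add: algebra_simps)
    also have "\<bar>\<dots>\<bar> \<le> (\<integral>z. \<bar>f z * ?R z\<bar> \<partial>Nd d)" by (rule integral_abs_bound)
    also have "\<dots> \<le> (\<integral>z. \<bar>?R z\<bar> \<partial>Nd d)"
      using Ri fg by (intro integral_mono integrable_abs) (auto intro: Bochner_Integration.integrable_bound[OF Ri])
    also have "\<dots> \<le> sqrt (\<integral>z. (?R z)\<^sup>2 \<partial>Nd d)"
      by (rule integral_abs_le_sqrt(2)) (use L prob_space_Nd in auto)
    also have "\<dots> \<le> sqrt (t\<^sup>2)"
      unfolding L(4) using exp_bound[OF t0 True] by (intro real_sqrt_le_mono) (simp add: t_def)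
    also have "\<dots> \<le> 2 * t" using t0 by simp
    finally show ?thesis by (simp add: t_def)
  next
    case False
    have a: "\<bar>(\<integral>z. f z * dotp d m z \<partial>Nd d)\<bar> \<le> sqrt t"
    proof -
      have "\<bar>(\<integral>z. f z * dotp d m z \<partial>Nd d)\<bar> \<le> (\<integral>z. \<bar>f z * dotp d m z\<bar> \<partial>Nd d)" by (rule integral_abs_bound)
      also have "\<dots> \<le> (\<integral>z. \<bar>dotp d m z\<bar> \<partial>Nd d)"
        using fw fg Nd_dotp[of d m] by (intro integral_mono integrable_abs) auto
      also have "\<dots> \<le> sqrt (\<integral>z. (dotp d m z)\<^sup>2 \<partial>Nd d)"
        by (rule integral_abs_le_sqrt(2)) (use Nd_dotp prob_space_Nd in auto)
      finally show ?thesis using Nd_dotp[of d m] by (simp add: t_def)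
    qed
    have "0 \<le> (\<integral>z. f z \<partial>Nd d)" "0 \<le> (\<integral>z. f (\<lambda>i\<in>{..<d}. z i + m i) \<partial>Nd d)" using f by auto
    moreover have "(\<integral>z. f z \<partial>Nd d) \<le> 1" "(\<integral>z. f (\<lambda>i\<in>{..<d}. z i + m i) \<partial>Nd d) \<le> 1"
      using f fi fs by (auto intro!: Nd.integral_le_const)
    moreover have t1: "1 \<le> t" using False by simp
    moreover have "sqrt t \<le> t" using t1 by (intro real_le_lsqrt) (auto simp: power2_eq_square)
    ultimately show ?thesis using a unfolding t_def[symmetric] by linarith
  qed
qed

section \<open>Rotation invariance\<close>

text \<open>The angle may vary with the coordinate: a constant angle gives the Gaussian smoothing,
  an angle supported on a set \<open>J\<close> gives noise on \<open>J\<close> alone.\<close>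

definition rot :: "nat \<Rightarrow> (nat \<Rightarrow> real) \<Rightarrow> (nat \<Rightarrow> real) \<times> (nat \<Rightarrow> real) \<Rightarrow> (nat \<Rightarrow> real) \<times> (nat \<Rightarrow> real)" where
  "rot d \<theta> p = ((\<lambda>i\<in>{..<d}. cos (\<theta> i) * fst p i + sin (\<theta> i) * snd p i),
                (\<lambda>i\<in>{..<d}. cos (\<theta> i) * snd p i - sin (\<theta> i) * fst p i))"

interpretation Rd2: pair_sigma_finite "Rd d" "Rd d'" ..

lemma measurable_pair_component [measurable]:
  "i < d \<Longrightarrow> (\<lambda>p. fst p i) \<in> borel_measurable (Rd d \<Otimes>\<^sub>M N)"
  "i < d \<Longrightarrow> (\<lambda>p. snd p i) \<in> borel_measurable (N \<Otimes>\<^sub>M Rd d)"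
  by (auto intro: measurable_compose[OF measurable_fst] measurable_compose[OF measurable_snd])

lemma measurable_rot [measurable]: "rot d \<theta> \<in> Rd d \<Otimes>\<^sub>M Rd d \<rightarrow>\<^sub>M Rd d \<Otimes>\<^sub>M Rd d"
  unfolding rot_def by (intro measurable_Pair measurable_vecI) measurable

text \<open>A shear moves one component by an amount depending on the other, so on each fibre it is
  a translation. This reduces rotation invariance to \<open>nn_integral_Rd_shift\<close>, with no
  determinant involved.\<close>

definition shear1 :: "nat \<Rightarrow> (nat \<Rightarrow> real) \<Rightarrow> (nat \<Rightarrow> real) \<times> (nat \<Rightarrow> real) \<Rightarrow> (nat \<Rightarrow> real) \<times> (nat \<Rightarrow> real)" where
  "shear1 d t p = ((\<lambda>i\<in>{..<d}. fst p i + t i * snd p i), snd p)"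

definition shear2 :: "nat \<Rightarrow> (nat \<Rightarrow> real) \<Rightarrow> (nat \<Rightarrow> real) \<times> (nat \<Rightarrow> real) \<Rightarrow> (nat \<Rightarrow> real) \<times> (nat \<Rightarrow> real)" where
  "shear2 d t p = (fst p, (\<lambda>i\<in>{..<d}. snd p i + t i * fst p i))"

lemma measurable_shear [measurable]:
  "shear1 d t \<in> Rd d \<Otimes>\<^sub>M Rd d \<rightarrow>\<^sub>M Rd d \<Otimes>\<^sub>M Rd d"
  "shear2 d t \<in> Rd d \<Otimes>\<^sub>M Rd d \<rightarrow>\<^sub>M Rd d \<Otimes>\<^sub>M Rd d"
  unfolding shear1_def shear2_def by (intro measurable_Pair measurable_vecI; measurable)+

lemma nn_integral_shear:
  assumes [measurable]: "F \<in> borel_measurable (Rd d \<Otimes>\<^sub>M Rd d)"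
  shows "(\<integral>\<^sup>+p. F (shear1 d t p) \<partial>(Rd d \<Otimes>\<^sub>M Rd d)) = (\<integral>\<^sup>+p. F p \<partial>(Rd d \<Otimes>\<^sub>M Rd d))"
    and "(\<integral>\<^sup>+p. F (shear2 d t p) \<partial>(Rd d \<Otimes>\<^sub>M Rd d)) = (\<integral>\<^sup>+p. F p \<partial>(Rd d \<Otimes>\<^sub>M Rd d))"
proof -
  have "(\<integral>\<^sup>+p. F (shear1 d t p) \<partial>(Rd d \<Otimes>\<^sub>M Rd d)) = (\<integral>\<^sup>+y. \<integral>\<^sup>+x. F (shear1 d t (x, y)) \<partial>Rd d \<partial>Rd d)"
    by (rule Rd2.nn_integral_snd[symmetric]) measurable
  also have "\<dots> = (\<integral>\<^sup>+y. \<integral>\<^sup>+x. F (x, y) \<partial>Rd d \<partial>Rd d)"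
  proof (rule nn_integral_cong)
    fix y assume "y \<in> space (Rd d)"
    then show "(\<integral>\<^sup>+x. F (shear1 d t (x, y)) \<partial>Rd d) = (\<integral>\<^sup>+x. F (x, y) \<partial>Rd d)"
      using nn_integral_Rd_shift[of "\<lambda>x. F (x, y)" d "\<lambda>i. t i * y i"] by (simp add: shear1_def)
  qed
  also have "\<dots> = (\<integral>\<^sup>+p. F p \<partial>(Rd d \<Otimes>\<^sub>M Rd d))" by (rule Rd2.nn_integral_snd) measurable
  finally show "(\<integral>\<^sup>+p. F (shear1 d t p) \<partial>(Rd d \<Otimes>\<^sub>M Rd d)) = (\<integral>\<^sup>+p. F p \<partial>(Rd d \<Otimes>\<^sub>M Rd d))" .
  have "(\<integral>\<^sup>+p. F (shear2 d t p) \<partial>(Rd d \<Otimes>\<^sub>M Rd d)) = (\<integral>\<^sup>+x. \<integral>\<^sup>+y. F (shear2 d t (x, y)) \<partial>Rd d \<partial>Rd d)"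
    by (rule Rd.nn_integral_fst[symmetric]) measurable
  also have "\<dots> = (\<integral>\<^sup>+x. \<integral>\<^sup>+y. F (x, y) \<partial>Rd d \<partial>Rd d)"
  proof (rule nn_integral_cong)
    fix x assume "x \<in> space (Rd d)"
    then show "(\<integral>\<^sup>+y. F (shear2 d t (x, y)) \<partial>Rd d) = (\<integral>\<^sup>+y. F (x, y) \<partial>Rd d)"
      using nn_integral_Rd_shift[of "\<lambda>y. F (x, y)" d "\<lambda>i. t i * x i"] by (simp add: shear2_def)
  qed
  also have "\<dots> = (\<integral>\<^sup>+p. F p \<partial>(Rd d \<Otimes>\<^sub>M Rd d))" by (rule Rd.nn_integral_fst) measurable
  finally show "(\<integral>\<^sup>+p. F (shear2 d t p) \<partial>(Rd d \<Otimes>\<^sub>M Rd d)) = (\<integral>\<^sup>+p. F p \<partial>(Rd d \<Otimes>\<^sub>M Rd d))" .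
qed

text \<open>The three-shear factorisation of a plane rotation, applied in every coordinate plane.
  The tangent of the half angle is the reason for restricting the angles to
  \<open>(-pi, pi)\<close>.\<close>

lemma rot_eq_shears:
  assumes "\<And>i. \<bar>\<theta> i\<bar> < pi"
  shows "rot d \<theta> p = shear1 d (\<lambda>i. tan (\<theta> i / 2)) (shear2 d (\<lambda>i. - sin (\<theta> i)) (shear1 d (\<lambda>i. tan (\<theta> i / 2)) p))"
proof -
  have c: "cos (\<theta> i / 2) \<noteq> 0" for i
  proof -
    have "\<bar>\<theta> i / 2\<bar> < pi / 2" using assms[of i] by simp
    then have "0 < cos (\<theta> i / 2)" by (intro cos_gt_zero_pi) (auto simp: abs_less_iff)
    then show ?thesis by simp
  qed
  have s: "sin (\<theta> i) = 2 * sin (\<theta> i / 2) * cos (\<theta> i / 2)" for i using sin_double[of "\<theta> i / 2"] by simp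
  have e1: "sin (\<theta> i) * tan (\<theta> i / 2) = 1 - cos (\<theta> i)" for i
    using c[of i] cos_double_sin[of "\<theta> i / 2"] by (simp add: s tan_def power2_eq_square)
  have e2: "tan (\<theta> i / 2) * (1 + cos (\<theta> i)) = sin (\<theta> i)" for i
    using c[of i] cos_double_cos[of "\<theta> i / 2"] by (simp add: s tan_def power2_eq_square)
  have a: "y - sin (\<theta> i) * (x + tan (\<theta> i / 2) * y) = cos (\<theta> i) * y - sin (\<theta> i) * x" for i x y
  proof -
    have "y - s * (x + t * y) = c * y - s * x" if "s * t = 1 - c" for s t c :: real
    proof -
      have "s * (t * y) = (1 - c) * y" using that by (metis mult.assoc)
      then show ?thesis by (simp add: algebra_simps)
    qed
    from this[OF e1] show ?thesis .
  qed
  have b: "x + tan (\<theta> i / 2) * y + tan (\<theta> i / 2) * (y - sin (\<theta> i) * (x + tan (\<theta> i / 2) * y))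
      = cos (\<theta> i) * x + sin (\<theta> i) * y" for i x y
  proof -
    have "x + t * y + t * (y - s * (x + t * y)) = c * x + s * y" if "s * t = 1 - c" "t * (1 + c) = s" for s t c :: real
    proof -
      have "t * (s * (x + t * y)) = (1 - c) * (x + t * y)" using that(1) by (metis mult.assoc mult.commute)
      then have "x + t * y + t * (y - s * (x + t * y)) = c * x + t * (1 + c) * y" by (simp add: algebra_simps)
      then show ?thesis using that by simp
    qed
    from this[OF e1 e2] show ?thesis .
  qed
  show ?thesis
    unfolding rot_def shear1_def shear2_def
    using a b by (auto simp: fun_eq_iff restrict_def)
qed

lemma Nd_pair_density:
  "Nd d \<Otimes>\<^sub>M Nd d = density (Rd d \<Otimes>\<^sub>M Rd d)
    (\<lambda>p. ennreal (exp (- (dotp d (fst p) (fst p) + dotp d (snd p) (snd p)) / 2) / (sqrt (2 * pi) ^ d * sqrt (2 * pi) ^ d)))"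
proof -
  have "Nd d \<Otimes>\<^sub>M Nd d = density (Rd d \<Otimes>\<^sub>M Rd d)
    (\<lambda>(x,y). ennreal (\<Prod>i<d. std_normal_density (x i)) * ennreal (\<Prod>i<d. std_normal_density (y i)))"
    unfolding Nd_density using Rd.sigma_finite_measure_axioms Nd.sigma_finite_measure_axioms[of d, unfolded Nd_density]
    by (intro pair_measure_density) auto
  also have "(\<lambda>(x,y). ennreal (\<Prod>i<d. std_normal_density (x i)) * ennreal (\<Prod>i<d. std_normal_density (y i))) =
    (\<lambda>p. ennreal (exp (- (dotp d (fst p) (fst p) + dotp d (snd p) (snd p)) / 2) / (sqrt (2 * pi) ^ d * sqrt (2 * pi) ^ d)))"
    unfolding std_normal_prod_eq
    by (auto simp: fun_eq_iff ennreal_mult'[symmetric] exp_add[symmetric] add_divide_distrib)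
  finally show ?thesis .
qed

lemma dotp_rot:
  "dotp d (fst (rot d \<theta> p)) (fst (rot d \<theta> p)) + dotp d (snd (rot d \<theta> p)) (snd (rot d \<theta> p))
    = dotp d (fst p) (fst p) + dotp d (snd p) (snd p)"
proof -
  have "(cos a * x + s * y) * (cos a * x + s * y) + (cos a * y - s * x) * (cos a * y - s * x) = x * x + y * y"
    if "s = sin a" for a x y s :: real
  proof -
    have "(c * x + s * y) * (c * x + s * y) + (c * y - s * x) * (c * y - s * x) = x * x + y * y"
      if "s\<^sup>2 + c\<^sup>2 = 1" for c
    proof -
      have "(c * x + s * y) * (c * x + s * y) + (c * y - s * x) * (c * y - s * x) = (s\<^sup>2 + c\<^sup>2) * (x * x + y * y)"
        by (simp add: power2_eq_square algebra_simps)
      then show ?thesis using that by simp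
    qed
    from this[of "cos a"] show ?thesis using that by simp
  qed
  note key = this[OF refl]
  show ?thesis unfolding dotp_def rot_def fst_conv snd_conv sum.distrib[symmetric]
    by (intro sum.cong refl) (simp only: restrict_apply' key)
qed

text \<open>The joint density depends only on \<open>|x|^2 + |y|^2\<close>, which
  \<open>dotp_rot\<close> preserves, and Lebesgue measure is invariant under each of the three
  shears.\<close>

lemma distr_rot:
  assumes "\<And>i. \<bar>\<theta> i\<bar> < pi"
  shows "distr (Nd d \<Otimes>\<^sub>M Nd d) (Rd d \<Otimes>\<^sub>M Rd d) (rot d \<theta>) = Nd d \<Otimes>\<^sub>M Nd d"
proof (rule measure_eqI)
  have s: "sets (Nd d \<Otimes>\<^sub>M Nd d) = sets (Rd d \<Otimes>\<^sub>M Rd d)" by (intro sets_pair_measure_cong sets_Nd)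
  then show "sets (distr (Nd d \<Otimes>\<^sub>M Nd d) (Rd d \<Otimes>\<^sub>M Rd d) (rot d \<theta>)) = sets (Nd d \<Otimes>\<^sub>M Nd d)" by simp
  fix A assume "A \<in> sets (distr (Nd d \<Otimes>\<^sub>M Nd d) (Rd d \<Otimes>\<^sub>M Rd d) (rot d \<theta>))"
  then have A [measurable]: "A \<in> sets (Rd d \<Otimes>\<^sub>M Rd d)" by simp
  have AN: "A \<in> sets (Nd d \<Otimes>\<^sub>M Nd d)" using A s by simp
  define \<Phi> where "\<Phi> p = ennreal (exp (- (dotp d (fst p) (fst p) + dotp d (snd p) (snd p)) / 2) / (sqrt (2 * pi) ^ d * sqrt (2 * pi) ^ d))" for p
  have [measurable]: "\<Phi> \<in> borel_measurable (Rd d \<Otimes>\<^sub>M Rd d)" unfolding \<Phi>_def by measurable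
  have inv: "\<Phi> (rot d \<theta> p) = \<Phi> p" for p unfolding \<Phi>_def dotp_rot ..
  have "emeasure (distr (Nd d \<Otimes>\<^sub>M Nd d) (Rd d \<Otimes>\<^sub>M Rd d) (rot d \<theta>)) A
    = (\<integral>\<^sup>+p. indicator A p \<partial>distr (Nd d \<Otimes>\<^sub>M Nd d) (Rd d \<Otimes>\<^sub>M Rd d) (rot d \<theta>))" by simp
  also have "\<dots> = (\<integral>\<^sup>+p. indicator A (rot d \<theta> p) \<partial>(Nd d \<Otimes>\<^sub>M Nd d))"
    by (subst nn_integral_distr) (auto simp: measurable_cong_sets[OF s refl])
  also have "\<dots> = (\<integral>\<^sup>+p. \<Phi> p * indicator A (rot d \<theta> p) \<partial>(Rd d \<Otimes>\<^sub>M Rd d))"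
    unfolding Nd_pair_density by (subst nn_integral_density) (auto simp: \<Phi>_def)
  also have "\<dots> = (\<integral>\<^sup>+p. (\<lambda>p. \<Phi> p * indicator A p) (rot d \<theta> p) \<partial>(Rd d \<Otimes>\<^sub>M Rd d))"
    by (simp add: inv)
  also have "\<dots> = (\<integral>\<^sup>+p. \<Phi> p * indicator A p \<partial>(Rd d \<Otimes>\<^sub>M Rd d))"
    unfolding rot_eq_shears[OF assms]
    by (subst nn_integral_shear(1)[of "\<lambda>p. \<Phi> (shear1 d _ (shear2 d _ p)) * indicator A (shear1 d _ (shear2 d _ p))"], measurable,
        subst nn_integral_shear(2)[of "\<lambda>p. \<Phi> (shear1 d _ p) * indicator A (shear1 d _ p)"], measurable,
        subst nn_integral_shear(1)[of "\<lambda>p. \<Phi> p * indicator A p"], measurable)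
  also have "\<dots> = (\<integral>\<^sup>+p. indicator A p \<partial>(Nd d \<Otimes>\<^sub>M Nd d))"
    unfolding Nd_pair_density by (subst nn_integral_density) (auto simp: \<Phi>_def)
  also have "\<dots> = emeasure (Nd d \<Otimes>\<^sub>M Nd d) A" using AN by simp
  finally show "emeasure (distr (Nd d \<Otimes>\<^sub>M Nd d) (Rd d \<Otimes>\<^sub>M Rd d) (rot d \<theta>)) A = emeasure (Nd d \<Otimes>\<^sub>M Nd d) A" .
qed

lemma nn_integral_rot:
  assumes "\<And>i. \<bar>\<theta> i\<bar> < pi" and [measurable]: "F \<in> borel_measurable (Rd d \<Otimes>\<^sub>M Rd d)"
  shows "(\<integral>\<^sup>+p. F (rot d \<theta> p) \<partial>(Nd d \<Otimes>\<^sub>M Nd d)) = (\<integral>\<^sup>+p. F p \<partial>(Nd d \<Otimes>\<^sub>M Nd d))"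
proof -
  have s: "sets (Nd d \<Otimes>\<^sub>M Nd d) = sets (Rd d \<Otimes>\<^sub>M Rd d)" by (intro sets_pair_measure_cong sets_Nd)
  show ?thesis
    by (subst (2) distr_rot[OF assms(1), symmetric], subst nn_integral_distr) (auto simp: measurable_cong_sets[OF s refl])
qed

lemma nn_integral_rot_fst:
  assumes "\<And>i. \<bar>\<theta> i\<bar> < pi" and [measurable]: "F \<in> borel_measurable (Rd d)"
  shows "(\<integral>\<^sup>+p. F (fst (rot d \<theta> p)) \<partial>(Nd d \<Otimes>\<^sub>M Nd d)) = (\<integral>\<^sup>+x. F x \<partial>Nd d)"
proof -
  have [measurable]: "F \<in> borel_measurable (Nd d)" by measurable
  have "(\<integral>\<^sup>+p. F (fst (rot d \<theta> p)) \<partial>(Nd d \<Otimes>\<^sub>M Nd d)) = (\<integral>\<^sup>+p. F (fst p) \<partial>(Nd d \<Otimes>\<^sub>M Nd d))"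
    by (rule nn_integral_rot[OF assms(1), of "\<lambda>p. F (fst p)"]) measurable
  also have "\<dots> = (\<integral>\<^sup>+x. \<integral>\<^sup>+y. F (fst (x, y)) \<partial>Nd d \<partial>Nd d)"
    by (rule Nd.nn_integral_fst[symmetric]) measurable
  also have "\<dots> = (\<integral>\<^sup>+x. F x \<partial>Nd d)" by (simp add: Nd.emeasure_space_1)
  finally show ?thesis .
qed

section \<open>Gaussian smoothing and surface area\<close>

lemma std_gaussian_eq_Nd: "std_gaussian d = Nd d"
proof -
  let ?I = "1\<^sub>m d :: real mat"
  have I: "?I \<in> carrier_mat d d" by simp
  obtain B where B: "mat_inverse ?I = Some B" "?I * B = ?I" "B \<in> carrier_mat d d"
  proof (cases "mat_inverse ?I")
    case None
    have "?I \<in> Units (ring_mat TYPE(real) d undefined)"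
      unfolding Units_def ring_mat_simps by auto
    then show ?thesis using mat_inverse(1)[OF I None, of undefined] by blast
  next
    case (Some B)
    then show ?thesis using mat_inverse(2)[OF I Some] that by auto
  qed
  then have BI: "the (mat_inverse ?I) = ?I" by simp
  have s: "scalar_prod z (?I *\<^sub>v z) = dotp d (\<lambda>i. z $ i) (\<lambda>i. z $ i)" if "z \<in> carrier_vec d" for z
    using that by (simp add: scalar_prod_def dotp_def atLeast0LessThan)
  have e: "dotp d (($) (Matrix.vec d (\<lambda>i. x i - (\<lambda>i\<in>{..<d}. 0) i))) (($) (Matrix.vec d (\<lambda>i. x i - (\<lambda>i\<in>{..<d}. 0) i))) = dotp d x x" for x
    unfolding dotp_def by (intro sum.cong) auto
  have "gaussian d (\<lambda>i\<in>{..<d}. 0) ?I = density (Rd d) (\<lambda>x. ennreal (\<Prod>i<d. std_normal_density (x i)))"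
    unfolding gaussian_def Let_def BI
  proof (intro density_cong AE_I2)
    fix x
    show "ennreal (exp (- scalar_prod (Matrix.vec d (\<lambda>i. x i - (\<lambda>i\<in>{..<d}. 0) i))
        (?I *\<^sub>v Matrix.vec d (\<lambda>i. x i - (\<lambda>i\<in>{..<d}. 0) i)) / 2) / sqrt ((2 * pi) ^ d * Determinant.det ?I)) =
      ennreal (\<Prod>i<d. std_normal_density (x i))"
      unfolding std_normal_prod_eq by (subst s, simp, simp only: e) (simp add: real_sqrt_power real_sqrt_mult power_mult_distrib)
  next
    show "(\<lambda>x. ennreal (exp (- scalar_prod (Matrix.vec d (\<lambda>i. x i - (\<lambda>i\<in>{..<d}. 0) i))
        (?I *\<^sub>v Matrix.vec d (\<lambda>i. x i - (\<lambda>i\<in>{..<d}. 0) i)) / 2) / sqrt ((2 * pi) ^ d * Determinant.det ?I)))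
        \<in> borel_measurable (Rd d)"
      by (subst s, simp, simp only: e) measurable
  qed measurable
  then show ?thesis by (simp add: Nd_density)
qed

section \<open>Euclidean neighbourhoods and shells\<close>

lemma L2_set_diff_commute: "L2_set (\<lambda>i. x i - y i) I = L2_set (\<lambda>i. y i - (x i :: real)) I"
  unfolding L2_set_def by (simp add: power2_commute)

lemma L2_set_diff_triangle:
  "L2_set (\<lambda>i. x i - z i) I \<le> L2_set (\<lambda>i. x i - y i) I + L2_set (\<lambda>i. y i - (z i :: real)) I"
  using L2_set_triangle_ineq[of "\<lambda>i. x i - y i" "\<lambda>i. y i - z i" I] by simp

text \<open>The distance \<open>D\<close> to an arbitrary set, measurable or not, is 1-Lipschitz.
  Hence it equals the infimum of \<open>D q + |x - q|\<close> over rational points \<open>q\<close>,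
  a countable infimum of measurable functions of \<open>x\<close>.\<close>

lemma neighbourhood_sets [measurable]: "neighbourhood d A \<delta> \<in> sets (Rd d)"
proof -
  define D where "D x = (INF y\<in>A. ennreal (L2_set (\<lambda>i. x i - y i) {..<d}))" for x :: "nat \<Rightarrow> real"
  define Q where "Q = ({..<d} \<rightarrow>\<^sub>E (\<rat> :: real set))"
  have cQ: "countable Q" unfolding Q_def by (intro countable_PiE) (auto simp: countable_rat)
  have lip: "D x \<le> D y + ennreal (L2_set (\<lambda>i. x i - y i) {..<d})" for x y
  proof (cases "A = {}")
    case False
    have "D x - ennreal (L2_set (\<lambda>i. x i - y i) {..<d}) \<le> D y"
      unfolding D_def[of y]
    proof (rule INF_greatest)
      fix a assume "a \<in> A"
      then have "D x \<le> ennreal (L2_set (\<lambda>i. x i - a i) {..<d})" unfolding D_def by (rule INF_lower)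
      also have "\<dots> \<le> ennreal (L2_set (\<lambda>i. x i - y i) {..<d}) + ennreal (L2_set (\<lambda>i. y i - a i) {..<d})"
        by (subst ennreal_plus[symmetric])
          (auto intro!: ennreal_leI L2_set_diff_triangle simp del: ennreal_plus)
      finally show "D x - ennreal (L2_set (\<lambda>i. x i - y i) {..<d}) \<le> ennreal (L2_set (\<lambda>i. y i - a i) {..<d})"
        by (simp add: ennreal_minus_le_iff)
    qed
    then show ?thesis by (simp add: ennreal_minus_le_iff add.commute)
  qed (simp add: D_def)
  have D: "D x = (INF q\<in>Q. D q + ennreal (L2_set (\<lambda>i. x i - q i) {..<d}))" if x: "x \<in> space (Rd d)" for x
  proof (rule antisym)
    show "D x \<le> (INF q\<in>Q. D q + ennreal (L2_set (\<lambda>i. x i - q i) {..<d}))"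
      by (intro INF_greatest lip)
    show "(INF q\<in>Q. D q + ennreal (L2_set (\<lambda>i. x i - q i) {..<d})) \<le> D x"
    proof (rule ennreal_le_epsilon)
      fix e :: real assume e: "0 < e"
      \<comment> \<open>With every coordinate off by less than \<open>e'\<close>, the
        \<open>d\<close> errors sum to at most \<open>e / 2\<close>; one half pays for the distance
        to \<open>q\<close>, the other for the change of \<open>D\<close>.\<close>
      define e' where "e' = e / (2 * (real d + 1))"
      have e': "0 < e'" using e by (simp add: e'_def)
      have "\<exists>q\<in>\<rat>. x i < q \<and> q < x i + e'" for i
        using Rats_dense_in_real[of "x i" "x i + e'"] e' by auto
      then obtain q where q: "\<And>i. q i \<in> \<rat>" "\<And>i. x i < q i" "\<And>i. q i < x i + e'" by metis
      have "L2_set (\<lambda>i. x i - restrict q {..<d} i) {..<d} \<le> (\<Sum>i<d. \<bar>x i - restrict q {..<d} i\<bar>)"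
        by (rule L2_set_le_sum_abs)
      also have "\<dots> \<le> (\<Sum>i<d. e')"
      proof (intro sum_mono)
        fix i assume "i \<in> {..<d}"
        then show "\<bar>x i - restrict q {..<d} i\<bar> \<le> e'" using q(2)[of i] q(3)[of i] by auto
      qed
      also have "\<dots> \<le> e / 2" using e by (simp add: e'_def field_simps)
      finally have l: "L2_set (\<lambda>i. x i - restrict q {..<d} i) {..<d} \<le> e / 2" .
      have "(INF q\<in>Q. D q + ennreal (L2_set (\<lambda>i. x i - q i) {..<d})) \<le>
        D (restrict q {..<d}) + ennreal (L2_set (\<lambda>i. x i - restrict q {..<d} i) {..<d})"
        using q by (intro INF_lower) (auto simp: Q_def)
      also have "\<dots> \<le> D x + ennreal (e / 2) + ennreal (e / 2)"
        using l lip[of "restrict q {..<d}" x]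
        by (intro add_mono order_trans[OF lip[of "restrict q {..<d}" x]] order_refl ennreal_leI)
          (subst L2_set_diff_commute, auto)
      also have "\<dots> = D x + ennreal e" using e by (simp add: add.assoc ennreal_plus[symmetric] del: ennreal_plus)
      finally show "(INF q\<in>Q. D q + ennreal (L2_set (\<lambda>i. x i - q i) {..<d})) \<le> D x + ennreal e" .
    qed
  qed
  have "(\<lambda>x. INF q\<in>Q. D q + ennreal (L2_set (\<lambda>i. x i - q i) {..<d})) \<in> borel_measurable (Rd d)"
    unfolding L2_set_def using cQ by (intro borel_measurable_INF) measurable
  then have [measurable]: "D \<in> borel_measurable (Rd d)" using D by (simp cong: measurable_cong)
  have "neighbourhood d A \<delta> = {x \<in> space (Rd d). D x \<le> ennreal \<delta>}"
    unfolding neighbourhood_def D_def ..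
  then show ?thesis by simp
qed

lemma in_neighbourhood:
  assumes "x \<in> space (Rd d)" "y \<in> A" "L2_set (\<lambda>i. x i - y i) {..<d} \<le> \<delta>"
  shows "x \<in> neighbourhood d A \<delta>"
  using assms unfolding neighbourhood_def by (auto intro!: INF_lower2 ennreal_leI)

text \<open>One-sided: of two points within distance \<open>h\<close>, one in \<open>A\<close> and
  one not, the outer one lies in the shell.\<close>

definition shell :: "nat \<Rightarrow> (nat \<Rightarrow> real) set \<Rightarrow> real \<Rightarrow> (nat \<Rightarrow> real) set" where
  "shell d A h = neighbourhood d A h - A"

lemma shell_sets [measurable]: "A \<in> sets (Rd d) \<Longrightarrow> shell d A h \<in> sets (Rd d)"
  unfolding shell_def by simp

text \<open>A bound on a lower limit speaks only about arbitrarily small good values of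
  \<open>h\<close>, not about all small ones. This is enough, since \<open>h\<close> serves only as
  a length that may be taken as small as desired.\<close>

lemma surface_area_frequently:
  assumes G: "gauss_surface_area d A \<le> ennreal G" "0 \<le> G" and "0 < \<iota>" "0 < h0"
  shows "\<exists>h. 0 < h \<and> h < h0 \<and> measure (Nd d) (shell d A h) \<le> (G + \<iota>) * h"
proof -
  have "\<not> (\<forall>\<^sub>F h in at_right 0. ennreal (G + \<iota>) \<le> emeasure (std_gaussian d) (neighbourhood d A h - A) / ennreal h)"
  proof
    assume "\<forall>\<^sub>F h in at_right 0. ennreal (G + \<iota>) \<le> emeasure (std_gaussian d) (neighbourhood d A h - A) / ennreal h"
    then have "ennreal (G + \<iota>) \<le> gauss_surface_area d A"
      unfolding gauss_surface_area_def by (rule Liminf_bounded)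
    then have "ennreal (G + \<iota>) \<le> ennreal G" using G(1) by (rule order_trans)
    then show False using assms by (simp add: ennreal_le_iff)
  qed
  moreover have "\<forall>\<^sub>F h in at_right (0::real). 0 < h \<and> h < h0"
    using \<open>0 < h0\<close> by (auto simp: eventually_at_right_field intro!: exI[of _ h0])
  ultimately have "\<exists>\<^sub>F h in at_right 0. \<not> ennreal (G + \<iota>) \<le> emeasure (std_gaussian d) (neighbourhood d A h - A) / ennreal h \<and> 0 < h \<and> h < h0"
    unfolding not_eventually by (elim frequently_rev_mp eventually_mono) simp
  then obtain h where h: "\<not> ennreal (G + \<iota>) \<le> emeasure (Nd d) (shell d A h) / ennreal h" "0 < h" "h < h0"
    unfolding std_gaussian_eq_Nd shell_def by (auto dest: frequently_ex)
  then have "\<not> G + \<iota> \<le> measure (Nd d) (shell d A h) / h"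
    by (simp add: Nd.emeasure_eq_measure divide_ennreal)
  then have "measure (Nd d) (shell d A h) / h \<le> G + \<iota>" by simp
  then show ?thesis using h by (auto simp: pos_divide_le_eq)
qed

text \<open>Mehler's formula for the Ornstein-Uhlenbeck operator with correlation
  \<open>cos \<phi>\<close>.\<close>

definition smooth :: "nat \<Rightarrow> real \<Rightarrow> ((nat \<Rightarrow> real) \<Rightarrow> real) \<Rightarrow> (nat \<Rightarrow> real) \<Rightarrow> real" where
  "smooth d \<phi> f x = (\<integral>z. f (fst (rot d (\<lambda>_. \<phi>) (x, z))) \<partial>Nd d)"

text \<open>By Gaussian integration by parts the gradient of \<open>smooth d \<phi> f\<close> is
  \<open>cot \<phi>\<close> times this. The derivative falls on the noise \<open>z\<close>, so
  \<open>f\<close> may be an indicator.\<close>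

definition grad :: "nat \<Rightarrow> real \<Rightarrow> ((nat \<Rightarrow> real) \<Rightarrow> real) \<Rightarrow> (nat \<Rightarrow> real) \<Rightarrow> nat \<Rightarrow> real" where
  "grad d \<phi> f x i = (\<integral>z. f (fst (rot d (\<lambda>_. \<phi>) (x, z))) * z i \<partial>Nd d)"

lemma sets_Rd_Nd [measurable_cong]: "sets (Rd d \<Otimes>\<^sub>M Nd d) = sets (Rd d \<Otimes>\<^sub>M Rd d)"
  "sets (Nd d \<Otimes>\<^sub>M Nd d) = sets (Rd d \<Otimes>\<^sub>M Rd d)"
  by (intro sets_pair_measure_cong sets_Nd refl)+

lemma measurable_smooth [measurable]:
  assumes [measurable]: "f \<in> borel_measurable (Rd d)"
  shows "smooth d \<phi> f \<in> borel_measurable (Rd d)"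
  unfolding smooth_def by (intro Nd.borel_measurable_lebesgue_integral) simp

lemma measurable_grad [measurable]:
  assumes [measurable]: "f \<in> borel_measurable (Rd d)" and i: "i < d"
  shows "(\<lambda>x. grad d \<phi> f x i) \<in> borel_measurable (Rd d)"
  unfolding grad_def using i by (intro Nd.borel_measurable_lebesgue_integral) simp

lemma rot_section [measurable]:
  "x \<in> space (Rd d) \<Longrightarrow> (\<lambda>z. fst (rot d \<theta> (x, z))) \<in> Rd d \<rightarrow>\<^sub>M Rd d"
  by measurable

lemma smooth_bounds:
  assumes [measurable]: "f \<in> borel_measurable (Rd d)" and f: "\<And>z. 0 \<le> f z" "\<And>z. f z \<le> (1::real)"
    and x: "x \<in> space (Rd d)"
  shows "0 \<le> smooth d \<phi> f x" "smooth d \<phi> f x \<le> 1"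
proof -
  show "0 \<le> smooth d \<phi> f x" unfolding smooth_def using f by simp
  show "smooth d \<phi> f x \<le> 1" unfolding smooth_def
    using f x by (intro Nd.integral_le_const Nd.integrable_const_bound[of _ 1]) (auto simp: abs_le_iff)
qed

text \<open>A displacement of the argument is a shift of the noise by \<open>cot \<phi>\<close>
  times as much, so the shift lemmas for \<open>Nd\<close> become regularity of
  \<open>smooth\<close>.\<close>

lemma rot_shift:
  assumes "sin \<phi> \<noteq> 0"
  shows "fst (rot d (\<lambda>_. \<phi>) ((\<lambda>i\<in>{..<d}. x i + u i), z))
    = fst (rot d (\<lambda>_. \<phi>) (x, (\<lambda>i\<in>{..<d}. z i + cos \<phi> / sin \<phi> * u i)))"
  using assms unfolding rot_def by (auto simp: fun_eq_iff algebra_simps restrict_def)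

lemma dotp_scale: "dotp d (\<lambda>i. c * u i) v = c * dotp d u v" "dotp d u (\<lambda>i. c * v i) = c * dotp d u v"
  unfolding dotp_def sum_distrib_left by (intro sum.cong; simp)+

lemma dotp_nonneg: "0 \<le> dotp d u u"
  unfolding dotp_def by (intro sum_nonneg) simp

text \<open>\<open>Nd_shift_linear\<close> for the section of \<open>f\<close> at \<open>x\<close>:
  its linear term is the first noise moment, which is the vector \<open>grad\<close>.\<close>

lemma smooth_linear:
  assumes [measurable]: "f \<in> borel_measurable (Rd d)" and f: "\<And>z. 0 \<le> f z" "\<And>z. f z \<le> (1::real)"
    and x: "x \<in> space (Rd d)" and s: "sin \<phi> \<noteq> 0"
  defines "\<kappa> \<equiv> cos \<phi> / sin \<phi>"
  shows "\<bar>smooth d \<phi> f (\<lambda>i\<in>{..<d}. x i + u i) - smooth d \<phi> f x - \<kappa> * dotp d u (grad d \<phi> f x)\<bar>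
     \<le> 2 * \<kappa>\<^sup>2 * dotp d u u"
proof -
  define F where "F z = f (fst (rot d (\<lambda>_. \<phi>) (x, z)))" for z
  have [measurable]: "F \<in> borel_measurable (Rd d)" unfolding F_def using x by measurable
  have F: "0 \<le> F z" "F z \<le> 1" for z unfolding F_def using f by auto
  have Fz: "integrable (Nd d) (\<lambda>z. F z * z i)" if "i < d" for i
  proof (rule Bochner_Integration.integrable_bound[OF Nd_coord(1)[OF that]])
    show "AE z in Nd d. norm (F z * z i) \<le> norm (z i)"
      using F by (auto simp: abs_mult intro!: mult_left_le_one_le)
  qed (use that in measurable)
  have "(\<integral>z. F z * dotp d (\<lambda>i. \<kappa> * u i) z \<partial>Nd d) = (\<integral>z. (\<Sum>i<d. \<kappa> * u i * (F z * z i)) \<partial>Nd d)"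
    unfolding dotp_def sum_distrib_left by (intro Bochner_Integration.integral_cong sum.cong refl) (simp add: ac_simps)
  also have "\<dots> = \<kappa> * dotp d u (grad d \<phi> f x)"
  proof (subst Bochner_Integration.integral_sum)
    show "integrable (Nd d) (\<lambda>z. \<kappa> * u i * (F z * z i))" if "i \<in> {..<d}" for i
      using Fz that by (intro integrable_mult_right) auto
    show "(\<Sum>i<d. \<integral>z. \<kappa> * u i * (F z * z i) \<partial>Nd d) = \<kappa> * dotp d u (grad d \<phi> f x)"
      unfolding dotp_def sum_distrib_left grad_def F_def[symmetric]
      by (intro sum.cong refl) (simp only: integral_mult_right_zero mult.assoc)
  qed
  finally have e: "(\<integral>z. F z * dotp d (\<lambda>i. \<kappa> * u i) z \<partial>Nd d) = \<kappa> * dotp d u (grad d \<phi> f x)" .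
  have "smooth d \<phi> f (\<lambda>i\<in>{..<d}. x i + u i) = (\<integral>z. F (\<lambda>i\<in>{..<d}. z i + \<kappa> * u i) \<partial>Nd d)"
    unfolding smooth_def F_def \<kappa>_def rot_shift[OF s] ..
  moreover have "smooth d \<phi> f x = (\<integral>z. F z \<partial>Nd d)" unfolding smooth_def F_def ..
  ultimately show ?thesis using Nd_shift_linear[of F d "\<lambda>i. \<kappa> * u i"] F e
    by (simp add: dotp_scale power2_eq_square)
qed

lemma smooth_diff:
  assumes [measurable]: "f \<in> borel_measurable (Rd d)" and f: "\<And>z. 0 \<le> f z" "\<And>z. f z \<le> (1::real)"
    and x: "x \<in> space (Rd d)" and s: "sin \<phi> \<noteq> 0"
  defines "\<kappa> \<equiv> cos \<phi> / sin \<phi>"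
  assumes u: "\<kappa>\<^sup>2 * dotp d u u \<le> 1" and \<kappa>: "0 \<le> \<kappa>"
  shows "\<bar>smooth d \<phi> f (\<lambda>i\<in>{..<d}. x i + u i) - smooth d \<phi> f x\<bar>
     \<le> 2 * \<kappa> * sqrt (smooth d \<phi> f x) * sqrt (dotp d u u)"
proof -
  define F where "F z = f (fst (rot d (\<lambda>_. \<phi>) (x, z)))" for z
  have [measurable]: "F \<in> borel_measurable (Rd d)" unfolding F_def using x by measurable
  have F: "0 \<le> F z" "F z \<le> 1" for z unfolding F_def using f by auto
  have "smooth d \<phi> f (\<lambda>i\<in>{..<d}. x i + u i) = (\<integral>z. F (\<lambda>i\<in>{..<d}. z i + \<kappa> * u i) \<partial>Nd d)"
    unfolding smooth_def F_def \<kappa>_def rot_shift[OF s] ..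
  moreover have "smooth d \<phi> f x = (\<integral>z. F z \<partial>Nd d)" unfolding smooth_def F_def ..
  moreover have "sqrt (\<kappa> * (\<kappa> * dotp d u u)) = \<kappa> * sqrt (dotp d u u)"
    using \<kappa> by (simp add: mult.assoc[symmetric] real_sqrt_mult)
  ultimately show ?thesis using Nd_shift_diff[of F d "\<lambda>i. \<kappa> * u i"] F u
    by (simp add: dotp_scale power2_eq_square mult_ac)
qed

text \<open>The first component of a rotated pair of independent standard Gaussians is again
  standard Gaussian.\<close>

lemma integral_smooth:
  assumes [measurable]: "f \<in> borel_measurable (Rd d)" and f: "\<And>z. 0 \<le> f z" "\<And>z. f z \<le> (1::real)"
    and \<phi>: "\<bar>\<phi>\<bar> < pi"
  shows "(\<integral>x. smooth d \<phi> f x \<partial>Nd d) = (\<integral>x. f x \<partial>Nd d)"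
proof -
  have "ennreal (\<integral>x. smooth d \<phi> f x \<partial>Nd d) = (\<integral>\<^sup>+x. ennreal (smooth d \<phi> f x) \<partial>Nd d)"
    using smooth_bounds[OF assms(1) f] by (intro nn_integral_eq_integral[symmetric] Nd.integrable_const_bound[of _ 1])
      (auto simp: space_Nd space_Rd)
  also have "\<dots> = (\<integral>\<^sup>+x. \<integral>\<^sup>+z. ennreal (f (fst (rot d (\<lambda>_. \<phi>) (x, z)))) \<partial>Nd d \<partial>Nd d)"
    unfolding smooth_def using f
    by (intro nn_integral_cong nn_integral_eq_integral[symmetric] Nd.integrable_const_bound[of _ 1])
      (auto simp: space_Nd space_Rd[symmetric] abs_le_iff)
  also have "\<dots> = (\<integral>\<^sup>+p. ennreal (f (fst (rot d (\<lambda>_. \<phi>) p))) \<partial>(Nd d \<Otimes>\<^sub>M Nd d))"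
    by (rule Nd.nn_integral_fst) measurable
  also have "\<dots> = (\<integral>\<^sup>+x. ennreal (f x) \<partial>Nd d)"
    using \<phi> by (intro nn_integral_rot_fst[of _ "\<lambda>x. ennreal (f x)"]) auto
  also have "\<dots> = ennreal (\<integral>x. f x \<partial>Nd d)"
    using f by (intro nn_integral_eq_integral Nd.integrable_const_bound[of _ 1]) (auto simp: abs_le_iff)
  finally show ?thesis using f smooth_bounds[OF assms(1) f]
    by (subst (asm) ennreal_inj) (auto intro!: integral_nonneg_AE simp: space_Nd space_Rd)
qed

section \<open>The mean gradient is controlled by the surface area\<close>

definition nrm :: "nat \<Rightarrow> (nat \<Rightarrow> real) \<Rightarrow> real" where "nrm d u = sqrt (dotp d u u)"

lemma nrm_nonneg [simp]: "0 \<le> nrm d u" unfolding nrm_def by (simp add: dotp_nonneg)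

lemma nrm_sq: "(nrm d u)\<^sup>2 = dotp d u u" unfolding nrm_def by (simp add: dotp_nonneg)

lemma nrm_eq_L2_set: "nrm d u = L2_set u {..<d}"
  unfolding nrm_def dotp_def L2_set_def by (simp add: power2_eq_square)

lemma measurable_nrm [measurable]:
  assumes "\<And>i. i < d \<Longrightarrow> (\<lambda>w. f w i) \<in> borel_measurable M"
  shows "(\<lambda>w. nrm d (f w)) \<in> borel_measurable M"
  unfolding nrm_def using measurable_dotp[of d f M f] assms by measurable

lemma grad_le_1:
  assumes [measurable]: "f \<in> borel_measurable (Rd d)" and f: "\<And>z. 0 \<le> f z" "\<And>z. f z \<le> (1::real)"
    and x: "x \<in> space (Rd d)" and i: "i < d"
  shows "\<bar>grad d \<phi> f x i\<bar> \<le> 1"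
proof -
  have z: "integrable (Nd d) (\<lambda>z. (z i)\<^sup>2)" "(\<integral>z. (z i)\<^sup>2 \<partial>Nd d) = 1"
    using Nd_coord_mult[OF i i] by (auto simp: power2_eq_square)
  have b: "\<bar>f w * t\<bar> \<le> \<bar>t\<bar>" for w t using f[of w] by (simp add: abs_mult mult_left_le_one_le)
  have [measurable]: "(\<lambda>z. f (fst (rot d (\<lambda>_. \<phi>) (x, z)))) \<in> borel_measurable (Nd d)" using x by measurable
  have [measurable]: "(\<lambda>z. z i) \<in> borel_measurable (Nd d)" using i by measurable
  have "\<bar>grad d \<phi> f x i\<bar> \<le> (\<integral>z. \<bar>f (fst (rot d (\<lambda>_. \<phi>) (x, z))) * z i\<bar> \<partial>Nd d)"
    unfolding grad_def by (rule integral_abs_bound)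
  also have "\<dots> \<le> (\<integral>z. \<bar>z i\<bar> \<partial>Nd d)"
    using b by (intro integral_mono integrable_abs Nd_coord i Bochner_Integration.integrable_bound[OF Nd_coord(1)[OF i]]) auto
  also have "\<dots> \<le> sqrt (\<integral>z. (z i)\<^sup>2 \<partial>Nd d)"
    by (rule integral_abs_le_sqrt(2)) (use z prob_space_Nd in auto)
  finally show ?thesis using z by simp
qed

lemma nrm_le:
  assumes "\<And>i. i < d \<Longrightarrow> \<bar>u i\<bar> \<le> 1"
  shows "nrm d u \<le> real d"
proof -
  have "nrm d u \<le> (\<Sum>i<d. \<bar>u i\<bar>)" unfolding nrm_eq_L2_set by (rule L2_set_le_sum_abs)
  also have "\<dots> \<le> (\<Sum>i<d. 1)" using assms by (intro sum_mono) auto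
  finally show ?thesis by simp
qed

text \<open>The point is moved by \<open>h\<close> along the gradient. To first order the smoothing
  gains \<open>cot \<phi> h |grad|\<close>, while all rotated points move by at most
  \<open>h\<close>, so the indicator changes only where an endpoint lies in the shell. The last two
  terms are the error of comparing the shell masses seen from the two points and the second-order
  remainder.\<close>

lemma grad_shell:
  assumes A [measurable]: "A \<in> sets (Rd d)" and x: "x \<in> space (Rd d)" and \<phi>: "0 < \<phi>" "\<phi> < pi / 2" and h: "0 < h"
  defines "\<kappa> \<equiv> cos \<phi> / sin \<phi>"
  assumes \<kappa>h: "\<kappa> * h \<le> 1"
  shows "\<kappa> * h * nrm d (grad d \<phi> (indicator A) x)
    \<le> 2 * smooth d \<phi> (indicator (shell d A h)) x + 2 * \<kappa> * h * sqrt (smooth d \<phi> (indicator (shell d A h)) x)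
      + 2 * \<kappa>\<^sup>2 * h\<^sup>2"
proof -
  let ?g = "grad d \<phi> (indicator A) x" and ?P = "smooth d \<phi> (indicator A)"
  let ?B = "shell d A h"
  have s: "0 < sin \<phi>" "0 < cos \<phi>" using \<phi> by (auto intro: sin_gt_zero cos_gt_zero)
  then have \<kappa>: "0 < \<kappa>" unfolding \<kappa>_def by simp
  show ?thesis
  proof (cases "nrm d ?g = 0")
    case True
    have "0 \<le> smooth d \<phi> (indicator ?B) x" by (rule smooth_bounds) (auto simp: x)
    then show ?thesis using True \<kappa> h by simp
  next
    case False
    then have n: "0 < nrm d ?g" using nrm_nonneg[of d ?g] by linarith
    define u where "u i = h / nrm d ?g * ?g i" for i
    have ug: "dotp d u ?g = h * nrm d ?g"
      using n unfolding u_def dotp_scale by (simp add: nrm_sq[symmetric] power2_eq_square)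
    have "dotp d u u = h / nrm d ?g * (h / nrm d ?g * dotp d ?g ?g)"
      unfolding u_def dotp_scale ..
    then have uu: "dotp d u u = h\<^sup>2"
      using n by (simp add: nrm_sq[symmetric] power2_eq_square)
    let ?x' = "\<lambda>i\<in>{..<d}. x i + u i"
    have x': "?x' \<in> space (Rd d)" by (simp add: space_Rd)
    have lin: "\<bar>?P ?x' - ?P x - \<kappa> * dotp d u ?g\<bar> \<le> 2 * \<kappa>\<^sup>2 * dotp d u u"
      unfolding \<kappa>_def by (rule smooth_linear) (use x s in auto)
    \<comment> \<open>Both endpoints have to appear: the shell is one-sided, and either point may be
      the one outside \<open>A\<close>. This doubles the constant in
      \<open>grad_bound\<close>.\<close>
    have pt: "\<bar>indicator A (fst (rot d (\<lambda>_. \<phi>) (?x', z))) - indicator A (fst (rot d (\<lambda>_. \<phi>) (x, z)))\<bar>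
      \<le> indicator ?B (fst (rot d (\<lambda>_. \<phi>) (?x', z))) + (indicator ?B (fst (rot d (\<lambda>_. \<phi>) (x, z))) :: real)" for z
    proof -
      let ?p = "fst (rot d (\<lambda>_. \<phi>) (x, z))" and ?p' = "fst (rot d (\<lambda>_. \<phi>) (?x', z))"
      have "L2_set (\<lambda>i. ?p' i - ?p i) {..<d} = L2_set (\<lambda>i. cos \<phi> * u i) {..<d}"
        unfolding rot_def by (intro L2_set_cong) (auto simp: algebra_simps)
      also have "\<dots> = cos \<phi> * nrm d u"
        unfolding nrm_eq_L2_set using s by (intro L2_set_right_distrib[symmetric]) auto
      also have "\<dots> \<le> 1 * h" using s h by (intro mult_mono) (auto simp: nrm_def uu)
      finally have l: "L2_set (\<lambda>i. ?p' i - ?p i) {..<d} \<le> h" by simp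
      then have l': "L2_set (\<lambda>i. ?p i - ?p' i) {..<d} \<le> h" by (subst L2_set_diff_commute)
      have sp: "?p \<in> space (Rd d)" "?p' \<in> space (Rd d)" by (auto simp: rot_def space_Rd)
      show ?thesis
        using in_neighbourhood[OF sp(1) _ l'] in_neighbourhood[OF sp(2) _ l]
        by (auto simp: indicator_def shell_def)
    qed
    have meas: "(\<lambda>z. indicator C (fst (rot d (\<lambda>_. \<phi>) (y, z))) :: real) \<in> borel_measurable (Nd d)"
      if [measurable]: "C \<in> sets (Rd d)" and "y \<in> space (Rd d)" for C y
      using that(2) by measurable
    have int: "integrable (Nd d) (\<lambda>z. indicator C (fst (rot d (\<lambda>_. \<phi>) (y, z))) :: real)"
      if "C \<in> sets (Rd d)" "y \<in> space (Rd d)" for C y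
      by (intro Nd.integrable_const_bound[of _ 1] meas that) auto
    have "\<bar>?P ?x' - ?P x\<bar> = \<bar>\<integral>z. indicator A (fst (rot d (\<lambda>_. \<phi>) (?x', z))) - indicator A (fst (rot d (\<lambda>_. \<phi>) (x, z))) \<partial>Nd d\<bar>"
      unfolding smooth_def using int x x' by (subst Bochner_Integration.integral_diff) auto
    also have "\<dots> \<le> (\<integral>z. \<bar>indicator A (fst (rot d (\<lambda>_. \<phi>) (?x', z))) - indicator A (fst (rot d (\<lambda>_. \<phi>) (x, z)))\<bar> \<partial>Nd d)"
      by (rule integral_abs_bound)
    also have "\<dots> \<le> (\<integral>z. indicator ?B (fst (rot d (\<lambda>_. \<phi>) (?x', z))) + (indicator ?B (fst (rot d (\<lambda>_. \<phi>) (x, z)))) \<partial>Nd d)"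
      using int x x' pt by (intro integral_mono integrable_abs Bochner_Integration.integrable_diff Bochner_Integration.integrable_add) auto
    also have "\<dots> = smooth d \<phi> (indicator ?B) ?x' + smooth d \<phi> (indicator ?B) x"
      unfolding smooth_def using int x x' by (subst Bochner_Integration.integral_add) auto
    finally have 1: "\<bar>?P ?x' - ?P x\<bar> \<le> smooth d \<phi> (indicator ?B) ?x' + smooth d \<phi> (indicator ?B) x" .
    have "(\<kappa> * h)\<^sup>2 \<le> 1" using \<kappa>h \<kappa> h by (simp add: power_le_one)
    then have "\<kappa>\<^sup>2 * dotp d u u \<le> 1" by (simp add: uu power_mult_distrib)
    then have 2: "\<bar>smooth d \<phi> (indicator ?B) ?x' - smooth d \<phi> (indicator ?B) x\<bar>
       \<le> 2 * \<kappa> * sqrt (smooth d \<phi> (indicator ?B) x) * h"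
      using smooth_diff[of "indicator ?B" d x \<phi> u] x s \<kappa> h unfolding \<kappa>_def[symmetric] by (simp add: uu)
    show ?thesis using lin 1 2 unfolding uu ug by (simp add: mult_ac abs_le_iff)
  qed
qed

lemma grad_integrable:
  assumes A [measurable]: "A \<in> sets (Rd d)"
  shows "integrable (Nd d) (\<lambda>x. nrm d (grad d \<phi> (indicator A) x))"
  "integrable (Nd d) (\<lambda>x. nrm d (\<lambda>i. if i \<in> J then grad d \<phi> (indicator A) x i else 0))"
proof -
  have m: "i < d \<Longrightarrow> (\<lambda>x. if i \<in> J then grad d \<phi> (indicator A) x i else 0) \<in> borel_measurable (Nd d)" for i J
    by (cases "i \<in> J") auto
  have *: "integrable (Nd d) (\<lambda>x. nrm d (\<lambda>i. if i \<in> J then grad d \<phi> (indicator A) x i else 0))" for J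
  proof (rule Nd.integrable_const_bound[of _ "real d"])
    show "AE x in Nd d. norm (nrm d (\<lambda>i. if i \<in> J then grad d \<phi> (indicator A) x i else 0)) \<le> real d"
    proof (rule AE_I2)
      fix x assume "x \<in> space (Nd d)"
      then have "\<bar>grad d \<phi> (indicator A) x i\<bar> \<le> 1" if "i < d" for i
        using that by (intro grad_le_1) (simp_all add: space_Nd space_Rd)
      then have "nrm d (\<lambda>i. if i \<in> J then grad d \<phi> (indicator A) x i else 0) \<le> real d"
        by (intro nrm_le) simp
      then show "norm (nrm d (\<lambda>i. if i \<in> J then grad d \<phi> (indicator A) x i else 0)) \<le> real d" by simp
    qed
  qed (intro measurable_nrm m)
  then show "integrable (Nd d) (\<lambda>x. nrm d (\<lambda>i. if i \<in> J then grad d \<phi> (indicator A) x i else 0))" .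
  show "integrable (Nd d) (\<lambda>x. nrm d (grad d \<phi> (indicator A) x))" using *[of UNIV] by simp
qed

context
  fixes d :: nat and A :: "(nat \<Rightarrow> real) set" and G :: real
  assumes A [measurable]: "A \<in> sets (Rd d)"
    and G: "gauss_surface_area d A \<le> ennreal G" "0 \<le> G"
begin

text \<open>\<open>grad_shell\<close> is averaged over \<open>x\<close> and divided by
  \<open>h\<close>. The shell terms give \<open>2 G\<close> because smoothing preserves mass; the
  errors are of order \<open>sqrt h\<close> and \<open>h\<close> and disappear along the good values
  of \<open>h\<close>. The bound is uniform in \<open>\<phi>\<close>.\<close>

lemma grad_bound:
  assumes \<phi>: "0 < \<phi>" "\<phi> < pi / 2"
  shows "cos \<phi> / sin \<phi> * (\<integral>x. nrm d (grad d \<phi> (indicator A) x) \<partial>Nd d) \<le> 2 * G"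
proof (rule field_le_epsilon)
  define \<kappa> where "\<kappa> = cos \<phi> / sin \<phi>"
  have \<kappa>: "0 < \<kappa>" unfolding \<kappa>_def using \<phi> by (intro divide_pos_pos sin_gt_zero cos_gt_zero) auto
  let ?E = "\<integral>x. nrm d (grad d \<phi> (indicator A) x) \<partial>Nd d"
  fix e :: real assume e: "0 < e"
  have "((\<lambda>h. 2 * \<kappa> * sqrt ((G + e / 4) * h) + 2 * \<kappa>\<^sup>2 * h) \<longlongrightarrow> 2 * \<kappa> * sqrt ((G + e / 4) * 0) + 2 * \<kappa>\<^sup>2 * 0) (at_right 0)"
    by (intro tendsto_intros)
  then have "\<forall>\<^sub>F h in at_right 0. 2 * \<kappa> * sqrt ((G + e / 4) * h) + 2 * \<kappa>\<^sup>2 * h < e / 2"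
    using e by (intro order_tendstoD) auto
  then obtain h0 where h0: "0 < h0" "\<And>h. 0 < h \<Longrightarrow> h < h0 \<Longrightarrow> 2 * \<kappa> * sqrt ((G + e / 4) * h) + 2 * \<kappa>\<^sup>2 * h < e / 2"
    by (auto simp: eventually_at_right_field)
  obtain h where h: "0 < h" "h < min h0 (1 / \<kappa>)" "measure (Nd d) (shell d A h) \<le> (G + e / 4) * h"
    using surface_area_frequently[OF G, of "e / 4" "min h0 (1 / \<kappa>)"] e h0 \<kappa> by auto
  let ?S = "smooth d \<phi> (indicator (shell d A h))"
  have \<kappa>h: "\<kappa> * h \<le> 1" using h \<kappa> by (simp add: field_simps)
  have Sb: "x \<in> space (Nd d) \<Longrightarrow> 0 \<le> ?S x \<and> ?S x \<le> 1" for x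
    by (intro conjI smooth_bounds) (auto simp: space_Nd space_Rd)
  have Si: "integrable (Nd d) ?S"
    using Sb by (intro Nd.integrable_const_bound[of _ 1]) auto
  have sSi: "integrable (Nd d) (\<lambda>x. sqrt (?S x))"
    using Sb by (intro Nd.integrable_const_bound[of _ 1]) auto
  have ES: "(\<integral>x. ?S x \<partial>Nd d) = measure (Nd d) (shell d A h)"
    using \<phi> by (subst integral_smooth) auto
  have EsS: "(\<integral>x. sqrt (?S x) \<partial>Nd d) \<le> sqrt (measure (Nd d) (shell d A h))"
  proof -
    have "(\<integral>x. sqrt (?S x) \<partial>Nd d) \<le> (\<integral>x. \<bar>sqrt (?S x)\<bar> \<partial>Nd d)"
      using sSi by (intro integral_mono integrable_abs) auto
    also have "\<dots> \<le> sqrt (\<integral>x. (sqrt (?S x))\<^sup>2 \<partial>Nd d)"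
    proof (rule integral_abs_le_sqrt(2)[OF prob_space_Nd])
      show "integrable (Nd d) (\<lambda>x. (sqrt (?S x))\<^sup>2)"
        by (rule Bochner_Integration.integrable_cong[THEN iffD2, OF refl _ Si]) (use Sb in simp)
    qed measurable
    also have "(\<integral>x. (sqrt (?S x))\<^sup>2 \<partial>Nd d) = (\<integral>x. ?S x \<partial>Nd d)"
      using Sb by (intro Bochner_Integration.integral_cong) auto
    finally show ?thesis unfolding ES .
  qed
  have "\<kappa> * h * ?E = (\<integral>x. \<kappa> * h * nrm d (grad d \<phi> (indicator A) x) \<partial>Nd d)" by simp
  also have "\<dots> \<le> (\<integral>x. 2 * ?S x + 2 * \<kappa> * h * sqrt (?S x) + 2 * \<kappa>\<^sup>2 * h\<^sup>2 \<partial>Nd d)"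
    using grad_shell[OF A _ \<phi> h(1)] \<kappa>h unfolding \<kappa>_def[symmetric]
    by (intro integral_mono Bochner_Integration.integrable_add integrable_mult_right Si sSi grad_integrable A)
      (auto simp: space_Nd space_Rd)
  also have "\<dots> = 2 * (\<integral>x. ?S x \<partial>Nd d) + 2 * \<kappa> * h * (\<integral>x. sqrt (?S x) \<partial>Nd d) + 2 * \<kappa>\<^sup>2 * h\<^sup>2"
    using Si sSi by (simp add: Nd.prob_space)
  also have "\<dots> \<le> 2 * ((G + e / 4) * h) + 2 * \<kappa> * h * sqrt ((G + e / 4) * h) + 2 * \<kappa>\<^sup>2 * h\<^sup>2"
    unfolding ES using \<kappa> h by (intro add_mono mult_left_mono order_refl order_trans[OF EsS]) auto
  also have "\<dots> = h * (2 * G + e / 2 + (2 * \<kappa> * sqrt ((G + e / 4) * h) + 2 * \<kappa>\<^sup>2 * h))"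
    by (simp add: field_simps power2_eq_square)
  also have "\<dots> \<le> h * (2 * G + e / 2 + e / 2)"
    using h h0(2)[of h] by (intro mult_left_mono) auto
  finally have "\<kappa> * h * ?E \<le> h * (2 * G + e / 2 + e / 2)" .
  moreover have "\<kappa> * h * ?E = h * (\<kappa> * ?E)" by simp
  ultimately have "h * (\<kappa> * ?E) \<le> h * (2 * G + e)" by (simp only:) (simp add: algebra_simps)
  then show "cos \<phi> / sin \<phi> * ?E \<le> 2 * G + e" using h unfolding \<kappa>_def[symmetric] by simp
qed

end

section \<open>Rotations on a set of coordinates, in small steps\<close>

lemma rot_rot: "rot d \<theta>2 (rot d \<theta>1 p) = rot d (\<lambda>i. \<theta>1 i + \<theta>2 i) p"
  unfolding rot_def by (auto simp: fun_eq_iff restrict_def cos_add sin_add algebra_simps)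

definition ang :: "nat set \<Rightarrow> real \<Rightarrow> nat \<Rightarrow> real" where
  "ang J \<theta> = (\<lambda>i. if i \<in> J then \<theta> else 0)"

lemma ang_lt: "0 \<le> \<theta> \<Longrightarrow> \<theta> < pi \<Longrightarrow> \<bar>ang J \<theta> i\<bar> < pi" by (simp add: ang_def)

lemma ang_add: "(\<lambda>i. ang J a i + ang J b i) = ang J (a + b)" by (auto simp: ang_def)

lemma cos_lower: "1 - cos h \<le> h\<^sup>2 / 2" for h :: real
proof -
  have "1 - cos h = 2 * (sin (h / 2))\<^sup>2" using cos_double_sin[of "h / 2"] by simp
  also have "(sin (h / 2))\<^sup>2 \<le> (h / 2)\<^sup>2" using abs_sin_x_le_abs_x[of "h / 2"] unfolding abs_le_square_iff .
  finally show ?thesis by (simp add: power_divide)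
qed

text \<open>Displacement of \<open>x\<close> in one rotation step; only the part
  \<open>sin h * y i\<close> is of first order in \<open>h\<close>.\<close>

definition disp :: "nat set \<Rightarrow> real \<Rightarrow> (nat \<Rightarrow> real) \<Rightarrow> (nat \<Rightarrow> real) \<Rightarrow> nat \<Rightarrow> real" where
  "disp J h x y i = (if i \<in> J then (cos h - 1) * x i + sin h * y i else 0)"

lemma fst_rot_disp: "fst (rot d (ang J h) (x, y)) = (\<lambda>i\<in>{..<d}. x i + disp J h x y i)"
  unfolding rot_def ang_def disp_def by (auto simp: fun_eq_iff restrict_def algebra_simps)

lemma disp_sq:
  assumes h: "0 \<le> h" "h \<le> 1"
  shows "dotp d (disp J h x y) (disp J h x y) \<le> 2 * h\<^sup>2 * (dotp d x x + dotp d y y)"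
proof -
  have "disp J h x y i * disp J h x y i \<le> 2 * h\<^sup>2 * (x i * x i + y i * y i)" for i
  proof -
    have a: "(cos h - 1)\<^sup>2 \<le> h\<^sup>2"
    proof -
      have "1 - cos h \<le> h" using cos_lower[of h] h mult_left_le[of h h] by (simp add: power2_eq_square)
      then have "(1 - cos h)\<^sup>2 \<le> h\<^sup>2" by (intro power_mono) auto
      then show ?thesis by (simp add: power2_commute)
    qed
    have b: "(sin h)\<^sup>2 \<le> h\<^sup>2" using abs_sin_x_le_abs_x[of h] unfolding abs_le_square_iff .
    have "((cos h - 1) * x i + sin h * y i)\<^sup>2 \<le> 2 * ((cos h - 1) * x i)\<^sup>2 + 2 * (sin h * y i)\<^sup>2"
      using sum_squares_bound[of "(cos h - 1) * x i" "sin h * y i"] by (simp add: power2_sum)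
    also have "\<dots> \<le> 2 * (h\<^sup>2 * (x i)\<^sup>2) + 2 * (h\<^sup>2 * (y i)\<^sup>2)"
      unfolding power_mult_distrib by (intro add_mono mult_left_mono mult_right_mono a b) auto
    finally have "((cos h - 1) * x i + sin h * y i)\<^sup>2 \<le> 2 * h\<^sup>2 * (x i * x i + y i * y i)"
      by (simp add: power2_eq_square algebra_simps)
    then show ?thesis by (cases "i \<in> J") (auto simp: disp_def power2_eq_square[of "(cos h - 1) * x i + sin h * y i"])
  qed
  then show ?thesis unfolding dotp_def sum.distrib[symmetric] sum_distrib_left by (intro sum_mono) auto
qed

lemma nn_integral_dotp_self:
  "(\<integral>\<^sup>+p. ennreal (dotp d (fst p) (fst p) + dotp d (snd p) (snd p)) \<partial>(Nd d \<Otimes>\<^sub>M Nd d)) = ennreal (2 * real d)"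
proof -
  have i: "integrable (Nd d) (\<lambda>z. dotp d z z)" "(\<integral>z. dotp d z z \<partial>Nd d) = d"
  proof -
    have "has_bochner_integral (Nd d) (\<lambda>z. \<Sum>i<d. z i * z i) (\<Sum>i<d. 1)"
      by (intro has_bochner_integral_sum) (simp add: has_bochner_integral_iff Nd_coord_mult)
    then show "integrable (Nd d) (\<lambda>z. dotp d z z)" "(\<integral>z. dotp d z z \<partial>Nd d) = d"
      unfolding dotp_def by (auto simp: has_bochner_integral_iff)
  qed
  have "(\<integral>\<^sup>+p. ennreal (dotp d (fst p) (fst p) + dotp d (snd p) (snd p)) \<partial>(Nd d \<Otimes>\<^sub>M Nd d)) =
    (\<integral>\<^sup>+x. \<integral>\<^sup>+y. ennreal (dotp d (fst (x, y)) (fst (x, y)) + dotp d (snd (x, y)) (snd (x, y))) \<partial>Nd d \<partial>Nd d)"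
    by (rule Nd.nn_integral_fst[symmetric]) measurable
  also have "\<dots> = (\<integral>\<^sup>+x. ennreal (dotp d x x + d) \<partial>Nd d)"
    using i by (intro nn_integral_cong) (subst nn_integral_eq_integral, auto simp: dotp_nonneg Nd.prob_space)
  also have "\<dots> = ennreal (2 * real d)"
    using i by (subst nn_integral_eq_integral) (auto simp: dotp_nonneg Nd.prob_space)
  finally show ?thesis .
qed

definition restr :: "nat set \<Rightarrow> (nat \<Rightarrow> real) \<Rightarrow> nat \<Rightarrow> real" where
  "restr J u = (\<lambda>i. if i \<in> J then u i else 0)"

lemma Nd_dotp_self: "integrable (Nd d) (\<lambda>z. dotp d z z)" "(\<integral>z. dotp d z z \<partial>Nd d) = d"
proof -
  have "has_bochner_integral (Nd d) (\<lambda>z. \<Sum>i<d. z i * z i) (\<Sum>i<d. 1)"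
    by (intro has_bochner_integral_sum) (simp add: has_bochner_integral_iff Nd_coord_mult)
  then show "integrable (Nd d) (\<lambda>z. dotp d z z)" "(\<integral>z. dotp d z z \<partial>Nd d) = d"
    unfolding dotp_def by (auto simp: has_bochner_integral_iff)
qed

lemma Nd_abs_coord:
  assumes "i < d" shows "(\<integral>z. \<bar>z i\<bar> \<partial>Nd d) \<le> 1"
proof -
  have z: "integrable (Nd d) (\<lambda>z. (z i)\<^sup>2)" "(\<integral>z. (z i)\<^sup>2 \<partial>Nd d) = 1"
    using Nd_coord_mult[OF assms assms] by (auto simp: power2_eq_square)
  have "(\<lambda>z. z i) \<in> borel_measurable (Nd d)" using assms by measurable
  then show ?thesis using integral_abs_le_sqrt(2)[OF prob_space_Nd _ z(1)] z(2) by simp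
qed

lemma Nd_abs_dotp: "(\<integral>z. \<bar>dotp d m z\<bar> \<partial>Nd d) \<le> nrm d m"
  using integral_abs_le_sqrt(2)[OF prob_space_Nd, of "dotp d m" d] Nd_dotp(3,4)[of d m]
  by (simp add: nrm_def)

text \<open>For fixed \<open>x\<close> the first-order term is a centred Gaussian in
  \<open>y\<close> whose standard deviation is \<open>cot \<phi> h\<close> times the norm of the
  gradient restricted to \<open>J\<close>; this is where the set \<open>J\<close> enters. The
  \<open>cos h - 1\<close> part of the displacement and the Taylor remainder are of order
  \<open>h^2\<close>.\<close>

lemma smooth_rot_step:
  assumes f [measurable]: "f \<in> borel_measurable (Rd d)" "\<And>z. 0 \<le> f z" "\<And>z. f z \<le> (1::real)"
    and x: "x \<in> space (Rd d)" and \<phi>: "0 < \<phi>" "\<phi> < pi / 2" and h: "0 \<le> h" "h \<le> 1"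
  defines "\<kappa> \<equiv> cos \<phi> / sin \<phi>"
  shows "\<bar>smooth d \<phi> f (fst (rot d (ang J h) (x, y))) - smooth d \<phi> f x\<bar>
    \<le> \<kappa> * h * \<bar>dotp d (restr J (grad d \<phi> f x)) y\<bar> + \<kappa> * (h\<^sup>2 / 2) * (\<Sum>i<d. \<bar>x i\<bar>)
       + 4 * \<kappa>\<^sup>2 * h\<^sup>2 * (dotp d x x + dotp d y y)"
proof -
  let ?u = "disp J h x y" and ?g = "grad d \<phi> f x"
  have s: "0 < sin \<phi>" "0 < cos \<phi>" using \<phi> by (auto intro: sin_gt_zero cos_gt_zero)
  then have \<kappa>: "0 < \<kappa>" unfolding \<kappa>_def by simp
  have lin: "\<bar>smooth d \<phi> f (\<lambda>i\<in>{..<d}. x i + ?u i) - smooth d \<phi> f x - \<kappa> * dotp d ?u ?g\<bar> \<le> 2 * \<kappa>\<^sup>2 * dotp d ?u ?u"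
    unfolding \<kappa>_def by (rule smooth_linear) (use f x s in auto)
  have "dotp d ?u ?g = sin h * dotp d (restr J ?g) y + (cos h - 1) * dotp d (restr J ?g) x"
    unfolding dotp_def sum_distrib_left sum.distrib[symmetric]
    by (intro sum.cong) (auto simp: disp_def restr_def algebra_simps)
  also have "\<bar>\<dots>\<bar> \<le> \<bar>sin h\<bar> * \<bar>dotp d (restr J ?g) y\<bar> + \<bar>cos h - 1\<bar> * \<bar>dotp d (restr J ?g) x\<bar>"
    by (metis abs_mult abs_triangle_ineq)
  also have "\<dots> \<le> h * \<bar>dotp d (restr J ?g) y\<bar> + (h\<^sup>2 / 2) * (\<Sum>i<d. \<bar>x i\<bar>)"
  proof (intro add_mono mult_mono)
    show "\<bar>sin h\<bar> \<le> h" using abs_sin_x_le_abs_x[of h] h by simp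
    show "\<bar>cos h - 1\<bar> \<le> h\<^sup>2 / 2" using cos_lower[of h] cos_le_one[of h] by linarith
    have "\<bar>dotp d (restr J ?g) x\<bar> \<le> (\<Sum>i<d. \<bar>restr J ?g i * x i\<bar>)"
      unfolding dotp_def by (rule sum_abs)
    also have "\<dots> \<le> (\<Sum>i<d. \<bar>x i\<bar>)"
    proof (intro sum_mono)
      fix i assume "i \<in> {..<d}"
      then have "\<bar>?g i\<bar> \<le> 1" using grad_le_1[OF f x] by simp
      then show "\<bar>restr J ?g i * x i\<bar> \<le> \<bar>x i\<bar>" by (auto simp: restr_def abs_mult mult_left_le_one_le)
    qed
    finally show "\<bar>dotp d (restr J ?g) x\<bar> \<le> (\<Sum>i<d. \<bar>x i\<bar>)" .
  qed (use h in \<open>auto intro: sum_nonneg\<close>)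
  finally have "\<kappa> * \<bar>dotp d ?u ?g\<bar> \<le> \<kappa> * (h * \<bar>dotp d (restr J ?g) y\<bar> + (h\<^sup>2 / 2) * (\<Sum>i<d. \<bar>x i\<bar>))"
    using \<kappa> by simp
  moreover have "\<bar>\<kappa> * dotp d ?u ?g\<bar> = \<kappa> * \<bar>dotp d ?u ?g\<bar>" using \<kappa> by (simp add: abs_mult)
  moreover have "2 * \<kappa>\<^sup>2 * dotp d ?u ?u \<le> 2 * \<kappa>\<^sup>2 * (2 * h\<^sup>2 * (dotp d x x + dotp d y y))"
    by (intro mult_left_mono disp_sq h) auto
  ultimately show ?thesis using lin unfolding fst_rot_disp by (simp add: algebra_simps)
qed

text \<open>Mean change of \<open>f\<close> under rotation by \<open>\<theta>\<close> on
  \<open>J\<close>, kept in \<open>ennreal\<close> so that adding steps and rotating integrals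
  carries no integrability conditions.\<close>

definition rvar :: "nat \<Rightarrow> ((nat \<Rightarrow> real) \<Rightarrow> real) \<Rightarrow> nat set \<Rightarrow> real \<Rightarrow> ennreal" where
  "rvar d f J \<theta> = (\<integral>\<^sup>+p. ennreal \<bar>f (fst (rot d (ang J \<theta>) p)) - f (fst p)\<bar> \<partial>(Nd d \<Otimes>\<^sub>M Nd d))"

text \<open>After the first rotation the pair has its old law, so the second rotation costs as much
  as if it came first; the rest is the triangle inequality.\<close>

lemma rvar_add:
  assumes [measurable]: "f \<in> borel_measurable (Rd d)" and \<theta>: "0 \<le> \<theta>1" "\<theta>1 < pi"
  shows "rvar d f J (\<theta>1 + \<theta>2) \<le> rvar d f J \<theta>1 + rvar d f J \<theta>2"
proof -
  have "rvar d f J (\<theta>1 + \<theta>2) \<le> (\<integral>\<^sup>+p. ennreal \<bar>f (fst (rot d (ang J \<theta>1) p)) - f (fst p)\<bar>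
     + ennreal \<bar>f (fst (rot d (ang J \<theta>2) (rot d (ang J \<theta>1) p))) - f (fst (rot d (ang J \<theta>1) p))\<bar> \<partial>(Nd d \<Otimes>\<^sub>M Nd d))"
    unfolding rvar_def rot_rot ang_add
    by (intro nn_integral_mono, subst ennreal_plus[symmetric]) (auto intro!: ennreal_leI simp del: ennreal_plus)
  also have "\<dots> = rvar d f J \<theta>1 + (\<integral>\<^sup>+p. ennreal \<bar>f (fst (rot d (ang J \<theta>2) (rot d (ang J \<theta>1) p))) - f (fst (rot d (ang J \<theta>1) p))\<bar> \<partial>(Nd d \<Otimes>\<^sub>M Nd d))"
    unfolding rvar_def by (rule nn_integral_add) measurable
  also have "(\<integral>\<^sup>+p. ennreal \<bar>f (fst (rot d (ang J \<theta>2) (rot d (ang J \<theta>1) p))) - f (fst (rot d (ang J \<theta>1) p))\<bar> \<partial>(Nd d \<Otimes>\<^sub>M Nd d)) = rvar d f J \<theta>2"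
    unfolding rvar_def
    by (rule nn_integral_rot[of "ang J \<theta>1" "\<lambda>p. ennreal \<bar>f (fst (rot d (ang J \<theta>2) p)) - f (fst p)\<bar>" d])
      (use \<theta> in \<open>auto intro: ang_lt\<close>)
  finally show ?thesis .
qed

lemma rvar_zero: "rvar d f J 0 = 0"
proof -
  have "rvar d f J 0 = (\<integral>\<^sup>+p. 0 \<partial>(Nd d \<Otimes>\<^sub>M Nd d))"
    unfolding rvar_def
  proof (rule nn_integral_cong)
    fix p :: "(nat \<Rightarrow> real) \<times> (nat \<Rightarrow> real)" assume "p \<in> space (Nd d \<Otimes>\<^sub>M Nd d)"
    then have "fst (rot d (ang J 0) p) = fst p"
      unfolding rot_def ang_def by (auto simp: space_pair_measure space_Nd fun_eq_iff PiE_def extensional_def)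
    then show "ennreal \<bar>f (fst (rot d (ang J 0) p)) - f (fst p)\<bar> = 0" by simp
  qed
  then show ?thesis by simp
qed

lemma rvar_mult:
  assumes [measurable]: "f \<in> borel_measurable (Rd d)" and h: "0 \<le> h" "real n * h < pi"
  shows "rvar d f J (real n * h) \<le> of_nat n * rvar d f J h"
  using h(2)
proof (induction n)
  case 0
  then show ?case by (simp add: rvar_zero)
next
  case (Suc n)
  have n: "real n * h < pi" using Suc.prems h by (simp add: algebra_simps)
  have "rvar d f J (real (Suc n) * h) = rvar d f J (real n * h + h)" by (simp add: algebra_simps)
  also have "\<dots> \<le> rvar d f J (real n * h) + rvar d f J h"
    using n h by (intro rvar_add) auto
  also have "\<dots> \<le> of_nat n * rvar d f J h + rvar d f J h" using Suc.IH[OF n] by (intro add_mono) auto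
  also have "\<dots> = of_nat (Suc n) * rvar d f J h" by (simp add: algebra_simps)
  finally show ?case .
qed

lemma rvar_smooth_step:
  assumes A [measurable]: "A \<in> sets (Rd d)" and \<phi>: "0 < \<phi>" "\<phi> < pi / 2" and h: "0 \<le> h" "h \<le> 1"
  defines "\<kappa> \<equiv> cos \<phi> / sin \<phi>"
  shows "rvar d (smooth d \<phi> (indicator A)) J h
    \<le> ennreal (\<kappa> * h * (\<integral>x. nrm d (restr J (grad d \<phi> (indicator A) x)) \<partial>Nd d) + (\<kappa> + 8 * \<kappa>\<^sup>2) * real d * h\<^sup>2)"
proof -
  let ?P = "smooth d \<phi> (indicator A)" and ?g = "\<lambda>x. restr J (grad d \<phi> (indicator A) x)"
  have s: "0 < sin \<phi>" "0 < cos \<phi>" using \<phi> by (auto intro: sin_gt_zero cos_gt_zero)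
  then have \<kappa>: "0 < \<kappa>" unfolding \<kappa>_def by simp
  have gi: "integrable (Nd d) (\<lambda>x. nrm d (?g x))"
    unfolding restr_def by (rule grad_integrable) fact
  have ai: "integrable (Nd d) (\<lambda>x. \<Sum>i<d. \<bar>x i\<bar>)"
    by (intro Bochner_Integration.integrable_sum integrable_abs Nd_coord) simp
  have aE: "(\<integral>x. (\<Sum>i<d. \<bar>x i\<bar>) \<partial>Nd d) \<le> real d"
  proof -
    have "(\<integral>x. (\<Sum>i<d. \<bar>x i\<bar>) \<partial>Nd d) = (\<Sum>i<d. \<integral>x. \<bar>x i\<bar> \<partial>Nd d)"
      by (intro Bochner_Integration.integral_sum integrable_abs Nd_coord) simp
    also have "\<dots> \<le> (\<Sum>i<d. 1)" by (intro sum_mono Nd_abs_coord) simp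
    finally show ?thesis by simp
  qed
  have "rvar d ?P J h = (\<integral>\<^sup>+x. \<integral>\<^sup>+y. ennreal \<bar>?P (fst (rot d (ang J h) (x, y))) - ?P (fst (x, y))\<bar> \<partial>Nd d \<partial>Nd d)"
    unfolding rvar_def by (rule Nd.nn_integral_fst[symmetric]) measurable
  also have "\<dots> \<le> (\<integral>\<^sup>+x. ennreal (\<kappa> * h * nrm d (?g x) + \<kappa> * (h\<^sup>2 / 2) * (\<Sum>i<d. \<bar>x i\<bar>)
       + 4 * \<kappa>\<^sup>2 * h\<^sup>2 * (dotp d x x + real d)) \<partial>Nd d)"
  proof (rule nn_integral_mono)
    fix x assume "x \<in> space (Nd d)"
    then have x: "x \<in> space (Rd d)" by (simp add: space_Nd space_Rd)
    let ?b = "\<lambda>y. \<kappa> * h * \<bar>dotp d (?g x) y\<bar> + \<kappa> * (h\<^sup>2 / 2) * (\<Sum>i<d. \<bar>x i\<bar>) + 4 * \<kappa>\<^sup>2 * h\<^sup>2 * (dotp d x x + dotp d y y)"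
    have bi: "integrable (Nd d) ?b"
      by (intro Bochner_Integration.integrable_add integrable_mult_right integrable_abs Nd_dotp Nd_dotp_self) auto
    have b0: "0 \<le> ?b y" for y using \<kappa> h by (intro add_nonneg_nonneg mult_nonneg_nonneg dotp_nonneg sum_nonneg) auto
    have "(\<integral>\<^sup>+y. ennreal \<bar>?P (fst (rot d (ang J h) (x, y))) - ?P (fst (x, y))\<bar> \<partial>Nd d) \<le> (\<integral>\<^sup>+y. ennreal (?b y) \<partial>Nd d)"
      using smooth_rot_step[of "indicator A" d x \<phi> h J] x \<phi> h unfolding \<kappa>_def[symmetric]
      by (intro nn_integral_mono ennreal_leI) simp
    also have "\<dots> = ennreal (\<integral>y. ?b y \<partial>Nd d)" using bi b0 by (intro nn_integral_eq_integral) auto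
    also have "(\<integral>y. ?b y \<partial>Nd d) = \<kappa> * h * (\<integral>y. \<bar>dotp d (?g x) y\<bar> \<partial>Nd d) + \<kappa> * (h\<^sup>2 / 2) * (\<Sum>i<d. \<bar>x i\<bar>)
       + 4 * \<kappa>\<^sup>2 * h\<^sup>2 * (dotp d x x + real d)"
      using Nd_dotp(1)[of d "?g x"] Nd_dotp_self[of d] by (simp add: Nd.prob_space)
    also have "ennreal \<dots> \<le> ennreal (\<kappa> * h * nrm d (?g x) + \<kappa> * (h\<^sup>2 / 2) * (\<Sum>i<d. \<bar>x i\<bar>)
       + 4 * \<kappa>\<^sup>2 * h\<^sup>2 * (dotp d x x + real d))"
      using \<kappa> h by (intro ennreal_leI add_mono mult_left_mono Nd_abs_dotp order_refl) auto
    finally show "(\<integral>\<^sup>+y. ennreal \<bar>?P (fst (rot d (ang J h) (x, y))) - ?P (fst (x, y))\<bar> \<partial>Nd d) \<le> \<dots>" .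
  qed
  also have "\<dots> = ennreal (\<integral>x. \<kappa> * h * nrm d (?g x) + \<kappa> * (h\<^sup>2 / 2) * (\<Sum>i<d. \<bar>x i\<bar>)
       + 4 * \<kappa>\<^sup>2 * h\<^sup>2 * (dotp d x x + real d) \<partial>Nd d)"
  proof (rule nn_integral_eq_integral)
    show "integrable (Nd d) (\<lambda>x. \<kappa> * h * nrm d (?g x) + \<kappa> * (h\<^sup>2 / 2) * (\<Sum>i<d. \<bar>x i\<bar>) + 4 * \<kappa>\<^sup>2 * h\<^sup>2 * (dotp d x x + real d))"
      by (intro Bochner_Integration.integrable_add integrable_mult_right gi ai Nd_dotp_self) auto
    show "AE x in Nd d. 0 \<le> \<kappa> * h * nrm d (?g x) + \<kappa> * (h\<^sup>2 / 2) * (\<Sum>i<d. \<bar>x i\<bar>) + 4 * \<kappa>\<^sup>2 * h\<^sup>2 * (dotp d x x + real d)"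
      using \<kappa> h by (intro AE_I2 add_nonneg_nonneg mult_nonneg_nonneg dotp_nonneg sum_nonneg) auto
  qed
  also have "(\<integral>x. \<kappa> * h * nrm d (?g x) + \<kappa> * (h\<^sup>2 / 2) * (\<Sum>i<d. \<bar>x i\<bar>)
       + 4 * \<kappa>\<^sup>2 * h\<^sup>2 * (dotp d x x + real d) \<partial>Nd d) =
      \<kappa> * h * (\<integral>x. nrm d (?g x) \<partial>Nd d) + \<kappa> * (h\<^sup>2 / 2) * (\<integral>x. (\<Sum>i<d. \<bar>x i\<bar>) \<partial>Nd d) + 4 * \<kappa>\<^sup>2 * h\<^sup>2 * (real d + real d)"
  proof -
    have 1: "integrable (Nd d) (\<lambda>x. \<kappa> * h * nrm d (?g x))" using gi by (rule integrable_mult_right)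
    have 2: "integrable (Nd d) (\<lambda>x. \<kappa> * (h\<^sup>2 / 2) * (\<Sum>i<d. \<bar>x i\<bar>))" using ai by (rule integrable_mult_right)
    have 3: "integrable (Nd d) (\<lambda>x. dotp d x x + real d)" by (intro Bochner_Integration.integrable_add Nd_dotp_self) auto
    have 4: "(\<integral>x. dotp d x x + real d \<partial>Nd d) = real d + real d"
      using Nd_dotp_self[of d] by (simp add: Nd.prob_space)
    show ?thesis
      by (subst Bochner_Integration.integral_add, intro Bochner_Integration.integrable_add 1 2,
          intro integrable_mult_right 3, subst Bochner_Integration.integral_add[OF 1 2])
        (simp only: integral_mult_right_zero 4)
  qed
  also have "\<dots> \<le> \<kappa> * h * (\<integral>x. nrm d (?g x) \<partial>Nd d) + \<kappa> * (h\<^sup>2 / 2) * real d + 4 * \<kappa>\<^sup>2 * h\<^sup>2 * (real d + real d)"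
    using \<kappa> aE by (intro add_mono mult_left_mono order_refl) auto
  also have "\<dots> \<le> \<kappa> * h * (\<integral>x. nrm d (?g x) \<partial>Nd d) + (\<kappa> + 8 * \<kappa>\<^sup>2) * real d * h\<^sup>2"
    using \<kappa> by (simp add: algebra_simps)
  finally show ?thesis by (simp add: ennreal_leI)
qed

text \<open>Subadditivity over \<open>N\<close> steps of length \<open>\<theta> / N\<close>: the
  linear terms add up exactly, the quadratic errors only to a multiple of
  \<open>1 / N\<close>.\<close>

lemma rvar_smooth:
  assumes A [measurable]: "A \<in> sets (Rd d)" and \<phi>: "0 < \<phi>" "\<phi> < pi / 2" and \<theta>: "0 \<le> \<theta>" "\<theta> \<le> pi / 2"
  defines "\<kappa> \<equiv> cos \<phi> / sin \<phi>"
  shows "rvar d (smooth d \<phi> (indicator A)) J \<theta>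
    \<le> ennreal (\<kappa> * \<theta> * (\<integral>x. nrm d (restr J (grad d \<phi> (indicator A) x)) \<partial>Nd d))"
proof (rule ennreal_le_epsilon)
  fix e :: real assume e: "0 < e"
  let ?P = "smooth d \<phi> (indicator A)"
  define E where "E = (\<integral>x. nrm d (restr J (grad d \<phi> (indicator A) x)) \<partial>Nd d)"
  have E0: "0 \<le> E" unfolding E_def by simp
  have s: "0 < sin \<phi>" "0 < cos \<phi>" using \<phi> by (auto intro: sin_gt_zero cos_gt_zero)
  then have \<kappa>: "0 < \<kappa>" unfolding \<kappa>_def by simp
  define K where "K = (\<kappa> + 8 * \<kappa>\<^sup>2) * real d"
  have K: "0 \<le> K" unfolding K_def using \<kappa> by simp
  \<comment> \<open>The bound 2 makes the step at most 1, since
    \<open>\<theta> \<le> pi / 2 < 2\<close>; the other bound makes the total quadratic error at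
    most \<open>e\<close>.\<close>
  obtain N :: nat where N: "N > max 2 (K * \<theta>\<^sup>2 / e)" using reals_Archimedean2 by blast
  have N0: "real N > 0" using N by simp
  define h where "h = \<theta> / real N"
  have h: "0 \<le> h" "h \<le> 1" "real N * h = \<theta>"
    using \<theta> N pi_less_4 unfolding h_def by (auto simp: field_simps)
  have "rvar d ?P J \<theta> = rvar d ?P J (real N * h)" by (simp add: h)
  also have "\<dots> \<le> of_nat N * rvar d ?P J h" using h \<theta> pi_gt_zero by (intro rvar_mult) (auto simp del: pi_gt_zero)
  also have "\<dots> \<le> of_nat N * ennreal (\<kappa> * h * E + K * h\<^sup>2)"
    unfolding E_def K_def \<kappa>_def using h \<phi> by (intro mult_left_mono rvar_smooth_step) auto
  also have "\<dots> = ennreal (real N * (\<kappa> * h * E + K * h\<^sup>2))"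
    by (simp add: ennreal_mult' ennreal_of_nat_eq_real_of_nat)
  also have "real N * (\<kappa> * h * E + K * h\<^sup>2) = \<kappa> * (real N * h) * E + K * (real N * h)\<^sup>2 / real N"
    using N0 by (simp add: power2_eq_square field_simps)
  also have "\<dots> = \<kappa> * \<theta> * E + K * \<theta>\<^sup>2 / real N" by (simp add: h)
  also have "ennreal (\<kappa> * \<theta> * E + K * \<theta>\<^sup>2 / real N) \<le> ennreal (\<kappa> * \<theta> * E + e)"
    using N e N0 by (intro ennreal_leI add_left_mono) (simp add: field_simps)
  finally show "rvar d ?P J \<theta> \<le> ennreal (\<kappa> * \<theta> * E) + ennreal e"
    using \<kappa> \<theta> E0 e by (subst ennreal_plus[symmetric]) (auto simp del: ennreal_plus intro: ennreal_leI)
qed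

text \<open>Only continuity at angle 0 is wanted, without a rate. A change of the indicator puts an
  endpoint in the shell unless the displacement exceeds \<open>h\<close>, and a large displacement
  is improbable by Markov's inequality for its square.\<close>

lemma indicator_rot_close:
  assumes A [measurable]: "A \<in> sets (Rd d)" and G: "gauss_surface_area d A \<le> ennreal G" "0 \<le> G" and "0 < \<iota>"
  shows "\<exists>\<phi>. 0 < \<phi> \<and> \<phi> < pi / 2 \<and> rvar d (indicator A) UNIV \<phi> \<le> ennreal \<iota>"
proof -
  \<comment> \<open>Fixed before the angle: the shell mass is at most \<open>\<iota> / 4\<close>,
    hence \<open>\<iota> / 2\<close> for both endpoints, and the other half is left for large
    displacements.\<close>
  define h0 where "h0 = \<iota> / (4 * (G + 1))"
  have h0: "0 < h0" using G \<open>0 < \<iota>\<close> by (simp add: h0_def)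
  obtain h where h: "0 < h" "h < h0" "measure (Nd d) (shell d A h) \<le> (G + 1) * h"
    using surface_area_frequently[OF G, of 1 h0] h0 by auto
  have "(G + 1) * h \<le> (G + 1) * h0" using h G by (intro mult_left_mono) auto
  also have "(G + 1) * h0 = \<iota> / 4"
  proof -
    have "G + 1 \<noteq> 0" using G by simp
    then show ?thesis unfolding h0_def by (simp add: field_simps)
  qed
  finally have m: "measure (Nd d) (shell d A h) \<le> \<iota> / 4" using h by simp
  let ?B = "shell d A h"
  have "((\<lambda>\<phi>. 4 * \<phi>\<^sup>2 * real d / h\<^sup>2) \<longlongrightarrow> 4 * 0\<^sup>2 * real d / h\<^sup>2) (at_right 0)"
    by (intro tendsto_intros) (use h in auto)
  then have "\<forall>\<^sub>F \<phi> in at_right 0. 4 * \<phi>\<^sup>2 * real d / h\<^sup>2 < \<iota> / 2"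
    using \<open>0 < \<iota>\<close> by (intro order_tendstoD) auto
  then obtain b where b: "0 < b" "\<And>\<phi>. 0 < \<phi> \<Longrightarrow> \<phi> < b \<Longrightarrow> 4 * \<phi>\<^sup>2 * real d / h\<^sup>2 < \<iota> / 2"
    by (auto simp: eventually_at_right_field)
  define \<phi> where "\<phi> = min (b / 2) 1"
  have \<phi>: "0 < \<phi>" "\<phi> \<le> 1" "\<phi> < b" using b(1) by (auto simp: \<phi>_def)
  have \<phi>d: "4 * \<phi>\<^sup>2 * real d / h\<^sup>2 < \<iota> / 2" using b(2)[OF \<phi>(1,3)] .
  have \<phi>pi: "\<phi> < pi / 2" using \<phi> pi_gt3 by simp
  let ?r = "rot d (ang UNIV \<phi>)" and ?S = "\<lambda>p. dotp d (fst p) (fst p) + dotp d (snd p) (snd p)"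
  have pt: "\<bar>indicator A (fst (?r p)) - indicator A (fst p)\<bar>
      \<le> indicator ?B (fst (?r p)) + indicator ?B (fst p) + 2 * \<phi>\<^sup>2 / h\<^sup>2 * ?S p"
    if "p \<in> space (Nd d \<Otimes>\<^sub>M Nd d)" for p
  proof -
    obtain x y where p: "p = (x, y)" by force
    have x: "x \<in> space (Rd d)" using that by (auto simp: p space_pair_measure space_Nd space_Rd)
    have x': "fst (?r p) \<in> space (Rd d)" by (simp add: rot_def space_Rd)
    let ?u = "disp UNIV \<phi> x y"
    have S0: "0 \<le> ?S p" by (simp add: dotp_nonneg)
    have e: "L2_set (\<lambda>i. fst (?r p) i - x i) {..<d} = nrm d ?u"
      unfolding p fst_rot_disp nrm_eq_L2_set by (intro L2_set_cong) auto
    show ?thesis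
    proof (cases "nrm d ?u \<le> h")
      case True
      then have l: "L2_set (\<lambda>i. fst (?r p) i - x i) {..<d} \<le> h" using e by simp
      then have l': "L2_set (\<lambda>i. x i - fst (?r p) i) {..<d} \<le> h" by (subst L2_set_diff_commute)
      have "0 \<le> 2 * \<phi>\<^sup>2 / h\<^sup>2 * ?S p" using S0 by simp
      moreover have "\<bar>indicator A (fst (?r p)) - indicator A (fst p)\<bar> \<le> indicator ?B (fst (?r p)) + (indicator ?B (fst p) :: real)"
        using in_neighbourhood[OF x _ l'] in_neighbourhood[OF x' _ l]
        by (auto simp: indicator_def shell_def p)
      ultimately show ?thesis by linarith
    next
      case False
      then have "h\<^sup>2 \<le> (nrm d ?u)\<^sup>2" using h by (intro power_mono) auto
      also have "\<dots> \<le> 2 * \<phi>\<^sup>2 * ?S p" unfolding nrm_sq using disp_sq[of \<phi> d UNIV x y] \<phi> by (simp add: p)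
      finally have "1 \<le> 2 * \<phi>\<^sup>2 / h\<^sup>2 * ?S p" using h by (simp add: field_simps)
      moreover have "\<bar>indicator A (fst (?r p)) - indicator A (fst p)\<bar> \<le> (1::real)" by (simp add: indicator_def)
      moreover have "0 \<le> indicator ?B (fst (?r p)) + (indicator ?B (fst p) :: real)" by (simp add: indicator_def)
      ultimately show ?thesis by linarith
    qed
  qed
  have "rvar d (indicator A) UNIV \<phi> \<le> (\<integral>\<^sup>+p. indicator ?B (fst (?r p)) + (indicator ?B (fst p) + ennreal (2 * \<phi>\<^sup>2 / h\<^sup>2) * ennreal (?S p)) \<partial>(Nd d \<Otimes>\<^sub>M Nd d))"
    unfolding rvar_def
  proof (rule nn_integral_mono)
    fix p assume "p \<in> space (Nd d \<Otimes>\<^sub>M Nd d)"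
    then have "ennreal \<bar>indicator A (fst (?r p)) - indicator A (fst p)\<bar> \<le>
        ennreal (indicator ?B (fst (?r p)) + indicator ?B (fst p) + 2 * \<phi>\<^sup>2 / h\<^sup>2 * ?S p)" by (intro ennreal_leI pt)
    also have "\<dots> = indicator ?B (fst (?r p)) + (indicator ?B (fst p) + ennreal (2 * \<phi>\<^sup>2 / h\<^sup>2) * ennreal (?S p))"
    proof -
      have "ennreal (a + b + c * s) = ennreal a + (ennreal b + ennreal c * ennreal s)"
        if "0 \<le> a" "0 \<le> b" "0 \<le> c" "0 \<le> s" for a b c s
        using that by (simp add: ennreal_plus ennreal_mult add.assoc)
      from this[of "indicator ?B (fst (?r p))" "indicator ?B (fst p)" "2 * \<phi>\<^sup>2 / h\<^sup>2" "?S p"] show ?thesis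
        by (simp only: ennreal_indicator) (simp add: dotp_nonneg)
    qed
    finally show "ennreal \<bar>indicator A (fst (?r p)) - indicator A (fst p)\<bar> \<le> \<dots>" .
  qed
  also have "\<dots> = (\<integral>\<^sup>+p. indicator ?B (fst (?r p)) \<partial>(Nd d \<Otimes>\<^sub>M Nd d)) + ((\<integral>\<^sup>+p. indicator ?B (fst p) \<partial>(Nd d \<Otimes>\<^sub>M Nd d))
     + ennreal (2 * \<phi>\<^sup>2 / h\<^sup>2) * (\<integral>\<^sup>+p. ennreal (?S p) \<partial>(Nd d \<Otimes>\<^sub>M Nd d)))"
    by (subst nn_integral_add, measurable, subst nn_integral_add, measurable, subst nn_integral_cmult, measurable)
  also have "(\<integral>\<^sup>+p. indicator ?B (fst (?r p)) \<partial>(Nd d \<Otimes>\<^sub>M Nd d)) = (\<integral>\<^sup>+x. indicator ?B x \<partial>Nd d)"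
    using \<phi> \<phi>pi by (intro nn_integral_rot_fst[of "ang UNIV \<phi>" "indicator ?B"]) (auto intro!: ang_lt)
  also have "(\<integral>\<^sup>+p. indicator ?B (fst p) \<partial>(Nd d \<Otimes>\<^sub>M Nd d)) = (\<integral>\<^sup>+x. \<integral>\<^sup>+y. indicator ?B (fst (x, y)) \<partial>Nd d \<partial>Nd d)"
    by (rule Nd.nn_integral_fst[symmetric]) measurable
  also have "(\<integral>\<^sup>+x. \<integral>\<^sup>+y. indicator ?B (fst (x, y)) \<partial>Nd d \<partial>Nd d) = (\<integral>\<^sup>+x. indicator ?B x \<partial>Nd d)"
    by (simp add: Nd.emeasure_space_1)
  also have "(\<integral>\<^sup>+x. indicator ?B x \<partial>Nd d) = ennreal (measure (Nd d) ?B)"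
    by (simp add: Nd.emeasure_eq_measure)
  also have "(\<integral>\<^sup>+p. ennreal (?S p) \<partial>(Nd d \<Otimes>\<^sub>M Nd d)) = ennreal (2 * real d)" by (rule nn_integral_dotp_self)
  also have "ennreal (measure (Nd d) ?B) + (ennreal (measure (Nd d) ?B) + ennreal (2 * \<phi>\<^sup>2 / h\<^sup>2) * ennreal (2 * real d))
     = ennreal (2 * measure (Nd d) ?B + 4 * \<phi>\<^sup>2 * real d / h\<^sup>2)"
    by (simp add: ennreal_mult'[symmetric] ennreal_plus[symmetric] del: ennreal_plus)
  also have "\<dots> \<le> ennreal \<iota>" using m \<phi>d by (intro ennreal_leI) linarith
  finally show ?thesis using \<phi> \<phi>pi by auto
qed

section \<open>Noise stability of the set itself\<close>

lemma rvar_indicator: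
  assumes A [measurable]: "A \<in> sets (Rd d)"
  shows "rvar d (indicator A) J \<theta> = ennreal (measure (Nd d \<Otimes>\<^sub>M Nd d) {p \<in> space (Nd d \<Otimes>\<^sub>M Nd d). (fst (rot d (ang J \<theta>) p) \<in> A) \<noteq> (fst p \<in> A)})"
proof -
  let ?D = "{p \<in> space (Nd d \<Otimes>\<^sub>M Nd d). (fst (rot d (ang J \<theta>) p) \<in> A) \<noteq> (fst p \<in> A)}"
  have [measurable]: "?D \<in> sets (Nd d \<Otimes>\<^sub>M Nd d)" by measurable
  have "rvar d (indicator A) J \<theta> = (\<integral>\<^sup>+p. indicator ?D p \<partial>(Nd d \<Otimes>\<^sub>M Nd d))"
    unfolding rvar_def by (intro nn_integral_cong) (auto simp: indicator_def)
  also have "\<dots> = emeasure (Nd d \<Otimes>\<^sub>M Nd d) ?D" by simp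
  finally show ?thesis by (simp add: Nd2.emeasure_eq_measure)
qed

text \<open>Both points have the law \<open>Nd d\<close>, so exchanging \<open>f\<close> for
  \<open>g\<close> costs the L1 distance twice.\<close>

lemma rvar_fst_diff:
  assumes [measurable]: "f \<in> borel_measurable (Rd d)" "g \<in> borel_measurable (Rd d)" and \<theta>: "0 \<le> \<theta>" "\<theta> < pi"
  shows "rvar d f J \<theta> \<le> rvar d g J \<theta> + 2 * (\<integral>\<^sup>+x. ennreal \<bar>f x - g x\<bar> \<partial>Nd d)"
proof -
  let ?r = "rot d (ang J \<theta>)"
  have "rvar d f J \<theta> \<le> (\<integral>\<^sup>+p. ennreal \<bar>g (fst (?r p)) - g (fst p)\<bar> + (ennreal \<bar>f (fst (?r p)) - g (fst (?r p))\<bar> + ennreal \<bar>f (fst p) - g (fst p)\<bar>) \<partial>(Nd d \<Otimes>\<^sub>M Nd d))"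
    unfolding rvar_def
    by (intro nn_integral_mono) (auto simp: ennreal_plus[symmetric] simp del: ennreal_plus intro!: ennreal_leI)
  also have "\<dots> = rvar d g J \<theta> + ((\<integral>\<^sup>+p. ennreal \<bar>f (fst (?r p)) - g (fst (?r p))\<bar> \<partial>(Nd d \<Otimes>\<^sub>M Nd d)) + (\<integral>\<^sup>+p. ennreal \<bar>f (fst p) - g (fst p)\<bar> \<partial>(Nd d \<Otimes>\<^sub>M Nd d)))"
    unfolding rvar_def by (subst nn_integral_add, measurable, subst nn_integral_add, measurable)
  also have "(\<integral>\<^sup>+p. ennreal \<bar>f (fst (?r p)) - g (fst (?r p))\<bar> \<partial>(Nd d \<Otimes>\<^sub>M Nd d)) = (\<integral>\<^sup>+x. ennreal \<bar>f x - g x\<bar> \<partial>Nd d)"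
    using \<theta> by (intro nn_integral_rot_fst[of "ang J \<theta>" "\<lambda>x. ennreal \<bar>f x - g x\<bar>"]) (auto intro!: ang_lt)
  also have "(\<integral>\<^sup>+p. ennreal \<bar>f (fst p) - g (fst p)\<bar> \<partial>(Nd d \<Otimes>\<^sub>M Nd d)) = (\<integral>\<^sup>+x. \<integral>\<^sup>+y. ennreal \<bar>f (fst (x, y)) - g (fst (x, y))\<bar> \<partial>Nd d \<partial>Nd d)"
    by (rule Nd.nn_integral_fst[symmetric]) measurable
  also have "(\<integral>\<^sup>+x. \<integral>\<^sup>+y. ennreal \<bar>f (fst (x, y)) - g (fst (x, y))\<bar> \<partial>Nd d \<partial>Nd d) = (\<integral>\<^sup>+x. ennreal \<bar>f x - g x\<bar> \<partial>Nd d)"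
    by (simp add: Nd.emeasure_space_1)
  finally show ?thesis by (simp add: mult_2)
qed

text \<open>The smoothing averages \<open>f\<close> over the rotated points, so by the triangle
  inequality for integrals its L1 distance from \<open>f\<close> is at most the mean change.\<close>

lemma smooth_close:
  assumes [measurable]: "f \<in> borel_measurable (Rd d)" and f: "\<And>z. 0 \<le> f z" "\<And>z. f z \<le> (1::real)"
  shows "(\<integral>\<^sup>+x. ennreal \<bar>f x - smooth d \<phi> f x\<bar> \<partial>Nd d) \<le> rvar d f UNIV \<phi>"
proof -
  have a: "ang UNIV \<phi> = (\<lambda>_. \<phi>)" by (simp add: ang_def)
  have "(\<integral>\<^sup>+x. ennreal \<bar>f x - smooth d \<phi> f x\<bar> \<partial>Nd d) \<le> (\<integral>\<^sup>+x. \<integral>\<^sup>+y. ennreal \<bar>f (fst (rot d (ang UNIV \<phi>) (x, y))) - f (fst (x, y))\<bar> \<partial>Nd d \<partial>Nd d)"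
  proof (rule nn_integral_mono)
    fix x assume "x \<in> space (Nd d)"
    then have x: "x \<in> space (Rd d)" by (simp add: space_Nd space_Rd)
    let ?F = "\<lambda>y. f (fst (rot d (\<lambda>_. \<phi>) (x, y)))"
    have [measurable]: "?F \<in> borel_measurable (Rd d)" using x by measurable
    have Fi: "integrable (Nd d) ?F" using f by (intro Nd.integrable_const_bound[of _ 1]) auto
    have "\<bar>f x - smooth d \<phi> f x\<bar> = \<bar>\<integral>y. f x - ?F y \<partial>Nd d\<bar>"
      unfolding smooth_def using Fi by (simp add: Nd.prob_space)
    also have "\<dots> \<le> (\<integral>y. \<bar>f x - ?F y\<bar> \<partial>Nd d)" by (rule integral_abs_bound)
    finally have "ennreal \<bar>f x - smooth d \<phi> f x\<bar> \<le> ennreal (\<integral>y. \<bar>f x - ?F y\<bar> \<partial>Nd d)" by (rule ennreal_leI)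
    also have "\<dots> = (\<integral>\<^sup>+y. ennreal \<bar>f x - ?F y\<bar> \<partial>Nd d)"
      using Fi by (intro nn_integral_eq_integral[symmetric]) auto
    finally show "ennreal \<bar>f x - smooth d \<phi> f x\<bar> \<le> (\<integral>\<^sup>+y. ennreal \<bar>f (fst (rot d (ang UNIV \<phi>) (x, y))) - f (fst (x, y))\<bar> \<partial>Nd d)"
      by (simp add: a abs_minus_commute)
  qed
  also have "\<dots> = rvar d f UNIV \<phi>" unfolding rvar_def by (rule Nd.nn_integral_fst) measurable
  finally show ?thesis .
qed

definition noise :: "nat \<Rightarrow> (nat \<Rightarrow> real) set \<Rightarrow> nat set \<Rightarrow> real \<Rightarrow> real" where
  "noise d A J \<theta> = measure (Nd d \<Otimes>\<^sub>M Nd d)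
     {p \<in> space (Nd d \<Otimes>\<^sub>M Nd d). (fst (rot d (ang J \<theta>) p) \<in> A) \<noteq> (fst p \<in> A)}"

text \<open>Cauchy-Schwarz over the random set: the mean of \<open>|g_J|\<close> is at most the root
  of the mean of \<open>|g_J|^2\<close>, which is the sum of \<open>P(i in J) g_i^2\<close>. This is
  the origin of \<open>sqrt \<delta>\<close>.\<close>

lemma sum_nrm_restr:
  assumes p: "\<And>J. J \<in> Pow {..<d} \<Longrightarrow> 0 \<le> p J" "(\<Sum>J\<in>Pow {..<d}. p J) = 1"
    and \<delta>: "\<And>i. i < d \<Longrightarrow> (\<Sum>J\<in>Pow {..<d}. if i \<in> J then p J else 0) \<le> \<delta>"
  shows "(\<Sum>J\<in>Pow {..<d}. p J * nrm d (restr J g)) \<le> sqrt \<delta> * nrm d g"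
proof -
  have "(\<Sum>J\<in>Pow {..<d}. p J * nrm d (restr J g))\<^sup>2 = (\<Sum>J\<in>Pow {..<d}. sqrt (p J) * (sqrt (p J) * nrm d (restr J g)))\<^sup>2"
    using p by (intro arg_cong[where f = "\<lambda>x. x\<^sup>2"] sum.cong) (auto simp: mult.assoc[symmetric])
  also have "\<dots> \<le> (\<Sum>J\<in>Pow {..<d}. (sqrt (p J))\<^sup>2) * (\<Sum>J\<in>Pow {..<d}. (sqrt (p J) * nrm d (restr J g))\<^sup>2)"
    by (rule Cauchy_Schwarz_ineq_sum)
  also have "(\<Sum>J\<in>Pow {..<d}. (sqrt (p J))\<^sup>2) = (\<Sum>J\<in>Pow {..<d}. p J)"
    using p(1) by (intro sum.cong) auto
  also note p(2)
  also have "(\<Sum>J\<in>Pow {..<d}. (sqrt (p J) * nrm d (restr J g))\<^sup>2) = (\<Sum>J\<in>Pow {..<d}. \<Sum>i<d. (if i \<in> J then p J else 0) * (g i)\<^sup>2)"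
  proof (intro sum.cong refl)
    fix J assume "J \<in> Pow {..<d}"
    then have "(sqrt (p J))\<^sup>2 = p J" using p(1) by simp
    then have "(sqrt (p J) * nrm d (restr J g))\<^sup>2 = p J * dotp d (restr J g) (restr J g)"
      by (simp only: power_mult_distrib nrm_sq)
    also have "\<dots> = (\<Sum>i<d. (if i \<in> J then p J else 0) * (g i)\<^sup>2)"
      unfolding dotp_def restr_def sum_distrib_left by (intro sum.cong) (auto simp: power2_eq_square)
    finally show "(sqrt (p J) * nrm d (restr J g))\<^sup>2 = (\<Sum>i<d. (if i \<in> J then p J else 0) * (g i)\<^sup>2)" .
  qed
  also have "\<dots> = (\<Sum>i<d. (\<Sum>J\<in>Pow {..<d}. if i \<in> J then p J else 0) * (g i)\<^sup>2)"
    unfolding sum_distrib_right by (rule sum.swap)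
  also have "\<dots> \<le> (\<Sum>i<d. \<delta> * (g i)\<^sup>2)" using \<delta> by (intro sum_mono mult_right_mono) auto
  also have "\<dots> = \<delta> * (nrm d g)\<^sup>2" 
    unfolding nrm_sq dotp_def by (simp add: sum_distrib_left power2_eq_square)
  finally have "(\<Sum>J\<in>Pow {..<d}. p J * nrm d (restr J g))\<^sup>2 \<le> \<delta> * (nrm d g)\<^sup>2" by simp
  then have "(\<Sum>J\<in>Pow {..<d}. p J * nrm d (restr J g)) \<le> sqrt (\<delta> * (nrm d g)\<^sup>2)" by (rule real_le_rsqrt)
  then show ?thesis by (simp add: real_sqrt_mult)
qed

text \<open>The error of replacing the indicator by its smoothing tends to 0 with
  \<open>\<phi>\<close>, while \<open>grad_bound\<close> is uniform in \<open>\<phi>\<close>; hence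
  no trace of the smoothing is left in the bound.\<close>

lemma noise_average:
  assumes A [measurable]: "A \<in> sets (Rd d)" and G: "gauss_surface_area d A \<le> ennreal G" "0 \<le> G"
    and \<theta>: "0 \<le> \<theta>" "\<theta> \<le> pi / 2"
    and p: "\<And>J. J \<in> Pow {..<d} \<Longrightarrow> 0 \<le> p J" "(\<Sum>J\<in>Pow {..<d}. p J) = 1"
    and \<delta>: "\<And>i. i < d \<Longrightarrow> (\<Sum>J\<in>Pow {..<d}. if i \<in> J then p J else 0) \<le> \<delta>" "0 \<le> \<delta>"
  shows "(\<Sum>J\<in>Pow {..<d}. p J * noise d A J \<theta>) \<le> 2 * \<theta> * sqrt \<delta> * G"
proof (rule field_le_epsilon)
  fix e :: real assume "0 < e"
  then obtain \<phi> where \<phi>: "0 < \<phi>" "\<phi> < pi / 2" "rvar d (indicator A) UNIV \<phi> \<le> ennreal (e / 2)"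
    using indicator_rot_close[OF A G, of "e / 2"] by auto
  define \<kappa> where "\<kappa> = cos \<phi> / sin \<phi>"
  have "0 < sin \<phi>" "0 < cos \<phi>" using \<phi> by (auto intro: sin_gt_zero cos_gt_zero)
  then have \<kappa>: "0 < \<kappa>" unfolding \<kappa>_def by simp
  let ?P = "smooth d \<phi> (indicator A)" and ?g = "grad d \<phi> (indicator A)"
  have gi: "integrable (Nd d) (\<lambda>x. nrm d (restr J (?g x)))" for J
    unfolding restr_def by (rule grad_integrable[OF A])
  have "noise d A J \<theta> \<le> \<kappa> * \<theta> * (\<integral>x. nrm d (restr J (?g x)) \<partial>Nd d) + e" for J
  proof -
    have "ennreal (noise d A J \<theta>) = rvar d (indicator A) J \<theta>" by (simp add: rvar_indicator noise_def)
    also have "\<dots> \<le> rvar d ?P J \<theta> + 2 * (\<integral>\<^sup>+x. ennreal \<bar>indicator A x - ?P x\<bar> \<partial>Nd d)"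
      using \<theta> pi_gt_zero by (intro rvar_fst_diff) (auto simp del: pi_gt_zero)
    also have "\<dots> \<le> ennreal (\<kappa> * \<theta> * (\<integral>x. nrm d (restr J (?g x)) \<partial>Nd d)) + 2 * ennreal (e / 2)"
      using smooth_close[of "indicator A" d \<phi>] \<phi> \<theta> unfolding \<kappa>_def
      by (intro add_mono rvar_smooth mult_left_mono order_trans[OF smooth_close \<phi>(3)]) auto
    also have "2 * ennreal (e / 2) = ennreal e"
      using \<open>0 < e\<close> by (simp add: ennreal_mult'[symmetric] flip: ennreal_numeral)
    also have "ennreal (\<kappa> * \<theta> * (\<integral>x. nrm d (restr J (?g x)) \<partial>Nd d)) + ennreal e
      = ennreal (\<kappa> * \<theta> * (\<integral>x. nrm d (restr J (?g x)) \<partial>Nd d) + e)"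
      using \<kappa> \<theta> \<open>0 < e\<close> by (subst ennreal_plus) auto
    finally show ?thesis using \<kappa> \<theta> \<open>0 < e\<close> by (subst (asm) ennreal_le_iff) auto
  qed
  then have "(\<Sum>J\<in>Pow {..<d}. p J * noise d A J \<theta>) \<le> (\<Sum>J\<in>Pow {..<d}. p J * (\<kappa> * \<theta> * (\<integral>x. nrm d (restr J (?g x)) \<partial>Nd d) + e))"
    using p by (intro sum_mono mult_left_mono) auto
  also have "\<dots> = \<theta> * \<kappa> * (\<Sum>J\<in>Pow {..<d}. p J * (\<integral>x. nrm d (restr J (?g x)) \<partial>Nd d)) + e"
    unfolding distrib_left sum.distrib sum_distrib_right[symmetric] p
    by (simp add: sum_distrib_left mult_ac)
  also have "\<dots> \<le> \<theta> * \<kappa> * (sqrt \<delta> * (\<integral>x. nrm d (?g x) \<partial>Nd d)) + e"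
  proof (intro add_right_mono mult_left_mono)
    have "(\<Sum>J\<in>Pow {..<d}. p J * (\<integral>x. nrm d (restr J (?g x)) \<partial>Nd d)) = (\<integral>x. (\<Sum>J\<in>Pow {..<d}. p J * nrm d (restr J (?g x))) \<partial>Nd d)"
      by (subst Bochner_Integration.integral_sum) (auto intro!: integrable_mult_right gi)
    also have "\<dots> \<le> (\<integral>x. sqrt \<delta> * nrm d (?g x) \<partial>Nd d)"
      using sum_nrm_restr[OF p \<delta>(1)] grad_integrable(1)[OF A]
      by (intro integral_mono Bochner_Integration.integrable_sum integrable_mult_right gi) auto
    finally show "(\<Sum>J\<in>Pow {..<d}. p J * (\<integral>x. nrm d (restr J (?g x)) \<partial>Nd d)) \<le> sqrt \<delta> * (\<integral>x. nrm d (?g x) \<partial>Nd d)"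
      by simp
  qed (use \<theta> \<kappa> in auto)
  also have "\<theta> * \<kappa> * (sqrt \<delta> * (\<integral>x. nrm d (?g x) \<partial>Nd d)) = \<theta> * sqrt \<delta> * (\<kappa> * (\<integral>x. nrm d (?g x) \<partial>Nd d))" by simp
  also have "\<theta> * sqrt \<delta> * (\<kappa> * (\<integral>x. nrm d (?g x) \<partial>Nd d)) + e \<le> \<theta> * sqrt \<delta> * (2 * G) + e"
    unfolding \<kappa>_def using \<theta> \<delta> by (intro add_right_mono mult_left_mono grad_bound[OF A G \<phi>(1,2)]) auto
  finally show "(\<Sum>J\<in>Pow {..<d}. p J * noise d A J \<theta>) \<le> 2 * \<theta> * sqrt \<delta> * G + e"
    by (simp add: mult_ac)
qed

lemma noise_all:
  assumes A: "A \<in> sets (Rd d)" and G: "gauss_surface_area d A \<le> ennreal G" "0 \<le> G"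
    and \<theta>: "0 \<le> \<theta>" "\<theta> \<le> pi / 2"
  shows "noise d A {..<d} \<theta> \<le> 2 * \<theta> * G"
proof -
  define p where "p J = (if J = {..<d} then 1 else 0 :: real)" for J
  have d: "(\<Sum>J\<in>Pow {..<d}. p J * q J) = q {..<d}" for q :: "nat set \<Rightarrow> real"
    unfolding p_def by (subst sum.remove[of _ "{..<d}"]) (auto intro!: sum.neutral)
  have "(\<Sum>J\<in>Pow {..<d}. p J * noise d A J \<theta>) \<le> 2 * \<theta> * sqrt 1 * G"
  proof (rule noise_average[OF A G \<theta>])
    show "(\<Sum>J\<in>Pow {..<d}. p J) = 1" using d[of "\<lambda>_. 1"] by simp
    show "(\<Sum>J\<in>Pow {..<d}. if i \<in> J then p J else 0) \<le> 1" if "i < d" for i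
    proof -
      have "(\<Sum>J\<in>Pow {..<d}. if i \<in> J then p J else 0) \<le> (\<Sum>J\<in>Pow {..<d}. p J * 1)"
        by (intro sum_mono) (auto simp: p_def)
      then show ?thesis using d[of "\<lambda>_. 1"] by simp
    qed
  qed (auto simp: p_def)
  then show ?thesis using d by simp
qed

section \<open>Cell bases and low-degree weight\<close>

text \<open>The Householder reflection exchanging the first unit vector with \<open>(sqrt (w c))\<^sub>c\<close> is symmetric
  and orthogonal, so its rescaled rows form an orthonormal basis that starts with the constant \<open>1\<close>.\<close>

lemma weighted_basis:
  fixes w :: "nat \<Rightarrow> real"
  assumes m: "2 \<le> m" and w: "\<And>c. c < m \<Longrightarrow> 0 < w c" "(\<Sum>c<m. w c) = 1"
  shows "\<exists>e. (\<forall>c<m. e 0 c = (1::real)) \<and>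
    (\<forall>j<m. \<forall>l<m. (\<Sum>c<m. w c * (e j c * e l c)) = (if j = l then 1 else 0)) \<and>
    (\<forall>c<m. \<forall>c'<m. (\<Sum>j<m. e j c * e j c') = (if c = c' then 1 / w c else 0))"
proof -
  define u where "u c = sqrt (w c)" for c
  define v where "v c = u c - (if c = 0 then 1 else 0)" for c
  define b where "b = 1 - u 0"
  \<comment> \<open>Since \<open>|v|^2 = 2 b\<close>, this is \<open>I - 2 v v^T / |v|^2\<close> for
    \<open>v\<close> the difference of the unit vector \<open>u\<close> and the first basis
    vector.\<close>
  define H where "H j c = (if j = c then 1 else 0) - v j * v c / b" for j c :: nat
  have m0: "0 < m" using m by simp
  have u: "0 < u c" "u c * u c = w c" if "c < m" for c using w(1)[OF that] by (auto simp: u_def)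
  have uu: "(\<Sum>c<m. u c * u c) = 1" using u w(2) by simp
  \<comment> \<open>The second weight is positive, which keeps \<open>u\<close> away from the first
    basis vector; otherwise \<open>v\<close> and \<open>b\<close> would vanish and the reflection
    would be undefined.\<close>
  have "w 0 < 1"
  proof -
    have "w 0 + w 1 = (\<Sum>c\<in>{0, 1}. w c)" by simp
    also have "\<dots> \<le> (\<Sum>c<m. w c)" using m w(1) by (intro sum_mono2) (auto intro: less_imp_le)
    finally show ?thesis using w(1)[of 1] w(2) m by simp
  qed
  then have b: "0 < b" unfolding b_def u_def by simp
  have vv: "(\<Sum>c<m. v c * v c) = 2 * b"
  proof -
    have "(\<Sum>c<m. v c * v c) = (\<Sum>c<m. u c * u c - 2 * (if c = 0 then u c else 0) + (if c = 0 then 1 else 0))"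
      by (intro sum.cong) (auto simp: v_def algebra_simps)
    also have "\<dots> = 1 - 2 * u 0 + 1"
      unfolding sum.distrib sum_subtractf uu sum_distrib_left[symmetric] using m0 by (simp add: sum.delta)
    finally show ?thesis by (simp add: b_def)
  qed
  have HH: "(\<Sum>c<m. H j c * H l c) = (if j = l then 1 else 0)" if "j < m" "l < m" for j l
  proof -
    have "(\<Sum>c<m. H j c * H l c) = (\<Sum>c<m. (if c = j then (if j = l then 1 else 0) else 0)
        - (if c = j then v l * v c / b else 0) - (if c = l then v j * v c / b else 0) + v j * v l / b\<^sup>2 * (v c * v c))"
      by (intro sum.cong) (auto simp: H_def power2_eq_square algebra_simps)
    also have "\<dots> = (if j = l then 1 else 0) - v l * v j / b - v j * v l / b + v j * v l / b\<^sup>2 * (2 * b)"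
      unfolding sum.distrib sum_subtractf sum_distrib_left[symmetric] vv using that by (simp add: sum.delta)
    also have "\<dots> = (if j = l then 1 else 0)" using b by (simp add: power2_eq_square field_simps)
    finally show ?thesis .
  qed
  have Hs: "H j c = H c j" for j c by (simp add: H_def mult.commute)
  define e where "e j c = H j c / u c" for j c
  have "e 0 c = 1" if "c < m" for c
  proof -
    have "v 0 = - b" by (simp add: v_def b_def)
    then have "H 0 c = u c" using b by (simp add: H_def v_def)
    then show ?thesis using u[OF that] by (simp add: e_def)
  qed
  moreover have "(\<Sum>c<m. w c * (e j c * e l c)) = (if j = l then 1 else 0)" if "j < m" "l < m" for j l
  proof -
    have "(\<Sum>c<m. w c * (e j c * e l c)) = (\<Sum>c<m. H j c * H l c)"
    proof (intro sum.cong refl)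
      fix c assume "c \<in> {..<m}"
      then have "0 < u c" "w c = u c * u c" using u[of c] by auto
      then show "w c * (e j c * e l c) = H j c * H l c" by (simp add: e_def)
    qed
    then show ?thesis using HH[OF that] by simp
  qed
  moreover have "(\<Sum>j<m. e j c * e j c') = (if c = c' then 1 / w c else 0)" if "c < m" "c' < m" for c c'
  proof -
    have "(\<Sum>j<m. e j c * e j c') = (\<Sum>j<m. H c j * H c' j) / (u c * u c')"
      unfolding sum_divide_distrib by (intro sum.cong refl) (simp add: e_def Hs[of _ c] Hs[of _ c'])
    then show ?thesis using HH[OF that] u[OF that(1)] by auto
  qed
  ultimately show ?thesis by blast
qed

text \<open>Cells of width \<open>1 / N\<close> on about \<open>[-N, N]\<close> and two unbounded
  tails; the offset makes the index a natural number. The clipping level \<open>N^2 + 1\<close> lies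
  beyond every floor of \<open>N * t\<close> with \<open>|t| < N\<close>, so such \<open>t\<close>
  never fall into a tail cell.\<close>

definition cell :: "nat \<Rightarrow> real \<Rightarrow> nat" where
  "cell N t = nat (max (- int (N\<^sup>2 + 1)) (min (int (N\<^sup>2 + 1)) \<lfloor>real N * t\<rfloor>) + int (N\<^sup>2 + 1))"

lemma cell_lt: "cell N t < 2 * N\<^sup>2 + 3"
proof -
  have "nat (max (- int J) (min (int J) z) + int J) < 2 * J + 1" for J z by auto
  from this[of "N\<^sup>2 + 1" "\<lfloor>real N * t\<rfloor>"] show ?thesis unfolding cell_def by linarith
qed

lemma measurable_cell [measurable]: "cell N \<in> borel \<rightarrow>\<^sub>M count_space UNIV"
  unfolding cell_def by measurable

text \<open>One bounded point suffices: its floor is not clipped, so a point in the same cell has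
  the same floor.\<close>

lemma cell_close:
  assumes N: "1 \<le> N" and c: "cell N s = cell N t" and s: "\<bar>s\<bar> < real N"
  shows "\<bar>s - t\<bar> \<le> 1 / real N"
proof -
  let ?J = "int (N\<^sup>2 + 1)"
  have N0: "0 < real N" using N by simp
  have "\<bar>real N * s\<bar> < real N * real N" using s N0 by (simp add: abs_mult)
  then have b: "\<bar>real N * s\<bar> < real (N\<^sup>2)" by (simp add: power2_eq_square)
  have 1: "- ?J < \<lfloor>real N * s\<rfloor>"
  proof -
    have "- (real (N\<^sup>2)) < real N * s" using b by linarith
    then have "- int (N\<^sup>2) \<le> \<lfloor>real N * s\<rfloor>" by (subst le_floor_iff) simp
    then show ?thesis by simp
  qed
  have 2: "\<lfloor>real N * s\<rfloor> < ?J" using b by (subst floor_less_iff) (simp add: abs_less_iff)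
  from c have "max (- ?J) (min ?J \<lfloor>real N * s\<rfloor>) = max (- ?J) (min ?J \<lfloor>real N * t\<rfloor>)"
    unfolding cell_def by (subst (asm) eq_nat_nat_iff) auto
  then have f: "\<lfloor>real N * s\<rfloor> = \<lfloor>real N * t\<rfloor>" using 1 2 by (auto simp: max_def min_def split: if_splits)
  have "\<bar>real N * s - real N * t\<bar> < 1"
    using floor_correct[of "real N * s"] floor_correct[of "real N * t"] unfolding f by linarith
  then have "real N * \<bar>s - t\<bar> < 1" using N0 by (simp add: abs_mult right_diff_distrib[symmetric])
  then show ?thesis using N0 by (simp add: field_simps)
qed

text \<open>Each cell contains an interval of length \<open>1 / N\<close>. Positivity matters
  because the basis divides by roots of the cell weights.\<close>

lemma cell_measure_pos:
  assumes N: "1 \<le> N" and c: "c < 2 * N\<^sup>2 + 3"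
  shows "0 < measure std_normal_distribution {t. cell N t = c}"
proof -
  interpret prob_space std_normal_distribution by (rule prob_space_normal_density) simp
  let ?J = "int (N\<^sup>2 + 1)"
  have N0: "0 < real N" using N by simp
  define j where "j = int c - ?J"
  have "c \<le> 2 * (N\<^sup>2 + 1)" using c by simp
  then have "int c \<le> int (2 * (N\<^sup>2 + 1))" by (simp only: of_nat_le_iff)
  then have "int c \<le> 2 * ?J" by simp
  then have j: "- ?J \<le> j" "j \<le> ?J" by (simp_all add: j_def)
  define l r where "l = real_of_int j / real N" and "r = (real_of_int j + 1) / real N"
  have lr: "l < r" using N0 by (simp add: l_def r_def divide_strict_right_mono)
  have sub: "{l..<r} \<subseteq> {t. cell N t = c}"
  proof
    fix t assume "t \<in> {l..<r}"
    then have "\<lfloor>real N * t\<rfloor> = j" using N0 by (intro floor_unique) (auto simp: l_def r_def field_simps)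
    then show "t \<in> {t. cell N t = c}" unfolding cell_def using j by (auto simp: j_def)
  qed
  have "emeasure std_normal_distribution {l..<r} \<noteq> 0"
  proof
    assume "emeasure std_normal_distribution {l..<r} = 0"
    then have "(\<integral>\<^sup>+t. ennreal (std_normal_density t) * indicator {l..<r} t \<partial>lborel) = 0"
      by (subst (asm) emeasure_density) auto
    then have "AE t in lborel. ennreal (std_normal_density t) * indicator {l..<r} t = 0"
      by (subst (asm) nn_integral_0_iff_AE) auto
    then have "AE t in lborel. t \<notin> {l..<r}"
    proof (rule AE_mp, intro AE_I2 impI)
      fix t assume h: "ennreal (std_normal_density t) * indicator {l..<r} t = 0"
      have "0 < std_normal_density t" by (simp add: normal_density_pos)
      with h show "t \<notin> {l..<r}" by (auto simp: indicator_def split: if_splits)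
    qed
    then have "emeasure lborel {l..<r} = 0" by (subst (asm) AE_iff_measurable[of "{l..<r}"]) auto
    then show False using lr by simp
  qed
  then have "0 < measure std_normal_distribution {l..<r}"
    by (simp add: emeasure_eq_measure zero_less_measure_iff)
  also have "\<dots> \<le> measure std_normal_distribution {t. cell N t = c}"
    using sub by (intro finite_measure_mono) auto
  finally show ?thesis .
qed

text \<open>The Gaussian cell masses are the weights in \<open>weighted_basis\<close>. Completeness
  of the finite basis makes the sum of \<open>\<psi> j s * \<psi> j t\<close> the reciprocal weight
  when \<open>s\<close> and \<open>t\<close> share a cell and 0 otherwise; its sign and its support
  are all that is kept of it.\<close>

lemma cell_basis:
  assumes N: "1 \<le> N"
  defines "m \<equiv> 2 * N\<^sup>2 + 3"
  shows "\<exists>\<psi> :: nat \<Rightarrow> real \<Rightarrow> real. (\<forall>j<m. \<psi> j \<in> borel_measurable borel) \<and> (\<exists>B. \<forall>j<m. \<forall>t. \<bar>\<psi> j t\<bar> \<le> B) \<and> (\<forall>t. \<psi> 0 t = 1) \<and>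
    (\<forall>j<m. \<forall>l<m. (\<integral>t. \<psi> j t * \<psi> l t \<partial>std_normal_distribution) = (if j = l then 1 else 0)) \<and>
    (\<forall>s t. 0 \<le> (\<Sum>j<m. \<psi> j s * \<psi> j t)) \<and>
    (\<forall>s t. \<bar>s\<bar> < real N \<longrightarrow> (\<Sum>j<m. \<psi> j s * \<psi> j t) \<noteq> 0 \<longrightarrow> \<bar>s - t\<bar> \<le> 1 / real N)"
proof -
  interpret prob_space std_normal_distribution by (rule prob_space_normal_density) simp
  let ?g = "std_normal_distribution"
  define w where "w c = measure ?g {t. cell N t = c}" for c
  have lt: "cell N t < m" for t using cell_lt[of N t] by (simp add: m_def)
  have wp: "c < m \<Longrightarrow> 0 < w c" for c using cell_measure_pos[OF N] by (simp add: w_def m_def)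
  have "(\<Sum>c<m. w c) = measure ?g (\<Union>c<m. {t. cell N t = c})"
    unfolding w_def by (intro finite_measure_finite_Union[symmetric]) (auto simp: disjoint_family_on_def)
  also have "(\<Union>c<m. {t. cell N t = c}) = space ?g" using lt by auto
  finally have ws: "(\<Sum>c<m. w c) = 1" using prob_space by simp
  have m2: "2 \<le> m" by (simp add: m_def)
  obtain e where "\<forall>c<m. e 0 c = (1::real)"
    "\<forall>j<m. \<forall>l<m. (\<Sum>c<m. w c * (e j c * e l c)) = (if j = l then 1 else 0)"
    "\<forall>c<m. \<forall>c'<m. (\<Sum>j<m. e j c * e j c') = (if c = c' then 1 / w c else 0)"
    using weighted_basis[OF m2 wp ws] by blast
  then have e: "\<And>c. c < m \<Longrightarrow> e 0 c = 1"
    "\<And>j l. j < m \<Longrightarrow> l < m \<Longrightarrow> (\<Sum>c<m. w c * (e j c * e l c)) = (if j = l then 1 else 0)"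
    "\<And>c c'. c < m \<Longrightarrow> c' < m \<Longrightarrow> (\<Sum>j<m. e j c * e j c') = (if c = c' then 1 / w c else 0)"
    by blast+
  define \<psi> where "\<psi> j t = e j (cell N t)" for j t
  have [measurable]: "\<psi> j \<in> borel_measurable borel" for j
    unfolding \<psi>_def by (rule measurable_compose[OF measurable_cell]) simp
  have "\<bar>\<psi> j t\<bar> \<le> (\<Sum>j<m. \<Sum>c<m. \<bar>e j c\<bar>)" if "j < m" for j t
  proof -
    have "\<bar>\<psi> j t\<bar> \<le> (\<Sum>c<m. \<bar>e j c\<bar>)" unfolding \<psi>_def using lt by (intro member_le_sum) auto
    also have "\<dots> \<le> (\<Sum>j<m. \<Sum>c<m. \<bar>e j c\<bar>)"
      using that by (intro member_le_sum[of j "{..<m}" "\<lambda>j. \<Sum>c<m. \<bar>e j c\<bar>"]) (auto intro: sum_nonneg)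
    finally show ?thesis .
  qed
  moreover have "(\<integral>t. \<psi> j t * \<psi> l t \<partial>?g) = (if j = l then 1 else 0)" if "j < m" "l < m" for j l
  proof -
    have "(\<integral>t. \<psi> j t * \<psi> l t \<partial>?g) = (\<integral>t. (\<Sum>c<m. (e j c * e l c) * indicator {t. cell N t = c} t) \<partial>?g)"
    proof (intro Bochner_Integration.integral_cong refl)
      fix t
      have "(\<Sum>c<m. (e j c * e l c) * indicator {t. cell N t = c} t) = (\<Sum>c<m. if c = cell N t then e j c * e l c else 0)"
        by (intro sum.cong) (auto simp: indicator_def)
      then show "\<psi> j t * \<psi> l t = (\<Sum>c<m. (e j c * e l c) * indicator {t. cell N t = c} t)"
        using lt by (simp add: \<psi>_def sum.delta)
    qed
    also have "\<dots> = (\<Sum>c<m. (e j c * e l c) * w c)"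
      unfolding w_def by (subst Bochner_Integration.integral_sum) (auto simp: integrable_real_mult_indicator less_top[symmetric])
    also have "\<dots> = (if j = l then 1 else 0)" using e(2)[OF that] by (simp add: mult.commute)
    finally show ?thesis .
  qed
  moreover have "(\<Sum>j<m. \<psi> j s * \<psi> j t) = (if cell N s = cell N t then 1 / w (cell N s) else 0)" for s t
    unfolding \<psi>_def using e(3)[OF lt lt] .
  moreover have "0 \<le> (if cell N s = cell N t then 1 / w (cell N s) else 0)" for s t
    using wp[OF lt] by (simp add: less_imp_le)
  moreover have "\<psi> 0 t = 1" for t unfolding \<psi>_def using e(1)[OF lt] .
  ultimately show ?thesis
    using cell_close[OF N] \<open>\<And>j. \<psi> j \<in> borel_measurable borel\<close>
    by (intro exI[of _ \<psi>]) (auto split: if_splits)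
qed

section \<open>Product basis and averaging over cells\<close>

definition Psi :: "nat \<Rightarrow> (nat \<Rightarrow> real \<Rightarrow> real) \<Rightarrow> (nat \<Rightarrow> nat) \<Rightarrow> (nat \<Rightarrow> real) \<Rightarrow> real" where
  "Psi d \<psi> a x = (\<Prod>i<d. \<psi> (a i) (x i))"

definition fcoef :: "nat \<Rightarrow> (nat \<Rightarrow> real \<Rightarrow> real) \<Rightarrow> (nat \<Rightarrow> real) set \<Rightarrow> (nat \<Rightarrow> nat) \<Rightarrow> real" where
  "fcoef d \<psi> A a = (\<integral>x. indicator A x * Psi d \<psi> a x \<partial>Nd d)"

text \<open>The reproducing kernel of the span of the product basis; for the cell basis it is the
  density of a point resampled within the box of cells containing \<open>x\<close>.\<close>

definition kern :: "nat \<Rightarrow> nat \<Rightarrow> (nat \<Rightarrow> real \<Rightarrow> real) \<Rightarrow> (nat \<Rightarrow> real) \<Rightarrow> (nat \<Rightarrow> real) \<Rightarrow> real" where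
  "kern d m \<psi> x y = (\<Sum>a\<in>{..<d} \<rightarrow>\<^sub>E {..<m}. Psi d \<psi> a x * Psi d \<psi> a y)"

text \<open>The orthogonal projection of the indicator of \<open>A\<close>; for the cell basis it is
  the average of the indicator over the box of cells containing \<open>x\<close>.\<close>

definition fbar :: "nat \<Rightarrow> nat \<Rightarrow> (nat \<Rightarrow> real \<Rightarrow> real) \<Rightarrow> (nat \<Rightarrow> real) set \<Rightarrow> (nat \<Rightarrow> real) \<Rightarrow> real" where
  "fbar d m \<psi> A x = (\<Sum>a\<in>{..<d} \<rightarrow>\<^sub>E {..<m}. fcoef d \<psi> A a * Psi d \<psi> a x)"

definition fresh :: "nat \<Rightarrow> nat set \<Rightarrow> (nat \<Rightarrow> real) \<times> (nat \<Rightarrow> real) \<Rightarrow> (nat \<Rightarrow> real)" where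
  "fresh d J p = (\<lambda>i\<in>{..<d}. if i \<in> J then snd p i else fst p i)"

text \<open>The link between geometry and Fourier analysis: a bound on rotation noise at a quarter
  turn is a bound on resampling, of which the product basis functions are eigenfunctions.\<close>

lemma fresh_eq_rot: "fst (rot d (ang J (pi / 2)) p) = fresh d J p"
  unfolding rot_def ang_def fresh_def by (auto simp: fun_eq_iff restrict_def)

lemma measurable_fresh [measurable]: "fresh d J \<in> Rd d \<Otimes>\<^sub>M Rd d \<rightarrow>\<^sub>M Rd d"
  unfolding fresh_eq_rot[symmetric] by measurable

text \<open>What the sequel uses of the cells: a bounded orthonormal system that starts with 1 and
  has a nonnegative kernel living near the diagonal.\<close>

locale cell_system =
  fixes d m N :: nat and \<psi> :: "nat \<Rightarrow> real \<Rightarrow> real"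
  assumes m: "0 < m" and N: "1 \<le> N"
    and meas [measurable]: "\<And>j. j < m \<Longrightarrow> \<psi> j \<in> borel_measurable borel"
    and bounded: "\<exists>B. \<forall>j<m. \<forall>t. \<bar>\<psi> j t\<bar> \<le> B"
    and one: "\<And>t. \<psi> 0 t = 1"
    and orth: "\<And>j l. j < m \<Longrightarrow> l < m \<Longrightarrow> (\<integral>t. \<psi> j t * \<psi> l t \<partial>std_normal_distribution) = (if j = l then 1 else 0)"
    and nonneg: "\<And>s t. 0 \<le> (\<Sum>j<m. \<psi> j s * \<psi> j t)"
    and close: "\<And>s t. \<bar>s\<bar> < real N \<Longrightarrow> (\<Sum>j<m. \<psi> j s * \<psi> j t) \<noteq> 0 \<Longrightarrow> \<bar>s - t\<bar> \<le> 1 / real N"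
begin

abbreviation "Idx \<equiv> {..<d} \<rightarrow>\<^sub>E {..<m}"

lemma finite_Idx: "finite Idx" by (intro finite_PiE) auto

lemma Idx_lt: "a \<in> Idx \<Longrightarrow> i < d \<Longrightarrow> a i < m" by (auto simp: PiE_iff)

lemma psi_integrable:
  assumes "j < m" "l < m"
  shows "integrable std_normal_distribution (\<psi> j)" "integrable std_normal_distribution (\<lambda>t. \<psi> j t * \<psi> l t)"
proof -
  interpret prob_space std_normal_distribution by (rule prob_space_normal_density) simp
  obtain B where B: "\<And>j t. j < m \<Longrightarrow> \<bar>\<psi> j t\<bar> \<le> B" using bounded by blast
  have B0: "0 \<le> B" using B[OF m, of 0] by simp
  show "integrable std_normal_distribution (\<psi> j)"
    using B assms by (intro integrable_const_bound[of _ B]) auto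
  have "\<bar>\<psi> j t * \<psi> l t\<bar> \<le> B * B" for t
    unfolding abs_mult using B assms B0 by (intro mult_mono) auto
  then show "integrable std_normal_distribution (\<lambda>t. \<psi> j t * \<psi> l t)"
    using assms by (intro integrable_const_bound[of _ "B * B"]) auto
qed

lemma Psi_measurable [measurable]:
  assumes "a \<in> Idx" shows "Psi d \<psi> a \<in> borel_measurable (Rd d)"
  unfolding Psi_def using Idx_lt[OF assms]
  by (intro borel_measurable_prod) (auto intro!: measurable_compose[OF measurable_Rd_component meas])

lemma Psi_bounded: "\<exists>C\<ge>0. \<forall>a\<in>Idx. \<forall>x. \<bar>Psi d \<psi> a x\<bar> \<le> C"
proof -
  obtain B where B: "\<And>j t. j < m \<Longrightarrow> \<bar>\<psi> j t\<bar> \<le> B" using bounded by blast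
  have B0: "0 \<le> B" using B[OF m, of 0] by simp
  have "\<bar>Psi d \<psi> a x\<bar> \<le> B ^ d" if "a \<in> Idx" for a x
  proof -
    have "\<bar>Psi d \<psi> a x\<bar> \<le> (\<Prod>i<d. B)"
      unfolding Psi_def abs_prod using B Idx_lt[OF that] by (intro prod_mono) auto
    then show ?thesis by simp
  qed
  then show ?thesis using B0 by (intro exI[of _ "B ^ d"]) auto
qed

lemma bounded_mult_integrable:
  assumes [measurable]: "f \<in> borel_measurable (Rd d)" and f: "\<And>x. \<bar>f x\<bar> \<le> (1::real)" and a: "a \<in> Idx"
  shows "integrable (Nd d) (\<lambda>x. f x * Psi d \<psi> a x)"
proof -
  obtain C where C: "0 \<le> C" "\<And>x. \<bar>Psi d \<psi> a x\<bar> \<le> C" using Psi_bounded a by blast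
  have [measurable]: "Psi d \<psi> a \<in> borel_measurable (Rd d)" using a by measurable
  have "\<bar>f x * Psi d \<psi> a x\<bar> \<le> 1 * C" for x unfolding abs_mult using f C by (intro mult_mono) auto
  then show ?thesis by (intro Nd.integrable_const_bound[of _ C]) auto
qed

lemma Psi_orth:
  assumes "a \<in> Idx" "b \<in> Idx"
  shows "integrable (Nd d) (\<lambda>x. Psi d \<psi> a x * Psi d \<psi> b x)"
    "(\<integral>x. Psi d \<psi> a x * Psi d \<psi> b x \<partial>Nd d) = (if a = b then 1 else 0)"
proof -
  have e: "Psi d \<psi> a x * Psi d \<psi> b x = (\<Prod>i<d. \<psi> (a i) (x i) * \<psi> (b i) (x i))" for x
    unfolding Psi_def by (simp add: prod.distrib)
  have i: "i \<in> {..<d} \<Longrightarrow> integrable std_normal_distribution (\<lambda>t. \<psi> (a i) t * \<psi> (b i) t)" for i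
    using Idx_lt assms by (intro psi_integrable) auto
  show "integrable (Nd d) (\<lambda>x. Psi d \<psi> a x * Psi d \<psi> b x)"
    unfolding e Nd_def using i by (intro std_normal_prod.product_integrable_prod) auto
  have "(\<integral>x. Psi d \<psi> a x * Psi d \<psi> b x \<partial>Nd d) = (\<Prod>i<d. \<integral>t. \<psi> (a i) t * \<psi> (b i) t \<partial>std_normal_distribution)"
    unfolding e Nd_def using i by (intro std_normal_prod.product_integral_prod) auto
  also have "\<dots> = (\<Prod>i<d. if a i = b i then 1 else 0)"
    using Idx_lt assms by (intro prod.cong refl orth) auto
  also have "\<dots> = (if a = b then 1 else 0)"
  proof (cases "a = b")
    case False
    then obtain i where "i < d" "a i \<noteq> b i" using assms by (metis PiE_ext lessThan_iff)
    then show ?thesis using False by (auto intro!: prod_zero)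
  qed simp
  finally show "(\<integral>x. Psi d \<psi> a x * Psi d \<psi> b x \<partial>Nd d) = (if a = b then 1 else 0)" .
qed

abbreviation "a0 \<equiv> (\<lambda>i\<in>{..<d}. 0 :: nat)"

lemma a0: "a0 \<in> Idx" "Psi d \<psi> a0 x = 1"
  using m one by (auto simp: Psi_def)

lemma Psi_integral:
  assumes "a \<in> Idx" shows "integrable (Nd d) (Psi d \<psi> a)" "(\<integral>x. Psi d \<psi> a x \<partial>Nd d) = (if a = a0 then 1 else 0)"
  using Psi_orth[OF assms a0(1)] a0(2) by auto

text \<open>The sum over multi-indices factorises, so sign and support of the kernel reduce to one
  coordinate.\<close>

lemma kern_prod: "kern d m \<psi> x y = (\<Prod>i<d. \<Sum>j<m. \<psi> j (x i) * \<psi> j (y i))"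
  unfolding kern_def Psi_def by (subst prod_sum_PiE) (auto simp: prod.distrib)

lemma kern_nonneg: "0 \<le> kern d m \<psi> x y"
  unfolding kern_prod using nonneg by (intro prod_nonneg) auto

lemma kern_commute: "kern d m \<psi> x y = kern d m \<psi> y x"
  unfolding kern_def by (simp add: mult.commute)

lemma kern_measurable [measurable]: "(\<lambda>p. kern d m \<psi> (fst p) (snd p)) \<in> borel_measurable (Rd d \<Otimes>\<^sub>M Rd d)"
  unfolding kern_def
  by (intro borel_measurable_sum borel_measurable_times)
    (auto intro: measurable_compose[OF measurable_fst Psi_measurable] measurable_compose[OF measurable_snd Psi_measurable])

lemma kern_section_measurable [measurable]: "kern d m \<psi> x \<in> borel_measurable (Rd d)"
  unfolding kern_def by measurable

text \<open>Every basis function except the constant one integrates to 0, so the kernel is a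
  probability density in \<open>y\<close>.\<close>

lemma kern_integral:
  "integrable (Nd d) (kern d m \<psi> x)" "(\<integral>y. kern d m \<psi> x y \<partial>Nd d) = 1" "(\<integral>\<^sup>+y. ennreal (kern d m \<psi> x y) \<partial>Nd d) = 1"
proof -
  show i: "integrable (Nd d) (kern d m \<psi> x)"
    unfolding kern_def by (intro Bochner_Integration.integrable_sum integrable_mult_right Psi_integral)
  have "(\<integral>y. kern d m \<psi> x y \<partial>Nd d) = (\<Sum>a\<in>Idx. Psi d \<psi> a x * (if a = a0 then 1 else 0))"
    unfolding kern_def
    by (subst Bochner_Integration.integral_sum)
      (auto intro!: sum.cong integrable_mult_right Psi_integral simp: Psi_integral)
  also have "\<dots> = (\<Sum>a\<in>Idx. if a = a0 then 1 else 0)" by (intro sum.cong) (auto simp: a0(2))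
  also have "\<dots> = 1" using a0(1) finite_Idx by (subst sum.delta) auto
  finally show e: "(\<integral>y. kern d m \<psi> x y \<partial>Nd d) = 1" .
  show "(\<integral>\<^sup>+y. ennreal (kern d m \<psi> x y) \<partial>Nd d) = 1"
    using i e kern_nonneg by (subst nn_integral_eq_integral) auto
qed

lemma bounded_kern_integrable:
  assumes [measurable]: "f \<in> borel_measurable (Rd d)" and f: "\<And>x. \<bar>f x\<bar> \<le> (1::real)"
  shows "integrable (Nd d) (\<lambda>y. f y * kern d m \<psi> x y)"
proof (rule Bochner_Integration.integrable_bound[OF kern_integral(1)[of x]])
  show "AE y in Nd d. norm (f y * kern d m \<psi> x y) \<le> norm (kern d m \<psi> x y)"
    using f by (auto simp: abs_mult intro!: mult_left_le_one_le)
qed measurable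

context
  fixes A assumes A [measurable]: "A \<in> sets (Rd d)"
begin

lemma fbar_measurable [measurable]: "fbar d m \<psi> A \<in> borel_measurable (Rd d)"
  unfolding fbar_def by measurable

lemma fbar_eq: "fbar d m \<psi> A x = (\<integral>y. indicator A y * kern d m \<psi> x y \<partial>Nd d)"
proof -
  have "(\<integral>y. indicator A y * kern d m \<psi> x y \<partial>Nd d) = (\<integral>y. (\<Sum>a\<in>Idx. Psi d \<psi> a x * (indicator A y * Psi d \<psi> a y)) \<partial>Nd d)"
    unfolding kern_def by (simp add: sum_distrib_left mult_ac)
  also have "\<dots> = (\<Sum>a\<in>Idx. \<integral>y. Psi d \<psi> a x * (indicator A y * Psi d \<psi> a y) \<partial>Nd d)"
    by (intro Bochner_Integration.integral_sum integrable_mult_right bounded_mult_integrable) (auto simp: indicator_def)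
  also have "\<dots> = fbar d m \<psi> A x" unfolding fbar_def fcoef_def by (simp add: mult.commute)
  finally show ?thesis ..
qed

text \<open>The projection is an average of an indicator against a probability density. These bounds
  let products of \<open>fbar\<close> be compared with products of indicators in
  \<open>fresh_lower\<close>.\<close>

lemma fbar_bounds: "0 \<le> fbar d m \<psi> A x" "fbar d m \<psi> A x \<le> 1"
proof -
  show "0 \<le> fbar d m \<psi> A x" unfolding fbar_eq by (intro Bochner_Integration.integral_nonneg mult_nonneg_nonneg kern_nonneg) auto
  have "fbar d m \<psi> A x \<le> (\<integral>y. kern d m \<psi> x y \<partial>Nd d)"
    unfolding fbar_eq using kern_nonneg
    by (intro integral_mono bounded_kern_integrable kern_integral) (auto simp: indicator_def)
  then show "fbar d m \<psi> A x \<le> 1" by (simp add: kern_integral)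
qed

lemma fbar_pointwise:
  assumes x: "x \<in> space (Rd d)"
  shows "ennreal \<bar>indicator A x - fbar d m \<psi> A x\<bar>
    \<le> (\<integral>\<^sup>+y. ennreal \<bar>indicator A x - indicator A y\<bar> * ennreal (kern d m \<psi> x y) \<partial>Nd d)"
proof -
  let ?k = "kern d m \<psi> x"
  have i: "integrable (Nd d) (\<lambda>y. (indicator A x - indicator A y) * ?k y)"
    by (intro bounded_kern_integrable) (auto simp: indicator_def)
  have "indicator A x - fbar d m \<psi> A x = (\<integral>y. indicator A x * ?k y \<partial>Nd d) - (\<integral>y. indicator A y * ?k y \<partial>Nd d)"
    unfolding fbar_eq by (simp add: kern_integral)
  also have "\<dots> = (\<integral>y. (indicator A x - indicator A y) * ?k y \<partial>Nd d)"
    by (subst Bochner_Integration.integral_diff[symmetric])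
      (auto intro!: bounded_kern_integrable integrable_mult_right kern_integral simp: indicator_def left_diff_distrib)
  also have "\<bar>\<dots>\<bar> \<le> (\<integral>y. \<bar>(indicator A x - indicator A y) * ?k y\<bar> \<partial>Nd d)" by (rule integral_abs_bound)
  finally have "ennreal \<bar>indicator A x - fbar d m \<psi> A x\<bar> \<le> ennreal (\<integral>y. \<bar>(indicator A x - indicator A y) * ?k y\<bar> \<partial>Nd d)"
    by (rule ennreal_leI)
  also have "\<dots> = (\<integral>\<^sup>+y. ennreal \<bar>(indicator A x - indicator A y) * ?k y\<bar> \<partial>Nd d)"
    using integrable_abs[OF i] by (intro nn_integral_eq_integral[symmetric]) auto
  also have "\<dots> = (\<integral>\<^sup>+y. ennreal \<bar>indicator A x - indicator A y\<bar> * ennreal (?k y) \<partial>Nd d)"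
    using kern_nonneg by (intro nn_integral_cong) (simp add: abs_mult ennreal_mult')
  finally show ?thesis .
qed

text \<open>Inside the box \<open>|x i| < N\<close> a nonzero kernel keeps \<open>x\<close> and
  \<open>y\<close> within \<open>1 / N\<close> in every coordinate. Outside it
  \<open>|x|^2 / N^2\<close> is at least 1, which covers the oscillation of \<open>g\<close>; this
  quadratic term is convenient because its mean is \<open>d / N^2\<close>.\<close>

lemma kern_close:
  assumes k: "kern d m \<psi> x y \<noteq> 0"
    and g: "\<bar>g x - g y\<bar> \<le> L * nrm d (\<lambda>i. x i - y i)" "\<bar>g x - g y\<bar> \<le> (1::real)" "0 \<le> L"
  shows "\<bar>g x - g y\<bar> \<le> L * real d / real N + dotp d x x / (real N)\<^sup>2"
proof (cases "\<forall>i<d. \<bar>x i\<bar> < real N")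
  case True
  have "\<bar>x i - y i\<bar> \<le> 1 / real N" if "i < d" for i
    using k that True unfolding kern_prod by (intro close) auto
  then have "(\<Sum>i<d. \<bar>x i - y i\<bar>) \<le> (\<Sum>i<d. 1 / real N)" by (intro sum_mono) auto
  then have "nrm d (\<lambda>i. x i - y i) \<le> real d / real N"
    using L2_set_le_sum_abs[of "\<lambda>i. x i - y i" "{..<d}"] by (simp add: nrm_eq_L2_set)
  then have "L * nrm d (\<lambda>i. x i - y i) \<le> L * (real d / real N)" using g(3) by (intro mult_left_mono) auto
  moreover have "0 \<le> dotp d x x / (real N)\<^sup>2" by (simp add: dotp_nonneg)
  ultimately show ?thesis using g(1) by simp
next
  case False
  then obtain i where i: "i < d" "real N \<le> \<bar>x i\<bar>" by (auto simp: not_less)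
  have "(real N)\<^sup>2 \<le> \<bar>x i\<bar>\<^sup>2" using i by (intro power_mono) auto
  also have "\<dots> = x i * x i" by (simp add: power2_eq_square)
  also have "\<dots> \<le> dotp d x x" unfolding dotp_def using i by (intro member_le_sum) auto
  finally have "1 \<le> dotp d x x / (real N)\<^sup>2" using N by simp
  moreover have "0 \<le> L * real d / real N" using g(3) by simp
  ultimately show ?thesis using g(2) by linarith
qed

text \<open>An indicator is not Lipschitz, so it is exchanged for a Lipschitz \<open>g\<close> at
  both \<open>x\<close> and \<open>y\<close>. The kernel is symmetric and stochastic, hence the
  error at \<open>y\<close> integrates to the same as the error at \<open>x\<close>, which explains
  the factor 2.\<close>

lemma fbar_close:
  fixes g :: "(nat \<Rightarrow> real) \<Rightarrow> real"
  assumes [measurable]: "g \<in> borel_measurable (Rd d)" and L: "0 \<le> L"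
    and g: "\<And>x y. x \<in> space (Rd d) \<Longrightarrow> y \<in> space (Rd d) \<Longrightarrow> \<bar>g x - g y\<bar> \<le> L * nrm d (\<lambda>i. x i - y i)"
      "\<And>x y. x \<in> space (Rd d) \<Longrightarrow> y \<in> space (Rd d) \<Longrightarrow> \<bar>g x - g y\<bar> \<le> 1"
  shows "(\<integral>\<^sup>+x. ennreal \<bar>indicator A x - fbar d m \<psi> A x\<bar> \<partial>Nd d)
    \<le> 2 * (\<integral>\<^sup>+x. ennreal \<bar>indicator A x - g x\<bar> \<partial>Nd d) + ennreal (L * real d / real N + real d / (real N)\<^sup>2)"
proof -
  let ?k = "\<lambda>x y. ennreal (kern d m \<psi> x y)"
  let ?u = "\<lambda>x. ennreal \<bar>indicator A x - g x\<bar>"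
  let ?w = "\<lambda>x. ennreal (L * real d / real N + dotp d x x / (real N)\<^sup>2)"
  have sp: "space (Nd d) = space (Rd d)" by (simp add: space_Nd space_Rd)
  have "(\<integral>\<^sup>+x. ennreal \<bar>indicator A x - fbar d m \<psi> A x\<bar> \<partial>Nd d) \<le>
     (\<integral>\<^sup>+x. (\<integral>\<^sup>+y. (?u x * ?k x y + ?w x * ?k x y) + ?u y * ?k x y \<partial>Nd d) \<partial>Nd d)"
  proof (intro nn_integral_mono order_trans[OF fbar_pointwise], simp add: sp)
    fix x y assume xy: "x \<in> space (Nd d)" "y \<in> space (Nd d)"
    show "ennreal \<bar>indicator A x - indicator A y\<bar> * ?k x y \<le> (?u x * ?k x y + ?w x * ?k x y) + ?u y * ?k x y"
    proof (cases "kern d m \<psi> x y = 0")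
      case False
      have "\<bar>g x - g y\<bar> \<le> L * real d / real N + dotp d x x / (real N)\<^sup>2"
        using xy by (intro kern_close[OF False _ _ L] g) (auto simp: sp)
      then have "\<bar>indicator A x - indicator A y\<bar> \<le> \<bar>indicator A x - g x\<bar> + (L * real d / real N + dotp d x x / (real N)\<^sup>2) + \<bar>indicator A y - g y\<bar>"
        by linarith
      then have "ennreal \<bar>indicator A x - indicator A y\<bar> \<le> ?u x + ?w x + ?u y"
        using L dotp_nonneg[of d x]
        by (subst ennreal_plus[symmetric], simp, simp, subst ennreal_plus[symmetric]) (auto intro!: ennreal_leI simp del: ennreal_plus)
      then have "ennreal \<bar>indicator A x - indicator A y\<bar> * ?k x y \<le> (?u x + ?w x + ?u y) * ?k x y"
        by (intro mult_right_mono) auto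
      then show ?thesis by (simp add: distrib_right)
    qed simp
  qed
  also have "\<dots> = (\<integral>\<^sup>+x. (?u x + ?w x) + (\<integral>\<^sup>+y. ?u y * ?k x y \<partial>Nd d) \<partial>Nd d)"
    by (intro nn_integral_cong) (simp add: nn_integral_add nn_integral_cmult kern_integral)
  also have "\<dots> = ((\<integral>\<^sup>+x. ?u x \<partial>Nd d) + (\<integral>\<^sup>+x. ?w x \<partial>Nd d)) + (\<integral>\<^sup>+x. \<integral>\<^sup>+y. ?u y * ?k x y \<partial>Nd d \<partial>Nd d)"
    by (subst nn_integral_add, measurable, subst nn_integral_add, measurable)
  also have "(\<integral>\<^sup>+x. \<integral>\<^sup>+y. ?u y * ?k x y \<partial>Nd d \<partial>Nd d) = (\<integral>\<^sup>+y. \<integral>\<^sup>+x. ?u y * ?k x y \<partial>Nd d \<partial>Nd d)"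
    by (rule Nd2.Fubini'[symmetric]) measurable
  also have "\<dots> = (\<integral>\<^sup>+y. ?u y \<partial>Nd d)"
  proof (rule nn_integral_cong)
    fix y
    have [measurable]: "(\<lambda>x. kern d m \<psi> x y) \<in> borel_measurable (Rd d)" by (subst kern_commute) measurable
    have "(\<integral>\<^sup>+x. ?u y * ?k x y \<partial>Nd d) = ?u y * (\<integral>\<^sup>+x. ?k y x \<partial>Nd d)"
      by (subst nn_integral_cmult) (auto simp: kern_commute[of y])
    then show "(\<integral>\<^sup>+x. ?u y * ?k x y \<partial>Nd d) = ?u y" by (simp add: kern_integral)
  qed
  also have "(\<integral>\<^sup>+x. ?w x \<partial>Nd d) = ennreal (L * real d / real N + real d / (real N)\<^sup>2)"
  proof -
    have "integrable (Nd d) (\<lambda>x. L * real d / real N + dotp d x x / (real N)\<^sup>2)"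
      by (intro Bochner_Integration.integrable_add integrable_divide Nd_dotp_self) auto
    then show ?thesis using L Nd_dotp_self[of d] dotp_nonneg
      by (subst nn_integral_eq_integral) (auto simp: Nd.prob_space)
  qed
  finally show ?thesis by (simp add: mult_2 ac_simps)
qed

end

end

section \<open>Random resampling and low-degree Fourier weight\<close>

lemma integral_fst_snd:
  fixes F :: "_ \<Rightarrow> real"
  assumes [measurable]: "F \<in> borel_measurable (Rd d)" and i: "integrable (Nd d) F"
    and \<theta>: "\<And>i. \<bar>\<theta> i\<bar> < pi"
  shows "integrable (Nd d \<Otimes>\<^sub>M Nd d) (\<lambda>p. F (fst (rot d \<theta> p)))"
    "(\<integral>p. F (fst (rot d \<theta> p)) \<partial>(Nd d \<Otimes>\<^sub>M Nd d)) = (\<integral>x. F x \<partial>Nd d)"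
    "integrable (Nd d \<Otimes>\<^sub>M Nd d) (\<lambda>p. F (fst p))"
    "(\<integral>p. F (fst p) \<partial>(Nd d \<Otimes>\<^sub>M Nd d)) = (\<integral>x. F x \<partial>Nd d)"
proof -
  have d: "distr (Nd d \<Otimes>\<^sub>M Nd d) (Nd d) fst = Nd d"
    by (rule Nd.distr_pair_fst)
  have *: "F \<in> borel_measurable (Nd d)" by measurable
  show f: "integrable (Nd d \<Otimes>\<^sub>M Nd d) (\<lambda>p. F (fst p))"
    using i integrable_distr_eq[of fst "Nd d \<Otimes>\<^sub>M Nd d" "Nd d" F] * unfolding d by simp
  show fe: "(\<integral>p. F (fst p) \<partial>(Nd d \<Otimes>\<^sub>M Nd d)) = (\<integral>x. F x \<partial>Nd d)"
    using integral_distr[of fst "Nd d \<Otimes>\<^sub>M Nd d" "Nd d" F] * unfolding d by simp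
  have r: "rot d \<theta> \<in> Nd d \<Otimes>\<^sub>M Nd d \<rightarrow>\<^sub>M Rd d \<Otimes>\<^sub>M Rd d" by measurable
  have m: "(\<lambda>p. F (fst p)) \<in> borel_measurable (Rd d \<Otimes>\<^sub>M Rd d)" by measurable
  show "integrable (Nd d \<Otimes>\<^sub>M Nd d) (\<lambda>p. F (fst (rot d \<theta> p)))"
    using integrable_distr_eq[OF r, of "\<lambda>p. F (fst p)"] f m unfolding distr_rot[OF \<theta>] by simp
  show "(\<integral>p. F (fst (rot d \<theta> p)) \<partial>(Nd d \<Otimes>\<^sub>M Nd d)) = (\<integral>x. F x \<partial>Nd d)"
    using integral_distr[OF r m] fe unfolding distr_rot[OF \<theta>] by simp
qed

text \<open>The law of the random set \<open>J\<close> of resampled coordinates.\<close>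

definition subset_weight :: "nat \<Rightarrow> real \<Rightarrow> nat set \<Rightarrow> real" where
  "subset_weight d \<rho> J = (1 - \<rho>) ^ card J * \<rho> ^ card ({..<d} - J)"

lemma subset_weight_nonneg: "0 \<le> \<rho> \<Longrightarrow> \<rho> \<le> 1 \<Longrightarrow> 0 \<le> subset_weight d \<rho> J"
  unfolding subset_weight_def by simp

text \<open>The probability that no coordinate of \<open>T\<close> is resampled, each being kept
  with probability \<open>\<rho>\<close>. It comes from expanding a product over coordinates, with
  the resampling term deleted on \<open>T\<close>, into a sum over subsets.\<close>

lemma subset_weight_disjoint:
  assumes T: "T \<subseteq> {..<d}"
  shows "(\<Sum>J\<in>Pow {..<d}. if J \<inter> T = {} then subset_weight d \<rho> J else 0) = \<rho> ^ card T"
proof -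
  have "\<rho> ^ card T = (\<Prod>i\<in>T. \<rho>) * (\<Prod>i\<in>{..<d} - T. 1)" by simp
  also have "\<dots> = (\<Prod>i<d. (if i \<in> T then 0 else 1 - \<rho>) + \<rho>)"
  proof -
    let ?F = "\<lambda>i. (if i \<in> T then 0 else 1 - \<rho>) + \<rho>"
    have "prod ?F {..<d} = prod ?F ({..<d} - T) * prod ?F T"
      using T by (intro prod.subset_diff) auto
    also have "prod ?F ({..<d} - T) = (\<Prod>i\<in>{..<d} - T. 1)" by (intro prod.cong) auto
    also have "prod ?F T = (\<Prod>i\<in>T. \<rho>)" by (intro prod.cong) auto
    finally show ?thesis by simp
  qed
  also have "\<dots> = (\<Sum>J\<in>Pow {..<d}. (\<Prod>i\<in>J. if i \<in> T then 0 else 1 - \<rho>) * (\<Prod>i\<in>{..<d} - J. \<rho>))"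
    by (rule prod_add) simp
  also have "\<dots> = (\<Sum>J\<in>Pow {..<d}. if J \<inter> T = {} then subset_weight d \<rho> J else 0)"
  proof (intro sum.cong refl)
    fix J assume "J \<in> Pow {..<d}"
    then have fJ: "finite J" by (auto intro: finite_subset)
    show "(\<Prod>i\<in>J. if i \<in> T then 0 else 1 - \<rho>) * (\<Prod>i\<in>{..<d} - J. \<rho>) = (if J \<inter> T = {} then subset_weight d \<rho> J else 0)"
    proof (cases "J \<inter> T = {}")
      case True
      then have "(\<Prod>i\<in>J. if i \<in> T then 0 else 1 - \<rho>) = (\<Prod>i\<in>J. 1 - \<rho>)" by (intro prod.cong) auto
      then show ?thesis using True by (simp add: subset_weight_def)
    next
      case False
      then have "(\<Prod>i\<in>J. if i \<in> T then 0 else 1 - \<rho>) = 0" using fJ by (intro prod_zero) auto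
      then show ?thesis using False by simp
    qed
  qed
  finally show ?thesis ..
qed

lemma subset_weight_sum: "(\<Sum>J\<in>Pow {..<d}. subset_weight d \<rho> J) = 1"
  using subset_weight_disjoint[of "{}" d \<rho>] by simp

lemma subset_weight_marginal:
  assumes "i < d"
  shows "(\<Sum>J\<in>Pow {..<d}. if i \<in> J then subset_weight d \<rho> J else 0) = 1 - \<rho>"
proof -
  have "(\<Sum>J\<in>Pow {..<d}. if i \<in> J then subset_weight d \<rho> J else 0) + (\<Sum>J\<in>Pow {..<d}. if J \<inter> {i} = {} then subset_weight d \<rho> J else 0)
    = (\<Sum>J\<in>Pow {..<d}. subset_weight d \<rho> J)"
    unfolding sum.distrib[symmetric] by (intro sum.cong) auto
  then show ?thesis using subset_weight_disjoint[of "{i}" d \<rho>] assms by (simp add: subset_weight_sum)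
qed

text \<open>This plays the role of the degree of \<open>Psi d \<psi> a\<close>.\<close>

definition supp_size :: "nat \<Rightarrow> (nat \<Rightarrow> nat) \<Rightarrow> nat" where
  "supp_size d a = card {i. i < d \<and> a i \<noteq> 0}"

text \<open>\<open>cot \<phi>\<close> is at most \<open>2 / \<phi>\<close> in this range. When
  \<open>cot \<phi> |u|\<close> exceeds 1 the local estimate \<open>smooth_diff\<close> is out of
  reach, but then the claimed bound exceeds the whole range of \<open>smooth\<close>.\<close>

lemma smooth_lipschitz:
  assumes f [measurable]: "f \<in> borel_measurable (Rd d)" "\<And>z. 0 \<le> f z" "\<And>z. f z \<le> (1::real)"
    and \<phi>: "0 < \<phi>" "\<phi> \<le> 1" and x: "x \<in> space (Rd d)" and y: "y \<in> space (Rd d)"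
  shows "\<bar>smooth d \<phi> f x - smooth d \<phi> f y\<bar> \<le> 4 / \<phi> * nrm d (\<lambda>i. x i - y i)"
proof -
  have "\<bar>sin \<phi> - \<phi>\<bar> \<le> inverse (fact 3) * \<bar>\<phi>\<bar> ^ 3"
    using Maclaurin_sin_bound[of \<phi> 3] by (simp add: sin_coeff_def numeral_3_eq_3 lessThan_Suc)
  also have "\<dots> \<le> 1 / 6 * \<phi>"
    using \<phi> power_decreasing[of 1 3 \<phi>] by (simp add: fact_numeral)
  finally have s2: "\<phi> / 2 \<le> sin \<phi>" using \<phi> by linarith
  then have s: "0 < sin \<phi>" using \<phi> by linarith
  have c: "0 \<le> cos \<phi>" using \<phi> pi_gt3 by (intro cos_ge_zero) auto
  define \<kappa> where "\<kappa> = cos \<phi> / sin \<phi>"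
  have \<kappa>: "0 \<le> \<kappa>" "\<kappa> \<le> 2 / \<phi>"
  proof -
    show "0 \<le> \<kappa>" using s c by (simp add: \<kappa>_def)
    have "cos \<phi> / sin \<phi> \<le> 1 / (\<phi> / 2)" using s2 \<phi> c by (intro frac_le) auto
    then show "\<kappa> \<le> 2 / \<phi>" by (simp add: \<kappa>_def)
  qed
  define u where "u i = x i - y i" for i
  have xe: "x = (\<lambda>i\<in>{..<d}. y i + u i)" using x by (auto simp: u_def space_Rd PiE_iff extensional_def fun_eq_iff)
  note b = smooth_bounds[OF f x, of \<phi>] smooth_bounds[OF f y, of \<phi>]
  have "\<bar>smooth d \<phi> f x - smooth d \<phi> f y\<bar> \<le> 2 * \<kappa> * nrm d u"
  proof (cases "\<kappa> * nrm d u \<le> 1")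
    case True
    then have "(\<kappa> * nrm d u)\<^sup>2 \<le> 1" using \<kappa> by (simp add: power_le_one)
    then have "\<kappa>\<^sup>2 * dotp d u u \<le> 1" by (simp add: power_mult_distrib nrm_sq)
    then have "\<bar>smooth d \<phi> f x - smooth d \<phi> f y\<bar> \<le> 2 * \<kappa> * sqrt (smooth d \<phi> f y) * nrm d u"
      unfolding xe nrm_def \<kappa>_def using y s \<kappa> f by (intro smooth_diff) (auto simp: \<kappa>_def)
    also have "\<dots> \<le> 2 * \<kappa> * 1 * nrm d u" using b \<kappa> by (intro mult_right_mono mult_left_mono) auto
    finally show ?thesis by simp
  next
    case False
    then show ?thesis using b by (simp add: abs_le_iff)
  qed
  also have "\<dots> \<le> 2 * (2 / \<phi>) * nrm d u" using \<kappa> by (intro mult_right_mono mult_left_mono) auto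
  also have "u = (\<lambda>i. x i - y i)" by (rule ext) (simp add: u_def)
  finally show ?thesis by simp
qed

lemma rvar_UNIV: "rvar d f UNIV \<theta> = rvar d f {..<d} \<theta>"
proof -
  have "rot d (ang UNIV \<theta>) p = rot d (ang {..<d} \<theta>) p" for p
    unfolding rot_def ang_def by (auto simp: fun_eq_iff restrict_def)
  then show ?thesis unfolding rvar_def by simp
qed

context cell_system
begin

text \<open>\<open>fbar_close\<close> with \<open>g\<close> the smoothing of the indicator:
  \<open>noise_all\<close> bounds the smoothing error by \<open>2 \<phi> G\<close>, and the
  Lipschitz constant is \<open>4 / \<phi>\<close>. A small \<open>\<phi>\<close> is paid for by a
  large \<open>N\<close>.\<close>

lemma fbar_close_surface:
  assumes A [measurable]: "A \<in> sets (Rd d)" and G: "gauss_surface_area d A \<le> ennreal G" "0 \<le> G"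
    and \<phi>: "0 < \<phi>" "\<phi> \<le> 1"
  shows "(\<integral>x. \<bar>indicator A x - fbar d m \<psi> A x\<bar> \<partial>Nd d) \<le> 4 * \<phi> * G + 4 * real d / (\<phi> * real N) + real d / (real N)\<^sup>2"
proof -
  let ?g = "smooth d \<phi> (indicator A)"
  let ?e = "4 / \<phi> * real d / real N + real d / (real N)\<^sup>2"
  have \<phi>pi: "\<phi> \<le> pi / 2" using \<phi> pi_gt3 by simp
  have b: "0 \<le> fbar d m \<psi> A x" "fbar d m \<psi> A x \<le> 1" for x using fbar_bounds[OF A] by auto
  have [measurable]: "fbar d m \<psi> A \<in> borel_measurable (Rd d)" by (rule fbar_measurable[OF A])
  have b1: "\<bar>indicator A x - fbar d m \<psi> A x\<bar> \<le> 1" for x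
    using b[of x] by (cases "x \<in> A") auto
  have "ennreal (\<integral>x. \<bar>indicator A x - fbar d m \<psi> A x\<bar> \<partial>Nd d) = (\<integral>\<^sup>+x. ennreal \<bar>indicator A x - fbar d m \<psi> A x\<bar> \<partial>Nd d)"
    using b1 by (intro nn_integral_eq_integral[symmetric] Nd.integrable_const_bound[of _ 1]) auto
  also have "\<dots> \<le> 2 * (\<integral>\<^sup>+x. ennreal \<bar>indicator A x - ?g x\<bar> \<partial>Nd d) + ennreal ?e"
  proof (rule fbar_close[OF A])
    show "\<bar>?g x - ?g y\<bar> \<le> 1" if "x \<in> space (Rd d)" "y \<in> space (Rd d)" for x y
      using smooth_bounds[of "indicator A" d x \<phi>] smooth_bounds[of "indicator A" d y \<phi>] that by auto
    show "\<bar>?g x - ?g y\<bar> \<le> 4 / \<phi> * nrm d (\<lambda>i. x i - y i)" if "x \<in> space (Rd d)" "y \<in> space (Rd d)" for x y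
      by (rule smooth_lipschitz[OF _ _ _ \<phi> that]) simp_all
  qed (use \<phi> in auto)
  also have "\<dots> \<le> 2 * ennreal (2 * \<phi> * G) + ennreal ?e"
  proof (intro add_mono mult_left_mono order_refl)
    have "(\<integral>\<^sup>+x. ennreal \<bar>indicator A x - ?g x\<bar> \<partial>Nd d) \<le> rvar d (indicator A) UNIV \<phi>"
      by (rule smooth_close) auto
    also have "\<dots> = ennreal (noise d A {..<d} \<phi>)" unfolding rvar_UNIV by (simp add: rvar_indicator noise_def)
    also have "\<dots> \<le> ennreal (2 * \<phi> * G)" using noise_all[OF A G _ \<phi>pi] \<phi> by (intro ennreal_leI) auto
    finally show "(\<integral>\<^sup>+x. ennreal \<bar>indicator A x - ?g x\<bar> \<partial>Nd d) \<le> ennreal (2 * \<phi> * G)" .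
  qed auto
  also have "\<dots> = ennreal (4 * \<phi> * G + ?e)"
  proof -
    have "2 * ennreal (2 * \<phi> * G) = ennreal (2 * (2 * \<phi> * G))"
      unfolding ennreal_numeral[symmetric] by (rule ennreal_mult'[symmetric]) simp
    moreover have "ennreal (2 * (2 * \<phi> * G)) + ennreal ?e = ennreal (2 * (2 * \<phi> * G) + ?e)"
      using \<phi> G by (intro ennreal_plus[symmetric]) auto
    ultimately show ?thesis by (simp only: mult.assoc[symmetric] mult_2_right numeral_times_numeral) simp
  qed
  finally have "(\<integral>x. \<bar>indicator A x - fbar d m \<psi> A x\<bar> \<partial>Nd d) \<le> 4 * \<phi> * G + ?e"
    using \<phi> G by (subst (asm) ennreal_le_iff) auto
  then show ?thesis by simp
qed

text \<open>A nontrivial factor in a resampled coordinate is orthogonal to 1 and averages to 0;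
  factors elsewhere are untouched. So each basis function is an eigenfunction with eigenvalue 0 or
  1.\<close>

lemma Psi_fresh:
  assumes b: "b \<in> Idx" and J: "J \<subseteq> {..<d}"
  shows "(\<integral>y. Psi d \<psi> b (fresh d J (x, y)) \<partial>Nd d) = (if \<forall>i\<in>J. b i = 0 then Psi d \<psi> b x else 0)"
proof -
  interpret g: prob_space std_normal_distribution by (rule prob_space_normal_density) simp
  let ?f = "\<lambda>i t. if i \<in> J then \<psi> (b i) t else \<psi> (b i) (x i)"
  have e: "Psi d \<psi> b (fresh d J (x, y)) = (\<Prod>i<d. ?f i (y i))" for y
    unfolding Psi_def fresh_def by (intro prod.cong) auto
  have i: "i \<in> {..<d} \<Longrightarrow> integrable std_normal_distribution (?f i)" for i
    using Idx_lt[OF b] m by (cases "i \<in> J") (auto intro: psi_integrable)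
  have I: "(\<integral>t. \<psi> j t \<partial>std_normal_distribution) = (if j = 0 then 1 else 0)" if "j < m" for j
    using orth[OF that m] one by simp
  have "(\<integral>y. Psi d \<psi> b (fresh d J (x, y)) \<partial>Nd d) = (\<Prod>i<d. \<integral>t. ?f i t \<partial>std_normal_distribution)"
    unfolding e Nd_def using i by (intro std_normal_prod.product_integral_prod) auto
  also have "\<dots> = (\<Prod>i<d. if i \<in> J then (if b i = 0 then 1 else 0) else \<psi> (b i) (x i))"
    using Idx_lt[OF b] I g.prob_space by (intro prod.cong refl) auto
  also have "\<dots> = (if \<forall>i\<in>J. b i = 0 then Psi d \<psi> b x else 0)"
  proof (cases "\<forall>i\<in>J. b i = 0")
    case True
    then show ?thesis using one unfolding Psi_def by (auto intro!: prod.cong)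
  next
    case False
    then obtain i where "i \<in> J" "b i \<noteq> 0" by blast
    then show ?thesis using J by (auto intro!: prod_zero bexI[of _ i])
  qed
  finally show ?thesis .
qed

context
  fixes A assumes A [measurable]: "A \<in> sets (Rd d)"
begin

text \<open>Parseval after integrating out the fresh coordinates: only indices that are trivial on
  \<open>J\<close> remain.\<close>

lemma fresh_correlation:
  assumes J: "J \<subseteq> {..<d}"
  shows "(\<integral>p. fbar d m \<psi> A (fst p) * fbar d m \<psi> A (fresh d J p) \<partial>(Nd d \<Otimes>\<^sub>M Nd d))
    = (\<Sum>a\<in>Idx. if \<forall>i\<in>J. a i = 0 then (fcoef d \<psi> A a)\<^sup>2 else 0)"
proof -
  let ?F = "fbar d m \<psi> A" and ?c = "fcoef d \<psi> A"
  have b: "0 \<le> ?F x" "?F x \<le> 1" for x using fbar_bounds[OF A] by auto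
  have [measurable]: "?F \<in> borel_measurable (Rd d)" by (rule fbar_measurable[OF A])
  have b2: "\<bar>?F x * ?F y\<bar> \<le> 1" for x y using b[of x] b[of y] by (auto simp: abs_mult intro: mult_le_one)
  have "(\<integral>p. ?F (fst p) * ?F (fresh d J p) \<partial>(Nd d \<Otimes>\<^sub>M Nd d)) = (\<integral>x. \<integral>y. ?F (fst (x, y)) * ?F (fresh d J (x, y)) \<partial>Nd d \<partial>Nd d)"
    using b2 by (intro Nd2.integral_fst'[symmetric] Nd2.integrable_const_bound[of _ 1]) auto
  also have "\<dots> = (\<integral>x. ?F x * (\<Sum>a\<in>Idx. if \<forall>i\<in>J. a i = 0 then ?c a * Psi d \<psi> a x else 0) \<partial>Nd d)"
  proof (intro Bochner_Integration.integral_cong refl)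
    fix x assume x: "x \<in> space (Nd d)"
    have [measurable]: "(\<lambda>y. fresh d J (x, y)) \<in> Nd d \<rightarrow>\<^sub>M Rd d"
      using x by (intro measurable_compose[OF _ measurable_fresh]) (auto simp: space_Nd space_Rd)
    have Pi: "integrable (Nd d) (\<lambda>y. Psi d \<psi> a (fresh d J (x, y)))" if a: "a \<in> Idx" for a
    proof -
      obtain C where "0 \<le> C" "\<And>x. \<bar>Psi d \<psi> a x\<bar> \<le> C" using Psi_bounded a by blast
      moreover have [measurable]: "Psi d \<psi> a \<in> borel_measurable (Rd d)" using a by measurable
      ultimately show ?thesis by (intro Nd.integrable_const_bound[of _ C]) auto
    qed
    have "(\<integral>y. ?F (fresh d J (x, y)) \<partial>Nd d) = (\<Sum>a\<in>Idx. \<integral>y. ?c a * Psi d \<psi> a (fresh d J (x, y)) \<partial>Nd d)"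
      unfolding fbar_def by (intro Bochner_Integration.integral_sum integrable_mult_right Pi)
    also have "\<dots> = (\<Sum>a\<in>Idx. if \<forall>i\<in>J. a i = 0 then ?c a * Psi d \<psi> a x else 0)"
      by (intro sum.cong refl) (simp add: Psi_fresh[OF _ J])
    finally show "(\<integral>y. ?F (fst (x, y)) * ?F (fresh d J (x, y)) \<partial>Nd d) = ?F x * (\<Sum>a\<in>Idx. if \<forall>i\<in>J. a i = 0 then ?c a * Psi d \<psi> a x else 0)"
      by simp
  qed
  also have "\<dots> = (\<integral>x. (\<Sum>a\<in>Idx. \<Sum>b\<in>Idx. (if \<forall>i\<in>J. a i = 0 then ?c a * ?c b else 0) * (Psi d \<psi> b x * Psi d \<psi> a x)) \<partial>Nd d)"
    unfolding fbar_def sum_distrib_left sum_distrib_right by (intro Bochner_Integration.integral_cong refl sum.cong) auto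
  also have "\<dots> = (\<Sum>a\<in>Idx. \<Sum>b\<in>Idx. (if \<forall>i\<in>J. a i = 0 then ?c a * ?c b else 0) * (if b = a then 1 else 0))"
  proof -
    have "has_bochner_integral (Nd d) (\<lambda>x. \<Sum>a\<in>Idx. \<Sum>b\<in>Idx. (if \<forall>i\<in>J. a i = 0 then ?c a * ?c b else 0) * (Psi d \<psi> b x * Psi d \<psi> a x))
       (\<Sum>a\<in>Idx. \<Sum>b\<in>Idx. (if \<forall>i\<in>J. a i = 0 then ?c a * ?c b else 0) * (if b = a then 1 else 0))"
      by (intro has_bochner_integral_sum has_bochner_integral_mult_right) (auto simp: has_bochner_integral_iff Psi_orth)
    then show ?thesis by (rule has_bochner_integral_integral_eq)
  qed
  also have "\<dots> = (\<Sum>a\<in>Idx. \<Sum>b\<in>Idx. if b = a then (if \<forall>i\<in>J. a i = 0 then (?c a)\<^sup>2 else 0) else 0)"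
    by (intro sum.cong refl) (auto simp: power2_eq_square)
  also have "\<dots> = (\<Sum>a\<in>Idx. if \<forall>i\<in>J. a i = 0 then (?c a)\<^sup>2 else 0)"
    using finite_Idx by (intro sum.cong refl) (subst sum.delta, auto)
  finally show ?thesis .
qed

text \<open>Two points of equal law both fall into \<open>A\<close> with probability
  \<open>|A|\<close> minus half the probability that they disagree. Replacing both indicators by the
  projection costs the L1 distance twice, since all factors lie in \<open>[0, 1]\<close>.\<close>

lemma fresh_lower:
  assumes J: "J \<subseteq> {..<d}"
  shows "measure (Nd d) A - (\<Sum>a\<in>Idx. if \<forall>i\<in>J. a i = 0 then (fcoef d \<psi> A a)\<^sup>2 else 0)
    \<le> noise d A J (pi / 2) / 2 + 2 * (\<integral>x. \<bar>indicator A x - fbar d m \<psi> A x\<bar> \<partial>Nd d)"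
proof -
  let ?F = "fbar d m \<psi> A" and ?\<theta> = "ang J (pi / 2)" and ?P = "Nd d \<Otimes>\<^sub>M Nd d"
  let ?I = "indicator A :: _ \<Rightarrow> real" and ?s = "\<lambda>p. fst (rot d ?\<theta> p)"
  have \<theta>: "\<bar>?\<theta> i\<bar> < pi" for i by (rule ang_lt) auto
  have b: "0 \<le> ?F x" "?F x \<le> 1" for x using fbar_bounds[OF A] by auto
  have [measurable]: "?F \<in> borel_measurable (Rd d)" by (rule fbar_measurable[OF A])
  have bi: "integrable ?P (\<lambda>p. h p :: real)" if "h \<in> borel_measurable (Rd d \<Otimes>\<^sub>M Rd d)" "\<And>p. \<bar>h p\<bar> \<le> 1" for h
    using that by (intro Nd2.integrable_const_bound[of _ 1]) auto
  have Ii: "integrable (Nd d) ?I" by (intro Nd.integrable_const_bound[of _ 1]) auto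
  have b1: "\<bar>?I x - ?F x\<bar> \<le> 1" for x
    using b[of x] by (cases "x \<in> A") auto
  have di: "integrable (Nd d) (\<lambda>x. \<bar>?I x - ?F x\<bar>)"
    using b1 by (intro Nd.integrable_const_bound[of _ 1]) auto
  have dm: "(\<lambda>x. \<bar>?I x - ?F x\<bar>) \<in> borel_measurable (Rd d)" by measurable
  have n: "noise d A J (pi / 2) = (\<integral>p. ?I (?s p) + ?I (fst p) - 2 * (?I (fst p) * ?I (?s p)) \<partial>?P)"
  proof -
    have [measurable]: "{p \<in> space ?P. (?s p \<in> A) \<noteq> (fst p \<in> A)} \<in> sets ?P" by measurable
    have "noise d A J (pi / 2) = (\<integral>p. indicator {p \<in> space ?P. (?s p \<in> A) \<noteq> (fst p \<in> A)} p \<partial>?P)"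
      unfolding noise_def by simp
    also have "\<dots> = (\<integral>p. ?I (?s p) + ?I (fst p) - 2 * (?I (fst p) * ?I (?s p)) \<partial>?P)"
      by (intro Bochner_Integration.integral_cong refl) (auto simp: indicator_def)
    finally show ?thesis .
  qed
  have pi2: "integrable ?P (\<lambda>p. ?I (fst p) * ?I (?s p))" by (intro bi) (auto simp: indicator_def)
  have "noise d A J (pi / 2) = (\<integral>x. ?I x \<partial>Nd d) + (\<integral>x. ?I x \<partial>Nd d) - 2 * (\<integral>p. ?I (fst p) * ?I (?s p) \<partial>?P)"
    unfolding n using integral_fst_snd[OF _ Ii \<theta>] pi2 by simp
  moreover have "(\<integral>x. ?I x \<partial>Nd d) = measure (Nd d) A" by (simp add: sets_Nd)
  ultimately have S1: "measure (Nd d) A - noise d A J (pi / 2) / 2 = (\<integral>p. ?I (fst p) * ?I (?s p) \<partial>?P)"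
    by linarith
  have pF: "integrable ?P (\<lambda>p. ?F (fst p) * ?F (?s p))"
    by (intro bi) (auto simp: abs_mult b intro!: mult_le_one)
  have "(\<integral>p. ?I (fst p) * ?I (?s p) \<partial>?P) - (\<integral>p. ?F (fst p) * ?F (?s p) \<partial>?P)
     = (\<integral>p. ?I (fst p) * ?I (?s p) - ?F (fst p) * ?F (?s p) \<partial>?P)"
    using pi2 pF by simp
  also have "\<dots> \<le> (\<integral>p. \<bar>?I (?s p) - ?F (?s p)\<bar> + \<bar>?I (fst p) - ?F (fst p)\<bar> \<partial>?P)"
  proof (intro integral_mono Bochner_Integration.integrable_diff Bochner_Integration.integrable_add pi2 pF)
    show "integrable ?P (\<lambda>p. \<bar>?I (?s p) - ?F (?s p)\<bar>)" "integrable ?P (\<lambda>p. \<bar>?I (fst p) - ?F (fst p)\<bar>)"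
      using integral_fst_snd[OF dm di \<theta>] by auto
    fix p
    have "?I (fst p) * ?I (?s p) - ?F (fst p) * ?F (?s p) = ?I (fst p) * (?I (?s p) - ?F (?s p)) + ?F (?s p) * (?I (fst p) - ?F (fst p))"
      by (simp add: algebra_simps)
    also have "\<dots> \<le> \<bar>?I (fst p)\<bar> * \<bar>?I (?s p) - ?F (?s p)\<bar> + \<bar>?F (?s p)\<bar> * \<bar>?I (fst p) - ?F (fst p)\<bar>"
      unfolding abs_mult[symmetric] by (intro add_mono abs_ge_self)
    also have "\<dots> \<le> 1 * \<bar>?I (?s p) - ?F (?s p)\<bar> + 1 * \<bar>?I (fst p) - ?F (fst p)\<bar>"
      using b by (intro add_mono mult_right_mono) (auto simp: indicator_def)
    finally show "?I (fst p) * ?I (?s p) - ?F (fst p) * ?F (?s p) \<le> \<bar>?I (?s p) - ?F (?s p)\<bar> + \<bar>?I (fst p) - ?F (fst p)\<bar>"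
      by simp
  qed
  also have "\<dots> = 2 * (\<integral>x. \<bar>?I x - ?F x\<bar> \<partial>Nd d)"
    using integral_fst_snd[OF dm di \<theta>] by simp
  finally show ?thesis using S1 fresh_correlation[OF J] unfolding fresh_eq_rot by simp
qed

text \<open>Pythagoras for the orthonormal family: \<open>|A|\<close> is the squared norm of the
  indicator, so the first difference is the weight outside \<open>I\<close> and the last sum is the
  error in the coefficients.\<close>

lemma square_error:
  assumes I: "I \<subseteq> Idx"
  shows "(\<integral>x. (indicator A x - (\<Sum>a\<in>I. \<theta> a * Psi d \<psi> a x))\<^sup>2 \<partial>Nd d)
    = measure (Nd d) A - (\<Sum>a\<in>I. (fcoef d \<psi> A a)\<^sup>2) + (\<Sum>a\<in>I. (\<theta> a - fcoef d \<psi> A a)\<^sup>2)"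
    "integrable (Nd d) (\<lambda>x. (indicator A x - (\<Sum>a\<in>I. \<theta> a * Psi d \<psi> a x))\<^sup>2)"
proof -
  have fI: "finite I" using I finite_Idx finite_subset by blast
  let ?I = "indicator A :: _ \<Rightarrow> real"
  have e: "(?I x - (\<Sum>a\<in>I. \<theta> a * Psi d \<psi> a x))\<^sup>2 = ?I x + (\<Sum>a\<in>I. (- 2 * \<theta> a) * (?I x * Psi d \<psi> a x))
     + (\<Sum>a\<in>I. \<Sum>b\<in>I. (\<theta> a * \<theta> b) * (Psi d \<psi> a x * Psi d \<psi> b x))" for x
  proof -
    have "(?I x - s)\<^sup>2 = ?I x + (- 2) * ?I x * s + s * s" for s
      by (auto simp: indicator_def power2_eq_square algebra_simps)
    note this[of "\<Sum>a\<in>I. \<theta> a * Psi d \<psi> a x"]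
    moreover have "(\<Sum>a\<in>I. \<theta> a * Psi d \<psi> a x) * (\<Sum>a\<in>I. \<theta> a * Psi d \<psi> a x) =
      (\<Sum>a\<in>I. \<Sum>b\<in>I. (\<theta> a * \<theta> b) * (Psi d \<psi> a x * Psi d \<psi> b x))"
      unfolding sum_product by (intro sum.cong refl) simp
    moreover have "(- 2) * ?I x * (\<Sum>a\<in>I. \<theta> a * Psi d \<psi> a x) = (\<Sum>a\<in>I. (- 2 * \<theta> a) * (?I x * Psi d \<psi> a x))"
      unfolding sum_distrib_left by (intro sum.cong refl) simp
    ultimately show ?thesis by (simp only:)
  qed
  have h: "has_bochner_integral (Nd d) (\<lambda>x. (?I x - (\<Sum>a\<in>I. \<theta> a * Psi d \<psi> a x))\<^sup>2)
    (measure (Nd d) A + (\<Sum>a\<in>I. (- 2 * \<theta> a) * fcoef d \<psi> A a) + (\<Sum>a\<in>I. \<Sum>b\<in>I. (\<theta> a * \<theta> b) * (if a = b then 1 else 0)))"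
    unfolding e
  proof (intro has_bochner_integral_add has_bochner_integral_sum has_bochner_integral_mult_right)
    show "has_bochner_integral (Nd d) ?I (measure (Nd d) A)"
      by (rule has_bochner_integral_real_indicator) (auto simp: sets_Nd Nd.emeasure_eq_measure)
    show "has_bochner_integral (Nd d) (\<lambda>x. ?I x * Psi d \<psi> a x) (fcoef d \<psi> A a)" if "a \<in> I" for a
      unfolding has_bochner_integral_iff fcoef_def using that I
      by (auto intro!: bounded_mult_integrable simp: indicator_def)
    show "has_bochner_integral (Nd d) (\<lambda>x. Psi d \<psi> a x * Psi d \<psi> b x) (if a = b then 1 else 0)" if "a \<in> I" "b \<in> I" for a b
    proof -
      have "a \<in> Idx" "b \<in> Idx" using that I by auto
      then show ?thesis unfolding has_bochner_integral_iff by (intro conjI Psi_orth)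
    qed
  qed
  have s: "(\<Sum>a\<in>I. \<Sum>b\<in>I. (\<theta> a * \<theta> b) * (if a = b then 1 else 0)) = (\<Sum>a\<in>I. (\<theta> a)\<^sup>2)"
  proof (intro sum.cong refl)
    fix a assume "a \<in> I"
    have "(\<Sum>b\<in>I. (\<theta> a * \<theta> b) * (if a = b then 1 else 0)) = (\<Sum>b\<in>I. if a = b then (\<theta> a)\<^sup>2 else 0)"
      by (intro sum.cong) (auto simp: power2_eq_square)
    then show "(\<Sum>b\<in>I. (\<theta> a * \<theta> b) * (if a = b then 1 else 0)) = (\<theta> a)\<^sup>2" using fI \<open>a \<in> I\<close> by simp
  qed
  have t: "(\<Sum>a\<in>I. (- 2 * \<theta> a) * fcoef d \<psi> A a) + (\<Sum>a\<in>I. (\<theta> a)\<^sup>2) = (\<Sum>a\<in>I. (\<theta> a - fcoef d \<psi> A a)\<^sup>2) - (\<Sum>a\<in>I. (fcoef d \<psi> A a)\<^sup>2)"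
    unfolding sum.distrib[symmetric] sum_subtractf[symmetric] by (intro sum.cong refl) (simp add: power2_eq_square algebra_simps)
  show "integrable (Nd d) (\<lambda>x. (indicator A x - (\<Sum>a\<in>I. \<theta> a * Psi d \<psi> a x))\<^sup>2)"
    using h unfolding has_bochner_integral_iff by blast
  show "(\<integral>x. (indicator A x - (\<Sum>a\<in>I. \<theta> a * Psi d \<psi> a x))\<^sup>2 \<partial>Nd d)
    = measure (Nd d) A - (\<Sum>a\<in>I. (fcoef d \<psi> A a)\<^sup>2) + (\<Sum>a\<in>I. (\<theta> a - fcoef d \<psi> A a)\<^sup>2)"
    unfolding has_bochner_integral_integral_eq[OF h] s using t by linarith
qed

lemma bessel: "(\<Sum>a\<in>Idx. (fcoef d \<psi> A a)\<^sup>2) \<le> 1"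
proof -
  have "0 \<le> (\<integral>x. (indicator A x - (\<Sum>a\<in>Idx. fcoef d \<psi> A a * Psi d \<psi> a x))\<^sup>2 \<partial>Nd d)" by simp
  also have "\<dots> = measure (Nd d) A - (\<Sum>a\<in>Idx. (fcoef d \<psi> A a)\<^sup>2)" by (subst square_error) auto
  finally show ?thesis using Nd.prob_le_1[of d A] by linarith
qed

text \<open>Averaging \<open>fresh_lower\<close> over \<open>J\<close> weights the squared
  coefficient of \<open>a\<close> by \<open>\<rho>\<close> to the power
  \<open>supp_size d a\<close>. Stability makes the weighted sum nearly \<open>|A|\<close>, and by
  Bessel the indices of size above \<open>k\<close> contribute at most \<open>\<rho>^(k+1)\<close>
  to it.\<close>

lemma low_degree_weight:
  assumes G: "gauss_surface_area d A \<le> ennreal G" "0 \<le> G" and \<rho>: "0 \<le> \<rho>" "\<rho> \<le> 1" and \<phi>: "0 < \<phi>" "\<phi> \<le> 1"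
  shows "measure (Nd d) A - (\<Sum>a | a \<in> Idx \<and> supp_size d a \<le> k. (fcoef d \<psi> A a)\<^sup>2)
    \<le> 2 * sqrt (1 - \<rho>) * G + 2 * (4 * \<phi> * G + 4 * real d / (\<phi> * real N) + real d / (real N)\<^sup>2) + \<rho> ^ (k + 1)"
proof -
  let ?c = "\<lambda>a. (fcoef d \<psi> A a)\<^sup>2" and ?w = "subset_weight d \<rho>"
  let ?\<tau> = "\<integral>x. \<bar>indicator A x - fbar d m \<psi> A x\<bar> \<partial>Nd d"
  note w0 = subset_weight_nonneg[OF \<rho>]
  have avg: "(\<Sum>J\<in>Pow {..<d}. ?w J * (\<Sum>a\<in>Idx. if \<forall>i\<in>J. a i = 0 then ?c a else 0)) = (\<Sum>a\<in>Idx. \<rho> ^ supp_size d a * ?c a)"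
  proof -
    have "(\<Sum>J\<in>Pow {..<d}. ?w J * (\<Sum>a\<in>Idx. if \<forall>i\<in>J. a i = 0 then ?c a else 0)) =
      (\<Sum>a\<in>Idx. \<Sum>J\<in>Pow {..<d}. ?w J * (if \<forall>i\<in>J. a i = 0 then ?c a else 0))"
      unfolding sum_distrib_left by (rule sum.swap)
    also have "\<dots> = (\<Sum>a\<in>Idx. (\<Sum>J\<in>Pow {..<d}. if J \<inter> {i. i < d \<and> a i \<noteq> 0} = {} then ?w J else 0) * ?c a)"
      unfolding sum_distrib_right by (intro sum.cong refl) (auto simp: disjoint_iff)
    also have "\<dots> = (\<Sum>a\<in>Idx. \<rho> ^ supp_size d a * ?c a)"
      unfolding supp_size_def by (intro sum.cong refl arg_cong2[where f = "(*)"] subset_weight_disjoint) auto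
    finally show ?thesis .
  qed
  have "measure (Nd d) A - (\<Sum>a\<in>Idx. \<rho> ^ supp_size d a * ?c a)
    = (\<Sum>J\<in>Pow {..<d}. ?w J * (measure (Nd d) A - (\<Sum>a\<in>Idx. if \<forall>i\<in>J. a i = 0 then ?c a else 0)))"
    unfolding right_diff_distrib sum_subtractf avg sum_distrib_right[symmetric] subset_weight_sum by simp
  also have "\<dots> \<le> (\<Sum>J\<in>Pow {..<d}. ?w J * (noise d A J (pi / 2) / 2 + 2 * ?\<tau>))"
    using w0 by (intro sum_mono mult_left_mono fresh_lower) auto
  also have "\<dots> = (\<Sum>J\<in>Pow {..<d}. ?w J * noise d A J (pi / 2)) / 2 + 2 * ?\<tau>"
    unfolding distrib_left sum.distrib sum_distrib_right[symmetric] subset_weight_sum by (simp add: sum_divide_distrib)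
  also have "\<dots> \<le> (2 * (pi / 2) * sqrt (1 - \<rho>) * G) / 2 + 2 * (4 * \<phi> * G + 4 * real d / (\<phi> * real N) + real d / (real N)\<^sup>2)"
  proof (intro add_mono divide_right_mono mult_left_mono fbar_close_surface[OF A G \<phi>])
    show "(\<Sum>J\<in>Pow {..<d}. ?w J * noise d A J (pi / 2)) \<le> 2 * (pi / 2) * sqrt (1 - \<rho>) * G"
    proof (rule noise_average[OF A G _ _ w0 subset_weight_sum])
      show "(\<Sum>J\<in>Pow {..<d}. if i \<in> J then ?w J else 0) \<le> 1 - \<rho>" if "i < d" for i
        unfolding subset_weight_marginal[OF that] ..
    qed (use \<rho> in simp_all)
  qed simp_all
  \<comment> \<open>\<open>noise_average\<close> at a quarter turn with
    \<open>\<delta> = 1 - \<rho>\<close> gives the factor \<open>pi\<close>, halved by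
    \<open>fresh_lower\<close>; the integer 2 replaces \<open>pi / 2\<close>.\<close>
  also have "(2 * (pi / 2) * sqrt (1 - \<rho>) * G) / 2 \<le> 2 * sqrt (1 - \<rho>) * G"
  proof -
    have "pi / 2 * (sqrt (1 - \<rho>) * G) \<le> 2 * (sqrt (1 - \<rho>) * G)"
      using pi_less_4 \<rho> G by (intro mult_right_mono) auto
    then show ?thesis by simp
  qed
  finally have 1: "measure (Nd d) A - (\<Sum>a\<in>Idx. \<rho> ^ supp_size d a * ?c a) \<le>
     2 * sqrt (1 - \<rho>) * G + 2 * (4 * \<phi> * G + 4 * real d / (\<phi> * real N) + real d / (real N)\<^sup>2)" by simp
  have "(\<Sum>a\<in>Idx. \<rho> ^ supp_size d a * ?c a) \<le> (\<Sum>a\<in>Idx. (if supp_size d a \<le> k then ?c a else 0) + \<rho> ^ (k + 1) * ?c a)"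
  proof (intro sum_mono)
    fix a assume "a \<in> Idx"
    show "\<rho> ^ supp_size d a * ?c a \<le> (if supp_size d a \<le> k then ?c a else 0) + \<rho> ^ (k + 1) * ?c a"
    proof (cases "supp_size d a \<le> k")
      case True
      have "\<rho> ^ supp_size d a * ?c a \<le> 1 * ?c a" using \<rho> by (intro mult_right_mono power_le_one) auto
      moreover have "0 \<le> \<rho> ^ (k + 1) * ?c a" using \<rho> by simp
      ultimately show ?thesis using True by (simp only: if_True)
    next
      case False
      then have "\<rho> ^ supp_size d a \<le> \<rho> ^ (k + 1)" using \<rho> by (intro power_decreasing) auto
      then show ?thesis using False by (simp add: mult_right_mono del: power_Suc)
    qed
  qed
  also have "\<dots> = (\<Sum>a | a \<in> Idx \<and> supp_size d a \<le> k. ?c a) + \<rho> ^ (k + 1) * (\<Sum>a\<in>Idx. ?c a)"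
    unfolding sum.distrib sum_distrib_left[symmetric] sum.inter_filter[OF finite_Idx] ..
  also have "\<dots> \<le> (\<Sum>a | a \<in> Idx \<and> supp_size d a \<le> k. ?c a) + \<rho> ^ (k + 1) * 1"
    using bessel \<rho> by (intro add_left_mono mult_left_mono) auto
  finally show ?thesis using 1 by simp
qed

end

end

section \<open>Covers of sets of bounded surface area\<close>

context cell_system
begin

text \<open>An index of size \<open>k + 1\<close> arises from one of size \<open>k\<close> by
  setting one of \<open>d\<close> coordinates to one of \<open>m\<close> values.\<close>

lemma card_low_degree: "card {a \<in> Idx. supp_size d a \<le> k} \<le> (1 + d * m) ^ k"
proof (induction k)
  case 0
  have "{a \<in> Idx. supp_size d a \<le> 0} \<subseteq> {a0}"
  proof
    fix a assume a: "a \<in> {a \<in> Idx. supp_size d a \<le> 0}"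
    then have "{i. i < d \<and> a i \<noteq> 0} = {}" by (simp add: supp_size_def)
    then show "a \<in> {a0}" using a by (auto simp: PiE_iff extensional_def fun_eq_iff)
  qed
  then have "card {a \<in> Idx. supp_size d a \<le> 0} \<le> card {a0}" by (intro card_mono) auto
  then show ?case by simp
next
  case (Suc k)
  let ?L = "\<lambda>k. {a \<in> Idx. supp_size d a \<le> k}"
  have fL: "finite (?L k)" for k using finite_Idx by (rule finite_subset[rotated]) auto
  have "?L (Suc k) \<subseteq> ?L k \<union> (\<lambda>(a, i, c). a(i := c)) ` (?L k \<times> {..<d} \<times> {..<m})"
  proof
    fix a assume a: "a \<in> ?L (Suc k)"
    show "a \<in> ?L k \<union> (\<lambda>(a, i, c). a(i := c)) ` (?L k \<times> {..<d} \<times> {..<m})"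
    proof (cases "supp_size d a \<le> k")
      case False
      then have "{i. i < d \<and> a i \<noteq> 0} \<noteq> {}" unfolding supp_size_def by (metis card.empty le0)
      then obtain i where i: "i < d" "a i \<noteq> 0" by blast
      have "{l. l < d \<and> (a(i := 0)) l \<noteq> 0} = {l. l < d \<and> a l \<noteq> 0} - {i}" by auto
      then have "supp_size d (a(i := 0)) = supp_size d a - 1"
        using i unfolding supp_size_def by (simp add: card_Diff_singleton)
      then have "a(i := 0) \<in> ?L k" using a i m by (auto simp: PiE_iff extensional_def)
      moreover have "a i < m" using a i by (auto simp: PiE_iff)
      ultimately have "(a(i := 0), i, a i) \<in> ?L k \<times> {..<d} \<times> {..<m}" using i by auto
      moreover have "a = (\<lambda>(a, i, c). a(i := c)) (a(i := 0), i, a i)" by simp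
      ultimately show ?thesis by blast
    qed (use a in auto)
  qed
  then have "card (?L (Suc k)) \<le> card (?L k \<union> (\<lambda>(a, i, c). a(i := c)) ` (?L k \<times> {..<d} \<times> {..<m}))"
    using fL by (intro card_mono) auto
  also have "\<dots> \<le> card (?L k) + card ((\<lambda>(a, i, c). a(i := c)) ` (?L k \<times> {..<d} \<times> {..<m}))"
    by (rule card_Un_le)
  also have "\<dots> \<le> card (?L k) + card (?L k \<times> {..<d} \<times> {..<m})"
    using fL by (intro add_left_mono card_image_le) auto
  also have "\<dots> = card (?L k) * (1 + d * m)" by (simp add: card_cartesian_product)
  also have "\<dots> \<le> (1 + d * m) ^ k * (1 + d * m)" using Suc.IH by (rule mult_right_mono) simp
  finally show ?case by (simp only: power_Suc2)
qed

text \<open>The better count when \<open>d\<close> is small compared with \<open>k\<close>; it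
  serves the case of large surface area in \<open>cover_budget\<close>.\<close>

lemma card_low_degree': "card {a \<in> Idx. supp_size d a \<le> k} \<le> m ^ d"
proof -
  have "card {a \<in> Idx. supp_size d a \<le> k} \<le> card Idx" using finite_Idx by (intro card_mono) auto
  then show ?thesis by (simp add: card_PiE)
qed

definition thr :: "(nat \<Rightarrow> nat) set \<Rightarrow> ((nat \<Rightarrow> nat) \<Rightarrow> real) \<Rightarrow> (nat \<Rightarrow> real) set" where
  "thr I \<theta> = {x \<in> space (Rd d). 1 / 2 \<le> (\<Sum>a\<in>I. \<theta> a * Psi d \<psi> a x)}"

lemma thr_sets: "I \<subseteq> Idx \<Longrightarrow> thr I \<theta> \<in> sets (Rd d)"
proof -
  assume I: "I \<subseteq> Idx"
  have "(\<lambda>x. \<Sum>a\<in>I. \<theta> a * Psi d \<psi> a x) \<in> borel_measurable (Rd d)"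
    using I by (intro borel_measurable_sum borel_measurable_times Psi_measurable) auto
  then show ?thesis unfolding thr_def by measurable
qed

text \<open>Where thresholding at 1/2 errs, the combination is at least 1/2 away from the indicator,
  so the indicator of the error is at most 4 times the squared deviation.\<close>

lemma thr_error:
  assumes A [measurable]: "A \<in> sets (Rd d)" and I: "I \<subseteq> Idx"
  shows "measure (Nd d) (sym_diff A (thr I \<theta>))
    \<le> 4 * (measure (Nd d) A - (\<Sum>a\<in>I. (fcoef d \<psi> A a)\<^sup>2) + (\<Sum>a\<in>I. (\<theta> a - fcoef d \<psi> A a)\<^sup>2))"
proof -
  have [measurable]: "thr I \<theta> \<in> sets (Rd d)" using I by (rule thr_sets)
  have S: "sym_diff A (thr I \<theta>) \<in> sets (Nd d)" by measurable
  let ?p = "\<lambda>x. \<Sum>a\<in>I. \<theta> a * Psi d \<psi> a x"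
  have "measure (Nd d) (sym_diff A (thr I \<theta>)) = (\<integral>x. indicator (sym_diff A (thr I \<theta>)) x \<partial>Nd d)" using S by simp
  also have "\<dots> \<le> (\<integral>x. 4 * (indicator A x - ?p x)\<^sup>2 \<partial>Nd d)"
  proof (rule integral_mono)
    show "integrable (Nd d) (indicator (sym_diff A (thr I \<theta>)) :: _ \<Rightarrow> real)"
      using S by (intro Nd.integrable_const_bound[of _ 1]) auto
    show "integrable (Nd d) (\<lambda>x. 4 * (indicator A x - ?p x)\<^sup>2)"
      by (intro integrable_mult_right square_error(2)[OF A I])
    fix x assume "x \<in> space (Nd d)"
    then have x: "x \<in> space (Rd d)" by (simp add: space_Nd space_Rd)
    have "1 \<le> 4 * (1 - p)\<^sup>2" if "p < 1 / 2" for p :: real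
    proof -
      have "(1 / 2)\<^sup>2 \<le> (1 - p)\<^sup>2" using that by (intro power_mono) auto
      then show ?thesis by (simp add: power2_eq_square)
    qed
    moreover have "1 \<le> 4 * p\<^sup>2" if "1 / 2 \<le> p" for p :: real
    proof -
      have "(1 / 2)\<^sup>2 \<le> p\<^sup>2" using that by (intro power_mono) auto
      then show ?thesis by (simp add: power2_eq_square)
    qed
    ultimately show "indicator (sym_diff A (thr I \<theta>)) x \<le> 4 * (indicator A x - ?p x)\<^sup>2"
      using x by (auto simp: indicator_def thr_def not_le)
  qed
  also have "\<dots> = 4 * (measure (Nd d) A - (\<Sum>a\<in>I. (fcoef d \<psi> A a)\<^sup>2) + (\<Sum>a\<in>I. (\<theta> a - fcoef d \<psi> A a)\<^sup>2))"
    using square_error(1)[OF A I] by simp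
  finally show ?thesis .
qed

text \<open>Bessel puts all coefficients into \<open>[-1, 1]\<close>, where a grid of step
  \<open>1 / n0\<close> has \<open>2 n0 + 1\<close> points; rounding changes each by at most
  \<open>1 / n0\<close>. The cover is fixed before \<open>A\<close>, so a learner can know
  it.\<close>

lemma cover:
  fixes n0 k :: nat
  assumes n0: "1 \<le> n0"
  defines "I \<equiv> {a \<in> Idx. supp_size d a \<le> k}"
  shows "\<exists>\<T>. finite \<T> \<and> \<T> \<subseteq> sets (Rd d) \<and> card \<T> \<le> (2 * n0 + 1) ^ card I \<and>
    (\<forall>A\<in>sets (Rd d). \<exists>T\<in>\<T>. measure (Nd d) (sym_diff A T)
      \<le> 4 * (measure (Nd d) A - (\<Sum>a\<in>I. (fcoef d \<psi> A a)\<^sup>2) + real (card I) / (real n0)\<^sup>2))"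
proof -
  have I: "I \<subseteq> Idx" unfolding I_def by auto
  have fI: "finite I" using finite_Idx I by (rule finite_subset[rotated])
  define \<Theta> where "\<Theta> = (I \<rightarrow>\<^sub>E (\<lambda>z. real_of_int z / real n0) ` {- int n0..int n0})"
  have f\<Theta>: "finite \<Theta>" unfolding \<Theta>_def using fI by (intro finite_PiE) auto
  have "card \<Theta> \<le> (2 * n0 + 1) ^ card I"
  proof -
    have "card ((\<lambda>z. real_of_int z / real n0) ` {- int n0..int n0}) \<le> card {- int n0..int n0}"
      by (rule card_image_le) simp
    also have "\<dots> = 2 * n0 + 1" by simp
    finally show ?thesis unfolding \<Theta>_def using fI by (simp add: card_PiE power_mono)
  qed
  then have c: "card (thr I ` \<Theta>) \<le> (2 * n0 + 1) ^ card I" using card_image_le[OF f\<Theta>, of "thr I"] by linarith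
  have "\<exists>T\<in>thr I ` \<Theta>. measure (Nd d) (sym_diff A T)
      \<le> 4 * (measure (Nd d) A - (\<Sum>a\<in>I. (fcoef d \<psi> A a)\<^sup>2) + real (card I) / (real n0)\<^sup>2)"
    if A: "A \<in> sets (Rd d)" for A
  proof -
    let ?c = "fcoef d \<psi> A"
    define \<theta> where "\<theta> = (\<lambda>a\<in>I. real_of_int \<lfloor>?c a * real n0\<rfloor> / real n0)"
    have c1: "\<bar>?c a\<bar> \<le> 1" if "a \<in> I" for a
    proof -
      have "(?c a)\<^sup>2 \<le> (\<Sum>a\<in>Idx. (?c a)\<^sup>2)" using that I finite_Idx by (intro member_le_sum) auto
      also have "\<dots> \<le> 1" by (rule bessel[OF A])
      finally show ?thesis by (simp add: abs_square_le_1)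
    qed
    have "\<theta> \<in> \<Theta>"
      unfolding \<Theta>_def \<theta>_def
    proof (rule restrict_PiE_iff[THEN iffD2], intro ballI imageI)
      fix a assume "a \<in> I"
      then have a: "- 1 \<le> ?c a" "?c a \<le> 1" using c1[of a] by auto
      then have "- 1 * real n0 \<le> ?c a * real n0" "?c a * real n0 \<le> 1 * real n0"
        by (intro mult_right_mono; simp)+
      then have "- int n0 \<le> \<lfloor>?c a * real n0\<rfloor>" "\<lfloor>?c a * real n0\<rfloor> \<le> int n0"
        by (auto simp: le_floor_iff floor_le_iff)
      then show "\<lfloor>?c a * real n0\<rfloor> \<in> {- int n0..int n0}" by simp
    qed
    moreover have "measure (Nd d) (sym_diff A (thr I \<theta>))
      \<le> 4 * (measure (Nd d) A - (\<Sum>a\<in>I. (?c a)\<^sup>2) + real (card I) / (real n0)\<^sup>2)"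
    proof -
      have "(\<Sum>a\<in>I. (\<theta> a - ?c a)\<^sup>2) \<le> (\<Sum>a\<in>I. (1 / real n0)\<^sup>2)"
      proof (intro sum_mono)
        fix a assume a: "a \<in> I"
        have n: "0 < real n0" using n0 by simp
        have "\<theta> a - ?c a = (real_of_int \<lfloor>?c a * real n0\<rfloor> - ?c a * real n0) / real n0"
          using a n by (simp add: \<theta>_def field_simps)
        then have "\<bar>\<theta> a - ?c a\<bar> = \<bar>real_of_int \<lfloor>?c a * real n0\<rfloor> - ?c a * real n0\<bar> / real n0"
          using n by simp
        also have "\<dots> \<le> 1 / real n0"
          using n floor_correct[of "?c a * real n0"] by (intro divide_right_mono) linarith+
        finally have "\<bar>\<theta> a - ?c a\<bar>\<^sup>2 \<le> (1 / real n0)\<^sup>2" by (intro power_mono) auto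
        then show "(\<theta> a - ?c a)\<^sup>2 \<le> (1 / real n0)\<^sup>2" by simp
      qed
      also have "\<dots> = real (card I) / (real n0)\<^sup>2" by (simp add: power_divide)
      finally show ?thesis
        by (intro order_trans[OF thr_error[OF A I, of \<theta>]] mult_left_mono add_left_mono) simp_all
    qed
    ultimately show ?thesis by blast
  qed
  then show ?thesis
    using f\<Theta> c thr_sets[OF I] by (intro exI[of _ "thr I ` \<Theta>"]) auto
qed

end

text \<open>All parameters stay free, to be balanced in \<open>cover_budget\<close>.
  \<open>D\<close> is the number of basis functions kept, and the cover depends neither on
  \<open>A\<close> nor on \<open>G\<close>.\<close>

lemma cover_surface_area:
  fixes N n0 k d :: nat
  assumes N: "1 \<le> N" and n0: "1 \<le> n0" and \<rho>: "0 \<le> \<rho>" "\<rho> \<le> 1" and \<phi>: "0 < \<phi>" "\<phi> \<le> 1"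
  shows "\<exists>D \<T>. D \<le> (1 + d * (2 * N\<^sup>2 + 3)) ^ k \<and> D \<le> (2 * N\<^sup>2 + 3) ^ d \<and>
    finite \<T> \<and> \<T> \<subseteq> sets (Rd d) \<and> card \<T> \<le> (2 * n0 + 1) ^ D \<and>
    (\<forall>A\<in>sets (Rd d). \<forall>G\<ge>0. gauss_surface_area d A \<le> ennreal G \<longrightarrow>
      (\<exists>T\<in>\<T>. measure (Nd d) (sym_diff A T)
        \<le> 4 * (2 * sqrt (1 - \<rho>) * G + 2 * (4 * \<phi> * G + 4 * real d / (\<phi> * real N) + real d / (real N)\<^sup>2)
            + \<rho> ^ (k + 1) + real D / (real n0)\<^sup>2)))"
proof -
  obtain \<psi> where "cell_system (2 * N\<^sup>2 + 3) N \<psi>"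
    using cell_basis[OF N] N by (auto simp: cell_system_def)
  then interpret cell_system d "2 * N\<^sup>2 + 3" N \<psi> .
  obtain \<T> where T: "finite \<T>" "\<T> \<subseteq> sets (Rd d)" "card \<T> \<le> (2 * n0 + 1) ^ card {a \<in> Idx. supp_size d a \<le> k}"
    "\<And>A. A \<in> sets (Rd d) \<Longrightarrow> \<exists>T\<in>\<T>. measure (Nd d) (sym_diff A T)
      \<le> 4 * (measure (Nd d) A - (\<Sum>a\<in>{a \<in> Idx. supp_size d a \<le> k}. (fcoef d \<psi> A a)\<^sup>2) + real (card {a \<in> Idx. supp_size d a \<le> k}) / (real n0)\<^sup>2)"
    using cover[OF n0, of k] by blast
  show ?thesis
  proof (intro exI[of _ "card {a \<in> Idx. supp_size d a \<le> k}"] exI[of _ \<T>] conjI ballI allI impI)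
    fix A G assume A: "A \<in> sets (Rd d)" and G: "0 \<le> G" "gauss_surface_area d A \<le> ennreal G"
    obtain T where t: "T \<in> \<T>" "measure (Nd d) (sym_diff A T)
      \<le> 4 * (measure (Nd d) A - (\<Sum>a\<in>{a \<in> Idx. supp_size d a \<le> k}. (fcoef d \<psi> A a)\<^sup>2) + real (card {a \<in> Idx. supp_size d a \<le> k}) / (real n0)\<^sup>2)"
      using T(4)[OF A] by blast
    show "\<exists>T\<in>\<T>. measure (Nd d) (sym_diff A T)
        \<le> 4 * (2 * sqrt (1 - \<rho>) * G + 2 * (4 * \<phi> * G + 4 * real d / (\<phi> * real N) + real d / (real N)\<^sup>2)
            + \<rho> ^ (k + 1) + real (card {a \<in> Idx. supp_size d a \<le> k}) / (real n0)\<^sup>2)"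
      by (intro bexI[OF _ t(1)] order_trans[OF t(2)] mult_left_mono add_right_mono low_degree_weight[OF A G(2,1) \<rho> \<phi>]) simp
  qed (use T card_low_degree card_low_degree' in auto)
qed

text \<open>A crude isoperimetric inequality. Resampling all coordinates gives an independent copy,
  so the noise is exactly \<open>2 |A| (1 - |A|)\<close>. A set of tiny surface area is therefore
  nearly null or nearly everything.\<close>

lemma surface_area_trivial:
  assumes A [measurable]: "A \<in> sets (Rd d)" and G: "gauss_surface_area d A \<le> ennreal G" "0 \<le> G"
  shows "measure (Nd d) A * (1 - measure (Nd d) A) \<le> 2 * G"
proof -
  let ?P = "Nd d \<Otimes>\<^sub>M Nd d" and ?N = "measure (Nd d) A"
  have AN: "A \<in> sets (Nd d)" by (simp add: sets_Nd)
  have sp: "space (Nd d) = space (Rd d)" by (simp add: space_Nd space_Rd)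
  let ?c = "space (Nd d) - A"
  have "{p \<in> space ?P. (fst (rot d (ang {..<d} (pi / 2)) p) \<in> A) \<noteq> (fst p \<in> A)} = A \<times> ?c \<union> ?c \<times> A"
  proof (rule Set.set_eqI)
    fix p :: "(nat \<Rightarrow> real) \<times> (nat \<Rightarrow> real)"
    obtain x y where p: "p = (x, y)" by force
    have sub: "A \<subseteq> space (Nd d)" using sets.sets_into_space[OF AN] .
    have "fresh d {..<d} (x, y) = y" if "y \<in> space (Nd d)"
      using that by (auto simp: fresh_def space_Nd PiE_iff extensional_def fun_eq_iff)
    then have "(x, y) \<in> {p \<in> space ?P. (fresh d {..<d} p \<in> A) \<noteq> (fst p \<in> A)} \<longleftrightarrow>
        x \<in> space (Nd d) \<and> y \<in> space (Nd d) \<and> (y \<in> A) \<noteq> (x \<in> A)"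
      by (auto simp: space_pair_measure)
    also have "\<dots> \<longleftrightarrow> (x, y) \<in> A \<times> ?c \<union> ?c \<times> A" using sub by blast
    finally show "p \<in> {p \<in> space ?P. (fst (rot d (ang {..<d} (pi / 2)) p) \<in> A) \<noteq> (fst p \<in> A)} \<longleftrightarrow> p \<in> A \<times> ?c \<union> ?c \<times> A"
      unfolding fresh_eq_rot p .
  qed
  then have "noise d A {..<d} (pi / 2) = measure ?P (A \<times> ?c \<union> ?c \<times> A)" by (simp add: noise_def)
  also have "\<dots> = measure ?P (A \<times> ?c) + measure ?P (?c \<times> A)"
    using AN by (intro Nd2.finite_measure_Union) auto
  also have "\<dots> = ?N * (1 - ?N) + (1 - ?N) * ?N"
    using AN
    by (simp add: measure_def Nd.emeasure_pair_measure_Times enn2real_mult sets.compl_sets)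
      (simp add: measure_def[symmetric] Nd.prob_compl)
  finally have "2 * (?N * (1 - ?N)) = noise d A {..<d} (pi / 2)" by simp
  also have "\<dots> \<le> 2 * (pi / 2) * G" by (rule noise_all[OF A G]) auto
  also have "\<dots> \<le> 4 * G" using pi_less_4 G by (intro mult_right_mono) auto
  finally show ?thesis by simp
qed

section \<open>Gaussian integrals and spectra\<close>

text \<open>The coefficients are a function on pairs of naturals, so the same \<open>M\<close> can
  be read in every dimension of an induction.\<close>

definition qf :: "nat \<Rightarrow> (nat \<Rightarrow> nat \<Rightarrow> real) \<Rightarrow> (nat \<Rightarrow> real) \<Rightarrow> real" where
  "qf d M x = (\<Sum>i<d. \<Sum>j<d. M i j * x i * x j)"

definition posdef :: "nat \<Rightarrow> (nat \<Rightarrow> nat \<Rightarrow> real) \<Rightarrow> bool" where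
  "posdef d M \<longleftrightarrow> (\<forall>i<d. \<forall>j<d. M i j = M j i) \<and> (\<forall>x. (\<exists>i<d. x i \<noteq> 0) \<longrightarrow> 0 < qf d M x)"

abbreviation matf :: "nat \<Rightarrow> (nat \<Rightarrow> nat \<Rightarrow> real) \<Rightarrow> real mat" where
  "matf d M \<equiv> Matrix.mat d d (\<lambda>(i, j). M i j)"

text \<open>Gaussian elimination of the last variable: multiplication by a unit triangular block
  matrix clears the last column above the pivot and leaves the Schur complement.\<close>

lemma det_schur:
  fixes M :: "nat \<Rightarrow> nat \<Rightarrow> real"
  assumes c: "M d d \<noteq> 0"
  shows "Determinant.det (matf (Suc d) M) = M d d * Determinant.det (matf d (\<lambda>i j. M i j - M i d * M d j / M d d))"
proof -
  let ?A = "matf d M" and ?b = "Matrix.mat d 1 (\<lambda>(i, j). M i d)" and ?r = "Matrix.mat 1 d (\<lambda>(i, j). M d j)"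
  let ?c = "Matrix.mat 1 1 (\<lambda>(i, j). M d d)" and ?e = "Matrix.mat d 1 (\<lambda>(i, j). - M i d / M d d)"
  let ?S = "matf d (\<lambda>i j. M i j - M i d * M d j / M d d)"
  have M: "matf (Suc d) M = four_block_mat ?A ?b ?r ?c"
    by (rule eq_matI) (auto simp: less_Suc_eq)
  let ?L = "four_block_mat (1\<^sub>m d) ?e (0\<^sub>m 1 d) (1\<^sub>m 1)"
  have "?L * matf (Suc d) M = four_block_mat (1\<^sub>m d * ?A + ?e * ?r) (1\<^sub>m d * ?b + ?e * ?c) (0\<^sub>m 1 d * ?A + 1\<^sub>m 1 * ?r) (0\<^sub>m 1 d * ?b + 1\<^sub>m 1 * ?c)"
    unfolding M by (rule mult_four_block_mat) auto
  also have "1\<^sub>m d * ?A + ?e * ?r = ?S"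
    by (rule eq_matI) (auto simp: scalar_prod_def)
  also have "1\<^sub>m d * ?b + ?e * ?c = 0\<^sub>m d 1"
    using c by (intro eq_matI) (auto simp: scalar_prod_def)
  also have "0\<^sub>m 1 d * ?A + 1\<^sub>m 1 * ?r = ?r" by (rule eq_matI) (auto simp: scalar_prod_def)
  also have "0\<^sub>m 1 d * ?b + 1\<^sub>m 1 * ?c = ?c" by (rule eq_matI) (auto simp: scalar_prod_def)
  finally have LM: "?L * matf (Suc d) M = four_block_mat ?S (0\<^sub>m d 1) ?r ?c" .
  have "Determinant.det ?L = Determinant.det (1\<^sub>m d) * Determinant.det (1\<^sub>m 1 :: real mat)"
    by (rule det_four_block_mat_lower_left_zero) auto
  then have L: "Determinant.det ?L = 1" by simp
  have Lc: "?L \<in> carrier_mat (Suc d) (Suc d)"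
    using four_block_carrier_mat[of "1\<^sub>m d" d d "1\<^sub>m 1 :: real mat" 1 1] by simp
  have "Determinant.det (?L * matf (Suc d) M) = Determinant.det ?L * Determinant.det (matf (Suc d) M)"
    by (rule det_mult[OF Lc]) simp
  moreover have "Determinant.det (?L * matf (Suc d) M) = Determinant.det ?S * Determinant.det ?c"
    unfolding LM by (rule det_four_block_mat_upper_right_zero) auto
  moreover have "Determinant.det ?c = M d d" by (subst det_single) auto
  ultimately show ?thesis using L by simp
qed

lemma nn_integral_gauss_1:
  fixes c s :: real
  assumes "0 < c"
  shows "(\<integral>\<^sup>+t. ennreal (exp (- (c * (t + s)\<^sup>2) / 2)) \<partial>lborel) = ennreal (sqrt (2 * pi / c))"
proof -
  define \<sigma> where "\<sigma> = 1 / sqrt c"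
  have \<sigma>: "0 < \<sigma>" "\<sigma>\<^sup>2 = 1 / c" using assms by (auto simp: \<sigma>_def power_divide)
  have "exp (- (c * (t + s)\<^sup>2) / 2) = sqrt (2 * pi / c) * normal_density (- s) \<sigma> t" for t
    using assms unfolding normal_density_def \<sigma>(2) by (simp add: field_simps real_sqrt_divide)
  then have "(\<integral>\<^sup>+t. ennreal (exp (- (c * (t + s)\<^sup>2) / 2)) \<partial>lborel)
      = (\<integral>\<^sup>+t. ennreal (sqrt (2 * pi / c)) * ennreal (normal_density (- s) \<sigma> t) \<partial>lborel)"
    using assms by (intro nn_integral_cong) (simp add: ennreal_mult)
  also have "\<dots> = ennreal (sqrt (2 * pi / c)) * (\<integral>\<^sup>+t. ennreal (normal_density (- s) \<sigma> t) \<partial>lborel)"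
    by (rule nn_integral_cmult) simp
  also have "(\<integral>\<^sup>+t. ennreal (normal_density (- s) \<sigma> t) \<partial>lborel) = 1"
  proof -
    interpret prob_space "density lborel (normal_density (- s) \<sigma>)" using \<sigma>(1) by (rule prob_space_normal_density)
    show ?thesis using emeasure_space_1 by (simp add: emeasure_density)
  qed
  finally show ?thesis by simp
qed

text \<open>Completing the square in the last variable produces the same Schur complement as
  \<open>det_schur\<close>, so integral and determinant obey the same recursion.\<close>

lemma qf_Suc:
  assumes sym: "\<And>i j. i < Suc d \<Longrightarrow> j < Suc d \<Longrightarrow> M i j = M j i" and c: "M d d \<noteq> 0"
  shows "qf (Suc d) M (x(d := t)) =
    qf d (\<lambda>i j. M i j - M i d * M d j / M d d) x + M d d * (t + (\<Sum>i<d. M i d * x i) / M d d)\<^sup>2"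
proof -
  define b where "b = (\<Sum>i<d. M i d * x i)"
  have 1: "qf (Suc d) M (x(d := t)) = qf d M x + 2 * t * b + M d d * t\<^sup>2"
  proof -
    have "qf (Suc d) M (x(d := t)) = (\<Sum>i<d. (\<Sum>j<d. M i j * x i * x j) + M i d * x i * t) + ((\<Sum>j<d. M d j * t * x j) + M d d * t * t)"
      unfolding qf_def by simp
    also have "(\<Sum>j<d. M d j * t * x j) = t * b"
      unfolding b_def sum_distrib_left using sym by (intro sum.cong) auto
    also have "(\<Sum>i<d. (\<Sum>j<d. M i j * x i * x j) + M i d * x i * t) = qf d M x + b * t"
      unfolding sum.distrib qf_def b_def sum_distrib_right ..
    finally show ?thesis by (simp add: power2_eq_square del: fun_upd_apply)
  qed
  have 2: "qf d (\<lambda>i j. M i j - M i d * M d j / M d d) x = qf d M x - b\<^sup>2 / M d d"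
  proof -
    have "b\<^sup>2 / M d d = (\<Sum>i<d. \<Sum>j<d. M i d * M d j / M d d * x i * x j)"
      unfolding b_def power2_eq_square sum_product sum_divide_distrib using sym by (intro sum.cong refl) auto
    then show ?thesis unfolding qf_def sum_subtractf[symmetric] by (simp add: algebra_simps sum_subtractf)
  qed
  show ?thesis unfolding 1 2 b_def[symmetric] using c by (simp add: power2_eq_square field_simps)
qed

lemma measurable_qf [measurable]:
  assumes "\<And>i. i < d \<Longrightarrow> (\<lambda>w. f w i) \<in> borel_measurable N"
  shows "(\<lambda>w. qf d M (f w)) \<in> borel_measurable N"
  unfolding qf_def using assms by (intro borel_measurable_sum borel_measurable_times) auto

text \<open>Induction on \<open>d\<close>, integrating out the last coordinate. Positivity of the
  determinant is carried along, as a product of positive pivots.\<close>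

lemma gauss_integral:
  assumes "posdef d M"
  shows "0 < Determinant.det (matf d M) \<and>
    (\<integral>\<^sup>+x. ennreal (exp (- qf d M x / 2)) \<partial>Rd d) = ennreal (sqrt ((2 * pi) ^ d / Determinant.det (matf d M)))"
  using assms
proof (induction d arbitrary: M)
  case 0
  have "Determinant.det (matf 0 M) = 1" by (subst det_dim_zero) auto
  moreover have "(\<integral>\<^sup>+x. ennreal (exp (- qf 0 M x / 2)) \<partial>Rd 0) = 1"
    unfolding Rd_def qf_def by (simp add: PiM_empty nn_integral_count_space_finite)
  ultimately show ?case by simp
next
  case (Suc d)
  have sym: "\<And>i j. i < Suc d \<Longrightarrow> j < Suc d \<Longrightarrow> M i j = M j i"
    and pd: "\<And>x. \<exists>i<Suc d. x i \<noteq> 0 \<Longrightarrow> 0 < qf (Suc d) M x"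
    using Suc.prems unfolding posdef_def by blast+
  have c: "0 < M d d"
  proof -
    have "0 < qf (Suc d) M (\<lambda>i. if i = d then 1 else 0)" by (rule pd) auto
    also have "\<dots> = M d d" unfolding qf_def by (simp add: if_distrib[of "\<lambda>z. _ * z"] sum.delta cong: if_cong)
    finally show ?thesis .
  qed
  then have c0: "M d d \<noteq> 0" by simp
  let ?M = "\<lambda>i j. M i j - M i d * M d j / M d d"
  have "posdef d ?M"
    unfolding posdef_def
  proof (intro conjI allI impI)
    fix i j assume "i < d" "j < d"
    then show "?M i j = ?M j i" using sym[of i j] sym[of i d] sym[of d j] by simp
  next
    fix x :: "nat \<Rightarrow> real" assume "\<exists>i<d. x i \<noteq> 0"
    \<comment> \<open>The value of the last variable that annuls the square, so positivity of the
      full form passes to the Schur complement.\<close>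
    then have "0 < qf (Suc d) M (x(d := - (\<Sum>i<d. M i d * x i) / M d d))" by (intro pd) force
    then show "0 < qf d ?M x" by (subst (asm) qf_Suc[of d M x]) (use sym c0 in simp_all)
  qed
  then have IH: "0 < Determinant.det (matf d ?M)"
    "(\<integral>\<^sup>+x. ennreal (exp (- qf d ?M x / 2)) \<partial>Rd d) = ennreal (sqrt ((2 * pi) ^ d / Determinant.det (matf d ?M)))"
    using Suc.IH by blast+
  have det: "Determinant.det (matf (Suc d) M) = M d d * Determinant.det (matf d ?M)"
    using c0 by (rule det_schur)
  have m: "(\<lambda>x. ennreal (exp (- qf (Suc d) M x / 2))) \<in> borel_measurable (Rd (Suc d))" by measurable
  have "(\<integral>\<^sup>+x. ennreal (exp (- qf (Suc d) M x / 2)) \<partial>Rd (Suc d)) =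
     (\<integral>\<^sup>+x. \<integral>\<^sup>+t. ennreal (exp (- qf (Suc d) M (x(d := t)) / 2)) \<partial>lborel \<partial>Rd d)"
    using m unfolding Rd_def lessThan_Suc by (intro lborel_prod.product_nn_integral_insert) auto
  also have "\<dots> = (\<integral>\<^sup>+x. ennreal (exp (- qf d ?M x / 2)) * ennreal (sqrt (2 * pi / M d d)) \<partial>Rd d)"
  proof (rule nn_integral_cong)
    fix x
    let ?s = "(\<Sum>i<d. M i d * x i) / M d d"
    have "exp (- qf (Suc d) M (x(d := t)) / 2) = exp (- qf d ?M x / 2) * exp (- (M d d * (t + ?s)\<^sup>2) / 2)" for t
    proof -
      have "qf (Suc d) M (x(d := t)) = qf d ?M x + M d d * (t + ?s)\<^sup>2" by (rule qf_Suc) (use sym c0 in simp_all)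
      then show ?thesis by (simp add: exp_add[symmetric] add_divide_distrib)
    qed
    then have "(\<integral>\<^sup>+t. ennreal (exp (- qf (Suc d) M (x(d := t)) / 2)) \<partial>lborel) =
       (\<integral>\<^sup>+t. ennreal (exp (- qf d ?M x / 2)) * ennreal (exp (- (M d d * (t + ?s)\<^sup>2) / 2)) \<partial>lborel)"
      by (intro nn_integral_cong) (simp add: ennreal_mult)
    also have "\<dots> = ennreal (exp (- qf d ?M x / 2)) * ennreal (sqrt (2 * pi / M d d))"
    proof -
      have m: "(\<lambda>t. ennreal (exp (- (M d d * (t + s)\<^sup>2) / 2))) \<in> borel_measurable lborel" for s :: real by simp
      show ?thesis by (simp only: nn_integral_cmult[OF m] nn_integral_gauss_1[OF c])
    qed
    finally show "(\<integral>\<^sup>+t. ennreal (exp (- qf (Suc d) M (x(d := t)) / 2)) \<partial>lborel) =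
       ennreal (exp (- qf d ?M x / 2)) * ennreal (sqrt (2 * pi / M d d))" .
  qed
  also have "\<dots> = (\<integral>\<^sup>+x. ennreal (exp (- qf d ?M x / 2)) \<partial>Rd d) * ennreal (sqrt (2 * pi / M d d))"
    by (rule nn_integral_multc) measurable
  also have "\<dots> = ennreal (sqrt ((2 * pi) ^ d / Determinant.det (matf d ?M)) * sqrt (2 * pi / M d d))"
    unfolding IH by (rule ennreal_mult''[symmetric]) (use c in simp)
  also have "sqrt ((2 * pi) ^ d / Determinant.det (matf d ?M)) * sqrt (2 * pi / M d d) = sqrt ((2 * pi) ^ Suc d / Determinant.det (matf (Suc d) M))"
    unfolding real_sqrt_mult[symmetric] det by (simp add: mult.commute)
  finally show ?case using det c IH(1) by simp
qed

lemma qf_add: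
  assumes "\<And>i j. i < d \<Longrightarrow> j < d \<Longrightarrow> M i j = M j i"
  shows "qf d M (\<lambda>i. z i + w i) = qf d M z + 2 * dotp d z (\<lambda>i. \<Sum>j<d. M i j * w j) + qf d M w"
proof -
  have "(\<Sum>i<d. \<Sum>j<d. M i j * w i * z j) = (\<Sum>i<d. \<Sum>j<d. M i j * z i * w j)"
    by (subst sum.swap) (intro sum.cong refl, use assms in auto)
  then have s: "(\<Sum>i<d. \<Sum>j<d. M i j * w i * z j) = dotp d z (\<lambda>i. \<Sum>j<d. M i j * w j)"
    unfolding dotp_def sum_distrib_left by (simp add: mult_ac)
  have s': "(\<Sum>i<d. \<Sum>j<d. M i j * z i * w j) = dotp d z (\<lambda>i. \<Sum>j<d. M i j * w j)"
    unfolding dotp_def sum_distrib_left by (simp add: mult_ac)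
  have "qf d M (\<lambda>i. z i + w i) = (\<Sum>i<d. \<Sum>j<d. M i j * z i * z j) + (\<Sum>i<d. \<Sum>j<d. M i j * z i * w j)
     + (\<Sum>i<d. \<Sum>j<d. M i j * w i * z j) + (\<Sum>i<d. \<Sum>j<d. M i j * w i * w j)"
    unfolding qf_def sum.distrib[symmetric] by (intro sum.cong refl) (simp add: algebra_simps)
  then show ?thesis unfolding s s' by (simp add: qf_def)
qed

lemma qf_cong: "(\<And>i. i < d \<Longrightarrow> x i = y i) \<Longrightarrow> qf d M x = qf d M y"
  unfolding qf_def by (intro sum.cong refl) auto

lemma dotp_cong: "(\<And>i. i < d \<Longrightarrow> x i = x' i) \<Longrightarrow> (\<And>i. i < d \<Longrightarrow> y i = y' i) \<Longrightarrow> dotp d x y = dotp d x' y'"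
  unfolding dotp_def by (intro sum.cong refl) auto

lemma dotp_add: "dotp d (\<lambda>i. x i + y i) z = dotp d x z + dotp d y z"
  unfolding dotp_def by (simp add: sum.distrib distrib_right)

lemma dotp_commute: "dotp d x y = dotp d y x"
  unfolding dotp_def by (simp add: mult.commute)

text \<open>Translation by \<open>\<mu> + w\<close> with \<open>M w = b\<close> absorbs the linear
  term and leaves the constant \<open>exp (dotp d w b / 2)\<close>; \<open>dotp d w b\<close> is the
  inverse quadratic form at \<open>b\<close>.\<close>

lemma gauss_linear:
  assumes M: "posdef d M" and w: "\<And>i. i < d \<Longrightarrow> (\<Sum>j<d. M i j * w j) = b i"
  shows "(\<integral>\<^sup>+x. ennreal (exp (- qf d M (\<lambda>i. x i - \<mu> i) / 2 + dotp d (\<lambda>i. x i - \<mu> i) b)) \<partial>Rd d)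
     = ennreal (sqrt ((2 * pi) ^ d / Determinant.det (matf d M)) * exp (dotp d w b / 2))"
proof -
  have sym: "\<And>i j. i < d \<Longrightarrow> j < d \<Longrightarrow> M i j = M j i" using M unfolding posdef_def by blast
  let ?F = "\<lambda>x. ennreal (exp (- qf d M (\<lambda>i. x i - \<mu> i) / 2 + dotp d (\<lambda>i. x i - \<mu> i) b))"
  have [measurable]: "?F \<in> borel_measurable (Rd d)" by measurable
  have "(\<integral>\<^sup>+x. ?F x \<partial>Rd d) = (\<integral>\<^sup>+x. ?F (\<lambda>i\<in>{..<d}. x i + (\<mu> i + w i)) \<partial>Rd d)"
    by (rule nn_integral_Rd_shift[symmetric]) measurable
  also have "\<dots> = (\<integral>\<^sup>+x. ennreal (exp (- qf d M x / 2)) * ennreal (exp (dotp d w b / 2)) \<partial>Rd d)"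
  proof (rule nn_integral_cong)
    fix x
    let ?y = "\<lambda>i. (\<lambda>i\<in>{..<d}. x i + (\<mu> i + w i)) i - \<mu> i"
    have "qf d M ?y = qf d M (\<lambda>i. x i + w i)" by (rule qf_cong) simp
    also have "\<dots> = qf d M x + 2 * dotp d x b + dotp d w b"
    proof -
      have "qf d M w = dotp d w (\<lambda>i. \<Sum>j<d. M i j * w j)"
        unfolding qf_def dotp_def sum_distrib_left by (simp add: mult_ac)
      also have "\<dots> = dotp d w b" using w by (intro dotp_cong) auto
      finally have "qf d M w = dotp d w b" .
      moreover have "dotp d x (\<lambda>i. \<Sum>j<d. M i j * w j) = dotp d x b" using w by (intro dotp_cong) auto
      ultimately show ?thesis by (simp add: qf_add[OF sym])
    qed
    finally have 1: "qf d M ?y = qf d M x + 2 * dotp d x b + dotp d w b" .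
    have "dotp d ?y b = dotp d (\<lambda>i. x i + w i) b" by (rule dotp_cong) auto
    also have "\<dots> = dotp d x b + dotp d w b" by (rule dotp_add)
    finally have 2: "dotp d ?y b = dotp d x b + dotp d w b" .
    have "- qf d M ?y / 2 + dotp d ?y b = - qf d M x / 2 + dotp d w b / 2"
      unfolding 1 2 by (simp add: field_simps)
    then have "exp (- qf d M ?y / 2 + dotp d ?y b) = exp (- qf d M x / 2) * exp (dotp d w b / 2)"
      by (simp only: exp_add)
    then show "?F (\<lambda>i\<in>{..<d}. x i + (\<mu> i + w i)) = ennreal (exp (- qf d M x / 2)) * ennreal (exp (dotp d w b / 2))"
      by (simp only: ennreal_mult exp_ge_zero)
  qed
  also have "\<dots> = (\<integral>\<^sup>+x. ennreal (exp (- qf d M x / 2)) \<partial>Rd d) * ennreal (exp (dotp d w b / 2))"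
    by (rule nn_integral_multc) measurable
  also have "\<dots> = ennreal (sqrt ((2 * pi) ^ d / Determinant.det (matf d M)) * exp (dotp d w b / 2))"
    using gauss_integral[OF M] by (simp add: ennreal_mult' ennreal_mult'')
  finally show ?thesis .
qed

section \<open>Eigenvalues of a symmetric matrix\<close>

definition mtrace :: "'a :: comm_ring_1 mat \<Rightarrow> 'a" where
  "mtrace A = (\<Sum>i<dim_row A. A $$ (i, i))"

lemma mtrace_mult:
  assumes "A \<in> carrier_mat n n" "B \<in> carrier_mat n n"
  shows "mtrace (A * B) = (\<Sum>i<n. \<Sum>j<n. A $$ (i, j) * B $$ (j, i))"
  using assms unfolding mtrace_def by (intro sum.cong) (auto simp: scalar_prod_def atLeast0LessThan)

lemma mtrace_commute:
  assumes "A \<in> carrier_mat n n" "B \<in> carrier_mat n n"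
  shows "mtrace (A * B) = mtrace (B * A)"
  unfolding mtrace_mult[OF assms] mtrace_mult[OF assms(2,1)]
  by (subst sum.swap) (simp add: mult.commute)

text \<open>For an eigenvector \<open>v = x + i y\<close> the Hermitian form at \<open>v\<close> is
  real by symmetry and equals \<open>qf d S x + qf d S y\<close>; the eigenvalue is thus a Rayleigh
  quotient and inherits both bounds.\<close>

lemma real_eigenvalue:
  fixes S :: "nat \<Rightarrow> nat \<Rightarrow> real"
  assumes sym: "\<And>i j. i < d \<Longrightarrow> j < d \<Longrightarrow> S i j = S j i"
    and lo: "\<And>x. lo * dotp d x x \<le> qf d S x" and hi: "\<And>x. qf d S x \<le> hi * dotp d x x"
    and ev: "eigenvalue (map_mat complex_of_real (matf d S)) k"
  shows "\<exists>l. k = complex_of_real l \<and> lo \<le> l \<and> l \<le> hi"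
proof -
  let ?A = "map_mat complex_of_real (matf d S)"
  obtain v where v: "v \<in> carrier_vec d" "v \<noteq> 0\<^sub>v d" "?A *\<^sub>v v = k \<cdot>\<^sub>v v"
    using ev unfolding eigenvalue_def eigenvector_def by auto
  define x y where "x i = Re (v $ i)" and "y i = Im (v $ i)" for i
  define n where "n = dotp d x x + dotp d y y"
  obtain i0 where i0: "i0 < d" "v $ i0 \<noteq> 0" using v(1,2) by (metis carrier_vecD eq_vecI index_zero_vec)
  have n: "0 < n"
  proof -
    have "0 < x i0 * x i0 + y i0 * y i0"
      using i0(2) unfolding x_def y_def complex_eq_iff by (auto simp: sum_squares_gt_zero_iff)
    also have "\<dots> \<le> (\<Sum>i<d. x i * x i + y i * y i)" using i0(1) by (intro member_le_sum) auto
    finally show ?thesis by (simp add: n_def dotp_def sum.distrib)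
  qed
  have e: "(\<Sum>j<d. complex_of_real (S i j) * v $ j) = k * v $ i" if "i < d" for i
  proof -
    have "(?A *\<^sub>v v) $ i = (\<Sum>j<d. complex_of_real (S i j) * v $ j)"
      using v(1) that by (auto simp: scalar_prod_def atLeast0LessThan intro!: sum.cong)
    then show ?thesis using v that by simp
  qed
  have "(\<Sum>i<d. cnj (v $ i) * (\<Sum>j<d. complex_of_real (S i j) * v $ j)) = k * (\<Sum>i<d. cnj (v $ i) * v $ i)"
    unfolding sum_distrib_left using e by (intro sum.cong refl) (simp add: sum_distrib_left[symmetric])
  also have "(\<Sum>i<d. cnj (v $ i) * v $ i) = complex_of_real n"
    unfolding n_def dotp_def sum.distrib[symmetric] of_real_sum
    by (intro sum.cong refl) (simp add: complex_eq_iff x_def y_def)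
  also have "(\<Sum>i<d. cnj (v $ i) * (\<Sum>j<d. complex_of_real (S i j) * v $ j)) = complex_of_real (qf d S x + qf d S y)"
  proof -
    have z: "(\<Sum>i<d. \<Sum>j<d. S i j * (x i * y j)) = (\<Sum>i<d. \<Sum>j<d. S i j * (y i * x j))"
      by (subst sum.swap) (intro sum.cong refl, use sym in auto)
    have "cnj (v $ i) * (complex_of_real (S i j) * v $ j)
      = Complex (S i j * x i * x j + S i j * y i * y j) (S i j * (x i * y j) - S i j * (y i * x j))" for i j
      by (simp add: complex_eq_iff x_def y_def algebra_simps)
    then have "(\<Sum>i<d. cnj (v $ i) * (\<Sum>j<d. complex_of_real (S i j) * v $ j)) =
      (\<Sum>i<d. \<Sum>j<d. Complex (S i j * x i * x j + S i j * y i * y j) (S i j * (x i * y j) - S i j * (y i * x j)))"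
      unfolding sum_distrib_left by simp
    also have "\<dots> = Complex (qf d S x + qf d S y) 0"
      using z by (simp add: complex_eq_iff qf_def sum.distrib sum_subtractf)
    finally show ?thesis by (simp add: complex_eq_iff)
  qed
  finally have "complex_of_real (qf d S x + qf d S y) = k * complex_of_real n" .
  then have k: "k = complex_of_real ((qf d S x + qf d S y) / n)" using n by (simp add: field_simps)
  have "lo * n \<le> qf d S x + qf d S y" "qf d S x + qf d S y \<le> hi * n"
    using lo[of x] lo[of y] hi[of x] hi[of y] by (simp_all add: n_def distrib_left)
  then show ?thesis using k n by (intro exI[of _ "(qf d S x + qf d S y) / n"]) (simp add: field_simps)
qed

text \<open>Triangularisation over the complex numbers is enough, without orthogonal
  diagonalisation: determinants of affine combinations and the trace of \<open>(S - I)^2\<close> are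
  similarity invariants that a triangular matrix shows on its diagonal.\<close>

lemma sym_spectrum:
  fixes S :: "nat \<Rightarrow> nat \<Rightarrow> real"
  assumes sym: "\<And>i j. i < d \<Longrightarrow> j < d \<Longrightarrow> S i j = S j i"
    and lo: "\<And>x. lo * dotp d x x \<le> qf d S x" and hi: "\<And>x. qf d S x \<le> hi * dotp d x x"
  obtains l :: "nat \<Rightarrow> real" where "\<And>i. i < d \<Longrightarrow> lo \<le> l i" "\<And>i. i < d \<Longrightarrow> l i \<le> hi"
    "\<And>\<alpha> \<beta>. Determinant.det (matf d (\<lambda>i j. \<alpha> * (if i = j then 1 else 0) + \<beta> * S i j)) = (\<Prod>i<d. \<alpha> + \<beta> * l i)"
    "(\<Sum>i<d. \<Sum>j<d. (S i j - (if i = j then 1 else 0))\<^sup>2) = (\<Sum>i<d. (l i - 1)\<^sup>2)"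
proof -
  let ?A = "map_mat complex_of_real (matf d S)"
  have A: "?A \<in> carrier_mat d d" by simp
  obtain as where "char_poly ?A = (\<Prod>a\<leftarrow>as. [:- a, 1:])" using char_poly_factorized[OF A] by blast
  from schur_decomposition_exists[OF A this] obtain B where
    B: "B \<in> carrier_mat d d" "upper_triangular B" "similar_mat ?A B" by blast
  from B(3) obtain P Q where w: "similar_mat_wit ?A B P Q" unfolding similar_mat_def by blast
  note W = similar_mat_witD2[OF A w]
  have "\<exists>l. B $$ (i, i) = complex_of_real l \<and> lo \<le> l \<and> l \<le> hi" if "i < d" for i
  proof (rule real_eigenvalue[OF sym lo hi])
    have "B $$ (i, i) \<in> set (diag_mat B)" using that B(1) by (auto simp: diag_mat_def)
    then have "poly (\<Prod>a\<leftarrow>diag_mat B. [:- a, 1:]) (B $$ (i, i)) = 0"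
      by (auto simp: poly_prod_list prod_list_zero_iff o_def image_iff)
    then have "poly (char_poly ?A) (B $$ (i, i)) = 0"
      unfolding char_poly_similar[OF B(3)] char_poly_upper_triangular[OF B(1,2)] .
    then show "eigenvalue ?A (B $$ (i, i))" using eigenvalue_root_char_poly[OF A] by simp
  qed
  then obtain l where l: "\<And>i. i < d \<Longrightarrow> B $$ (i, i) = complex_of_real (l i)"
    "\<And>i. i < d \<Longrightarrow> lo \<le> l i" "\<And>i. i < d \<Longrightarrow> l i \<le> hi" by metis
  have aff: "a \<cdot>\<^sub>m 1\<^sub>m d + b \<cdot>\<^sub>m ?A = P * (a \<cdot>\<^sub>m 1\<^sub>m d + b \<cdot>\<^sub>m B) * Q" for a b :: complex
  proof -
    have "P * (a \<cdot>\<^sub>m 1\<^sub>m d + b \<cdot>\<^sub>m B) * Q = (P * (a \<cdot>\<^sub>m 1\<^sub>m d) + P * (b \<cdot>\<^sub>m B)) * Q"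
      using W by (subst mult_add_distrib_mat[of _ d d]) auto
    also have "\<dots> = P * (a \<cdot>\<^sub>m 1\<^sub>m d) * Q + P * (b \<cdot>\<^sub>m B) * Q"
      using W by (subst add_mult_distrib_mat[of _ d d]) auto
    also have "P * (a \<cdot>\<^sub>m 1\<^sub>m d) * Q = a \<cdot>\<^sub>m 1\<^sub>m d"
      unfolding mult_smult_distrib[OF W(6) one_carrier_mat] right_mult_one_mat[OF W(6)]
        mult_smult_assoc_mat[OF W(6,7)] W(1) ..
    also have "P * (b \<cdot>\<^sub>m B) * Q = b \<cdot>\<^sub>m ?A"
      unfolding mult_smult_distrib[OF W(6,5)] mult_smult_assoc_mat[OF mult_carrier_mat[OF W(6,5)] W(7)] W(3)[symmetric] ..
    finally show ?thesis ..
  qed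
  have utri: "upper_triangular (a \<cdot>\<^sub>m 1\<^sub>m d + b \<cdot>\<^sub>m B)" for a b :: complex
    using B(1,2) by (auto simp: upper_triangular_def)
  have det: "Determinant.det (matf d (\<lambda>i j. \<alpha> * (if i = j then 1 else 0) + \<beta> * S i j)) = (\<Prod>i<d. \<alpha> + \<beta> * l i)" for \<alpha> \<beta>
  proof -
    let ?a = "complex_of_real \<alpha>" and ?b = "complex_of_real \<beta>"
    have "complex_of_real (Determinant.det (matf d (\<lambda>i j. \<alpha> * (if i = j then 1 else 0) + \<beta> * S i j)))
      = Determinant.det (map_mat complex_of_real (matf d (\<lambda>i j. \<alpha> * (if i = j then 1 else 0) + \<beta> * S i j)))"
      by (rule of_real_hom.hom_det[symmetric])
    also have "map_mat complex_of_real (matf d (\<lambda>i j. \<alpha> * (if i = j then 1 else 0) + \<beta> * S i j)) = ?a \<cdot>\<^sub>m 1\<^sub>m d + ?b \<cdot>\<^sub>m ?A"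
      by (rule eq_matI) auto
    also have "Determinant.det (?a \<cdot>\<^sub>m 1\<^sub>m d + ?b \<cdot>\<^sub>m ?A) = Determinant.det (?a \<cdot>\<^sub>m 1\<^sub>m d + ?b \<cdot>\<^sub>m B)"
    proof (rule det_similar)
      show "similar_mat (?a \<cdot>\<^sub>m 1\<^sub>m d + ?b \<cdot>\<^sub>m ?A) (?a \<cdot>\<^sub>m 1\<^sub>m d + ?b \<cdot>\<^sub>m B)"
        using W by (intro similar_matI[OF _ W(1,2) aff]) auto
    qed
    also have "\<dots> = prod_list (diag_mat (?a \<cdot>\<^sub>m 1\<^sub>m d + ?b \<cdot>\<^sub>m B))"
      by (rule det_upper_triangular[OF utri, of _ _ d]) (use B in auto)
    also have "\<dots> = (\<Prod>i<d. ?a + ?b * complex_of_real (l i))"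
    proof -
      have "diag_mat (?a \<cdot>\<^sub>m 1\<^sub>m d + ?b \<cdot>\<^sub>m B) = map (\<lambda>i. ?a + ?b * complex_of_real (l i)) [0..<d]"
        using B(1) l(1) by (auto simp: diag_mat_def)
      then show ?thesis by (simp add: prod.distinct_set_conv_list[symmetric] atLeast0LessThan)
    qed
    also have "\<dots> = complex_of_real (\<Prod>i<d. \<alpha> + \<beta> * l i)" by simp
    finally show ?thesis by (simp only: of_real_eq_iff)
  qed
  \<comment> \<open>\<open>S - I\<close> and its triangular form. By symmetry the trace of the
    square of the first is the squared Frobenius distance from the identity; for the second only
    diagonal products survive.\<close>
  let ?E = "- 1 \<cdot>\<^sub>m 1\<^sub>m d + 1 \<cdot>\<^sub>m ?A" and ?F = "- 1 \<cdot>\<^sub>m 1\<^sub>m d + 1 \<cdot>\<^sub>m B"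
  have c: "?E \<in> carrier_mat d d" "?F \<in> carrier_mat d d" using B(1) by auto
  have EF: "?E = P * ?F * Q" by (rule aff)
  have "(P * X * Q) * (P * X * Q) = P * (X * X) * Q" if X: "X \<in> carrier_mat d d" for X
  proof -
    have "Q * (P * X * Q) = Q * (P * X) * Q"
      using W X by (intro assoc_mult_mat[symmetric, of _ d d _ d _ d]) auto
    also have "Q * (P * X) = Q * P * X"
      using W X by (intro assoc_mult_mat[symmetric, of _ d d _ d _ d]) auto
    also have "Q * P * X = X" unfolding W(2) using X by simp
    finally have QX: "Q * (P * X * Q) = X * Q" .
    have "(P * X * Q) * (P * X * Q) = P * X * (Q * (P * X * Q))"
      using W X by (intro assoc_mult_mat[of _ d d _ d _ d]) auto
    also have "\<dots> = P * X * X * Q"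
      unfolding QX using W X by (intro assoc_mult_mat[symmetric, of _ d d _ d _ d]) auto
    also have "P * X * X = P * (X * X)"
      using W X by (intro assoc_mult_mat[of _ d d _ d _ d]) auto
    finally show ?thesis .
  qed
  then have "?E * ?E = P * (?F * ?F) * Q" unfolding EF using c(2) by blast
  also have "mtrace (P * (?F * ?F) * Q) = mtrace (Q * (P * (?F * ?F)))"
    using W c by (intro mtrace_commute[of _ d]) auto
  also have "Q * (P * (?F * ?F)) = (Q * P) * (?F * ?F)"
    using W c by (intro assoc_mult_mat[symmetric, of _ d d _ d _ d]) auto
  also have "\<dots> = ?F * ?F" unfolding W(2) using c by (intro left_mult_one_mat[of _ d d]) auto
  finally have tr: "mtrace (?E * ?E) = mtrace (?F * ?F)" .
  have "mtrace (?E * ?E) = (\<Sum>i<d. \<Sum>j<d. ?E $$ (i, j) * ?E $$ (j, i))"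
    by (rule mtrace_mult[OF c(1) c(1)])
  also have "\<dots> = (\<Sum>i<d. \<Sum>j<d. complex_of_real ((S i j - (if i = j then 1 else 0))\<^sup>2))"
  proof (intro sum.cong refl)
    fix i j assume "i \<in> {..<d}" "j \<in> {..<d}"
    then have "?E $$ (i, j) = complex_of_real (S i j - (if i = j then 1 else 0))"
      "?E $$ (j, i) = complex_of_real (S i j - (if i = j then 1 else 0))"
      using sym[of i j] by auto
    then show "?E $$ (i, j) * ?E $$ (j, i) = complex_of_real ((S i j - (if i = j then 1 else 0))\<^sup>2)"
      by (simp add: power2_eq_square)
  qed
  also have "\<dots> = complex_of_real (\<Sum>i<d. \<Sum>j<d. (S i j - (if i = j then 1 else 0))\<^sup>2)" by simp
  finally have 1: "mtrace (?E * ?E) = complex_of_real (\<Sum>i<d. \<Sum>j<d. (S i j - (if i = j then 1 else 0))\<^sup>2)" .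
  have "mtrace (?F * ?F) = (\<Sum>i<d. \<Sum>j<d. ?F $$ (i, j) * ?F $$ (j, i))"
    by (rule mtrace_mult[OF c(2) c(2)])
  also have "\<dots> = (\<Sum>i<d. \<Sum>j<d. if j = i then complex_of_real ((l i - 1)\<^sup>2) else 0)"
  proof (intro sum.cong refl)
    fix i j assume ij: "i \<in> {..<d}" "j \<in> {..<d}"
    show "?F $$ (i, j) * ?F $$ (j, i) = (if j = i then complex_of_real ((l i - 1)\<^sup>2) else 0)"
    proof (cases "j = i")
      case True
      then show ?thesis using ij l(1)[of i] B(1) by (simp add: power2_eq_square algebra_simps)
    next
      case False
      then have "B $$ (i, j) = 0 \<or> B $$ (j, i) = 0"
        using ij B(1,2) unfolding upper_triangular_def by (metis carrier_matD(1) lessThan_iff linorder_neqE_nat)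
      then show ?thesis using ij False B(1) by auto
    qed
  qed
  also have "\<dots> = complex_of_real (\<Sum>i<d. (l i - 1)\<^sup>2)" by simp
  finally have "(\<Sum>i<d. \<Sum>j<d. (S i j - (if i = j then 1 else 0))\<^sup>2) = (\<Sum>i<d. (l i - 1)\<^sup>2)"
    using 1 tr by (simp only: of_real_eq_iff)
  then show ?thesis using that l(2,3) det by blast
qed

section \<open>Change of measure\<close>

lemma scalar_prod_qf:
  assumes "A \<in> carrier_mat d d"
  shows "scalar_prod (Matrix.vec d x) (A *\<^sub>v Matrix.vec d x) = qf d (\<lambda>i j. A $$ (i, j)) x"
proof -
  have "scalar_prod (Matrix.vec d x) (A *\<^sub>v Matrix.vec d x) = (\<Sum>i<d. x i * (\<Sum>j<d. A $$ (i, j) * x j))"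
    using assms by (auto simp: scalar_prod_def atLeast0LessThan intro!: sum.cong)
  then show ?thesis unfolding qf_def sum_distrib_left by (simp add: mult_ac)
qed

lemma matf_eq: "A \<in> carrier_mat d d \<Longrightarrow> matf d (\<lambda>i j. A $$ (i, j)) = A"
  by (rule eq_matI) auto

abbreviation delta :: "nat \<Rightarrow> nat \<Rightarrow> real" where "delta i j \<equiv> if i = j then 1 else 0"

lemma qf_affine: "qf d (\<lambda>i j. \<alpha> * delta i j + \<beta> * M i j) x = \<alpha> * dotp d x x + \<beta> * qf d M x"
proof -
  have "qf d (\<lambda>i j. \<alpha> * delta i j + \<beta> * M i j) x = (\<Sum>i<d. \<Sum>j<d. (if j = i then \<alpha> * (x i * x i) else 0) + \<beta> * (M i j * x i * x j))"
    unfolding qf_def by (intro sum.cong refl) (auto simp: algebra_simps)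
  also have "\<dots> = \<alpha> * dotp d x x + \<beta> * qf d M x"
    unfolding sum.distrib qf_def dotp_def sum_distrib_left by (simp add: sum.delta)
  finally show ?thesis .
qed

lemma qf_dotp: "qf d M x = dotp d x (\<lambda>i. \<Sum>j<d. M i j * x j)"
  unfolding qf_def dotp_def sum_distrib_left by (simp add: mult_ac)

lemma qf_scale: "qf d M (\<lambda>i. c * x i) = c\<^sup>2 * qf d M x"
  unfolding qf_def sum_distrib_left by (intro sum.cong refl) (simp add: power2_eq_square)

lemma dotp_Cauchy_Schwarz: "(dotp d x y)\<^sup>2 \<le> dotp d x x * dotp d y y"
  using Cauchy_Schwarz_ineq_sum[of x y "{..<d}"] by (simp add: dotp_def power2_eq_square)

lemma dotp_pos: "\<exists>i<d. x i \<noteq> 0 \<Longrightarrow> 0 < dotp d x x"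
proof -
  assume "\<exists>i<d. x i \<noteq> 0"
  then obtain i where i: "i < d" "x i \<noteq> 0" by blast
  have "0 < x i * x i" using i by (metis not_real_square_gt_zero)
  also have "\<dots> \<le> dotp d x x" unfolding dotp_def using i by (intro member_le_sum) auto
  finally show ?thesis .
qed

section \<open>Positive definite linear systems\<close>

lemma posdef_from_lower:
  assumes "\<And>i j. i < d \<Longrightarrow> j < d \<Longrightarrow> M i j = M j i" "0 < c" "\<And>x. c * dotp d x x \<le> qf d M x"
  shows "posdef d M"
  unfolding posdef_def
proof (intro conjI allI impI)
  fix x :: "nat \<Rightarrow> real" assume "\<exists>i<d. x i \<noteq> 0"
  then have "0 < c * dotp d x x" using assms(2) dotp_pos by simp
  then show "0 < qf d M x" using assms(3)[of x] by linarith
qed (use assms(1) in auto)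

lemma posdef_solve:
  assumes "posdef d M"
  shows "\<exists>w. \<forall>i<d. (\<Sum>j<d. M i j * w j) = b i"
proof -
  have M: "matf d M \<in> carrier_mat d d" by simp
  have "Determinant.det (matf d M) \<noteq> 0" using gauss_integral[OF assms] by simp
  then have "matf d M \<in> Units (ring_mat TYPE(real) d undefined)" by (rule det_non_zero_imp_unit[OF M])
  then obtain B where B: "B \<in> carrier_mat d d" "matf d M * B = 1\<^sub>m d"
    unfolding Units_def ring_mat_simps by auto
  define w where "w = B *\<^sub>v Matrix.vec d b"
  have w: "w \<in> carrier_vec d" unfolding w_def using B by simp
  have "matf d M *\<^sub>v w = Matrix.vec d b"
    unfolding w_def using B M by (subst assoc_mult_mat_vec[symmetric, of _ d d _ d]) auto
  then have "(\<Sum>j<d. M i j * w $ j) = b i" if "i < d" for i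
  proof -
    have "(matf d M *\<^sub>v w) $ i = (\<Sum>j<d. M i j * w $ j)"
      using w that by (auto simp: scalar_prod_def atLeast0LessThan intro!: sum.cong)
    then show ?thesis using \<open>matf d M *\<^sub>v w = Matrix.vec d b\<close> that by simp
  qed
  then show ?thesis by blast
qed

text \<open>Coercivity bounds \<open>|w|^2\<close> by \<open>dotp d w b / c\<close>, and
  Cauchy-Schwarz bounds the square of \<open>dotp d w b\<close> by \<open>|w|^2 |b|^2\<close>; one
  factor cancels.\<close>

lemma posdef_solve_bound:
  assumes c: "0 < c" "\<And>x. c * dotp d x x \<le> qf d M x" and w: "\<And>i. i < d \<Longrightarrow> (\<Sum>j<d. M i j * w j) = b i"
  shows "dotp d w b \<le> dotp d b b / c"
proof -
  have q: "qf d M w = dotp d w b" unfolding qf_dotp using w by (intro dotp_cong) auto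
  show ?thesis
  proof (cases "dotp d w b \<le> 0")
    case True
    then show ?thesis using c(1) dotp_nonneg[of d b] by (smt (verit) divide_nonneg_pos)
  next
    case False
    have "dotp d w w \<le> dotp d w b / c" using c(2)[of w] c(1) q by (simp add: field_simps)
    then have "dotp d w w * dotp d b b \<le> dotp d w b / c * dotp d b b" by (intro mult_right_mono dotp_nonneg)
    then have "(dotp d w b)\<^sup>2 \<le> dotp d w b * (dotp d b b / c)" using dotp_Cauchy_Schwarz[of d w b] by simp
    then have "dotp d w b * dotp d w b \<le> dotp d w b * (dotp d b b / c)" by (simp add: power2_eq_square)
    moreover have "0 < dotp d w b" using False by simp
    ultimately show ?thesis by (rule mult_left_le_imp_le)
  qed
qed

text \<open>The products are the determinant factors of the two chi-square integrals. With
  \<open>t = (l - 1)^2\<close> the single factors are \<open>1 / (1 - t)\<close> and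
  \<open>1 + t / (2 l - 1)\<close>, each at most \<open>exp (2 t)\<close>; for eigenvalues
  \<open>l\<close> the sum of the \<open>t\<close> is the squared Frobenius distance.\<close>

lemma exp_prod_bounds:
  fixes l :: "nat \<Rightarrow> real"
  assumes l: "\<And>i. i < d \<Longrightarrow> 15 / 16 \<le> l i" "\<And>i. i < d \<Longrightarrow> l i \<le> 16 / 15"
  shows "(\<Prod>i<d. 1 / (l i * (2 - l i))) \<le> exp (2 * (\<Sum>i<d. (l i - 1)\<^sup>2))"
    "(\<Prod>i<d. (l i)\<^sup>2 / (2 * l i - 1)) \<le> exp (2 * (\<Sum>i<d. (l i - 1)\<^sup>2))"
proof -
  have e: "exp (2 * (\<Sum>i<d. (l i - 1)\<^sup>2)) = (\<Prod>i<d. exp (2 * (l i - 1)\<^sup>2))"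
    by (simp add: exp_sum[symmetric] sum_distrib_left)
  show "(\<Prod>i<d. 1 / (l i * (2 - l i))) \<le> exp (2 * (\<Sum>i<d. (l i - 1)\<^sup>2))"
    unfolding e
  proof (intro prod_mono conjI)
    fix i assume "i \<in> {..<d}"
    then have li: "15 / 16 \<le> l i" "l i \<le> 16 / 15" using l by auto
    then show "0 \<le> 1 / (l i * (2 - l i))" by simp
    define t where "t = (l i - 1)\<^sup>2"
    have "\<bar>l i - 1\<bar> \<le> 1 / 2" unfolding abs_le_iff using li by linarith
    then have "\<bar>l i - 1\<bar>\<^sup>2 \<le> (1 / 2)\<^sup>2" by (intro power_mono) auto
    then have t: "0 \<le> t" "t \<le> 1 / 4" by (auto simp: t_def power2_eq_square)
    have "1 \<le> (1 - t) * (1 + 2 * t)"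
    proof -
      have "0 \<le> t * (1 - 2 * t)" using t by simp
      then show ?thesis by (simp add: algebra_simps)
    qed
    also have "\<dots> \<le> (1 - t) * exp (2 * t)" using t exp_ge_add_one_self[of "2 * t"] by (intro mult_left_mono) auto
    finally have "1 / (1 - t) \<le> exp (2 * t)" using t by (simp add: field_simps)
    moreover have "l i * (2 - l i) = 1 - t" by (simp add: t_def power2_eq_square algebra_simps)
    ultimately show "1 / (l i * (2 - l i)) \<le> exp (2 * (l i - 1)\<^sup>2)" by (simp add: t_def)
  qed
  show "(\<Prod>i<d. (l i)\<^sup>2 / (2 * l i - 1)) \<le> exp (2 * (\<Sum>i<d. (l i - 1)\<^sup>2))"
    unfolding e
  proof (intro prod_mono conjI)
    fix i assume "i \<in> {..<d}"
    then have li: "15 / 16 \<le> l i" using l by auto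
    then show "0 \<le> (l i)\<^sup>2 / (2 * l i - 1)" by simp
    have p: "0 < 2 * l i - 1" using li by simp
    have "(l i)\<^sup>2 / (2 * l i - 1) = 1 + (l i - 1)\<^sup>2 / (2 * l i - 1)"
      using p by (simp add: field_simps power2_eq_square)
    also have "(l i - 1)\<^sup>2 / (2 * l i - 1) \<le> (l i - 1)\<^sup>2 / (1 / 2)"
      using li p by (intro divide_left_mono) auto
    also have "1 + (l i - 1)\<^sup>2 / (1 / 2) \<le> exp (2 * (l i - 1)\<^sup>2)" using exp_ge_add_one_self[of "2 * (l i - 1)\<^sup>2"] by (simp add: mult.commute)
    finally show "(l i)\<^sup>2 / (2 * l i - 1) \<le> exp (2 * (l i - 1)\<^sup>2)" by simp
  qed
qed

text \<open>\<open>K^2\<close> bounds the chi-square integral. Splitting \<open>f\<close> as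
  \<open>f / sqrt g\<close> times \<open>sqrt g\<close> shows that sets of small
  \<open>g\<close>-mass have small \<open>f\<close>-mass, at the price of a square root.\<close>

lemma density_Cauchy_Schwarz:
  fixes f g :: "'a \<Rightarrow> real"
  assumes [measurable]: "f \<in> borel_measurable M" "g \<in> borel_measurable M" "B \<in> sets M"
    and f: "\<And>x. 0 \<le> f x" and g: "\<And>x. 0 < g x"
    and K: "(\<integral>\<^sup>+x. ennreal ((f x)\<^sup>2 / g x) \<partial>M) \<le> ennreal (K\<^sup>2)" "0 \<le> K"
    and p: "prob_space (density M f)" "prob_space (density M g)"
  shows "measure (density M f) B \<le> K * sqrt (measure (density M g) B)"
proof -
  interpret F: prob_space "density M f" by fact
  interpret G: prob_space "density M g" by fact
  have "ennreal ((measure (density M f) B)\<^sup>2) = (emeasure (density M f) B)\<^sup>2"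
    by (simp add: F.emeasure_eq_measure ennreal_power)
  also have "emeasure (density M f) B = (\<integral>\<^sup>+x. ennreal (f x / sqrt (g x)) * (ennreal (sqrt (g x)) * indicator B x) \<partial>M)"
  proof (subst emeasure_density)
    have "ennreal (f x) = ennreal (f x / sqrt (g x)) * ennreal (sqrt (g x))" for x
      using f[of x] g[of x] by (subst ennreal_mult'[symmetric]) auto
    then show "(\<integral>\<^sup>+x. ennreal (f x) * indicator B x \<partial>M) = (\<integral>\<^sup>+x. ennreal (f x / sqrt (g x)) * (ennreal (sqrt (g x)) * indicator B x) \<partial>M)"
      by (simp add: mult.assoc)
  qed auto
  also have "\<dots>\<^sup>2 \<le> (\<integral>\<^sup>+x. (ennreal (f x / sqrt (g x)))\<^sup>2 \<partial>M) * (\<integral>\<^sup>+x. (ennreal (sqrt (g x)) * indicator B x)\<^sup>2 \<partial>M)"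
    by (rule Cauchy_Schwarz_nn_integral) measurable
  also have "(\<integral>\<^sup>+x. (ennreal (f x / sqrt (g x)))\<^sup>2 \<partial>M) = (\<integral>\<^sup>+x. ennreal ((f x)\<^sup>2 / g x) \<partial>M)"
    using f g by (intro nn_integral_cong) (simp add: ennreal_power power_divide less_imp_le)
  also have "(\<integral>\<^sup>+x. (ennreal (sqrt (g x)) * indicator B x)\<^sup>2 \<partial>M) = (\<integral>\<^sup>+x. ennreal (g x) * indicator B x \<partial>M)"
    using g by (intro nn_integral_cong) (auto simp: indicator_def ennreal_power less_imp_le)
  also have "\<dots> = emeasure (density M g) B" by (simp add: emeasure_density)
  also have "(\<integral>\<^sup>+x. ennreal ((f x)\<^sup>2 / g x) \<partial>M) * emeasure (density M g) B \<le> ennreal (K\<^sup>2) * emeasure (density M g) B"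
    by (intro mult_right_mono K) simp
  also have "\<dots> = ennreal (K\<^sup>2 * measure (density M g) B)"
    by (simp add: G.emeasure_eq_measure ennreal_mult')
  finally have "(measure (density M f) B)\<^sup>2 \<le> K\<^sup>2 * measure (density M g) B"
    by (subst (asm) ennreal_le_iff) auto
  then have "measure (density M f) B \<le> sqrt (K\<^sup>2 * measure (density M g) B)" by (rule real_le_rsqrt)
  then show ?thesis using K(2) by (simp add: real_sqrt_mult)
qed

section \<open>The Gaussian in isotropic position and its precision matrix\<close>

locale near_isotropic =
  fixes d :: nat and a :: real and \<mu> :: "nat \<Rightarrow> real" and \<Sigma> :: "real mat"
  assumes iso: "isotropic_position d a (1 / 16) \<mu> \<Sigma>"
begin

abbreviation "S i j \<equiv> \<Sigma> $$ (i, j)"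

lemma carr: "\<Sigma> \<in> carrier_mat d d" and sym: "i < d \<Longrightarrow> j < d \<Longrightarrow> S i j = S j i"
proof -
  have p: "psd_mat d \<Sigma>" using iso unfolding isotropic_position_def by blast
  then show c: "\<Sigma> \<in> carrier_mat d d" unfolding psd_mat_def by blast
  have "transpose_mat \<Sigma> = \<Sigma>" using p unfolding psd_mat_def by blast
  then show "i < d \<Longrightarrow> j < d \<Longrightarrow> S i j = S j i" using c by (metis carrier_matD index_transpose_mat(1))
qed

lemma lower: "15 / 16 * dotp d x x \<le> qf d S x" and upper: "qf d S x \<le> 16 / 15 * dotp d x x"
proof -
  have "psd_mat d (\<Sigma> - (1 - 1 / 16) \<cdot>\<^sub>m 1\<^sub>m d)" "psd_mat d ((1 / (1 - 1 / 16)) \<cdot>\<^sub>m 1\<^sub>m d - \<Sigma>)"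
    using iso unfolding isotropic_position_def by blast+
  then have "0 \<le> scalar_prod (Matrix.vec d x) ((\<Sigma> - (1 - 1 / 16) \<cdot>\<^sub>m 1\<^sub>m d) *\<^sub>v Matrix.vec d x)"
    "0 \<le> scalar_prod (Matrix.vec d x) (((1 / (1 - 1 / 16)) \<cdot>\<^sub>m 1\<^sub>m d - \<Sigma>) *\<^sub>v Matrix.vec d x)"
    unfolding psd_mat_def by auto
  moreover have "qf d (\<lambda>i j. (\<Sigma> - (1 - 1 / 16) \<cdot>\<^sub>m 1\<^sub>m d) $$ (i, j)) x = qf d (\<lambda>i j. - (15 / 16) * delta i j + 1 * S i j) x"
    unfolding qf_def using carr by (intro sum.cong refl) auto
  moreover have "qf d (\<lambda>i j. ((1 / (1 - 1 / 16)) \<cdot>\<^sub>m 1\<^sub>m d - \<Sigma>) $$ (i, j)) x = qf d (\<lambda>i j. 16 / 15 * delta i j + - 1 * S i j) x"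
    unfolding qf_def using carr by (intro sum.cong refl) auto
  ultimately show "15 / 16 * dotp d x x \<le> qf d S x" "qf d S x \<le> 16 / 15 * dotp d x x"
    using carr by (simp_all only: scalar_prod_qf[OF minus_carrier_mat[OF smult_carrier_mat[OF one_carrier_mat]]]
        scalar_prod_qf[OF minus_carrier_mat[OF carr]] qf_affine)
qed

lemma mean: "dotp d \<mu> \<mu> \<le> a"
  using iso unfolding isotropic_position_def nrm_eq_L2_set[symmetric] nrm_sq by blast

lemma frob: "(\<Sum>i<d. \<Sum>j<d. (S i j - delta i j)\<^sup>2) \<le> a"
proof -
  have "(frob_norm (\<Sigma> - 1\<^sub>m d))\<^sup>2 = (\<Sum>i<d. \<Sum>j<d. (S i j - delta i j)\<^sup>2)"
    using carr unfolding frob_norm_def by (simp add: sum_nonneg)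
  then show ?thesis using iso unfolding isotropic_position_def by simp
qed

lemma a0: "0 \<le> a" using mean dotp_nonneg[of d \<mu>] by linarith

lemma det_pos: "0 < Determinant.det \<Sigma>"
  using gauss_integral[OF posdef_from_lower[OF sym _ lower]] matf_eq[OF carr] by simp

definition P :: "real mat" where "P = the (mat_inverse \<Sigma>)"

abbreviation "p i j \<equiv> P $$ (i, j)"

lemma P: "P \<in> carrier_mat d d" "\<Sigma> * P = 1\<^sub>m d" "P * \<Sigma> = 1\<^sub>m d"
proof -
  obtain B where B: "mat_inverse \<Sigma> = Some B"
  proof (cases "mat_inverse \<Sigma>")
    case None
    have "\<Sigma> \<in> Units (ring_mat TYPE(real) d undefined)"
      using det_pos by (intro det_non_zero_imp_unit[OF carr]) simp
    then show ?thesis using mat_inverse(1)[OF carr None, of undefined] by blast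
  qed
  show "P \<in> carrier_mat d d" "\<Sigma> * P = 1\<^sub>m d" "P * \<Sigma> = 1\<^sub>m d"
    using mat_inverse(2)[OF carr B] B by (auto simp: P_def)
qed

lemma P_sym: "i < d \<Longrightarrow> j < d \<Longrightarrow> p i j = p j i"
proof -
  have "transpose_mat \<Sigma> = \<Sigma>" using iso unfolding isotropic_position_def psd_mat_def by blast
  then have "transpose_mat P * \<Sigma> = 1\<^sub>m d"
    using transpose_mult[OF carr P(1)] P(2) by simp
  have PT: "transpose_mat P \<in> carrier_mat d d" using P(1) by simp
  have "transpose_mat P = transpose_mat P * (\<Sigma> * P)" unfolding P(2) using PT by simp
  also have "\<dots> = transpose_mat P * \<Sigma> * P" by (rule assoc_mult_mat[OF PT carr P(1), symmetric])
  also have "\<dots> = P" unfolding \<open>transpose_mat P * \<Sigma> = 1\<^sub>m d\<close> using P(1) by simp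
  finally have "transpose_mat P = P" .
  then show "i < d \<Longrightarrow> j < d \<Longrightarrow> p i j = p j i" using P(1) by (metis carrier_matD index_transpose_mat(1))
qed

lemma SP: "i < d \<Longrightarrow> j < d \<Longrightarrow> (\<Sum>k<d. S i k * p k j) = delta i j"
proof -
  assume ij: "i < d" "j < d"
  have "(\<Sigma> * P) $$ (i, j) = (\<Sum>k<d. S i k * p k j)"
    using carr P(1) ij by (auto simp: scalar_prod_def atLeast0LessThan intro!: sum.cong)
  then show ?thesis using P(2) ij by simp
qed

text \<open>The two bounds for \<open>\<Sigma>\<close> are reciprocal to each other, so its inverse
  satisfies the same two.\<close>

lemma P_bounds: "15 / 16 * dotp d v v \<le> qf d p v" "qf d p v \<le> 16 / 15 * dotp d v v"
proof -
  define u where "u i = (\<Sum>j<d. p i j * v j)" for i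
  have Su: "(\<Sum>k<d. S i k * u k) = v i" if "i < d" for i
  proof -
    have "(\<Sum>k<d. S i k * u k) = (\<Sum>j<d. (\<Sum>k<d. S i k * p k j) * v j)"
      unfolding u_def sum_distrib_left sum_distrib_right by (subst sum.swap) (simp add: mult_ac)
    also have "\<dots> = (\<Sum>j<d. if j = i then v j else 0)" using SP that by (intro sum.cong) auto
    finally show ?thesis using that by (simp add: sum.delta)
  qed
  have q: "qf d p v = dotp d v u" unfolding qf_dotp u_def ..
  have qS: "qf d S u = dotp d v u"
    unfolding qf_dotp using Su by (subst dotp_commute) (intro dotp_cong, auto)
  \<comment> \<open>The form of \<open>\<Sigma>\<close> is nonnegative at \<open>u - c v\<close>,
    with \<open>u = P v\<close> and \<open>c = 15 / 16\<close>. It equals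
    \<open>c^2 qf(v) - 2 c |v|^2 + v.u\<close>, and \<open>qf(v) \<le> |v|^2 / c\<close> leaves
    \<open>v.u \<ge> c |v|^2\<close>.\<close>
  have "0 \<le> 15 / 16 * dotp d (\<lambda>i. u i + - (15 / 16) * v i) (\<lambda>i. u i + - (15 / 16) * v i)" by (simp add: dotp_nonneg)
  also have "\<dots> \<le> qf d S (\<lambda>i. u i + - (15 / 16) * v i)" by (rule lower)
  also have "\<dots> = qf d S (\<lambda>i. - (15 / 16) * v i + u i)" by (simp add: add.commute)
  also have "\<dots> = qf d S (\<lambda>i. - (15 / 16) * v i) + 2 * dotp d (\<lambda>i. - (15 / 16) * v i) (\<lambda>i. \<Sum>j<d. S i j * u j) + qf d S u"
    by (rule qf_add) (rule sym)
  also have "dotp d (\<lambda>i. - (15 / 16) * v i) (\<lambda>i. \<Sum>j<d. S i j * u j) = - (15 / 16) * dotp d v v"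
    unfolding dotp_scale using Su by (intro arg_cong2[where f = "(*)"] dotp_cong) auto
  also have "qf d S (\<lambda>i. - (15 / 16) * v i) = (15 / 16)\<^sup>2 * qf d S v" unfolding qf_scale by simp
  finally have "0 \<le> (15 / 16)\<^sup>2 * qf d S v + 2 * (- (15 / 16) * dotp d v v) + dotp d v u" unfolding qS .
  then show "15 / 16 * dotp d v v \<le> qf d p v" using upper[of v] unfolding q by (simp add: power2_eq_square)
  show "qf d p v \<le> 16 / 15 * dotp d v v"
  proof (cases "dotp d v u \<le> 0")
    case True
    then show ?thesis unfolding q using dotp_nonneg[of d v] by linarith
  next
    case False
    have "dotp d u u \<le> 16 / 15 * dotp d v u" using lower[of u] unfolding qS by simp
    then have "dotp d v v * dotp d u u \<le> dotp d v v * (16 / 15 * dotp d v u)" by (intro mult_left_mono dotp_nonneg)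
    then have "(dotp d v u)\<^sup>2 \<le> (16 / 15 * dotp d v v) * dotp d v u" using dotp_Cauchy_Schwarz[of d v u] by simp
    then show ?thesis unfolding q using False by (simp add: power2_eq_square)
  qed
qed

definition dens :: "(nat \<Rightarrow> real) \<Rightarrow> real" where
  "dens x = exp (- qf d p (\<lambda>i. x i - \<mu> i) / 2) / sqrt ((2 * pi) ^ d * Determinant.det \<Sigma>)"

lemma dens_measurable [measurable]: "dens \<in> borel_measurable (Rd d)"
  unfolding dens_def by measurable

lemma dens_pos: "0 < dens x" unfolding dens_def using det_pos by simp

lemma gaussian_eq: "gaussian d \<mu> \<Sigma> = density (Rd d) (\<lambda>x. ennreal (dens x))"
  unfolding gaussian_def Let_def P_def[symmetric] scalar_prod_qf[OF P(1)] dens_def ..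

end

context near_isotropic
begin

text \<open>\<open>\<Sigma> (\<alpha> I + \<beta> P) = \<beta> I + \<alpha> \<Sigma>\<close>, so the
  precision matrix requires no spectral analysis of its own.\<close>

lemma det_affine:
  assumes l: "\<And>\<alpha> \<beta>. Determinant.det (matf d (\<lambda>i j. \<alpha> * delta i j + \<beta> * S i j)) = (\<Prod>i<d. \<alpha> + \<beta> * l i)"
  shows "Determinant.det \<Sigma> * Determinant.det (matf d (\<lambda>i j. \<alpha> * delta i j + \<beta> * p i j)) = (\<Prod>i<d. \<beta> + \<alpha> * l i)"
proof -
  let ?M = "matf d (\<lambda>i j. \<alpha> * delta i j + \<beta> * p i j)"
  have "\<Sigma> * ?M = matf d (\<lambda>i j. \<beta> * delta i j + \<alpha> * S i j)"
  proof (rule eq_matI)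
    fix i j assume "i < dim_row (matf d (\<lambda>i j. \<beta> * delta i j + \<alpha> * S i j))" "j < dim_col (matf d (\<lambda>i j. \<beta> * delta i j + \<alpha> * S i j))"
    then have ij: "i < d" "j < d" by auto
    have "(\<Sigma> * ?M) $$ (i, j) = (\<Sum>k<d. S i k * (\<alpha> * delta k j + \<beta> * p k j))"
      using carr ij by (auto simp: scalar_prod_def atLeast0LessThan intro!: sum.cong)
    also have "\<dots> = (\<Sum>k<d. (if k = j then \<alpha> * S i k else 0) + \<beta> * (S i k * p k j))"
      by (intro sum.cong refl) (auto simp: algebra_simps)
    also have "\<dots> = \<alpha> * S i j + \<beta> * delta i j"
      unfolding sum.distrib sum_distrib_left[symmetric] SP[OF ij] using ij by (simp add: sum.delta)
    finally show "(\<Sigma> * ?M) $$ (i, j) = matf d (\<lambda>i j. \<beta> * delta i j + \<alpha> * S i j) $$ (i, j)"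
      using ij by (simp add: add.commute)
  qed (use carr in auto)
  then have "Determinant.det (\<Sigma> * ?M) = (\<Prod>i<d. \<beta> + \<alpha> * l i)" by (simp only: l)
  then show ?thesis using det_mult[OF carr, of ?M] by simp
qed

text \<open>One fixed choice of eigenvalues, shared by the normalisation and by both chi-square
  integrals.\<close>

definition ev :: "nat \<Rightarrow> real" where
  "ev = (SOME l. (\<forall>i<d. 15 / 16 \<le> l i \<and> l i \<le> 16 / 15) \<and>
     (\<forall>\<alpha> \<beta>. Determinant.det (matf d (\<lambda>i j. \<alpha> * delta i j + \<beta> * S i j)) = (\<Prod>i<d. \<alpha> + \<beta> * l i)) \<and>
     (\<Sum>i<d. \<Sum>j<d. (S i j - delta i j)\<^sup>2) = (\<Sum>i<d. (l i - 1)\<^sup>2))"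

lemma ev_props:
  "(\<forall>i<d. 15 / 16 \<le> ev i \<and> ev i \<le> 16 / 15) \<and>
   (\<forall>\<alpha> \<beta>. Determinant.det (matf d (\<lambda>i j. \<alpha> * delta i j + \<beta> * S i j)) = (\<Prod>i<d. \<alpha> + \<beta> * ev i)) \<and>
   (\<Sum>i<d. \<Sum>j<d. (S i j - delta i j)\<^sup>2) = (\<Sum>i<d. (ev i - 1)\<^sup>2)"
proof -
  obtain l where l: "\<And>i. i < d \<Longrightarrow> 15 / 16 \<le> l i" "\<And>i. i < d \<Longrightarrow> l i \<le> 16 / 15"
    "\<And>\<alpha> \<beta>. Determinant.det (matf d (\<lambda>i j. \<alpha> * delta i j + \<beta> * S i j)) = (\<Prod>i<d. \<alpha> + \<beta> * l i)"
    "(\<Sum>i<d. \<Sum>j<d. (S i j - delta i j)\<^sup>2) = (\<Sum>i<d. (l i - 1)\<^sup>2)"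
    using sym_spectrum[OF sym lower upper] by blast
  show ?thesis unfolding ev_def by (rule someI[of _ l]) (use l in auto)
qed

lemma ev_bounds: "i < d \<Longrightarrow> 15 / 16 \<le> ev i" "i < d \<Longrightarrow> ev i \<le> 16 / 15"
  using ev_props by auto

lemma det_eq_ev: "Determinant.det \<Sigma> = (\<Prod>i<d. ev i)"
proof -
  have "matf d (\<lambda>i j. 0 * delta i j + 1 * S i j) = \<Sigma>" using carr by (intro eq_matI) auto
  moreover have "Determinant.det (matf d (\<lambda>i j. 0 * delta i j + 1 * S i j)) = (\<Prod>i<d. 0 + 1 * ev i)"
    using ev_props by blast
  ultimately show ?thesis by simp
qed

lemma det_affine_ev:
  "Determinant.det \<Sigma> * Determinant.det (matf d (\<lambda>i j. \<alpha> * delta i j + \<beta> * p i j)) = (\<Prod>i<d. \<beta> + \<alpha> * ev i)"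
  using ev_props by (intro det_affine) blast

lemma sum_ev: "(\<Sum>i<d. (ev i - 1)\<^sup>2) \<le> a"
  using frob ev_props by simp

section \<open>Total mass and the two chi-square integrals\<close>

lemma posdef_affine:
  assumes "0 < c" "\<And>x. c * dotp d x x \<le> \<alpha> * dotp d x x + \<beta> * qf d p x"
  shows "posdef d (\<lambda>i j. \<alpha> * delta i j + \<beta> * p i j)"
  using assms by (intro posdef_from_lower[of d _ c]) (auto simp: P_sym qf_affine)

text \<open>Common shape of three integrals, centred at \<open>\<mu>\<close>: the total mass has
  \<open>\<alpha> = 0, \<beta> = 1\<close>, the chi-square integrals have
  \<open>\<alpha> = -1, \<beta> = 2\<close> and \<open>\<alpha> = 2, \<beta> = -1\<close>. The bound
  on \<open>dotp d w b\<close> controls the contribution of the mean.\<close>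

lemma moment_exponent:
  assumes c: "0 < c" "\<And>x. c * dotp d x x \<le> \<alpha> * dotp d x x + \<beta> * qf d p x"
  shows "\<exists>w. dotp d w b \<le> dotp d b b / c \<and>
    (\<integral>\<^sup>+x. ennreal (K * exp (- (\<alpha> * dotp d (\<lambda>i. x i - \<mu> i) (\<lambda>i. x i - \<mu> i) + \<beta> * qf d p (\<lambda>i. x i - \<mu> i)) / 2
        + dotp d (\<lambda>i. x i - \<mu> i) b)) \<partial>Rd d)
      = ennreal K * ennreal (sqrt ((2 * pi) ^ d / Determinant.det (matf d (\<lambda>i j. \<alpha> * delta i j + \<beta> * p i j))) * exp (dotp d w b / 2))"
proof -
  let ?M = "\<lambda>i j. \<alpha> * delta i j + \<beta> * p i j"
  have pd: "posdef d ?M" using c by (rule posdef_affine)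
  obtain w where w: "\<forall>i<d. (\<Sum>j<d. ?M i j * w j) = b i" using posdef_solve[OF pd] by (rule exE)
  note w = w[rule_format]
  have "dotp d w b \<le> dotp d b b / c"
    by (rule posdef_solve_bound[OF c(1) _ w]) (simp_all add: c(2) qf_affine)
  moreover have "(\<integral>\<^sup>+x. ennreal (K * exp (- qf d ?M (\<lambda>i. x i - \<mu> i) / 2 + dotp d (\<lambda>i. x i - \<mu> i) b)) \<partial>Rd d)
    = ennreal K * ennreal (sqrt ((2 * pi) ^ d / Determinant.det (matf d ?M)) * exp (dotp d w b / 2))"
  proof -
    let ?e = "\<lambda>x. exp (- qf d ?M (\<lambda>i. x i - \<mu> i) / 2 + dotp d (\<lambda>i. x i - \<mu> i) b)"
    have m: "(\<lambda>x. ennreal (?e x)) \<in> borel_measurable (Rd d)" by measurable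
    have "(\<integral>\<^sup>+x. ennreal (K * ?e x) \<partial>Rd d) = (\<integral>\<^sup>+x. ennreal K * ennreal (?e x) \<partial>Rd d)"
      by (intro nn_integral_cong ennreal_mult'') simp
    also have "\<dots> = ennreal K * (\<integral>\<^sup>+x. ennreal (?e x) \<partial>Rd d)" by (rule nn_integral_cmult[OF m])
    also note gauss_linear[OF pd w, of \<mu>]
    finally show ?thesis .
  qed
  ultimately show ?thesis unfolding qf_affine by blast
qed

lemma sqrt_2pi: "sqrt (2 * pi) ^ d = sqrt ((2 * pi) ^ d)" by (rule real_sqrt_power[symmetric])

lemma total_mass: "(\<integral>\<^sup>+x. ennreal (dens x) \<partial>Rd d) = 1"
proof -
  let ?K = "1 / sqrt ((2 * pi) ^ d * Determinant.det \<Sigma>)"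
  let ?D = "Determinant.det (matf d (\<lambda>i j. 0 * delta i j + 1 * p i j))"
  have c: "15 / 16 * dotp d x x \<le> 0 * dotp d x x + 1 * qf d p x" for x using P_bounds(1)[of x] by simp
  have c0: "0 < (15 / 16 :: real)" by simp
  obtain w where w: "(\<integral>\<^sup>+x. ennreal (?K * exp (- (0 * dotp d (\<lambda>i. x i - \<mu> i) (\<lambda>i. x i - \<mu> i) + 1 * qf d p (\<lambda>i. x i - \<mu> i)) / 2
        + dotp d (\<lambda>i. x i - \<mu> i) (\<lambda>_. 0))) \<partial>Rd d)
      = ennreal ?K * ennreal (sqrt ((2 * pi) ^ d / ?D) * exp (dotp d w (\<lambda>_. 0) / 2))"
    using moment_exponent[OF c0 c, of "\<lambda>_. 0" ?K] by blast
  have D: "?D = 1 / Determinant.det \<Sigma>" using det_affine_ev[of 0 1] det_pos by (simp add: nonzero_eq_divide_eq mult.commute)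
  have "(\<integral>\<^sup>+x. ennreal (dens x) \<partial>Rd d) = ennreal ?K * ennreal (sqrt ((2 * pi) ^ d / ?D))"
    using w by (simp add: dotp_def dens_def)
  also have "\<dots> = ennreal (?K * sqrt ((2 * pi) ^ d / ?D))"
    using det_pos by (intro ennreal_mult'[symmetric]) simp
  also have "?K * sqrt ((2 * pi) ^ d / ?D) = 1" unfolding D using det_pos by simp
  finally show ?thesis by simp
qed

lemma prob_space_gaussian: "prob_space (gaussian d \<mu> \<Sigma>)"
proof (rule prob_spaceI)
  have "emeasure (gaussian d \<mu> \<Sigma>) (space (gaussian d \<mu> \<Sigma>)) = (\<integral>\<^sup>+x. ennreal (dens x) * indicator (space (Rd d)) x \<partial>Rd d)"
    unfolding gaussian_eq by (simp add: emeasure_density)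
  also have "\<dots> = (\<integral>\<^sup>+x. ennreal (dens x) \<partial>Rd d)" by (intro nn_integral_cong) simp
  finally show "emeasure (gaussian d \<mu> \<Sigma>) (space (gaussian d \<mu> \<Sigma>)) = 1" using total_mass by simp
qed

abbreviation "std x \<equiv> \<Prod>i<d. std_normal_density (x i)"

lemma dotp_shift: "dotp d x x = dotp d (\<lambda>i. x i - \<mu> i) (\<lambda>i. x i - \<mu> i) + 2 * dotp d (\<lambda>i. x i - \<mu> i) \<mu> + dotp d \<mu> \<mu>"
  unfolding dotp_def sum_distrib_left sum.distrib[symmetric] by (intro sum.cong refl) (simp add: algebra_simps)

text \<open>In \<open>dens^2 / std\<close> the exponents combine to the matrix
  \<open>2 P - I\<close> and the linear term \<open>\<mu>\<close>. The determinants give the first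
  product of \<open>exp_prod_bounds\<close>, and the mean contributes a further power of
  \<open>exp a\<close>.\<close>

lemma moment1: "(\<integral>\<^sup>+x. ennreal ((dens x)\<^sup>2 / std x) \<partial>Rd d) \<le> ennreal ((exp (2 * a))\<^sup>2)"
proof -
  let ?t = "(2 * pi) ^ d" and ?d = "Determinant.det \<Sigma>"
  let ?D = "Determinant.det (matf d (\<lambda>i j. (-1) * delta i j + 2 * p i j))"
  let ?K = "exp (dotp d \<mu> \<mu> / 2) * sqrt ?t / (?t * ?d)"
  have t: "0 < ?t" by simp
  \<comment> \<open>\<open>7 / 8 = 2 * 15 / 16 - 1\<close>: the isotropic position keeps
    \<open>2 P - I\<close> positive definite, without which the integral would diverge.\<close>
  have c: "7 / 8 * dotp d x x \<le> (-1) * dotp d x x + 2 * qf d p x" for x using P_bounds(1)[of x] by linarith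
  have c0: "0 < (7 / 8 :: real)" by simp
  obtain w where w: "dotp d w \<mu> \<le> dotp d \<mu> \<mu> / (7 / 8)"
    "(\<integral>\<^sup>+x. ennreal (?K * exp (- ((-1) * dotp d (\<lambda>i. x i - \<mu> i) (\<lambda>i. x i - \<mu> i) + 2 * qf d p (\<lambda>i. x i - \<mu> i)) / 2
        + dotp d (\<lambda>i. x i - \<mu> i) \<mu>)) \<partial>Rd d)
      = ennreal ?K * ennreal (sqrt (?t / ?D) * exp (dotp d w \<mu> / 2))"
    using moment_exponent[OF c0 c, of \<mu> ?K] by blast
  have dD: "?d * ?D = (\<Prod>i<d. 2 - ev i)" using det_affine_ev[of "-1" 2] by simp
  have D: "0 < ?D"
  proof -
    have "0 < (\<Prod>i<d. 2 - ev i)"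
    proof (rule prod_pos)
      fix i assume "i \<in> {..<d}"
      then have "ev i \<le> 16 / 15" using ev_bounds(2) by simp
      then show "0 < 2 - ev i" by linarith
    qed
    then show ?thesis unfolding dD[symmetric] using det_pos by (simp add: zero_less_mult_iff)
  qed
  have "(dens x)\<^sup>2 / std x = ?K * exp (- ((-1) * dotp d (\<lambda>i. x i - \<mu> i) (\<lambda>i. x i - \<mu> i) + 2 * qf d p (\<lambda>i. x i - \<mu> i)) / 2
        + dotp d (\<lambda>i. x i - \<mu> i) \<mu>)" for x
  proof -
    let ?y = "\<lambda>i. x i - \<mu> i"
    have "(dens x)\<^sup>2 = exp (- qf d p ?y) / (?t * ?d)"
      unfolding dens_def power_divide using t det_pos by (simp add: power2_eq_square exp_add[symmetric])
    then have "(dens x)\<^sup>2 / std x = sqrt ?t / (?t * ?d) * (exp (- qf d p ?y) / exp (- dotp d x x / 2))"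
      unfolding std_normal_prod_eq sqrt_2pi by simp
    also have "exp (- qf d p ?y) / exp (- dotp d x x / 2) = exp (dotp d \<mu> \<mu> / 2) * exp (- ((-1) * dotp d ?y ?y + 2 * qf d p ?y) / 2 + dotp d ?y \<mu>)"
      unfolding exp_diff[symmetric] exp_add[symmetric] dotp_shift[of x] by (simp add: field_simps)
    finally show ?thesis by simp
  qed
  then have "(\<integral>\<^sup>+x. ennreal ((dens x)\<^sup>2 / std x) \<partial>Rd d) = ennreal ?K * ennreal (sqrt (?t / ?D) * exp (dotp d w \<mu> / 2))"
    using w(2) by simp
  also have "\<dots> = ennreal (?K * (sqrt (?t / ?D) * exp (dotp d w \<mu> / 2)))"
    using det_pos by (intro ennreal_mult'[symmetric]) simp
  also have "?K * (sqrt (?t / ?D) * exp (dotp d w \<mu> / 2)) = exp (dotp d \<mu> \<mu> / 2 + dotp d w \<mu> / 2) / (?d * sqrt ?D)"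
  proof -
    have "sqrt ?t * sqrt (?t / ?D) = ?t / sqrt ?D" by (simp add: real_sqrt_divide)
    then have "?K * (sqrt (?t / ?D) * exp (dotp d w \<mu> / 2)) = exp (dotp d \<mu> \<mu> / 2) * exp (dotp d w \<mu> / 2) * (?t / sqrt ?D) / (?t * ?d)"
      by (simp add: field_simps)
    then show ?thesis using t by (simp add: exp_add)
  qed
  also have "\<dots> = exp (dotp d \<mu> \<mu> / 2 + dotp d w \<mu> / 2) * sqrt (\<Prod>i<d. 1 / (ev i * (2 - ev i)))"
  proof -
    have "?d * sqrt ?D = sqrt (?d * (?d * ?D))"
      using det_pos by (simp add: real_sqrt_mult mult.assoc[symmetric])
    also have "?d * (?d * ?D) = ?d * (\<Prod>i<d. 2 - ev i)" by (simp only: dD)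
    also have "\<dots> = (\<Prod>i<d. ev i * (2 - ev i))" by (simp only: det_eq_ev prod.distrib)
    finally show ?thesis by (simp add: prod_dividef real_sqrt_divide)
  qed
  also have "\<dots> \<le> exp (2 * a) * sqrt (exp (2 * a))"
  proof (intro mult_mono real_sqrt_le_mono)
    \<comment> \<open>The mean contributes at most \<open>(1 / 2 + 4 / 7) |\<mu>|^2\<close>, where
      4/7 is half of the reciprocal of 7/8.\<close>
    have "dotp d \<mu> \<mu> / 2 + dotp d w \<mu> / 2 \<le> 2 * a" using w(1) mean a0 by simp
    then show "exp (dotp d \<mu> \<mu> / 2 + dotp d w \<mu> / 2) \<le> exp (2 * a)" by simp
    show "(\<Prod>i<d. 1 / (ev i * (2 - ev i))) \<le> exp (2 * a)"
      by (rule order_trans[OF exp_prod_bounds(1)[of d ev, OF ev_bounds]]) (use sum_ev in simp_all)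
    show "0 \<le> sqrt (\<Prod>i<d. 1 / (ev i * (2 - ev i)))"
    proof (intro real_sqrt_ge_zero prod_nonneg)
      fix i assume "i \<in> {..<d}"
      then have "15 / 16 \<le> ev i" "ev i \<le> 16 / 15" using ev_bounds by auto
      then show "0 \<le> 1 / (ev i * (2 - ev i))" by simp
    qed
  qed simp
  also have "\<dots> \<le> (exp (2 * a))\<^sup>2"
    unfolding power2_eq_square using a0 by (intro mult_left_mono real_le_lsqrt) (auto simp: power2_eq_square)
  finally show ?thesis by (simp add: ennreal_leI)
qed

text \<open>The mirror case, with \<open>2 I - P\<close> and linear term \<open>- 2 \<mu>\<close>;
  positivity now comes from the upper bound \<open>16 / 15\<close> on the precision form.\<close>

lemma moment2: "(\<integral>\<^sup>+x. ennreal ((std x)\<^sup>2 / dens x) \<partial>Rd d) \<le> ennreal ((exp (2 * a))\<^sup>2)"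
proof -
  let ?t = "(2 * pi) ^ d" and ?d = "Determinant.det \<Sigma>" and ?b = "\<lambda>i. (-2) * \<mu> i"
  let ?D = "Determinant.det (matf d (\<lambda>i j. 2 * delta i j + (-1) * p i j))"
  let ?K = "exp (- dotp d \<mu> \<mu>) * sqrt (?t * ?d) / ?t"
  have t: "0 < ?t" by simp
  have c: "14 / 15 * dotp d x x \<le> 2 * dotp d x x + (-1) * qf d p x" for x using P_bounds(2)[of x] by linarith
  have c0: "0 < (14 / 15 :: real)" by simp
  obtain w where w: "dotp d w ?b \<le> dotp d ?b ?b / (14 / 15)"
    "(\<integral>\<^sup>+x. ennreal (?K * exp (- (2 * dotp d (\<lambda>i. x i - \<mu> i) (\<lambda>i. x i - \<mu> i) + (-1) * qf d p (\<lambda>i. x i - \<mu> i)) / 2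
        + dotp d (\<lambda>i. x i - \<mu> i) ?b)) \<partial>Rd d)
      = ennreal ?K * ennreal (sqrt (?t / ?D) * exp (dotp d w ?b / 2))"
    using moment_exponent[OF c0 c, of ?b ?K] by blast
  have dD: "?d * ?D = (\<Prod>i<d. 2 * ev i - 1)" using det_affine_ev[of 2 "-1"] by simp
  have D: "0 < ?D"
  proof -
    have "0 < (\<Prod>i<d. 2 * ev i - 1)"
    proof (rule prod_pos)
      fix i assume "i \<in> {..<d}"
      then have "15 / 16 \<le> ev i" using ev_bounds(1) by simp
      then show "0 < 2 * ev i - 1" by linarith
    qed
    then show ?thesis unfolding dD[symmetric] using det_pos by (simp add: zero_less_mult_iff)
  qed
  have "(std x)\<^sup>2 / dens x = ?K * exp (- (2 * dotp d (\<lambda>i. x i - \<mu> i) (\<lambda>i. x i - \<mu> i) + (-1) * qf d p (\<lambda>i. x i - \<mu> i)) / 2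
        + dotp d (\<lambda>i. x i - \<mu> i) ?b)" for x
  proof -
    let ?y = "\<lambda>i. x i - \<mu> i"
    have "(std x)\<^sup>2 = exp (- dotp d x x) / ?t"
      unfolding std_normal_prod_eq sqrt_2pi power_divide using t by (simp add: power2_eq_square exp_add[symmetric])
    then have "(std x)\<^sup>2 / dens x = sqrt (?t * ?d) / ?t * (exp (- dotp d x x) / exp (- qf d p ?y / 2))"
      unfolding dens_def by simp
    also have "exp (- dotp d x x) / exp (- qf d p ?y / 2) = exp (- dotp d \<mu> \<mu>) * exp (- (2 * dotp d ?y ?y + (-1) * qf d p ?y) / 2 + dotp d ?y ?b)"
      unfolding exp_diff[symmetric] exp_add[symmetric] dotp_shift[of x] dotp_scale by (simp add: field_simps)
    finally show ?thesis by simp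
  qed
  then have "(\<integral>\<^sup>+x. ennreal ((std x)\<^sup>2 / dens x) \<partial>Rd d) = ennreal ?K * ennreal (sqrt (?t / ?D) * exp (dotp d w ?b / 2))"
    using w(2) by simp
  also have "\<dots> = ennreal (?K * (sqrt (?t / ?D) * exp (dotp d w ?b / 2)))"
    using det_pos by (intro ennreal_mult'[symmetric]) simp
  also have "?K * (sqrt (?t / ?D) * exp (dotp d w ?b / 2)) = exp (- dotp d \<mu> \<mu> + dotp d w ?b / 2) * sqrt (?d / ?D)"
  proof -
    have "sqrt (?t * ?d) * sqrt (?t / ?D) = ?t * sqrt (?d / ?D)"
    proof -
      have "sqrt (u * v) * sqrt (u / z) = sqrt u * sqrt u * (sqrt v / sqrt z)" for u v z :: real
        by (simp add: real_sqrt_mult real_sqrt_divide)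
      from this[of ?t ?d ?D] show ?thesis using t by (simp only: real_sqrt_mult_self real_sqrt_divide abs_of_pos)
    qed
    then have "?K * (sqrt (?t / ?D) * exp (dotp d w ?b / 2)) = exp (- dotp d \<mu> \<mu>) * exp (dotp d w ?b / 2) * (?t * sqrt (?d / ?D)) / ?t"
      by (simp add: field_simps)
    also have "\<dots> = exp (- dotp d \<mu> \<mu>) * exp (dotp d w ?b / 2) * sqrt (?d / ?D)" using t by simp
    finally show ?thesis unfolding exp_add .
  qed
  also have "?d / ?D = (\<Prod>i<d. (ev i)\<^sup>2 / (2 * ev i - 1))"
  proof -
    have "?d / ?D = ?d\<^sup>2 / (?d * ?D)" using det_pos by (simp add: power2_eq_square)
    also have "\<dots> = ?d\<^sup>2 / (\<Prod>i<d. 2 * ev i - 1)" by (simp only: dD)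
    also have "\<dots> = (\<Prod>i<d. (ev i)\<^sup>2 / (2 * ev i - 1))"
      unfolding det_eq_ev by (simp add: prod_dividef prod_power_distrib)
    finally show ?thesis .
  qed
  also have "exp (- dotp d \<mu> \<mu> + dotp d w ?b / 2) * sqrt (\<Prod>i<d. (ev i)\<^sup>2 / (2 * ev i - 1)) \<le> exp (2 * a) * sqrt (exp (2 * a))"
  proof (intro mult_mono real_sqrt_le_mono)
    have "dotp d w ?b \<le> 4 * dotp d \<mu> \<mu> / (14 / 15)" using w(1) unfolding dotp_scale by simp
    then have "- dotp d \<mu> \<mu> + dotp d w ?b / 2 \<le> 2 * a" using mean a0 by simp
    then show "exp (- dotp d \<mu> \<mu> + dotp d w ?b / 2) \<le> exp (2 * a)" by simp
    show "(\<Prod>i<d. (ev i)\<^sup>2 / (2 * ev i - 1)) \<le> exp (2 * a)"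
      by (rule order_trans[OF exp_prod_bounds(2)[of d ev, OF ev_bounds]]) (use sum_ev in simp_all)
    show "0 \<le> sqrt (\<Prod>i<d. (ev i)\<^sup>2 / (2 * ev i - 1))"
    proof (intro real_sqrt_ge_zero prod_nonneg)
      fix i assume "i \<in> {..<d}"
      then have "15 / 16 \<le> ev i" using ev_bounds by auto
      then show "0 \<le> (ev i)\<^sup>2 / (2 * ev i - 1)" by simp
    qed
  qed simp
  also have "\<dots> \<le> (exp (2 * a))\<^sup>2"
    unfolding power2_eq_square using a0 by (intro mult_left_mono real_le_lsqrt) (auto simp: power2_eq_square)
  finally show ?thesis by (simp add: ennreal_leI)
qed

text \<open>Both directions are used: from standard to unknown for the final error, from unknown to
  standard because the sample speaks only about the unknown Gaussian.\<close>

lemma change_of_measure: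
  assumes B: "B \<in> sets (Rd d)"
  shows "measure (gaussian d \<mu> \<Sigma>) B \<le> exp (2 * a) * sqrt (measure (Nd d) B)"
    "measure (Nd d) B \<le> exp (2 * a) * sqrt (measure (gaussian d \<mu> \<Sigma>) B)"
proof -
  have s: "0 < std x" for x by (intro prod_pos) (simp add: normal_density_pos)
  show "measure (gaussian d \<mu> \<Sigma>) B \<le> exp (2 * a) * sqrt (measure (Nd d) B)"
    unfolding gaussian_eq Nd_density
    using moment1 prob_space_gaussian[unfolded gaussian_eq] prob_space_Nd[of d, unfolded Nd_density] B
    by (intro density_Cauchy_Schwarz s) (auto simp: dens_pos less_imp_le)
  show "measure (Nd d) B \<le> exp (2 * a) * sqrt (measure (gaussian d \<mu> \<Sigma>) B)"
    unfolding gaussian_eq Nd_density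
    using moment2 prob_space_gaussian[unfolded gaussian_eq] prob_space_Nd[of d, unfolded Nd_density] B
    by (intro density_Cauchy_Schwarz dens_pos) (auto intro: less_imp_le[OF s])
qed

end

section \<open>Empirical selection from a finite class\<close>

text \<open>Markov's inequality is enough, since it is applied to a single set, the complement of
  one good cover element.\<close>

lemma empirical_upper:
  fixes \<nu> :: "'a measure"
  assumes "prob_space \<nu>" and C [measurable]: "C \<in> sets \<nu>" and \<zeta>: "0 < \<zeta>" and p: "measure \<nu> C \<le> \<zeta> / 200"
  shows "measure (Pi\<^sub>M {..<n::nat} (\<lambda>_. \<nu>)) {X \<in> space (Pi\<^sub>M {..<n} (\<lambda>_. \<nu>)). \<zeta> * real n < (\<Sum>i<n. indicator C (X i))} \<le> 1 / 200"
proof -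
  interpret v: prob_space \<nu> by fact
  interpret P: prob_space "Pi\<^sub>M {..<n} (\<lambda>_. \<nu>)" by (intro prob_space_PiM v.prob_space_axioms)
  let ?P = "Pi\<^sub>M {..<n} (\<lambda>_. \<nu>)"
  let ?c = "\<lambda>X. \<Sum>i<n. indicator C (X i) :: real"
  show ?thesis
  proof (cases "n = 0")
    case True
    then show ?thesis by simp
  next
    case False
    then have n: "0 < real n" by simp
    have ci: "integrable ?P (\<lambda>X. indicator C (X i) :: real)" "(\<integral>X. indicator C (X i) \<partial>?P) = measure \<nu> C" if "i < n" for i
    proof -
      have [measurable]: "(\<lambda>X. X i) \<in> ?P \<rightarrow>\<^sub>M \<nu>" using that by (intro measurable_component_singleton) auto
      have d: "distr ?P \<nu> (\<lambda>X. X i) = \<nu>"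
        using that by (intro distr_PiM_component[of "{..<n}" "\<lambda>_. \<nu>" i]) (auto intro: v.prob_space_axioms)
      show "integrable ?P (\<lambda>X. indicator C (X i) :: real)" by (intro P.integrable_const_bound[of _ 1]) auto
      have "(\<integral>X. indicator C (X i) \<partial>?P) = (\<integral>x. (indicator C x :: real) \<partial>distr ?P \<nu> (\<lambda>X. X i))"
        by (subst integral_distr) auto
      then show "(\<integral>X. indicator C (X i) \<partial>?P) = measure \<nu> C" by (simp add: d)
    qed
    have [measurable]: "?c \<in> borel_measurable ?P"
    proof (intro borel_measurable_sum)
      fix i assume "i \<in> {..<n}"
      then have [measurable]: "(\<lambda>X. X i) \<in> ?P \<rightarrow>\<^sub>M \<nu>" by (intro measurable_component_singleton) auto
      show "(\<lambda>X. indicator C (X i)) \<in> borel_measurable ?P" by measurable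
    qed
    let ?B = "{X \<in> space ?P. \<zeta> * real n < ?c X}"
    have [measurable]: "?B \<in> sets ?P" by measurable
    have c: "integrable ?P ?c" by (intro Bochner_Integration.integrable_sum ci) simp
    have "measure ?P ?B = (\<integral>X. indicator ?B X \<partial>?P)" by simp
    also have "\<dots> \<le> (\<integral>X. ?c X / (\<zeta> * real n) \<partial>?P)"
    proof (intro integral_mono)
      show "indicator ?B X \<le> ?c X / (\<zeta> * real n)" for X
        using n \<zeta> by (auto simp: indicator_def field_simps intro!: sum_nonneg divide_nonneg_nonneg)
    qed (use c in \<open>auto intro!: P.integrable_const_bound[of _ 1]\<close>)
    also have "\<dots> = (\<Sum>i<n. measure \<nu> C) / (\<zeta> * real n)"
      using ci by (simp add: Bochner_Integration.integral_sum)
    also have "\<dots> = measure \<nu> C / \<zeta>" using n by simp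
    also have "\<dots> \<le> 1 / 200" using p \<zeta> by (simp add: field_simps)
    finally show ?thesis .
  qed
qed

text \<open>Chernoff bound with parameter 1: the mean of \<open>exp (- indicator C x)\<close> is at
  most \<open>exp (- 2 \<zeta>)\<close> because \<open>1 - exp (- 1) \<ge> 1 / 2\<close>.
  Exponential decay is required here, as all bad cover elements have to be excluded by a union
  bound.\<close>

lemma empirical_lower:
  fixes \<nu> :: "'a measure"
  assumes "prob_space \<nu>" and C [measurable]: "C \<in> sets \<nu>" and \<zeta>: "0 < \<zeta>" and p: "4 * \<zeta> \<le> measure \<nu> C"
  shows "measure (Pi\<^sub>M {..<n::nat} (\<lambda>_. \<nu>)) {X \<in> space (Pi\<^sub>M {..<n} (\<lambda>_. \<nu>)). (\<Sum>i<n. indicator C (X i)) \<le> \<zeta> * real n}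
    \<le> exp (- \<zeta> * real n)"
proof -
  interpret v: prob_space \<nu> by fact
  interpret P: prob_space "Pi\<^sub>M {..<n} (\<lambda>_. \<nu>)" by (intro prob_space_PiM v.prob_space_axioms)
  interpret S: product_sigma_finite "\<lambda>_::nat. \<nu>" by unfold_locales
  let ?P = "Pi\<^sub>M {..<n} (\<lambda>_. \<nu>)"
  let ?c = "\<lambda>X. \<Sum>i<n. indicator C (X i) :: real"
  let ?f = "\<lambda>x. exp (- indicator C x) :: real"
  have fi: "integrable \<nu> ?f" by (intro v.integrable_const_bound[of _ 1]) (auto simp: indicator_def)
  have ec: "exp (- ?c X) = (\<Prod>i<n. ?f (X i))" for X by (simp add: exp_sum[symmetric] sum_negf)
  have ei: "integrable ?P (\<lambda>X. exp (- ?c X))"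
    unfolding ec by (intro S.product_integrable_prod fi) simp
  have "(\<integral>x. ?f x \<partial>\<nu>) = (\<integral>x. 1 - (1 - exp (-1)) * indicator C x \<partial>\<nu>)"
    by (intro Bochner_Integration.integral_cong) (auto simp: indicator_def)
  also have "\<dots> = 1 - (1 - exp (-1)) * measure \<nu> C"
    by (subst Bochner_Integration.integral_diff) (auto simp: v.prob_space integrable_real_indicator v.emeasure_eq_measure)
  also have "\<dots> \<le> exp (- ((1 - exp (-1)) * measure \<nu> C))" using exp_ge_add_one_self[of "- ((1 - exp (-1)) * measure \<nu> C)"] by simp
  also have "\<dots> \<le> exp (- (2 * \<zeta>))"
  proof -
    have "(2::real) \<le> exp 1" using exp_ge_add_one_self[of 1] by simp
    then have "exp (- 1) \<le> (1 / 2 :: real)" by (simp add: exp_minus field_simps)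
    then have "(1 / 2) * (4 * \<zeta>) \<le> (1 - exp (-1)) * measure \<nu> C" using p \<zeta> by (intro mult_mono) auto
    then show ?thesis by simp
  qed
  finally have f: "(\<integral>x. ?f x \<partial>\<nu>) \<le> exp (- (2 * \<zeta>))" .
  have [measurable]: "?c \<in> borel_measurable ?P"
  proof (intro borel_measurable_sum)
    fix i assume "i \<in> {..<n}"
    then have [measurable]: "(\<lambda>X. X i) \<in> ?P \<rightarrow>\<^sub>M \<nu>" by (intro measurable_component_singleton) auto
    show "(\<lambda>X. indicator C (X i)) \<in> borel_measurable ?P" by measurable
  qed
  let ?B = "{X \<in> space ?P. ?c X \<le> \<zeta> * real n}"
  have [measurable]: "?B \<in> sets ?P" by measurable
  have "measure ?P ?B = (\<integral>X. indicator ?B X \<partial>?P)" by simp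
  also have "\<dots> \<le> (\<integral>X. exp (\<zeta> * real n) * exp (- ?c X) \<partial>?P)"
  proof (intro integral_mono integrable_mult_right ei)
    show "indicator ?B X \<le> exp (\<zeta> * real n) * exp (- ?c X)" for X
      unfolding exp_add[symmetric] by (auto simp: indicator_def)
  qed (auto intro!: P.integrable_const_bound[of _ 1])
  also have "\<dots> = exp (\<zeta> * real n) * (\<integral>X. (\<Prod>i<n. ?f (X i)) \<partial>?P)" unfolding ec by simp
  also have "(\<integral>X. (\<Prod>i<n. ?f (X i)) \<partial>?P) = (\<Prod>i<n. \<integral>x. ?f x \<partial>\<nu>)"
    by (intro S.product_integral_prod fi) simp
  also have "\<dots> = (\<integral>x. ?f x \<partial>\<nu>) ^ n" by simp
  also have "exp (\<zeta> * real n) * (\<integral>x. ?f x \<partial>\<nu>) ^ n \<le> exp (\<zeta> * real n) * exp (- (2 * \<zeta>)) ^ n"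
    by (intro mult_left_mono power_mono f) auto
  also have "\<dots> = exp (- \<zeta> * real n)" by (simp add: exp_of_nat_mult[symmetric] exp_add[symmetric] algebra_simps)
  finally show ?thesis .
qed

text \<open>The estimator returns the member of smallest reference mass \<open>w\<close> that contains all but a \<open>\<zeta>\<close>-fraction of the sample.\<close>

lemma finite_class_estimator:
  fixes w :: "(nat \<Rightarrow> real) set \<Rightarrow> real"
  assumes T: "finite \<T>" "\<T> \<subseteq> sets (Rd d)" and \<zeta>: "0 < \<zeta>"
  shows "\<exists>E. set_estimator d n E \<and>
    (\<forall>\<nu> T R. prob_space \<nu> \<longrightarrow> sets \<nu> = sets (Rd d) \<longrightarrow> T \<in> \<T> \<longrightarrow> measure \<nu> (space (Rd d) - T) \<le> \<zeta> / 200 \<longrightarrow>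
      real (card \<T>) * exp (- \<zeta> * real n) \<le> 1 / 200 \<longrightarrow>
      (\<forall>T'\<in>\<T>. w T' \<le> w T \<longrightarrow> measure \<nu> (space (Rd d) - T') \<le> 4 * \<zeta> \<longrightarrow> R (indicator T')) \<longrightarrow>
      99 / 100 \<le> measure (Pi\<^sub>M {..<n} (\<lambda>_. \<nu>)) {X \<in> space (Pi\<^sub>M {..<n} (\<lambda>_. \<nu>)). R (E X)})"
proof -
  obtain xs0 where xs0: "set xs0 = \<T>" "distinct xs0" using T(1) finite_distinct_list by blast
  \<comment> \<open>Sorting by reference mass turns minimising \<open>w\<close> into taking the
    least admissible index.\<close>
  define xs where "xs = sort_key w xs0"
  have xs: "set xs = \<T>" "distinct xs" "sorted (map w xs)" using xs0 by (auto simp: xs_def)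
  define M where "M = length xs"
  have M: "M = card \<T>" using xs by (metis M_def distinct_card)
  define Tj where "Tj j = (if j < M then xs ! j else {})" for j
  have Tj: "Tj j \<in> sets (Rd d)" for j using xs T(2) by (auto simp: Tj_def M_def)
  define cnt where "cnt j X = (\<Sum>i<n. indicator (space (Rd d) - Tj j) (X i) :: real)" for j and X :: "nat \<Rightarrow> nat \<Rightarrow> real"
  \<comment> \<open>Index \<open>M\<close> is always admissible and stands for the empty set, so a
    least index exists for every sample, even when no element fits.\<close>
  define adm where "adm j X \<longleftrightarrow> M \<le> j \<or> cnt j X \<le> \<zeta> * real n" for j X
  define sel where "sel X = (LEAST j. adm j X)" for X
  let ?S = "Pi\<^sub>M {..<n} (\<lambda>_. Rd d)"
  have cnt_meas [measurable]: "cnt j \<in> borel_measurable ?S" for j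
    unfolding cnt_def
  proof (intro borel_measurable_sum)
    fix i assume "i \<in> {..<n}"
    then have [measurable]: "(\<lambda>X. X i) \<in> ?S \<rightarrow>\<^sub>M Rd d" by (intro measurable_component_singleton) auto
    have [measurable]: "space (Rd d) - Tj j \<in> sets (Rd d)" using Tj by auto
    show "(\<lambda>X. indicator (space (Rd d) - Tj j) (X i)) \<in> borel_measurable ?S" by measurable
  qed
  have sel_meas [measurable]: "sel \<in> ?S \<rightarrow>\<^sub>M count_space UNIV"
    unfolding sel_def[abs_def] adm_def by measurable
  define E where "E X = (indicator (Tj (sel X)) :: (nat \<Rightarrow> real) \<Rightarrow> real)" for X
  have "set_estimator d n E"
    unfolding set_estimator_def
  proof -
    have "(\<lambda>p. indicator (Tj (sel (fst p))) (snd p) :: real) \<in> ?S \<Otimes>\<^sub>M Rd d \<rightarrow>\<^sub>M count_space {0, 1}"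
    proof (rule measurable_compose_countable)
      fix j
      have [measurable]: "Tj j \<in> sets (Rd d)" by (rule Tj)
      show "(\<lambda>p. indicator (Tj j) (snd p) :: real) \<in> ?S \<Otimes>\<^sub>M Rd d \<rightarrow>\<^sub>M count_space {0, 1}"
        unfolding indicator_def by measurable
    qed measurable
    then show "(\<lambda>(X, x). E X x) \<in> ?S \<Otimes>\<^sub>M Rd d \<rightarrow>\<^sub>M count_space {0, 1}"
      by (simp add: E_def case_prod_beta')
  qed
  moreover have "99 / 100 \<le> measure (Pi\<^sub>M {..<n} (\<lambda>_. \<nu>)) {X \<in> space (Pi\<^sub>M {..<n} (\<lambda>_. \<nu>)). R (E X)}"
    if \<nu>: "prob_space \<nu>" "sets \<nu> = sets (Rd d)" and T': "T \<in> \<T>" "measure \<nu> (space (Rd d) - T) \<le> \<zeta> / 200"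
      and c: "real (card \<T>) * exp (- \<zeta> * real n) \<le> 1 / 200"
      and R: "\<And>T'. T' \<in> \<T> \<Longrightarrow> w T' \<le> w T \<Longrightarrow> measure \<nu> (space (Rd d) - T') \<le> 4 * \<zeta> \<Longrightarrow> R (indicator T')"
    for \<nu> T R
  proof -
    interpret v: prob_space \<nu> by fact
    let ?P = "Pi\<^sub>M {..<n} (\<lambda>_. \<nu>)"
    interpret P: prob_space ?P by (intro prob_space_PiM v.prob_space_axioms)
    have sP: "sets ?P = sets ?S" by (intro sets_PiM_cong) (auto simp: \<nu>)
    have [measurable]: "cnt j \<in> borel_measurable ?P" for j using cnt_meas measurable_cong_sets[OF sP refl] by blast
    have sel_P [measurable]: "sel \<in> ?P \<rightarrow>\<^sub>M count_space UNIV" using sel_meas measurable_cong_sets[OF sP refl] by blast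
    obtain s where s: "s < M" "xs ! s = T" using T'(1) xs(1) by (metis M_def in_set_conv_nth)
    have co: "space (Rd d) - Tj j \<in> sets \<nu>" for j unfolding \<nu>(2) using Tj by auto
    let ?J = "{j. j < M \<and> 4 * \<zeta> < measure \<nu> (space (Rd d) - Tj j)}"
    let ?B1 = "{X \<in> space ?P. \<zeta> * real n < cnt s X}" and ?B2 = "\<lambda>j. {X \<in> space ?P. cnt j X \<le> \<zeta> * real n}"
    have b1: "measure ?P ?B1 \<le> 1 / 200"
      unfolding cnt_def using s T'(2) by (intro empirical_upper[OF \<nu>(1) co \<zeta>]) (simp add: Tj_def)
    have b2: "measure ?P (\<Union>j\<in>?J. ?B2 j) \<le> 1 / 200"
    proof -
      have "measure ?P (\<Union>j\<in>?J. ?B2 j) \<le> (\<Sum>j\<in>?J. measure ?P (?B2 j))"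
        by (rule P.finite_measure_subadditive_finite) auto
      also have "\<dots> \<le> (\<Sum>j\<in>?J. exp (- \<zeta> * real n))"
        unfolding cnt_def by (intro sum_mono empirical_lower[OF \<nu>(1) co \<zeta>]) auto
      also have "\<dots> = real (card ?J) * exp (- \<zeta> * real n)" by simp
      also have "\<dots> \<le> real (card \<T>) * exp (- \<zeta> * real n)"
      proof (intro mult_right_mono)
        have "card ?J \<le> card {..<M}" by (intro card_mono) auto
        then show "real (card ?J) \<le> real (card \<T>)" by (simp add: M)
      qed simp
      finally show ?thesis using c by linarith
    qed
    let ?G = "{X \<in> space ?P. R (E X)}"
    \<comment> \<open>\<open>R\<close> is an arbitrary predicate; its event is measurable because
      \<open>E\<close> depends on the sample only through a natural number.\<close>
    have [measurable]: "?G \<in> sets ?P"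
    proof -
      have "?G = sel -` {j. R (indicator (Tj j))} \<inter> space ?P" by (auto simp: E_def)
      also have "\<dots> \<in> sets ?P" by (rule measurable_sets[OF sel_P]) simp
      finally show ?thesis .
    qed
    \<comment> \<open>Outside the bad events \<open>T\<close> itself is admissible, so the chosen
      element is no heavier, and it is not one of those that miss too much.\<close>
    have "space ?P - ?G \<subseteq> ?B1 \<union> (\<Union>j\<in>?J. ?B2 j)"
    proof
      fix X assume X: "X \<in> space ?P - ?G"
      show "X \<in> ?B1 \<union> (\<Union>j\<in>?J. ?B2 j)"
      proof (rule ccontr)
        assume n: "X \<notin> ?B1 \<union> (\<Union>j\<in>?J. ?B2 j)"
        have "adm s X" using n X by (auto simp: adm_def not_less)
        then have ls: "sel X \<le> s" and ad: "adm (sel X) X" unfolding sel_def by (auto intro: Least_le LeastI)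
        have lM: "sel X < M" using ls s by simp
        have e: "Tj (sel X) = xs ! sel X" using lM by (simp add: Tj_def)
        have "xs ! sel X \<in> \<T>" using lM xs(1) by (auto simp: M_def)
        moreover have "w (xs ! sel X) \<le> w T"
          using sorted_nth_mono[OF xs(3) ls] s lM by (simp add: M_def)
        moreover have "measure \<nu> (space (Rd d) - xs ! sel X) \<le> 4 * \<zeta>"
        proof (rule ccontr)
          assume "\<not> measure \<nu> (space (Rd d) - xs ! sel X) \<le> 4 * \<zeta>"
          then have "sel X \<in> ?J" using lM by (simp add: e)
          moreover have "X \<in> ?B2 (sel X)" using X ad lM by (simp add: adm_def)
          ultimately show False using n by blast
        qed
        ultimately have "R (indicator (xs ! sel X))" by (rule R)
        then show False using X by (simp add: E_def e)
      qed
    qed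
    then have "measure ?P (space ?P - ?G) \<le> measure ?P (?B1 \<union> (\<Union>j\<in>?J. ?B2 j))"
      by (intro P.finite_measure_mono sets.Un sets.finite_UN) auto
    also have "\<dots> \<le> measure ?P ?B1 + measure ?P (\<Union>j\<in>?J. ?B2 j)"
      by (intro measure_Un_le sets.finite_UN) auto
    also have "\<dots> \<le> 1 / 100" using b1 b2 by simp
    finally show ?thesis using P.prob_compl[of ?G] by simp
  qed
  ultimately show ?thesis by (intro exI[of _ E]) blast
qed

section \<open>Sample size\<close>

text \<open>The parameters are balanced for accuracy \<open>1 / r^2\<close>. The noise, degree and
  rounding terms get 1/24 of it each and the three discretisation terms 1/48 each, counted twice;
  the outer factor 4 makes the total 1. The exponent has to be quadratic in
  \<open>\<Gamma> + 1\<close>, so logarithms are absorbed into \<open>r\<close>, into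
  \<open>L\<close>, or for large surface area into \<open>g\<close>.\<close>

lemma cover_budget:
  fixes \<Gamma> r :: real and d n :: nat
  assumes \<Gamma>: "0 \<le> \<Gamma>" and d: "1 \<le> d" and r: "10 ^ 5 \<le> r"
    and n: "real (max d 2) powr (64 * (\<Gamma> + 1)\<^sup>2 * r ^ 7) \<le> real n"
  shows "\<exists>\<T>. finite \<T> \<and> \<T> \<subseteq> sets (Rd d) \<and> (\<forall>\<zeta>\<ge>1 / r\<^sup>2. real (card \<T>) * exp (- \<zeta> * real n) \<le> 1 / 200) \<and>
    (\<forall>A\<in>sets (Rd d). gauss_surface_area d A \<le> ennreal \<Gamma> \<longrightarrow> (\<exists>T\<in>\<T>. measure (Nd d) (sym_diff A T) \<le> 1 / r\<^sup>2))"
proof -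
  \<comment> \<open>At least 1, since it appears in denominators and under logarithms.\<close>
  define g where "g = \<Gamma> + 1"
  define L where "L = ln (real (max d 2))"
  have r0: "0 < r" "1 \<le> r" "24 \<le> r" using r by auto
  have g: "1 \<le> g" "\<Gamma> \<le> g" using \<Gamma> by (auto simp: g_def)
  have g2: "1 \<le> g\<^sup>2" "g \<le> g\<^sup>2" using g power_increasing[of 1 2 g] by simp_all
  have d1: "1 \<le> real d" using d by simp
  have L: "1 / 2 \<le> L" "ln (real d) \<le> L"
  proof -
    have "exp (1 / 2 :: real) \<le> 1 + 1 / 2 + (1 / 2)\<^sup>2" by (rule exp_bound) auto
    then have "exp (1 / 2) \<le> (2 :: real)" by (simp add: power2_eq_square)
    then have "1 / 2 \<le> ln (2 :: real)" by (subst ln_ge_iff) simp_all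
    also have "\<dots> \<le> L" unfolding L_def by simp
    finally show "1 / 2 \<le> L" .
    show "ln (real d) \<le> L" unfolding L_def using d by simp
  qed
  have lnr: "ln r \<le> r" using ln_le_minus_one[of r] r0 by linarith
  have lng: "ln g \<le> g" using ln_le_minus_one[of g] g by linarith

  \<comment> \<open>\<open>sqrt (1 - \<rho>) = 1 / (48 g r^2)\<close> makes the noise term
    \<open>2 sqrt (1 - \<rho>) \<Gamma>\<close> at most \<open>1 / (24 r^2)\<close>; the next choice
    makes \<open>4 \<phi> \<Gamma>\<close> at most \<open>1 / (48 r^2)\<close>.\<close>
  define \<rho> where "\<rho> = 1 - (1 / (48 * g * r\<^sup>2))\<^sup>2"
  define \<phi> where "\<phi> = 1 / (192 * g * r\<^sup>2)"
  have gr: "1 \<le> g * r\<^sup>2" using g r0 mult_mono[of 1 g 1 "r\<^sup>2"] by simp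
  have \<phi>: "0 < \<phi>" "\<phi> \<le> 1" unfolding \<phi>_def using gr by (auto simp: divide_le_eq)
  have q: "0 \<le> 1 / (48 * g * r\<^sup>2)" "1 / (48 * g * r\<^sup>2) \<le> 1" using gr by (auto simp: divide_le_eq)
  have "(1 / (48 * g * r\<^sup>2))\<^sup>2 \<le> 1" using q by (rule power_le_one)
  then have \<rho>: "0 \<le> \<rho>" "\<rho> \<le> 1" unfolding \<rho>_def by auto

  \<comment> \<open>\<open>36864 = 4 * 192 * 48\<close>: \<open>N \<ge> u\<close> brings the
    discretisation term \<open>4 d / (\<phi> N)\<close> below \<open>1 / (48 r^2)\<close>.\<close>
  define u where "u = 36864 * real d * g * r ^ 4"
  define N where "N = nat \<lceil>u\<rceil>"
  have u1: "36864 \<le> u"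
  proof -
    have "1 * 1 * 1 \<le> real d * g * r ^ 4" using d1 g r0 by (intro mult_mono one_le_power) auto
    then show ?thesis by (simp add: u_def)
  qed
  have N: "u \<le> real N" "real N \<le> u + 1" using u1 by (auto simp: N_def)
  have N1: "1 \<le> N" using N(1) u1 by linarith

  \<comment> \<open>\<open>2304 = 48^2\<close>, so \<open>v = ln (24 r^2) / (1 - \<rho>)\<close>,
    the degree from which on \<open>\<rho>^k\<close> is below \<open>1 / (24 r^2)\<close>. Its
    factor \<open>g^2\<close> is the source of \<open>\<Gamma>^2\<close> in the sample size.\<close>
  define v where "v = 2304 * g\<^sup>2 * r ^ 4 * ln (24 * r\<^sup>2)"
  define k where "k = nat \<lceil>v\<rceil>"
  have ln24: "0 \<le> ln (24 * r\<^sup>2)" "ln (24 * r\<^sup>2) \<le> 3 * r"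
  proof -
    have "1 \<le> r\<^sup>2" using r0 by simp
    then have "1 \<le> 24 * r\<^sup>2" by linarith
    then show "0 \<le> ln (24 * r\<^sup>2)" by simp
    have "24 * r\<^sup>2 \<le> r ^ 3" using r0 by (simp add: power2_eq_square power3_eq_cube mult_right_mono)
    then have "ln (24 * r\<^sup>2) \<le> ln (r ^ 3)" using r0 by (subst ln_le_cancel_iff) auto
    also have "\<dots> = 3 * ln r" using r0 by (simp add: ln_realpow)
    finally show "ln (24 * r\<^sup>2) \<le> 3 * r" using lnr by linarith
  qed
  have v0: "0 \<le> v" unfolding v_def using ln24 r0 by simp
  have k: "v \<le> real k" "real k \<le> v + 1" using v0 by (auto simp: k_def)

  define m where "m = 2 * N\<^sup>2 + 3"
  \<comment> \<open>For \<open>g > d\<close> the exponent \<open>k ln (1 + d m)\<close> would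
    contain \<open>g^2 ln g\<close>, which \<open>ln d\<close> does not control; \<open>m^d\<close>
    then gives a smaller count.\<close>
  define Dn where "Dn = (if g \<le> real d then (1 + d * m) ^ k else m ^ d)"
  have Dn1: "1 \<le> Dn" by (simp add: Dn_def m_def)
  \<comment> \<open>Fine enough that
    \<open>Dn / n0^2 \<le> Dn / n0 \<le> 1 / (24 r^2)\<close>.\<close>
  define n0 where "n0 = nat \<lceil>24 * real Dn * r\<^sup>2\<rceil>"
  have Dr: "1 \<le> real Dn * r\<^sup>2" using Dn1 r0 mult_mono[of 1 "real Dn" 1 "r\<^sup>2"] by simp
  have n0: "24 * real Dn * r\<^sup>2 \<le> real n0" "real n0 \<le> 24 * real Dn * r\<^sup>2 + 1" using Dr by (auto simp: n0_def)
  have n01: "1 \<le> n0" using n0(1) Dr by linarith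

  obtain D \<T> where T: "D \<le> (1 + d * m) ^ k" "D \<le> m ^ d" "finite \<T>" "\<T> \<subseteq> sets (Rd d)" "card \<T> \<le> (2 * n0 + 1) ^ D"
    "\<And>A G. A \<in> sets (Rd d) \<Longrightarrow> 0 \<le> G \<Longrightarrow> gauss_surface_area d A \<le> ennreal G \<Longrightarrow>
      \<exists>T\<in>\<T>. measure (Nd d) (sym_diff A T)
        \<le> 4 * (2 * sqrt (1 - \<rho>) * G + 2 * (4 * \<phi> * G + 4 * real d / (\<phi> * real N) + real d / (real N)\<^sup>2)
            + \<rho> ^ (k + 1) + real D / (real n0)\<^sup>2)"
    using cover_surface_area[OF N1 n01 \<rho> \<phi>, of d k, folded m_def] by blast
  have DD: "D \<le> Dn" using T(1,2) by (simp add: Dn_def)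

  have err: "4 * (2 * sqrt (1 - \<rho>) * \<Gamma> + 2 * (4 * \<phi> * \<Gamma> + 4 * real d / (\<phi> * real N) + real d / (real N)\<^sup>2)
            + \<rho> ^ (k + 1) + real D / (real n0)\<^sup>2) \<le> 1 / r\<^sup>2"
  proof -
    have rr: "0 < r\<^sup>2" using r0 by simp
    have e1: "2 * sqrt (1 - \<rho>) * \<Gamma> \<le> 1 / (24 * r\<^sup>2)"
    proof -
      have "sqrt (1 - \<rho>) = 1 / (48 * g * r\<^sup>2)" unfolding \<rho>_def using q by simp
      then have "2 * sqrt (1 - \<rho>) * \<Gamma> = (\<Gamma> / g) / (24 * r\<^sup>2)" by simp
      also have "\<dots> \<le> 1 / (24 * r\<^sup>2)" using g rr by (intro divide_right_mono) (auto simp: divide_le_eq)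
      finally show ?thesis .
    qed
    have e2: "4 * \<phi> * \<Gamma> \<le> 1 / (48 * r\<^sup>2)"
    proof -
      have "4 * \<phi> * \<Gamma> = (\<Gamma> / g) / (48 * r\<^sup>2)" by (simp add: \<phi>_def)
      also have "\<dots> \<le> 1 / (48 * r\<^sup>2)" using g rr by (intro divide_right_mono) (auto simp: divide_le_eq)
      finally show ?thesis .
    qed
    have e3: "4 * real d / (\<phi> * real N) \<le> 1 / (48 * r\<^sup>2)"
    proof -
      have "4 * real d / (\<phi> * real N) \<le> 4 * real d / (\<phi> * u)"
        using \<phi> N u1 by (intro divide_left_mono mult_left_mono mult_pos_pos) auto
      also have "\<dots> = 1 / (48 * r\<^sup>2)" unfolding \<phi>_def u_def using g d1 r0 by (simp add: field_simps power2_eq_square eval_nat_numeral)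
      finally show ?thesis .
    qed
    have e4: "real d / (real N)\<^sup>2 \<le> 1 / (48 * r\<^sup>2)"
    proof -
      have "real d / (real N)\<^sup>2 \<le> real d / real N"
        using N1 by (intro divide_left_mono) (auto simp: power2_eq_square)
      also have "\<dots> \<le> real d / u" using N u1 by (intro divide_left_mono) auto
      also have "\<dots> \<le> real d / (48 * real d * r\<^sup>2)"
      proof (intro divide_left_mono)
        have "48 * real d * (1 * r\<^sup>2) \<le> 36864 * real d * (g * r ^ 4)"
          using d1 g r0 by (intro mult_mono power_increasing) auto
        then show "48 * real d * r\<^sup>2 \<le> u" by (simp add: u_def mult.assoc)
      qed (use d1 u1 rr in auto)
      also have "\<dots> = 1 / (48 * r\<^sup>2)" using d1 by simp
      finally show ?thesis .
    qed
    have e5: "\<rho> ^ (k + 1) \<le> 1 / (24 * r\<^sup>2)"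
    proof -
      let ?\<delta> = "(1 / (48 * g * r\<^sup>2))\<^sup>2"
      have "\<rho> \<le> exp (- ?\<delta>)" unfolding \<rho>_def using exp_ge_add_one_self[of "- ?\<delta>"] by simp
      then have "\<rho> ^ (k + 1) \<le> exp (- ?\<delta>) ^ (k + 1)" using \<rho> by (intro power_mono) auto
      also have "\<dots> = exp (- (?\<delta> * (real k + 1)))" by (simp add: exp_of_nat_mult[symmetric] algebra_simps flip: exp_add)
      also have "\<dots> \<le> exp (- ln (24 * r\<^sup>2))"
      proof -
        have "ln (24 * r\<^sup>2) = ?\<delta> * v" unfolding v_def using g r0 by (simp add: field_simps power2_eq_square eval_nat_numeral)
        also have "\<dots> \<le> ?\<delta> * (real k + 1)" using k by (intro mult_left_mono) auto
        finally show ?thesis by simp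
      qed
      also have "\<dots> = 1 / (24 * r\<^sup>2)" using rr by (simp add: exp_minus inverse_eq_divide)
      finally show ?thesis .
    qed
    have e6: "real D / (real n0)\<^sup>2 \<le> 1 / (24 * r\<^sup>2)"
    proof -
      have "real D / (real n0)\<^sup>2 \<le> real Dn / real n0"
        using n01 DD by (intro frac_le) (auto simp: power2_eq_square)
      also have "\<dots> \<le> real Dn / (24 * real Dn * r\<^sup>2)" using n0 Dn1 r0 by (intro frac_le) auto
      also have "\<dots> = 1 / (24 * r\<^sup>2)" using Dn1 by simp
      finally show ?thesis .
    qed
    have "1 / (48 * r\<^sup>2) = 1 / r\<^sup>2 / 48" "1 / (24 * r\<^sup>2) = 1 / r\<^sup>2 / 24" by simp_all
    note eqs = this
    have "4 * (A1 + 2 * (A2 + A3 + A4) + A5 + A6) \<le> x"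
      if "A1 \<le> x / 24" "A2 \<le> x / 48" "A3 \<le> x / 48" "A4 \<le> x / 48" "A5 \<le> x / 24" "A6 \<le> x / 24"
      for A1 A2 A3 A4 A5 A6 x :: real
    proof -
      have "4 * (A1 + 2 * (A2 + A3 + A4) + A5 + A6) \<le> 4 * (x / 24 + 2 * (x / 48 + x / 48 + x / 48) + x / 24 + x / 24)"
        by (intro mult_left_mono add_mono that) auto
      then show ?thesis by simp
    qed
    from this[OF e1[unfolded eqs] e2[unfolded eqs] e3[unfolded eqs] e4[unfolded eqs] e5[unfolded eqs] e6[unfolded eqs]]
    show ?thesis .
  qed

  have m_le: "real m \<le> (real d)\<^sup>2 * g\<^sup>2 * r ^ 10"
  proof -
    have "real m \<le> 5 * (real N)\<^sup>2" using N1 by (simp add: m_def)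
    also have "\<dots> \<le> 5 * (40000 * (real d * g * r ^ 4))\<^sup>2"
    proof (intro mult_left_mono power_mono)
      have "u + 1 \<le> 40000 * (real d * g * r ^ 4)"
      proof -
        have "1 * 1 * 1 \<le> real d * g * r ^ 4" using d1 g r0 by (intro mult_mono one_le_power) auto
        then have "1 \<le> real d * g * r ^ 4" by simp
        moreover have "u = 36864 * (real d * g * r ^ 4)" by (simp add: u_def)
        ultimately show ?thesis by linarith
      qed
      then show "real N \<le> 40000 * (real d * g * r ^ 4)" using N by linarith
    qed auto
    also have "\<dots> = 8 * 10 ^ 9 * ((real d)\<^sup>2 * g\<^sup>2 * r ^ 8)" by (simp add: power_mult_distrib flip: power_mult)
    also have "\<dots> \<le> r\<^sup>2 * ((real d)\<^sup>2 * g\<^sup>2 * r ^ 8)"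
    proof (intro mult_right_mono)
      have "(10 ^ 5)\<^sup>2 \<le> r\<^sup>2" using r by (intro power_mono) auto
      then show "8 * 10 ^ 9 \<le> r\<^sup>2" by simp
    qed simp
    also have "\<dots> = (real d)\<^sup>2 * g\<^sup>2 * r ^ 10" by (simp add: eval_nat_numeral)
    finally show ?thesis .
  qed
  have m1: "1 \<le> m" by (simp add: m_def)
  have k_le: "real k \<le> g\<^sup>2 * r ^ 6"
  proof -
    have "v \<le> 2304 * g\<^sup>2 * r ^ 4 * (3 * r)" unfolding v_def using ln24 r0 by (intro mult_left_mono) auto
    then have "v \<le> 6912 * (g\<^sup>2 * r ^ 5)" by (simp add: eval_nat_numeral)
    moreover have "1 * 1 \<le> g\<^sup>2 * r ^ 5" using g g2 r0 by (intro mult_mono one_le_power) auto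
    ultimately have "real k \<le> 6913 * (g\<^sup>2 * r ^ 5)" using k by linarith
    also have "\<dots> \<le> r * (g\<^sup>2 * r ^ 5)" using r r0 by (intro mult_right_mono) auto
    also have "\<dots> = g\<^sup>2 * r ^ 6" by (simp add: eval_nat_numeral)
    finally show ?thesis .
  qed
  have r_L: "r \<le> 2 * L * r" "1 \<le> 2 * L" using L r0 by auto
  have lnDn: "ln (real Dn) \<le> 27 * (g\<^sup>2 * r ^ 7 * L)"
  proof (cases "g \<le> real d")
    case True
    have "1 + real d * real m \<le> (real d) ^ 3 * g\<^sup>2 * r ^ 11"
    proof -
      have "real d * real m \<le> real d * ((real d)\<^sup>2 * g\<^sup>2 * r ^ 10)" using m_le by (intro mult_left_mono) auto
      also have "\<dots> = (real d) ^ 3 * g\<^sup>2 * r ^ 10" by (simp add: eval_nat_numeral)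
      finally have 1: "real d * real m \<le> (real d) ^ 3 * g\<^sup>2 * r ^ 10" .
      have 2: "1 * 1 * 1 \<le> (real d) ^ 3 * g\<^sup>2 * r ^ 10" using d1 g g2 r0 by (intro mult_mono one_le_power) auto
      have "1 + real d * real m \<le> 2 * ((real d) ^ 3 * g\<^sup>2 * r ^ 10)" using 1 2 by linarith
      also have "\<dots> \<le> r * ((real d) ^ 3 * g\<^sup>2 * r ^ 10)" using r0 by (intro mult_right_mono) auto
      also have "\<dots> = (real d) ^ 3 * g\<^sup>2 * r ^ 11" by (simp add: eval_nat_numeral)
      finally show ?thesis .
    qed
    moreover have "0 < 1 + real d * real m" by (intro add_pos_nonneg) auto
    ultimately have "ln (1 + real d * real m) \<le> ln ((real d) ^ 3 * g\<^sup>2 * r ^ 11)"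
      by (subst ln_le_cancel_iff) auto
    also have "\<dots> = 3 * ln (real d) + 2 * ln g + 11 * ln r"
      using d1 g r0 by (simp add: ln_mult ln_realpow)
    also have "\<dots> \<le> 27 * (L * r)"
    proof -
      \<comment> \<open>Here the case assumption pays: \<open>ln g\<close> is absorbed by
        \<open>ln d\<close>.\<close>
      have "ln g \<le> ln (real d)" using True g by (subst ln_le_cancel_iff) auto
      then have "3 * ln (real d) + 2 * ln g \<le> 5 * L" using L by linarith
      moreover have "L * 1 \<le> L * r" using L r0 by (intro mult_left_mono) auto
      moreover have "r \<le> 2 * (L * r)" using r_L by simp
      ultimately show ?thesis using lnr by linarith
    qed
    finally have 1: "ln (1 + real d * real m) \<le> 27 * (L * r)" .
    have "ln (real Dn) = real k * ln (1 + real d * real m)"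
      using True by (simp add: Dn_def ln_realpow add_pos_nonneg)
    also have "\<dots> \<le> (g\<^sup>2 * r ^ 6) * (27 * (L * r))"
      using 1 k_le by (intro mult_mono) auto
    also have "\<dots> = 27 * (g\<^sup>2 * r ^ 7 * L)" by (simp add: eval_nat_numeral)
    finally show ?thesis .
  next
    case False
    have "ln (real m) \<le> ln ((real d)\<^sup>2 * g\<^sup>2 * r ^ 10)"
      using m_le m1 by (subst ln_le_cancel_iff) auto
    also have "\<dots> = 2 * ln (real d) + 2 * ln g + 10 * ln r"
      using d1 g r0 by (simp add: ln_mult ln_realpow)
    finally have lm: "ln (real m) \<le> 2 * L + 2 * g + 10 * r" using L lng lnr by linarith
    have m0: "0 \<le> ln (real m)" using m1 by simp
    have "ln (real Dn) = real d * ln (real m)" using False m1 by (simp add: Dn_def ln_realpow)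
    \<comment> \<open>\<open>d < g\<close>, and \<open>ln m\<close> is bounded linearly in
      \<open>g\<close>, so \<open>d ln m\<close> is again at most quadratic in
      \<open>g\<close>.\<close>
    also have "\<dots> \<le> g * (2 * L + 2 * g + 10 * r)" using False lm m0 by (intro mult_mono) auto
    also have "\<dots> \<le> 27 * (g\<^sup>2 * r ^ 7 * L)"
    proof -
      have r7: "r * 1 \<le> r * r ^ 6" using r0 by (intro mult_left_mono one_le_power) auto
      then have r7': "r \<le> r ^ 7" by (simp add: eval_nat_numeral)
      then have r71: "1 \<le> r ^ 7" using r0 by linarith
      have a: "g * L \<le> g\<^sup>2 * r ^ 7 * L"
        using mult_mono[of g "g\<^sup>2" 1 "r ^ 7"] g2 g r71 L by (intro mult_right_mono) auto
      have "g\<^sup>2 * 1 * 1 \<le> g\<^sup>2 * r ^ 7 * (2 * L)" using r71 r_L g2 r0 by (intro mult_mono) auto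
      then have b: "g * g \<le> 2 * (g\<^sup>2 * r ^ 7 * L)" by (simp add: power2_eq_square)
      have "g * r * 1 \<le> g\<^sup>2 * r ^ 7 * (2 * L)" using g2 g r0 r7' r_L by (intro mult_mono) auto
      then have c: "g * r \<le> 2 * (g\<^sup>2 * r ^ 7 * L)" by simp
      have "g * (2 * L + 2 * g + 10 * r) = 2 * (g * L) + 2 * (g * g) + 10 * (g * r)" by (simp add: algebra_simps)
      moreover have "0 \<le> g\<^sup>2 * r ^ 7 * L" using L r0 by (intro mult_nonneg_nonneg) auto
      ultimately show ?thesis using a b c by linarith
    qed
    finally show ?thesis .
  qed
  define W where "W = g\<^sup>2 * r ^ 7 * L"
  have nW: "exp (64 * W) \<le> real n"
  proof -
    have "real (max d 2) powr (64 * (\<Gamma> + 1)\<^sup>2 * r ^ 7) = exp (64 * W)"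
      unfolding powr_def W_def L_def g_def by (simp add: mult_ac)
    then show ?thesis using n by simp
  qed
  have DnW: "real Dn \<le> exp (27 * W)"
  proof -
    have "real Dn = exp (ln (real Dn))" using Dn1 by simp
    also have "\<dots> \<le> exp (27 * W)" using lnDn by (simp add: W_def)
    finally show ?thesis .
  qed
  \<comment> \<open>\<open>64 = 2 * 27 + 10\<close>: twice \<open>exp (27 W)\<close> for
    \<open>Dn^2\<close> and \<open>exp (10 W)\<close> for \<open>51 r^4\<close>. The logarithm of
    the size of the cover is at most \<open>50 Dn^2 r^2\<close>; the 51st copy leaves a surplus of
    at least 200 in the exponent.\<close>
  have big: "51 * (real Dn)\<^sup>2 * r ^ 4 \<le> real n"
  proof -
    have rW: "r \<le> 2 * W"
    proof -
      have "1 * (r * 1) * 1 \<le> g\<^sup>2 * (r * r ^ 6) * (2 * L)"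
        using g g2 r0 r_L by (intro mult_mono one_le_power) auto
      then show ?thesis by (simp add: W_def eval_nat_numeral)
    qed
    have "51 * r ^ 4 \<le> r * r ^ 4" using r r0 by (intro mult_right_mono) auto
    also have "\<dots> = r ^ 5" by (simp add: eval_nat_numeral)
    also have "\<dots> \<le> (exp r) ^ 5" using r0 exp_ge_add_one_self[of r] by (intro power_mono) linarith+
    also have "\<dots> = exp (5 * r)" by (simp add: exp_of_nat_mult[symmetric])
    also have "\<dots> \<le> exp (10 * W)" using rW by simp
    finally have 1: "51 * r ^ 4 \<le> exp (10 * W)" .
    have "(real Dn)\<^sup>2 \<le> (exp (27 * W))\<^sup>2" using DnW by (intro power_mono) auto
    also have "\<dots> = exp (54 * W)" by (simp add: exp_of_nat_mult[symmetric] flip: exp_of_nat_mult)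
    finally have "(51 * r ^ 4) * (real Dn)\<^sup>2 \<le> exp (10 * W) * exp (54 * W)" using 1 by (intro mult_mono) auto
    also have "\<dots> = exp (64 * W)" by (simp add: exp_add[symmetric])
    finally show ?thesis using nW by (simp add: mult_ac)
  qed
  have "real (card \<T>) * exp (- \<zeta> * real n) \<le> 1 / 200" if \<zeta>: "1 / r\<^sup>2 \<le> \<zeta>" for \<zeta>
  proof -
    have "real (card \<T>) \<le> real ((2 * n0 + 1) ^ Dn)"
    proof -
      have "(2 * n0 + 1) ^ D \<le> (2 * n0 + 1) ^ Dn" using DD by (intro power_increasing) auto
      then show ?thesis using T(5) by (simp only: of_nat_le_iff)
    qed
    also have "\<dots> = (1 + real (2 * n0)) ^ Dn" by (simp add: add.commute)
    also have "\<dots> \<le> exp (real (2 * n0)) ^ Dn" by (intro power_mono) auto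
    also have "\<dots> = exp (real Dn * real (2 * n0))" by (simp add: exp_of_nat_mult)
    also have "\<dots> \<le> exp (real Dn * (50 * real Dn * r\<^sup>2))"
      using n0(2) Dr by (subst exp_le_cancel_iff, intro mult_left_mono) auto
    finally have 1: "real (card \<T>) \<le> exp (real Dn * (50 * real Dn * r\<^sup>2))" .
    have z: "51 * (real Dn)\<^sup>2 * r\<^sup>2 \<le> \<zeta> * real n"
    proof -
      have "51 * (real Dn)\<^sup>2 * r\<^sup>2 = 1 / r\<^sup>2 * (51 * (real Dn)\<^sup>2 * r ^ 4)" using r0 by (simp add: field_simps eval_nat_numeral)
      also have "\<dots> \<le> \<zeta> * real n" using \<zeta> big r0 by (intro mult_mono) (auto intro: order_trans[OF _ \<zeta>])
      finally show ?thesis .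
    qed
    have "200 \<le> (real Dn)\<^sup>2 * r\<^sup>2"
    proof -
      have "1 * (10 ^ 5)\<^sup>2 \<le> (real Dn)\<^sup>2 * r\<^sup>2" using Dn1 r by (intro mult_mono power_mono one_le_power) auto
      then show ?thesis by simp
    qed
    then have "real Dn * (50 * real Dn * r\<^sup>2) + - \<zeta> * real n \<le> - 200" using z by (simp add: power2_eq_square)
    then have "exp (real Dn * (50 * real Dn * r\<^sup>2)) * exp (- \<zeta> * real n) \<le> exp (- 200)" by (simp only: exp_add[symmetric] exp_le_cancel_iff)
    also have "exp (- 200) \<le> (1 / 200 :: real)"
    proof -
      have "200 \<le> exp (200 :: real)" using exp_ge_add_one_self[of 200] by linarith
      then show ?thesis by (simp add: exp_minus field_simps)
    qed
    finally have "exp (real Dn * (50 * real Dn * r\<^sup>2)) * exp (- \<zeta> * real n) \<le> 1 / 200" .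
    moreover have "real (card \<T>) * exp (- \<zeta> * real n) \<le> exp (real Dn * (50 * real Dn * r\<^sup>2)) * exp (- \<zeta> * real n)"
      using 1 by (intro mult_right_mono) auto
    ultimately show ?thesis by linarith
  qed
  moreover have "\<exists>T\<in>\<T>. measure (Nd d) (sym_diff A T) \<le> 1 / r\<^sup>2"
    if "A \<in> sets (Rd d)" "gauss_surface_area d A \<le> ennreal \<Gamma>" for A
    using T(6)[OF that(1) \<Gamma> that(2)] by (rule bexE) (rule bexI, erule order_trans[OF _ err])
  ultimately show ?thesis using T(3,4) by blast
qed

section \<open>Recovery of the truncation set\<close>

lemma sets_gaussian [measurable_cong]: "sets (gaussian d \<mu> \<Sigma>) = sets (Rd d)"
  by (simp add: gaussian_def)

lemma space_gaussian: "space (gaussian d \<mu> \<Sigma>) = space (Rd d)"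
  by (simp add: gaussian_def)

context near_isotropic
begin

lemma truncated_gaussian:
  assumes A: "A \<in> sets (Rd d)" and pos: "0 < measure (gaussian d \<mu> \<Sigma>) A"
  shows "prob_space (truncated_gaussian d \<mu> \<Sigma> A)"
    and "sets (truncated_gaussian d \<mu> \<Sigma> A) = sets (Rd d)"
    and "\<And>B. B \<in> sets (Rd d) \<Longrightarrow> measure (truncated_gaussian d \<mu> \<Sigma> A) B =
      measure (gaussian d \<mu> \<Sigma>) (A \<inter> B) / measure (gaussian d \<mu> \<Sigma>) A"
proof -
  interpret G: prob_space "gaussian d \<mu> \<Sigma>" by (rule prob_space_gaussian)
  have nz: "emeasure (gaussian d \<mu> \<Sigma>) A \<noteq> 0" "emeasure (gaussian d \<mu> \<Sigma>) A \<noteq> \<infinity>"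
    using pos by (auto simp: G.emeasure_eq_measure)
  show "prob_space (truncated_gaussian d \<mu> \<Sigma> A)"
    unfolding truncated_gaussian_def using nz by (rule prob_space_uniform_measure)
  show "sets (truncated_gaussian d \<mu> \<Sigma> A) = sets (Rd d)"
    by (simp add: truncated_gaussian_def sets_gaussian)
  show "measure (truncated_gaussian d \<mu> \<Sigma> A) B =
      measure (gaussian d \<mu> \<Sigma>) (A \<inter> B) / measure (gaussian d \<mu> \<Sigma>) A" if "B \<in> sets (Rd d)" for B
    unfolding truncated_gaussian_def using nz that by (intro measure_uniform_measure) (auto simp: sets_gaussian)
qed

text \<open>\<open>Q\<close> bounds the factor in \<open>change_of_measure\<close>, so standard mass
  \<open>(\<epsilon> / Q)^2\<close> becomes at most \<open>\<epsilon>\<close> under the unknown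
  Gaussian.\<close>

lemma gaussian_disagreement:
  assumes A: "A \<in> sets (Rd d)" and T: "T \<in> sets (Rd d)" and Q: "exp (2 * a) \<le> Q"
    and \<epsilon>: "0 < \<epsilon>" and m: "measure (Nd d) (sym_diff T A) \<le> (\<epsilon> / Q)\<^sup>2"
  shows "\<P>(x in gaussian d \<mu> \<Sigma>. indicator T x \<noteq> (indicator A x :: real)) \<le> \<epsilon>"
proof -
  have Q0: "0 < Q" using Q exp_gt_zero[of "2 * a"] by linarith
  have sub: "A \<subseteq> space (Rd d)" "T \<subseteq> space (Rd d)" using A T by (auto dest: sets.sets_into_space)
  have "{x \<in> space (gaussian d \<mu> \<Sigma>). indicator T x \<noteq> (indicator A x :: real)} = sym_diff T A"
    unfolding space_gaussian using sub by (auto simp: indicator_def split: if_splits)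
  moreover have "measure (gaussian d \<mu> \<Sigma>) (sym_diff T A) \<le> exp (2 * a) * sqrt (measure (Nd d) (sym_diff T A))"
    using A T by (intro change_of_measure) auto
  moreover have "exp (2 * a) * sqrt (measure (Nd d) (sym_diff T A)) \<le> Q * sqrt ((\<epsilon> / Q)\<^sup>2)"
    using Q m Q0 by (intro mult_mono real_sqrt_le_mono) auto
  moreover have "Q * sqrt ((\<epsilon> / Q)\<^sup>2) = \<epsilon>" using Q0 \<epsilon> by simp
  ultimately show ?thesis by simp
qed

text \<open>Mass at least \<open>1 / Q\<close> under the unknown Gaussian means at least
  \<open>Q^(-4)\<close> under the standard one, and by \<open>surface_area_trivial\<close> the
  complement is then tiny. This settles the surface areas too small to dominate the summand 1 in
  \<open>\<Gamma> + 1\<close>.\<close>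

lemma small_surface_area_full:
  assumes A: "A \<in> sets (Rd d)" and Q: "exp (2 * a) \<le> Q" and big: "1 / Q \<le> measure (gaussian d \<mu> \<Sigma>) A"
    and \<Gamma>: "0 \<le> \<Gamma>" "gauss_surface_area d A \<le> ennreal \<Gamma>" and small: "2 * \<Gamma> * Q ^ 6 \<le> \<epsilon>\<^sup>2" and \<epsilon>: "0 < \<epsilon>"
  shows "\<P>(x in gaussian d \<mu> \<Sigma>. 1 \<noteq> (indicator A x :: real)) \<le> \<epsilon>"
proof -
  have Q0: "0 < Q" using Q exp_gt_zero[of "2 * a"] by linarith
  let ?m = "measure (Nd d) A"
  have sub: "A \<subseteq> space (Rd d)" using A by (auto dest: sets.sets_into_space)
  have "measure (gaussian d \<mu> \<Sigma>) A \<le> exp (2 * a) * sqrt ?m" by (rule change_of_measure[OF A])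
  also have "\<dots> \<le> Q * sqrt ?m" using Q by (intro mult_right_mono) auto
  finally have "1 / Q \<le> Q * sqrt ?m" using big by linarith
  then have "1 / Q\<^sup>2 \<le> sqrt ?m" using Q0 by (simp add: field_simps power2_eq_square)
  then have "(1 / Q\<^sup>2)\<^sup>2 \<le> (sqrt ?m)\<^sup>2" by (intro power_mono) auto
  then have m4: "1 / Q ^ 4 \<le> ?m" by (simp add: power_divide flip: power_mult)
  have "1 / Q ^ 4 * (1 - ?m) \<le> ?m * (1 - ?m)" using m4 by (intro mult_right_mono) auto
  also have "\<dots> \<le> 2 * \<Gamma>" using surface_area_trivial[OF A \<Gamma>(2,1)] .
  finally have "1 - ?m \<le> 2 * \<Gamma> * Q ^ 4" using Q0 by (simp add: field_simps)
  also have "\<dots> \<le> \<epsilon>\<^sup>2 / Q\<^sup>2"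
    using small Q0 by (simp add: le_divide_eq mult.assoc flip: power_add)
  finally have le: "1 - ?m \<le> (\<epsilon> / Q)\<^sup>2" by (simp add: power_divide)
  have "sym_diff (space (Rd d)) A = space (Nd d) - A" using sub by (auto simp: space_Nd space_Rd)
  then have "measure (Nd d) (sym_diff (space (Rd d)) A) = 1 - ?m" using A by (simp add: Nd.prob_compl)
  then have "\<P>(x in gaussian d \<mu> \<Sigma>. indicator (space (Rd d)) x \<noteq> (indicator A x :: real)) \<le> \<epsilon>"
    using le by (intro gaussian_disagreement[OF A _ Q \<epsilon>]) auto
  moreover have "{x \<in> space (gaussian d \<mu> \<Sigma>). indicator (space (Rd d)) x \<noteq> (indicator A x :: real)} =
      {x \<in> space (gaussian d \<mu> \<Sigma>). 1 \<noteq> (indicator A x :: real)}"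
    by (auto simp: space_gaussian)
  ultimately show ?thesis by simp
qed

text \<open>Conditioning divides by a mass of at least \<open>1 / Q\<close>, which turns the bound
  \<open>Q / r\<close> from the change of measure into \<open>Q^2 / r\<close>.\<close>

lemma truncated_complement_le:
  assumes A: "A \<in> sets (Rd d)" and T: "T \<in> sets (Rd d)" and Q: "exp (2 * a) \<le> Q"
    and big: "1 / Q \<le> measure (gaussian d \<mu> \<Sigma>) A" and r: "0 < r" and m: "measure (Nd d) (sym_diff A T) \<le> 1 / r\<^sup>2"
  shows "measure (truncated_gaussian d \<mu> \<Sigma> A) (space (Rd d) - T) \<le> Q\<^sup>2 / r"
proof -
  have Q0: "0 < Q" using Q exp_gt_zero[of "2 * a"] by linarith
  then have pos: "0 < measure (gaussian d \<mu> \<Sigma>) A" using big divide_pos_pos[of 1 Q] by linarith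
  have sub: "A \<subseteq> space (Rd d)" using A by (auto dest: sets.sets_into_space)
  have "measure (gaussian d \<mu> \<Sigma>) (A - T) \<le> exp (2 * a) * sqrt (measure (Nd d) (A - T))"
    using A T by (intro change_of_measure) auto
  also have "\<dots> \<le> Q * sqrt (1 / r\<^sup>2)"
  proof (intro mult_mono real_sqrt_le_mono)
    have "measure (Nd d) (A - T) \<le> measure (Nd d) (sym_diff A T)" using A T by (intro Nd.finite_measure_mono) auto
    then show "measure (Nd d) (A - T) \<le> 1 / r\<^sup>2" using m by linarith
  qed (use Q Q0 in auto)
  also have "\<dots> = Q / r" using r by (simp add: real_sqrt_divide)
  finally have le: "measure (gaussian d \<mu> \<Sigma>) (A - T) \<le> Q / r" .
  have "A \<inter> (space (Rd d) - T) = A - T" using sub by auto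
  then have "measure (truncated_gaussian d \<mu> \<Sigma> A) (space (Rd d) - T) =
      measure (gaussian d \<mu> \<Sigma>) (A - T) / measure (gaussian d \<mu> \<Sigma>) A"
    using truncated_gaussian(3)[OF A pos, of "space (Rd d) - T"] T by auto
  also have "\<dots> \<le> (Q / r) / (1 / Q)" using le big Q0 r by (intro frac_le) auto
  also have "\<dots> = Q\<^sup>2 / r" by (simp add: power2_eq_square)
  finally show ?thesis .
qed

text \<open>If \<open>A - T'\<close> is small and \<open>T'\<close> is no heavier than \<open>T \<approx> A\<close>, then \<open>T' - A\<close> is small as well.\<close>

lemma light_cover_disagreement:
  assumes A: "A \<in> sets (Rd d)" and T: "T \<in> sets (Rd d)" and T': "T' \<in> sets (Rd d)" and Q: "exp (2 * a) \<le> Q"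
    and big: "1 / Q \<le> measure (gaussian d \<mu> \<Sigma>) A"
    and m: "measure (Nd d) (sym_diff A T) \<le> (\<epsilon> / Q)\<^sup>2 / 3" and light: "measure (Nd d) T' \<le> measure (Nd d) T"
    and miss: "measure (truncated_gaussian d \<mu> \<Sigma> A) (space (Rd d) - T') \<le> \<epsilon> ^ 4 / (9 * Q ^ 6)" and \<epsilon>: "0 < \<epsilon>"
  shows "\<P>(x in gaussian d \<mu> \<Sigma>. indicator T' x \<noteq> (indicator A x :: real)) \<le> \<epsilon>"
proof -
  interpret G: prob_space "gaussian d \<mu> \<Sigma>" by (rule prob_space_gaussian)
  have Q0: "0 < Q" using Q exp_gt_zero[of "2 * a"] by linarith
  then have pos: "0 < measure (gaussian d \<mu> \<Sigma>) A" using big divide_pos_pos[of 1 Q] by linarith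
  have sub: "A \<subseteq> space (Rd d)" using A by (auto dest: sets.sets_into_space)
  have "A \<inter> (space (Rd d) - T') = A - T'" using sub by auto
  then have eq: "measure (truncated_gaussian d \<mu> \<Sigma> A) (space (Rd d) - T') =
      measure (gaussian d \<mu> \<Sigma>) (A - T') / measure (gaussian d \<mu> \<Sigma>) A"
    using truncated_gaussian(3)[OF A pos, of "space (Rd d) - T'"] T' by auto
  have "measure (gaussian d \<mu> \<Sigma>) (A - T') \<le> measure (gaussian d \<mu> \<Sigma>) (A - T') / measure (gaussian d \<mu> \<Sigma>) A"
    using pos G.prob_le_1[of A] by (simp add: le_divide_eq mult_left_le)
  then have le: "measure (gaussian d \<mu> \<Sigma>) (A - T') \<le> \<epsilon> ^ 4 / (9 * Q ^ 6)" using miss eq by linarith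
  have "measure (Nd d) (A - T') \<le> exp (2 * a) * sqrt (measure (gaussian d \<mu> \<Sigma>) (A - T'))"
    using A T' by (intro change_of_measure) auto
  \<comment> \<open>\<open>\<epsilon>^4 / (9 Q^6)\<close> is the square of
    \<open>\<epsilon>^2 / (3 Q^3)\<close>: after the root and the factor \<open>Q\<close> exactly
    one third of \<open>(\<epsilon> / Q)^2\<close> remains.\<close>
  also have "\<dots> \<le> Q * sqrt (\<epsilon> ^ 4 / (9 * Q ^ 6))" using le Q Q0 by (intro mult_mono real_sqrt_le_mono) auto
  also have "\<dots> = Q * sqrt ((\<epsilon>\<^sup>2 / (3 * Q ^ 3))\<^sup>2)" by (simp add: power_divide power_mult_distrib flip: power_mult)
  also have "\<dots> = Q * (\<epsilon>\<^sup>2 / (3 * Q ^ 3))" using Q0 by simp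
  also have "\<dots> = (\<epsilon> / Q)\<^sup>2 / 3" using Q0 by (simp add: power_divide power2_eq_square power3_eq_cube)
  finally have ST: "measure (Nd d) (A - T') \<le> (\<epsilon> / Q)\<^sup>2 / 3" .
  \<comment> \<open>Splitting \<open>A\<close> and \<open>T'\<close> along their intersection gives
    \<open>|T' - A| = |T'| - |A| + |A - T'|\<close>, and \<open>|T'| \<le> |T|\<close>. The three
    thirds of \<open>(\<epsilon> / Q)^2\<close> go to \<open>|A - T'|\<close>, counted twice, and to
    the distance of \<open>T\<close> from \<open>A\<close>.\<close>
  have mS: "measure (Nd d) A = measure (Nd d) (A \<inter> T') + measure (Nd d) (A - T')"
    using A T' by (subst Nd.finite_measure_Union[symmetric]) (auto intro: arg_cong[where f = "measure (Nd d)"])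
  have mT': "measure (Nd d) T' = measure (Nd d) (A \<inter> T') + measure (Nd d) (T' - A)"
    using A T' by (subst Nd.finite_measure_Union[symmetric]) (auto intro: arg_cong[where f = "measure (Nd d)"])
  have "measure (Nd d) T \<le> measure (Nd d) (A \<union> sym_diff A T)" using A T by (intro Nd.finite_measure_mono) auto
  also have "\<dots> \<le> measure (Nd d) A + measure (Nd d) (sym_diff A T)" using A T by (intro measure_Un_le) auto
  finally have TS: "measure (Nd d) T \<le> measure (Nd d) A + (\<epsilon> / Q)\<^sup>2 / 3" using m by linarith
  have "measure (Nd d) (sym_diff T' A) \<le> measure (Nd d) (T' - A) + measure (Nd d) (A - T')"
    using A T' by (intro measure_Un_le) auto
  also have "\<dots> \<le> (\<epsilon> / Q)\<^sup>2" using ST mS mT' TS light by linarith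
  finally show ?thesis by (rule gaussian_disagreement[OF A T' Q \<epsilon>])
qed

end

text \<open>For \<open>\<epsilon> \<ge> 1\<close> and for surface area below \<open>\<epsilon>\<^sup>2 / (2 Q\<^sup>6)\<close> the whole space is a good answer; otherwise
  \<open>\<Gamma> + 1\<close> is at most a multiple of \<open>\<Gamma>\<close>, and the cover fits the sample size.\<close>

theorem theorem6:
  fixes C :: real
  assumes "C > 0"
  shows "\<exists>p :: real poly.
    \<forall>(\<alpha>::real) (d::nat) (\<S> :: (nat \<Rightarrow> real) set set) (\<epsilon>::real) (n::nat).
      \<alpha> > 0 \<longrightarrow> d \<ge> 1 \<longrightarrow> \<epsilon> > 0 \<longrightarrow>
      \<S> \<subseteq> sets (Rd d) \<longrightarrow> class_surface_area d \<S> < \<infinity> \<longrightarrow>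
      real n \<ge> real (max d 2) powr
        (poly p (1 / \<alpha>) * (enn2real (class_surface_area d \<S>))\<^sup>2 / \<epsilon> ^ 32) \<longrightarrow>
      (\<exists>E. set_estimator d n E \<and>
        (\<forall>\<mu> \<Sigma> S.
          isotropic_position d (C * ln (1 / \<alpha>)) (1 / 16) \<mu> \<Sigma> \<longrightarrow>
          S \<in> \<S> \<longrightarrow> measure (gaussian d \<mu> \<Sigma>) S \<ge> \<alpha> \<longrightarrow>
          \<P>(X in Pi\<^sub>M {..<n} (\<lambda>_. truncated_gaussian d \<mu> \<Sigma> S).
            \<P>(x in gaussian d \<mu> \<Sigma>. E X x \<noteq> indicator S x) \<le> \<epsilon>) \<ge> 99 / 100))"
proof -
  \<comment> \<open>The exponent for which \<open>exp (2 a)\<close> with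
    \<open>a = C ln (1 / \<alpha>)\<close>, the factor in \<open>change_of_measure\<close>, is at
    most \<open>(1 / \<alpha>)^s\<close>, called \<open>Q\<close> below.\<close>
  define s where "s = nat \<lceil>2 * C\<rceil>"
  have s: "2 * C \<le> real s" by (simp add: s_def real_nat_ceiling_ge)
  have s1: "1 \<le> s" using s assms by (cases s) auto
  \<comment> \<open>\<open>576 = 64 * 9\<close> and \<open>10^35 = (10^5)^7\<close>;
    \<open>68 = 12 + 56\<close> is the power of \<open>Q\<close> that
    \<open>(\<Gamma> + 1)^2\<close> and \<open>r^7\<close> produce together in
    \<open>budget\<close>.\<close>
  define p :: "real poly" where "p = monom (576 * 10 ^ 35) (68 * s)"
  show ?thesis
  proof (intro exI[of _ p] allI impI)
    fix \<alpha> \<epsilon> :: real and d n :: nat and \<S> :: "(nat \<Rightarrow> real) set set"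
    assume \<alpha>: "\<alpha> > 0" and d: "d \<ge> 1" and \<epsilon>: "\<epsilon> > 0" and \<S>: "\<S> \<subseteq> sets (Rd d)"
      and fin: "class_surface_area d \<S> < \<infinity>"
      and n: "real n \<ge> real (max d 2) powr (poly p (1 / \<alpha>) * (enn2real (class_surface_area d \<S>))\<^sup>2 / \<epsilon> ^ 32)"
    define \<Gamma> where "\<Gamma> = enn2real (class_surface_area d \<S>)"
    have \<Gamma>0: "0 \<le> \<Gamma>" by (simp add: \<Gamma>_def)
    have \<Gamma>: "gauss_surface_area d S \<le> ennreal \<Gamma>" if "S \<in> \<S>" for S
    proof -
      have "gauss_surface_area d S \<le> class_surface_area d \<S>"
        unfolding class_surface_area_def using that by (rule SUP_upper)
      then show ?thesis using fin by (simp add: \<Gamma>_def)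
    qed
    define Q where "Q = (1 / \<alpha>) ^ s"
    let ?good = "\<lambda>E. \<forall>\<mu> \<Sigma> S. isotropic_position d (C * ln (1 / \<alpha>)) (1 / 16) \<mu> \<Sigma> \<longrightarrow>
          S \<in> \<S> \<longrightarrow> measure (gaussian d \<mu> \<Sigma>) S \<ge> \<alpha> \<longrightarrow>
          \<P>(X in Pi\<^sub>M {..<n} (\<lambda>_. truncated_gaussian d \<mu> \<Sigma> S).
            \<P>(x in gaussian d \<mu> \<Sigma>. E X x \<noteq> indicator S x) \<le> \<epsilon>) \<ge> 99 / 100"
    have facts: "near_isotropic d (C * ln (1 / \<alpha>)) \<mu> \<Sigma> \<and> exp (2 * (C * ln (1 / \<alpha>))) \<le> Q \<and>
        1 / Q \<le> measure (gaussian d \<mu> \<Sigma>) S \<and> S \<in> sets (Rd d) \<and> 0 < measure (gaussian d \<mu> \<Sigma>) S \<and> \<alpha> \<le> 1"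
      if iso: "isotropic_position d (C * ln (1 / \<alpha>)) (1 / 16) \<mu> \<Sigma>" and S: "S \<in> \<S>"
        and m: "measure (gaussian d \<mu> \<Sigma>) S \<ge> \<alpha>" for \<mu> \<Sigma> S
    proof -
      interpret I: near_isotropic d "C * ln (1 / \<alpha>)" \<mu> \<Sigma> by unfold_locales (rule iso)
      interpret G: prob_space "gaussian d \<mu> \<Sigma>" by (rule I.prob_space_gaussian)
      have a1: "\<alpha> \<le> 1" using m G.prob_le_1[of S] by linarith
      then have a1': "1 \<le> 1 / \<alpha>" using \<alpha> by simp
      have l0: "0 \<le> ln (1 / \<alpha>)" using a1' by simp
      have "exp (2 * (C * ln (1 / \<alpha>))) \<le> exp (real s * ln (1 / \<alpha>))"
        using mult_right_mono[OF s l0] by simp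
      also have "\<dots> = Q" using \<alpha> by (simp add: Q_def exp_of_nat_mult)
      finally have 1: "exp (2 * (C * ln (1 / \<alpha>))) \<le> Q" .
      have "(1 / \<alpha>) ^ 1 \<le> Q" unfolding Q_def using a1' s1 by (intro power_increasing) auto
      then have "1 / Q \<le> 1 / (1 / \<alpha>)" using \<alpha> by (intro divide_left_mono) (auto simp: Q_def)
      then have "1 / Q \<le> measure (gaussian d \<mu> \<Sigma>) S" using m by simp
      moreover have "0 < measure (gaussian d \<mu> \<Sigma>) S" using m \<alpha> by linarith
      ultimately show ?thesis using I.near_isotropic_axioms 1 S \<S> a1 by auto
    qed
    \<comment> \<open>The constant answer 1 ignores the sample, so its success is certain as soon as
      the complement of \<open>S\<close> is small.\<close>
    have full: "\<exists>E. set_estimator d n E \<and> ?good E"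
      if *: "\<And>\<mu> \<Sigma> S. isotropic_position d (C * ln (1 / \<alpha>)) (1 / 16) \<mu> \<Sigma> \<Longrightarrow> S \<in> \<S> \<Longrightarrow>
        measure (gaussian d \<mu> \<Sigma>) S \<ge> \<alpha> \<Longrightarrow> \<P>(x in gaussian d \<mu> \<Sigma>. 1 \<noteq> (indicator S x :: real)) \<le> \<epsilon>"
    proof (intro exI[of _ "\<lambda>_ _. 1"] conjI allI impI)
      show "set_estimator d n (\<lambda>_ _. 1)" by (simp add: set_estimator_def)
      fix \<mu> \<Sigma> S
      assume iso: "isotropic_position d (C * ln (1 / \<alpha>)) (1 / 16) \<mu> \<Sigma>" and S: "S \<in> \<S>"
        and m: "measure (gaussian d \<mu> \<Sigma>) S \<ge> \<alpha>"
      interpret I: near_isotropic d "C * ln (1 / \<alpha>)" \<mu> \<Sigma> by unfold_locales (rule iso)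
      interpret P: prob_space "Pi\<^sub>M {..<n} (\<lambda>_. truncated_gaussian d \<mu> \<Sigma> S)"
        using facts[OF iso S m] by (intro prob_space_PiM I.truncated_gaussian(1)) auto
      show "\<P>(X in Pi\<^sub>M {..<n} (\<lambda>_. truncated_gaussian d \<mu> \<Sigma> S).
            \<P>(x in gaussian d \<mu> \<Sigma>. 1 \<noteq> (indicator S x :: real)) \<le> \<epsilon>) \<ge> 99 / 100"
        using *[OF iso S m] by (simp add: P.prob_space)
    qed
    show "\<exists>E. set_estimator d n E \<and> ?good E"
    \<comment> \<open>For \<open>\<alpha> > 1\<close> no set carries enough mass and the claim is
      vacuous; splitting this case off leaves \<open>Q \<ge> 1\<close>.\<close>
    proof (cases "\<epsilon> \<ge> 1 \<or> \<alpha> > 1 \<or> 2 * \<Gamma> * Q ^ 6 \<le> \<epsilon>\<^sup>2")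
      case True
      show ?thesis
      proof (rule full)
        fix \<mu> \<Sigma> S
        assume iso: "isotropic_position d (C * ln (1 / \<alpha>)) (1 / 16) \<mu> \<Sigma>" and S: "S \<in> \<S>"
          and m: "measure (gaussian d \<mu> \<Sigma>) S \<ge> \<alpha>"
        interpret I: near_isotropic d "C * ln (1 / \<alpha>)" \<mu> \<Sigma> by unfold_locales (rule iso)
        interpret G: prob_space "gaussian d \<mu> \<Sigma>" by (rule I.prob_space_gaussian)
        note f = facts[OF iso S m]
        show "\<P>(x in gaussian d \<mu> \<Sigma>. 1 \<noteq> (indicator S x :: real)) \<le> \<epsilon>"
        proof (cases "\<epsilon> \<ge> 1")
          case True
          then show ?thesis by (rule order_trans[OF G.prob_le_1])
        next
          case False
          then have "2 * \<Gamma> * Q ^ 6 \<le> \<epsilon>\<^sup>2" using \<open>\<epsilon> \<ge> 1 \<or> \<alpha> > 1 \<or> 2 * \<Gamma> * Q ^ 6 \<le> \<epsilon>\<^sup>2\<close> f by auto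
          then show ?thesis using f \<Gamma>[OF S] \<Gamma>0 \<epsilon> by (intro I.small_surface_area_full[of S Q \<Gamma>]) auto
        qed
      qed
    next
      case False
      then have e1: "\<epsilon> < 1" and a1: "\<alpha> \<le> 1" and big: "\<epsilon>\<^sup>2 \<le> 2 * \<Gamma> * Q ^ 6" by auto
      have Q1: "1 \<le> Q" unfolding Q_def using \<alpha> a1 by (intro one_le_power) simp
      \<comment> \<open>The approximation of \<open>S\<close> misses sample mass at most
        \<open>Q^2 / r\<close>, which has to be at most \<open>\<zeta> / 200\<close>; since
        \<open>200 * 36 \<le> 10^5\<close>, this \<open>r\<close> suffices. In turn
        \<open>4 \<zeta>\<close> is the missing mass that \<open>light_cover_disagreement\<close>
        tolerates.\<close>
      define r where "r = 10 ^ 5 * Q ^ 8 / \<epsilon> ^ 4"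
      define \<zeta> where "\<zeta> = \<epsilon> ^ 4 / (36 * Q ^ 6)"
      have e4: "0 < \<epsilon> ^ 4" "\<epsilon> ^ 4 \<le> 1" using \<epsilon> e1 by (auto intro: power_le_one)
      have r1: "10 ^ 5 \<le> r"
      proof -
        have "\<epsilon> ^ 4 \<le> Q ^ 8" using e4 one_le_power[OF Q1, of 8] by linarith
        then show ?thesis unfolding r_def using e4 by (simp add: le_divide_eq)
      qed
      have r0: "0 < r" using r1 by (rule less_le_trans[rotated]) simp
      have \<zeta>0: "0 < \<zeta>" using \<epsilon> Q1 by (simp add: \<zeta>_def)
      have inv_r: "1 / r = \<epsilon> ^ 4 / (10 ^ 5 * Q ^ 8)" by (simp add: r_def)
      have rle: "1 / r\<^sup>2 \<le> 1 / r" using r1 r0 by (simp add: divide_le_cancel field_simps power2_eq_square)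
      have inv_r_le: "Q\<^sup>2 / r = \<epsilon> ^ 4 / (10 ^ 5 * Q ^ 6)"
        using Q1 \<epsilon> by (simp add: r_def field_simps flip: power_add)
      have r\<zeta>: "Q\<^sup>2 / r \<le> \<zeta> / 200"
        unfolding inv_r_le \<zeta>_def using Q1 \<epsilon> by (simp add: field_simps)
      have rQ: "1 / r \<le> Q\<^sup>2 / r" using Q1 r0 by (intro divide_right_mono) auto
      have \<zeta>r: "1 / r\<^sup>2 \<le> \<zeta>" using rle rQ r\<zeta> \<zeta>0 by linarith
      have r\<epsilon>: "1 / r\<^sup>2 \<le> (\<epsilon> / Q)\<^sup>2 / 3"
      proof -
        have "\<epsilon> ^ 4 / (10 ^ 5 * Q ^ 8) \<le> \<epsilon>\<^sup>2 / (3 * Q\<^sup>2)"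
          using Q1 \<epsilon> e1 by (intro frac_le mult_mono power_increasing power_decreasing) auto
        then show ?thesis using rle inv_r by (simp add: power_divide)
      qed
      have budget: "64 * (\<Gamma> + 1)\<^sup>2 * r ^ 7 \<le> poly p (1 / \<alpha>) * \<Gamma>\<^sup>2 / \<epsilon> ^ 32"
      proof -
        \<comment> \<open>The case assumption \<open>\<epsilon>^2 < 2 \<Gamma> Q^6\<close> removes
          the summand 1 at the price of \<open>\<epsilon>^(-2)\<close>; its square together with
          \<open>r^7\<close> gives \<open>\<epsilon>^(-32)\<close>.\<close>
        have "\<Gamma> + 1 \<le> 3 * \<Gamma> * Q ^ 6 / \<epsilon>\<^sup>2"
        proof -
          have "\<Gamma> * \<epsilon>\<^sup>2 \<le> \<Gamma> * Q ^ 6"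
            using \<Gamma>0 power_le_one[of \<epsilon> 2] \<epsilon> e1 one_le_power[OF Q1, of 6] by (intro mult_left_mono) linarith+
          then have "(\<Gamma> + 1) * \<epsilon>\<^sup>2 \<le> 3 * \<Gamma> * Q ^ 6" using big by (simp add: algebra_simps)
          then show ?thesis using \<epsilon> by (simp add: le_divide_eq)
        qed
        then have "(\<Gamma> + 1)\<^sup>2 \<le> (3 * \<Gamma> * Q ^ 6 / \<epsilon>\<^sup>2)\<^sup>2" using \<Gamma>0 by (intro power_mono) auto
        then have "64 * (\<Gamma> + 1)\<^sup>2 * r ^ 7 \<le> 64 * (3 * \<Gamma> * Q ^ 6 / \<epsilon>\<^sup>2)\<^sup>2 * r ^ 7"
          using r0 by (intro mult_right_mono mult_left_mono) auto
        also have "\<dots> = 576 * 10 ^ 35 * Q ^ 68 * \<Gamma>\<^sup>2 / \<epsilon> ^ 32"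
        proof -
          have "(3 * \<Gamma> * Q ^ 6 / \<epsilon>\<^sup>2)\<^sup>2 = 9 * \<Gamma>\<^sup>2 * Q ^ 12 / \<epsilon> ^ 4"
            by (simp add: power_divide power_mult_distrib flip: power_mult)
          moreover have "r ^ 7 = 10 ^ 35 * Q ^ 56 / \<epsilon> ^ 28"
            by (simp add: r_def power_divide power_mult_distrib flip: power_mult)
          moreover have "Q ^ 68 = Q ^ 12 * Q ^ 56" "\<epsilon> ^ 32 = \<epsilon> ^ 4 * \<epsilon> ^ 28" by (simp_all flip: power_add)
          ultimately show ?thesis by simp
        qed
        also have "\<dots> = poly p (1 / \<alpha>) * \<Gamma>\<^sup>2 / \<epsilon> ^ 32"
          by (simp add: p_def poly_monom Q_def mult.commute[of s] flip: power_mult)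
        finally show ?thesis .
      qed
      have "real (max d 2) powr (64 * (\<Gamma> + 1)\<^sup>2 * r ^ 7) \<le> real n"
        by (rule order_trans[OF _ n]) (rule powr_mono, use budget in \<open>auto simp: \<Gamma>_def\<close>)
      from cover_budget[OF \<Gamma>0 d r1 this] obtain \<T> where \<T>: "finite \<T>" "\<T> \<subseteq> sets (Rd d)"
        and card: "\<And>\<zeta>. 1 / r\<^sup>2 \<le> \<zeta> \<Longrightarrow> real (card \<T>) * exp (- \<zeta> * real n) \<le> 1 / 200"
        and cov: "\<And>A. A \<in> sets (Rd d) \<Longrightarrow> gauss_surface_area d A \<le> ennreal \<Gamma> \<Longrightarrow>
          \<exists>T\<in>\<T>. measure (Nd d) (sym_diff A T) \<le> 1 / r\<^sup>2"
        by blast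
      from finite_class_estimator[OF \<T> \<zeta>0, of n "measure (Nd d)"] obtain E where E: "set_estimator d n E"
        and learn: "\<And>\<nu> T R. prob_space \<nu> \<Longrightarrow> sets \<nu> = sets (Rd d) \<Longrightarrow> T \<in> \<T> \<Longrightarrow>
          measure \<nu> (space (Rd d) - T) \<le> \<zeta> / 200 \<Longrightarrow> real (card \<T>) * exp (- \<zeta> * real n) \<le> 1 / 200 \<Longrightarrow>
          (\<forall>T'\<in>\<T>. measure (Nd d) T' \<le> measure (Nd d) T \<longrightarrow> measure \<nu> (space (Rd d) - T') \<le> 4 * \<zeta> \<longrightarrow> R (indicator T')) \<Longrightarrow>
          99 / 100 \<le> measure (Pi\<^sub>M {..<n} (\<lambda>_. \<nu>)) {X \<in> space (Pi\<^sub>M {..<n} (\<lambda>_. \<nu>)). R (E X)}"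
        by blast
      have "?good E"
      proof (intro allI impI)
        fix \<mu> \<Sigma> S
        assume iso: "isotropic_position d (C * ln (1 / \<alpha>)) (1 / 16) \<mu> \<Sigma>" and S: "S \<in> \<S>"
          and m: "measure (gaussian d \<mu> \<Sigma>) S \<ge> \<alpha>"
        interpret I: near_isotropic d "C * ln (1 / \<alpha>)" \<mu> \<Sigma> by unfold_locales (rule iso)
        have f: "exp (2 * (C * ln (1 / \<alpha>))) \<le> Q" "1 / Q \<le> measure (gaussian d \<mu> \<Sigma>) S" "S \<in> sets (Rd d)"
          "0 < measure (gaussian d \<mu> \<Sigma>) S" using facts[OF iso S m] by auto
        obtain T where T: "T \<in> \<T>" and mT: "measure (Nd d) (sym_diff S T) \<le> 1 / r\<^sup>2"
          using cov[OF f(3) \<Gamma>[OF S]] by (rule bexE)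
        have T': "T \<in> sets (Rd d)" using T \<T> by auto
        have mT': "measure (Nd d) (sym_diff S T) \<le> (\<epsilon> / Q)\<^sup>2 / 3" using mT r\<epsilon> by (rule order_trans)
        have \<zeta>4: "4 * \<zeta> = \<epsilon> ^ 4 / (9 * Q ^ 6)" by (simp add: \<zeta>_def)
        show "\<P>(X in Pi\<^sub>M {..<n} (\<lambda>_. truncated_gaussian d \<mu> \<Sigma> S).
            \<P>(x in gaussian d \<mu> \<Sigma>. E X x \<noteq> indicator S x) \<le> \<epsilon>) \<ge> 99 / 100"
        proof (rule learn[of _ T "\<lambda>f. \<P>(x in gaussian d \<mu> \<Sigma>. f x \<noteq> indicator S x) \<le> \<epsilon>"])
          show "prob_space (truncated_gaussian d \<mu> \<Sigma> S)" by (rule I.truncated_gaussian(1)[OF f(3,4)])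
          show "sets (truncated_gaussian d \<mu> \<Sigma> S) = sets (Rd d)" by (rule I.truncated_gaussian(2)[OF f(3,4)])
          show "measure (truncated_gaussian d \<mu> \<Sigma> S) (space (Rd d) - T) \<le> \<zeta> / 200"
            using I.truncated_complement_le[OF f(3) T' f(1,2) r0 mT] r\<zeta> by (rule order_trans)
          show "real (card \<T>) * exp (- \<zeta> * real n) \<le> 1 / 200" by (rule card[OF \<zeta>r])
          show "\<forall>T'\<in>\<T>. measure (Nd d) T' \<le> measure (Nd d) T \<longrightarrow>
              measure (truncated_gaussian d \<mu> \<Sigma> S) (space (Rd d) - T') \<le> 4 * \<zeta> \<longrightarrow>
              \<P>(x in gaussian d \<mu> \<Sigma>. indicator T' x \<noteq> (indicator S x :: real)) \<le> \<epsilon>"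
            unfolding \<zeta>4 using \<T>(2)
            by (intro ballI impI I.light_cover_disagreement[OF f(3) T' _ f(1,2) mT' _ _ \<epsilon>]) auto
        qed (rule T)
      qed
      then show ?thesis using E by (intro exI[of _ E] conjI)
    qed
  qed
qed

end
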